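(* Suppose $\mathcal{M}=\int_Z^\oplus\mathcal{M}(\zeta)\,d\omega(\zeta)$ is a decomposable von Neumann algebra on the direct integral Hilbert space $\mathcal{H}=\int_Z^\oplus\mathcal{H}(\zeta)\,d\omega(\zeta)$. Let $T$ be a closed (possibly unbounded) operator in $\mathcal{H}$. Then $T$ is affiliated to $\mathcal{M}$ if and only if (a) $T$ is decomposable and (b) writing out the decomposition as $T=\int_Z^\oplus T(\zeta)\,d\omega(\zeta)$, we have that $T(\zeta)$ is affiliated to $\mathcal{M}(\zeta)$ for almost every $\zeta$.
   Context: Direct integrals. $Z$ is a standard Borel space (a Polish space with its Borel $\sigma$-algebra) and $\omega$ is a $\sigma$-finite positive measure on it. A measurable field of Hilbert spaces is a map $\zeta\mapsto\mathcal{H}(\zeta)$, each $\mathcal{H}(\zeta)$ a Hilbert space, with a set $S$ of vector fields $\zeta\mapsto x(\zeta)\in\mathcal{H}(\zeta)$ (called measurable) such that (i) $\zeta\mapsto\langle x(\zeta),y(\zeta)\rangle$ is measurable for all $x,y\in S$; (ii) if $v$ is a vector field with $\zeta\mapsto\langle x(\zeta),v(\zeta)\rangle$ measurable for every $x\in S$, then $v\in S$; (iii) there is a sequence $(x_n)$ in $S$ such that $\{x_n(\zeta)\}_n$ has dense linear span in $\mathcal{H}(\zeta)$ for every $\zeta$. The direct integral $\mathcal{H}=\int_Z^\oplus\mathcal{H}(\zeta)\,d\omega(\zeta)$ is the Hilbert space of all $x\in S$ (modulo a.e. equality) with $\int_Z\|x(\zeta)\|^2d\omega<\infty$ and inner product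 $\int_Z\langle x(\zeta),y(\zeta)\rangle\,d\omega(\zeta)$. Decomposable operators. A field of bounded operators $T(\zeta)\in B(\mathcal{H}(\zeta))$ is measurable if $\zeta\mapsto T(\zeta)x(\zeta)$ is in $S$ for all $x\in S$. If moreover $\zeta\mapsto\|T(\zeta)\|$ is essentially bounded, it defines a bounded decomposable operator $T=\int_Z^\oplus T(\zeta)\,d\omega(\zeta)$ by $(Tx)(\zeta)=T(\zeta)x(\zeta)$. The diagonal operators are the bounded decomposable operators with every $T(\zeta)$ a scalar multiple of the identity. A field of closed operators $T(\zeta)$ on $\mathcal{H}(\zeta)$ is measurable if the four entries of the projection in $M_2(B(\mathcal{H}(\zeta)))$ onto the graph of $T(\zeta)$ are measurable fields of bounded operators. The associated closed operator $T=\int_Z^\oplus T(\zeta)\,d\omega(\zeta)$ has domain the set of $x\in\mathcal{H}$ represented by square integrable fields with $x(\zeta)\in\mathrm{dom}(T(\zeta))$ for all $\zeta$ and $\zeta\mapsto T(\zeta)x(\zeta)$ square integrable, and $(Tx)(\zeta)=T(\zeta)x(\zeta)$. Closed operators of this form are called decomposable. Fields are identified when they agree almost everywhere. Decomposable von Neumann algebras. All von Neumann algebras are countably generated. A von Neumann algebra $\mathcal{M}\subseteq B(\mathcal{H})$ is decomposable, written $\mathcal{M}=\int_Z^\oplus\mathcal{M}(\zeta)\,d\omega(\zeta)$, if it is generated by the algebra of diagonal operators together with a countable set $\{T_i\mid i\ge1\}$ of bounded decomposable operators; $\mathcal{M}(\zeta)$ is the von Neumann algebra in $B(\mathcal{H}(\zeta))$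 generated by $\{T_i(\zeta)\mid i\ge1\}$. A bounded decomposable operator $A$ lies in $\mathcal{M}$ if and only if $A(\zeta)\in\mathcal{M}(\zeta)$ for almost every $\zeta$. Affiliation. A closed operator $T$ is affiliated to a von Neumann algebra $\mathcal{M}$ if it is densely defined and, with polar decomposition $T=V|T|$, one has $V\in\mathcal{M}$ and $E_{|T|}(B)\in\mathcal{M}$ for every Borel subset $B$ of $\mathbb{R}$, where $E_{|T|}(B)$ denotes the spectral projection. *)

theory Defs
  imports "HOL-Analysis.Analysis"
begin

section \<open>Complex Hilbert spaces\<close>

text \<open>
  The fibres of a measurable field are different Hilbert spaces, and their direct integral
  consists of equivalence classes of vector fields.  Hilbert spaces are therefore structures with
  an explicit carrier; nothing is assumed about their operations outside it.  Inner products are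
  linear in the first argument.
\<close>

record 'v hilbert_struct =
  hcarrier :: "'v set"
  hzero :: 'v
  hadd :: "'v \<Rightarrow> 'v \<Rightarrow> 'v"
  hscale :: "complex \<Rightarrow> 'v \<Rightarrow> 'v"
  hinner :: "'v \<Rightarrow> 'v \<Rightarrow> complex"

definition hdiff :: "'v hilbert_struct \<Rightarrow> 'v \<Rightarrow> 'v \<Rightarrow> 'v" where
  "hdiff H x y = hadd H x (hscale H (- 1) y)"

definition hnorm :: "'v hilbert_struct \<Rightarrow> 'v \<Rightarrow> real" where
  "hnorm H x = sqrt (Re (hinner H x x))"

definition hlim :: "'v hilbert_struct \<Rightarrow> (nat \<Rightarrow> 'v) \<Rightarrow> 'v \<Rightarrow> bool" where
  "hlim H X x \<longleftrightarrow> (\<lambda>n. hnorm H (hdiff H (X n) x)) \<longlonglongrightarrow> 0"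

definition hCauchy :: "'v hilbert_struct \<Rightarrow> (nat \<Rightarrow> 'v) \<Rightarrow> bool" where
  "hCauchy H X \<longleftrightarrow> (\<forall>e>0. \<exists>N. \<forall>m\<ge>N. \<forall>n\<ge>N. hnorm H (hdiff H (X m) (X n)) < e)"

locale hilbert_space =
  fixes H :: "'v hilbert_struct"
  assumes zero_closed: "hzero H \<in> hcarrier H"
    and add_closed: "\<lbrakk>x \<in> hcarrier H; y \<in> hcarrier H\<rbrakk> \<Longrightarrow> hadd H x y \<in> hcarrier H"
    and scale_closed: "x \<in> hcarrier H \<Longrightarrow> hscale H a x \<in> hcarrier H"
    and add_assoc: "\<lbrakk>x \<in> hcarrier H; y \<in> hcarrier H; z \<in> hcarrier H\<rbrakk>
      \<Longrightarrow> hadd H (hadd H x y) z = hadd H x (hadd H y z)"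
    and add_commute: "\<lbrakk>x \<in> hcarrier H; y \<in> hcarrier H\<rbrakk> \<Longrightarrow> hadd H x y = hadd H y x"
    and add_zero: "x \<in> hcarrier H \<Longrightarrow> hadd H x (hzero H) = x"
    and diff_self: "x \<in> hcarrier H \<Longrightarrow> hdiff H x x = hzero H"
    and scale_add_right: "\<lbrakk>x \<in> hcarrier H; y \<in> hcarrier H\<rbrakk>
      \<Longrightarrow> hscale H a (hadd H x y) = hadd H (hscale H a x) (hscale H a y)"
    and scale_add_left: "x \<in> hcarrier H
      \<Longrightarrow> hscale H (a + b) x = hadd H (hscale H a x) (hscale H b x)"
    and scale_scale: "x \<in> hcarrier H \<Longrightarrow> hscale H a (hscale H b x) = hscale H (a * b) x"
    and scale_one: "x \<in> hcarrier H \<Longrightarrow> hscale H 1 x = x"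
    and inner_cnj: "\<lbrakk>x \<in> hcarrier H; y \<in> hcarrier H\<rbrakk> \<Longrightarrow> hinner H y x = cnj (hinner H x y)"
    and inner_add: "\<lbrakk>x \<in> hcarrier H; y \<in> hcarrier H; z \<in> hcarrier H\<rbrakk>
      \<Longrightarrow> hinner H (hadd H x y) z = hinner H x z + hinner H y z"
    and inner_scale: "\<lbrakk>x \<in> hcarrier H; y \<in> hcarrier H\<rbrakk>
      \<Longrightarrow> hinner H (hscale H a x) y = a * hinner H x y"
    and inner_pos: "\<lbrakk>x \<in> hcarrier H; x \<noteq> hzero H\<rbrakk> \<Longrightarrow> 0 < Re (hinner H x x)"
    and complete: "\<lbrakk>\<And>n. X n \<in> hcarrier H; hCauchy H X\<rbrakk> \<Longrightarrow> \<exists>x\<in>hcarrier H. hlim H X x"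

definition hsubspace :: "'v hilbert_struct \<Rightarrow> 'v set \<Rightarrow> bool" where
  "hsubspace H K \<longleftrightarrow> K \<subseteq> hcarrier H \<and> hzero H \<in> K
     \<and> (\<forall>x\<in>K. \<forall>y\<in>K. hadd H x y \<in> K) \<and> (\<forall>a. \<forall>x\<in>K. hscale H a x \<in> K)"

definition hclosed :: "'v hilbert_struct \<Rightarrow> 'v set \<Rightarrow> bool" where
  "hclosed H K \<longleftrightarrow> (\<forall>X. \<forall>x\<in>hcarrier H. (\<forall>n. X n \<in> K) \<and> hlim H X x \<longrightarrow> x \<in> K)"

definition hdense :: "'v hilbert_struct \<Rightarrow> 'v set \<Rightarrow> bool" where
  "hdense H K \<longleftrightarrow> (\<forall>x\<in>hcarrier H. \<forall>e>0. \<exists>y\<in>K. hnorm H (hdiff H x y) < e)"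

definition hsum :: "'v hilbert_struct \<Rightarrow> 'w hilbert_struct \<Rightarrow> ('v \<times> 'w) hilbert_struct" where
  "hsum H K = \<lparr>
     hcarrier = hcarrier H \<times> hcarrier K,
     hzero = (hzero H, hzero K),
     hadd = (\<lambda>x y. (hadd H (fst x) (fst y), hadd K (snd x) (snd y))),
     hscale = (\<lambda>a x. (hscale H a (fst x), hscale K a (snd x))),
     hinner = (\<lambda>x y. hinner H (fst x) (fst y) + hinner K (snd x) (snd y))\<rparr>"


section \<open>Operators\<close>

text \<open>
  An operator in a Hilbert space, bounded or not, is a partial map: \<open>dom T\<close> is its domain and
  \<open>T \<circ>\<^sub>m U\<close> is the composition on its natural domain.  Equality of partial maps is equality
  of operators, including their domains.
\<close>

type_synonym 'v operator = "'v \<rightharpoonup> 'v"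

definition linear_op :: "'v hilbert_struct \<Rightarrow> 'v operator \<Rightarrow> bool" where
  "linear_op H T \<longleftrightarrow> hsubspace (hsum H H) (Map.graph T)"

text \<open>Closed operators need not be densely defined.\<close>

definition closed_op :: "'v hilbert_struct \<Rightarrow> 'v operator \<Rightarrow> bool" where
  "closed_op H T \<longleftrightarrow> linear_op H T \<and> hclosed (hsum H H) (Map.graph T)"

definition densely_defined :: "'v hilbert_struct \<Rightarrow> 'v operator \<Rightarrow> bool" where
  "densely_defined H T \<longleftrightarrow> hdense H (dom T)"

definition bounded_ops :: "'v hilbert_struct \<Rightarrow> 'v operator set" where
  "bounded_ops H = {T. linear_op H T \<and> dom T = hcarrier H
     \<and> (\<exists>K. \<forall>x\<in>hcarrier H. hnorm H (the (T x)) \<le> K * hnorm H x)}"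

definition op_norm :: "'v hilbert_struct \<Rightarrow> 'v operator \<Rightarrow> real" where
  "op_norm H T = (SUP x \<in> {x \<in> hcarrier H. hnorm H x \<le> 1}. hnorm H (the (T x)))"

definition scalar_op :: "'v hilbert_struct \<Rightarrow> complex \<Rightarrow> 'v operator" where
  "scalar_op H c = (\<lambda>x. if x \<in> hcarrier H then Some (hscale H c x) else None)"

definition op_kernel :: "'v hilbert_struct \<Rightarrow> 'v operator \<Rightarrow> 'v set" where
  "op_kernel H T = {x. T x = Some (hzero H)}"

definition adjoint_at :: "'v hilbert_struct \<Rightarrow> 'v operator \<Rightarrow> 'v \<Rightarrow> 'v \<Rightarrow> bool" where
  "adjoint_at H T y z \<longleftrightarrow> y \<in> hcarrier H \<and> z \<in> hcarrier H
     \<and> (\<forall>x\<in>dom T. hinner H (the (T x)) y = hinner H x z)"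

text \<open>Meaningful for densely defined \<open>T\<close>, where \<open>z\<close> is unique.\<close>

definition op_adjoint :: "'v hilbert_struct \<Rightarrow> 'v operator \<Rightarrow> 'v operator" where
  "op_adjoint H T = (\<lambda>y. if \<exists>z. adjoint_at H T y z then Some (THE z. adjoint_at H T y z) else None)"

definition projection_op :: "'v hilbert_struct \<Rightarrow> 'v operator \<Rightarrow> bool" where
  "projection_op H P \<longleftrightarrow> P \<in> bounded_ops H \<and> P \<circ>\<^sub>m P = P \<and> op_adjoint H P = P"

definition orth_proj :: "'v hilbert_struct \<Rightarrow> 'v set \<Rightarrow> 'v operator" where
  "orth_proj H K = (\<lambda>x. if x \<in> hcarrier H
     then Some (THE y. y \<in> K \<and> (\<forall>k\<in>K. hinner H (hdiff H x y) k = 0)) else None)"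


section \<open>Polar decomposition and spectral projections\<close>

definition partial_isometry :: "'v hilbert_struct \<Rightarrow> 'v operator \<Rightarrow> bool" where
  "partial_isometry H V \<longleftrightarrow> V \<in> bounded_ops H \<and> projection_op H (op_adjoint H V \<circ>\<^sub>m V)"

definition positive_selfadjoint :: "'v hilbert_struct \<Rightarrow> 'v operator \<Rightarrow> bool" where
  "positive_selfadjoint H A \<longleftrightarrow> linear_op H A \<and> densely_defined H A \<and> op_adjoint H A = A
     \<and> (\<forall>x\<in>dom A. 0 \<le> Re (hinner H (the (A x)) x))"

text \<open>
  \<open>A\<close> is the absolute value of \<open>T\<close>, the positive square root of \<open>T\<^sup>* T\<close>, and \<open>V\<close> is
  the partial isometry with the kernel of \<open>T\<close> such that \<open>T = V A\<close>.
\<close>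

definition polar_decomposition ::
    "'v hilbert_struct \<Rightarrow> 'v operator \<Rightarrow> 'v operator \<Rightarrow> 'v operator \<Rightarrow> bool" where
  "polar_decomposition H T V A \<longleftrightarrow>
     positive_selfadjoint H A \<and> A \<circ>\<^sub>m A = op_adjoint H T \<circ>\<^sub>m T
     \<and> partial_isometry H V \<and> T = V \<circ>\<^sub>m A \<and> op_kernel H V = op_kernel H T"

text \<open>Only the values of \<open>E\<close> on Borel sets are relevant.\<close>

definition projection_valued_measure ::
    "'v hilbert_struct \<Rightarrow> (real set \<Rightarrow> 'v operator) \<Rightarrow> bool" where
  "projection_valued_measure H E \<longleftrightarrow>
     (\<forall>B\<in>sets borel. projection_op H (E B))
     \<and> E UNIV = scalar_op H 1
     \<and> (\<forall>B\<in>sets borel. \<forall>C\<in>sets borel. E (B \<inter> C) = E B \<circ>\<^sub>m E C)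
     \<and> (\<forall>B :: nat \<Rightarrow> real set. range B \<subseteq> sets borel \<and> disjoint_family B \<longrightarrow>
          (\<forall>x\<in>hcarrier H. \<forall>y\<in>hcarrier H.
             (\<lambda>i. hinner H (the (E (B i) x)) y) sums hinner H (the (E (\<Union>i. B i) x)) y))"

definition spectral_distr ::
    "'v hilbert_struct \<Rightarrow> (real set \<Rightarrow> 'v operator) \<Rightarrow> 'v \<Rightarrow> real measure" where
  "spectral_distr H E x =
     measure_of UNIV (sets borel) (\<lambda>B. ennreal (Re (hinner H (the (E B x)) x)))"

text \<open>
  \<open>A\<close> is the integral of the identity function against \<open>E\<close>, so that the \<open>E B\<close> are the
  spectral projections of \<open>A\<close>.  By polarization the quadratic form determines \<open>A\<close> on its domain.
\<close>

definition spectral_resolution ::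
    "'v hilbert_struct \<Rightarrow> 'v operator \<Rightarrow> (real set \<Rightarrow> 'v operator) \<Rightarrow> bool" where
  "spectral_resolution H A E \<longleftrightarrow> linear_op H A \<and> projection_valued_measure H E
     \<and> dom A = {x \<in> hcarrier H. integrable (spectral_distr H E x) (\<lambda>t. t\<^sup>2)}
     \<and> (\<forall>x\<in>dom A. hinner H (the (A x)) x = complex_of_real (LINT t|spectral_distr H E x. t))"


section \<open>Von Neumann algebras and affiliation\<close>

definition commutant :: "'v hilbert_struct \<Rightarrow> 'v operator set \<Rightarrow> 'v operator set" where
  "commutant H X = {A \<in> bounded_ops H. \<forall>B\<in>X. A \<circ>\<^sub>m B = B \<circ>\<^sub>m A}"

text \<open>A bicommutant is automatically a unital algebra.\<close>

definition von_neumann_algebra :: "'v hilbert_struct \<Rightarrow> 'v operator set \<Rightarrow> bool" where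
  "von_neumann_algebra H M \<longleftrightarrow> M \<subseteq> bounded_ops H \<and> (\<forall>A\<in>M. op_adjoint H A \<in> M)
     \<and> commutant H (commutant H M) = M"

definition generated_vna :: "'v hilbert_struct \<Rightarrow> 'v operator set \<Rightarrow> 'v operator set" where
  "generated_vna H X = von_neumann_algebra H hull X"

text \<open>
  For closed, densely defined \<open>T\<close> the polar decomposition and the spectral projections exist
  and are unique.
\<close>

definition affiliated :: "'v hilbert_struct \<Rightarrow> 'v operator set \<Rightarrow> 'v operator \<Rightarrow> bool" where
  "affiliated H M T \<longleftrightarrow> closed_op H T \<and> densely_defined H T
     \<and> (\<exists>V A E. polar_decomposition H T V A \<and> spectral_resolution H A E
          \<and> V \<in> M \<and> (\<forall>B\<in>sets borel. E B \<in> M))"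


section \<open>Measurable fields of Hilbert spaces and direct integrals\<close>

locale measurable_hilbert_field =
  fixes \<omega> :: "'z measure" and H :: "'z \<Rightarrow> 'v hilbert_struct" and S :: "('z \<Rightarrow> 'v) set"
  assumes fibre: "hilbert_space (H \<zeta>)"
    and vector_field: "x \<in> S \<Longrightarrow> x \<zeta> \<in> hcarrier (H \<zeta>)"
    and inner_measurable: "\<lbrakk>x \<in> S; y \<in> S\<rbrakk>
      \<Longrightarrow> (\<lambda>\<zeta>. hinner (H \<zeta>) (x \<zeta>) (y \<zeta>)) \<in> borel_measurable \<omega>"
    and maximal: "\<lbrakk>\<And>\<zeta>. v \<zeta> \<in> hcarrier (H \<zeta>);
        \<And>x. x \<in> S \<Longrightarrow> (\<lambda>\<zeta>. hinner (H \<zeta>) (x \<zeta>) (v \<zeta>)) \<in> borel_measurable \<omega>\<rbrakk>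
      \<Longrightarrow> v \<in> S"
    and fundamental: "\<exists>X :: nat \<Rightarrow> 'z \<Rightarrow> 'v. (\<forall>n. X n \<in> S)
      \<and> (\<forall>\<zeta>. hdense (H \<zeta>) (hsubspace (H \<zeta>) hull range (\<lambda>n. X n \<zeta>)))"

definition sq_integrable_fields ::
    "'z measure \<Rightarrow> ('z \<Rightarrow> 'v hilbert_struct) \<Rightarrow> ('z \<Rightarrow> 'v) set \<Rightarrow> ('z \<Rightarrow> 'v) set" where
  "sq_integrable_fields \<omega> H S = {x \<in> S. integrable \<omega> (\<lambda>\<zeta>. (hnorm (H \<zeta>) (x \<zeta>))\<^sup>2)}"

definition dint_class ::
    "'z measure \<Rightarrow> ('z \<Rightarrow> 'v hilbert_struct) \<Rightarrow> ('z \<Rightarrow> 'v) set \<Rightarrow> ('z \<Rightarrow> 'v) \<Rightarrow> ('z \<Rightarrow> 'v) set" where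
  "dint_class \<omega> H S x = {y \<in> sq_integrable_fields \<omega> H S. AE \<zeta> in \<omega>. y \<zeta> = x \<zeta>}"

definition dint_rep :: "('z \<Rightarrow> 'v) set \<Rightarrow> 'z \<Rightarrow> 'v" where
  "dint_rep X = (SOME x. x \<in> X)"

definition direct_integral ::
    "'z measure \<Rightarrow> ('z \<Rightarrow> 'v hilbert_struct) \<Rightarrow> ('z \<Rightarrow> 'v) set \<Rightarrow> ('z \<Rightarrow> 'v) set hilbert_struct" where
  "direct_integral \<omega> H S = \<lparr>
     hcarrier = dint_class \<omega> H S ` sq_integrable_fields \<omega> H S,
     hzero = dint_class \<omega> H S (\<lambda>\<zeta>. hzero (H \<zeta>)),
     hadd = (\<lambda>X Y. dint_class \<omega> H S (\<lambda>\<zeta>. hadd (H \<zeta>) (dint_rep X \<zeta>) (dint_rep Y \<zeta>))),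
     hscale = (\<lambda>a X. dint_class \<omega> H S (\<lambda>\<zeta>. hscale (H \<zeta>) a (dint_rep X \<zeta>))),
     hinner = (\<lambda>X Y. LINT \<zeta>|\<omega>. hinner (H \<zeta>) (dint_rep X \<zeta>) (dint_rep Y \<zeta>))\<rparr>"


section \<open>Decomposable operators and von Neumann algebras\<close>

definition measurable_bounded_field ::
    "('z \<Rightarrow> 'v hilbert_struct) \<Rightarrow> ('z \<Rightarrow> 'v) set \<Rightarrow> ('z \<Rightarrow> 'v operator) \<Rightarrow> bool" where
  "measurable_bounded_field H S T \<longleftrightarrow> (\<forall>\<zeta>. T \<zeta> \<in> bounded_ops (H \<zeta>))
     \<and> (\<forall>x\<in>S. (\<lambda>\<zeta>. the (T \<zeta> (x \<zeta>))) \<in> S)"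

definition ess_bounded_field ::
    "'z measure \<Rightarrow> ('z \<Rightarrow> 'v hilbert_struct) \<Rightarrow> ('z \<Rightarrow> 'v) set \<Rightarrow> ('z \<Rightarrow> 'v operator) \<Rightarrow> bool" where
  "ess_bounded_field \<omega> H S T \<longleftrightarrow> measurable_bounded_field H S T
     \<and> (\<exists>K. AE \<zeta> in \<omega>. op_norm (H \<zeta>) (T \<zeta>) \<le> K)"

text \<open>
  The entries of the projection onto the graph, as a two by two matrix over the bounded
  operators acting on the sum of two copies of \<open>H\<close>.
\<close>

definition graph_proj :: "'v hilbert_struct \<Rightarrow> 'v operator \<Rightarrow> ('v \<times> 'v) operator" where
  "graph_proj H T = orth_proj (hsum H H) (Map.graph T)"

definition entry11 :: "'v hilbert_struct \<Rightarrow> ('v \<times> 'v) operator \<Rightarrow> 'v operator" where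
  "entry11 H P = (\<lambda>x. map_option fst (P (x, hzero H)))"

definition entry12 :: "'v hilbert_struct \<Rightarrow> ('v \<times> 'v) operator \<Rightarrow> 'v operator" where
  "entry12 H P = (\<lambda>x. map_option fst (P (hzero H, x)))"

definition entry21 :: "'v hilbert_struct \<Rightarrow> ('v \<times> 'v) operator \<Rightarrow> 'v operator" where
  "entry21 H P = (\<lambda>x. map_option snd (P (x, hzero H)))"

definition entry22 :: "'v hilbert_struct \<Rightarrow> ('v \<times> 'v) operator \<Rightarrow> 'v operator" where
  "entry22 H P = (\<lambda>x. map_option snd (P (hzero H, x)))"

definition measurable_closed_field ::
    "('z \<Rightarrow> 'v hilbert_struct) \<Rightarrow> ('z \<Rightarrow> 'v) set \<Rightarrow> ('z \<Rightarrow> 'v operator) \<Rightarrow> bool" where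
  "measurable_closed_field H S T \<longleftrightarrow> (\<forall>\<zeta>. closed_op (H \<zeta>) (T \<zeta>))
     \<and> measurable_bounded_field H S (\<lambda>\<zeta>. entry11 (H \<zeta>) (graph_proj (H \<zeta>) (T \<zeta>)))
     \<and> measurable_bounded_field H S (\<lambda>\<zeta>. entry12 (H \<zeta>) (graph_proj (H \<zeta>) (T \<zeta>)))
     \<and> measurable_bounded_field H S (\<lambda>\<zeta>. entry21 (H \<zeta>) (graph_proj (H \<zeta>) (T \<zeta>)))
     \<and> measurable_bounded_field H S (\<lambda>\<zeta>. entry22 (H \<zeta>) (graph_proj (H \<zeta>) (T \<zeta>)))"

text \<open>
  \<open>x\<close> is a representative of \<open>X\<close> witnessing that \<open>X\<close> is in the domain of the direct integral
  of \<open>T\<close>.  Any two such representatives agree almost everywhere, so the value does not depend on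
  the choice.
\<close>

definition dint_witness ::
    "'z measure \<Rightarrow> ('z \<Rightarrow> 'v hilbert_struct) \<Rightarrow> ('z \<Rightarrow> 'v) set \<Rightarrow> ('z \<Rightarrow> 'v operator)
      \<Rightarrow> ('z \<Rightarrow> 'v) set \<Rightarrow> ('z \<Rightarrow> 'v) \<Rightarrow> bool" where
  "dint_witness \<omega> H S T X x \<longleftrightarrow> X \<in> hcarrier (direct_integral \<omega> H S) \<and> x \<in> X
     \<and> (\<forall>\<zeta>. x \<zeta> \<in> dom (T \<zeta>)) \<and> (\<lambda>\<zeta>. the (T \<zeta> (x \<zeta>))) \<in> sq_integrable_fields \<omega> H S"

text \<open>On essentially bounded fields this is the everywhere defined bounded operator.\<close>

definition dint_op ::
    "'z measure \<Rightarrow> ('z \<Rightarrow> 'v hilbert_struct) \<Rightarrow> ('z \<Rightarrow> 'v) set \<Rightarrow> ('z \<Rightarrow> 'v operator)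
      \<Rightarrow> ('z \<Rightarrow> 'v) set operator" where
  "dint_op \<omega> H S T = (\<lambda>X. if \<exists>x. dint_witness \<omega> H S T X x
     then Some (dint_class \<omega> H S (\<lambda>\<zeta>. the (T \<zeta> ((SOME x. dint_witness \<omega> H S T X x) \<zeta>))))
     else None)"

definition decomposition_of ::
    "'z measure \<Rightarrow> ('z \<Rightarrow> 'v hilbert_struct) \<Rightarrow> ('z \<Rightarrow> 'v) set
      \<Rightarrow> ('z \<Rightarrow> 'v) set operator \<Rightarrow> ('z \<Rightarrow> 'v operator) \<Rightarrow> bool" where
  "decomposition_of \<omega> H S T Tf \<longleftrightarrow> measurable_closed_field H S Tf \<and> T = dint_op \<omega> H S Tf"

definition decomposable_op ::
    "'z measure \<Rightarrow> ('z \<Rightarrow> 'v hilbert_struct) \<Rightarrow> ('z \<Rightarrow> 'v) set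
      \<Rightarrow> ('z \<Rightarrow> 'v) set operator \<Rightarrow> bool" where
  "decomposable_op \<omega> H S T \<longleftrightarrow> (\<exists>Tf. decomposition_of \<omega> H S T Tf)"

definition diagonal_ops ::
    "'z measure \<Rightarrow> ('z \<Rightarrow> 'v hilbert_struct) \<Rightarrow> ('z \<Rightarrow> 'v) set
      \<Rightarrow> ('z \<Rightarrow> 'v) set operator set" where
  "diagonal_ops \<omega> H S =
     dint_op \<omega> H S ` {T. ess_bounded_field \<omega> H S T \<and> (\<forall>\<zeta>. \<exists>c. T \<zeta> = scalar_op (H \<zeta>) c)}"

text \<open>
  \<open>M\<close> is the direct integral of the field \<open>Mf\<close>, which only matters up to null sets;
  \<open>G\<close> is the countable set of fields that generates \<open>M\<close> together with the diagonal operators.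
\<close>

definition decomposable_vna ::
    "'z measure \<Rightarrow> ('z \<Rightarrow> 'v hilbert_struct) \<Rightarrow> ('z \<Rightarrow> 'v) set
      \<Rightarrow> ('z \<Rightarrow> 'v) set operator set \<Rightarrow> ('z \<Rightarrow> 'v operator set) \<Rightarrow> bool" where
  "decomposable_vna \<omega> H S M Mf \<longleftrightarrow> von_neumann_algebra (direct_integral \<omega> H S) M
     \<and> (\<exists>G. countable G \<and> (\<forall>T\<in>G. ess_bounded_field \<omega> H S T)
          \<and> M = generated_vna (direct_integral \<omega> H S) (diagonal_ops \<omega> H S \<union> dint_op \<omega> H S ` G)
          \<and> (AE \<zeta> in \<omega>. Mf \<zeta> = generated_vna (H \<zeta>) ((\<lambda>T. T \<zeta>) ` G)))"

end

theory Submission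
  imports Defs "HOL-Probability.Helly_Selection"
begin

text \<open>
  The proof replaces the closed operator \<open>T\<close> by the four entries of the projection onto its graph, which
  are bounded operators.

  For a densely defined \<open>T\<close> and any von Neumann algebra \<open>N\<close>, affiliation of \<open>T\<close> to \<open>N\<close> means that the entries
  belong to \<open>N\<close>.  If \<open>T = V A\<close> is affiliated, then every unitary of the commutant of \<open>N\<close> commutes with \<open>V\<close> and
  with the spectral projections of \<open>A\<close>.  It therefore leaves the graph of \<open>T\<close> invariant and commutes with the
  projection, and the unitaries span the commutant (\<open>affiliated_imp_entries\<close>).  Conversely, the first column of
  the projection consists of \<open>R = (1 + T* T)^(-1)\<close> and \<open>S = T R\<close>, and the polar decomposition can be recovered
  from these two (\<open>entries_imp_affiliated\<close>).  With \<open>cosine = R^(1/2)\<close> and \<open>sine = (1 - R)^(1/2)\<close>, the absolute value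
  of \<open>T\<close> is a tangent: its graph consists of the pairs \<open>(cosine w, sine w)\<close>.  Its spectral projections are
  Borel functions of \<open>R\<close>, and the phase is a strong limit of products of \<open>S\<close> with functions of \<open>R\<close>.  The Borel
  functions of \<open>R\<close> come from measures with the moments \<open>\<langle>R\<^sup>j x, x\<rangle>\<close>, which are found with Bernstein polynomials.

  A bounded operator belongs to \<open>M\<close> exactly if it is decomposable with almost all fibres in the algebras
  \<open>M(\<zeta>)\<close> (\<open>decomposable_vna_iff\<close>).  This rests on two facts: an operator that commutes with the diagonal
  operators is decomposable (\<open>commutant_diagonal_decomposable\<close>), and an operator in the bicommutant of a star
  algebra is approximated by the algebra strongly, together with its adjoint (\<open>strong_star_approximation\<close>).
  Fast convergence in the direct integral implies convergence in almost every fibre.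

  Finally, graph projections and direct integrals are compatible.  The entries of a direct integral of closed
  operators are the direct integrals of the entries (\<open>entries_dop\<close>).  In the other direction, a closed operator
  with decomposable entries is decomposable (\<open>decomposable_of_entries\<close>): what distinguishes the matrix of a graph
  projection are algebraic identities and the injectivity of one operator, and both can be tested in almost
  every fibre.  The domain of \<open>T\<close> is dense exactly if \<open>R\<close> is injective, which is decided in the fibres in
  the same way (\<open>densely_defined_fibres_iff\<close>).

  So \<open>T\<close> is affiliated to \<open>M\<close> exactly if it is densely defined with entries in \<open>M\<close>, that is, if it is a direct
  integral of operators that are, in almost every fibre, densely defined with entries in \<open>M(\<zeta>)\<close>.
\<close>

section \<open>Hilbert spaces with an explicit carrier\<close>

abbreviation ap :: "'v operator \<Rightarrow> 'v \<Rightarrow> 'v" where "ap T x \<equiv> the (T x)"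

lemma tendsto_0_le:
  fixes f :: "nat \<Rightarrow> 'a::real_normed_vector"
  assumes "g \<longlonglongrightarrow> 0" "\<And>n. norm (f n) \<le> g n" shows "f \<longlonglongrightarrow> 0"
  using Lim_null_comparison[of f g sequentially] assms by simp

lemma le_of_mult_le: fixes a b :: real shows "a * a \<le> b * a \<Longrightarrow> 0 \<le> b \<Longrightarrow> a \<le> b"
  by (cases "a \<le> 0") (auto dest: mult_right_le_imp_le)

definition mk_op :: "'v hilbert_struct \<Rightarrow> ('v \<Rightarrow> 'v) \<Rightarrow> 'v operator" where
  "mk_op H f = (\<lambda>x. if x \<in> hcarrier H then Some (f x) else None)"

definition op_lin :: "'v hilbert_struct \<Rightarrow> complex \<Rightarrow> 'v operator \<Rightarrow> complex \<Rightarrow> 'v operator \<Rightarrow> 'v operator" where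
  "op_lin H c A d B = mk_op H (\<lambda>x. hadd H (hscale H c (ap A x)) (hscale H d (ap B x)))"

lemma hsum_simps [simp]:
  "hcarrier (hsum H K) = hcarrier H \<times> hcarrier K"
  "hzero (hsum H K) = (hzero H, hzero K)"
  "hadd (hsum H K) x y = (hadd H (fst x) (fst y), hadd K (snd x) (snd y))"
  "hscale (hsum H K) a x = (hscale H a (fst x), hscale K a (snd x))"
  "hinner (hsum H K) x y = hinner H (fst x) (fst y) + hinner K (snd x) (snd y)"
  "hdiff (hsum H K) x y = (hdiff H (fst x) (fst y), hdiff K (snd x) (snd y))"
  by (simp_all add: hsum_def hdiff_def)

context hilbert_space
begin

declare zero_closed [simp] add_closed [simp] scale_closed [simp]
  inner_add [simp] inner_scale [simp]

abbreviation "C \<equiv> hcarrier H"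

lemma diff_closed [simp]: "x \<in> C \<Longrightarrow> y \<in> C \<Longrightarrow> hdiff H x y \<in> C"
  by (simp add: hdiff_def)

lemma inner_add_right [simp]:
  "\<lbrakk>x \<in> C; y \<in> C; z \<in> C\<rbrakk> \<Longrightarrow> hinner H z (hadd H x y) = hinner H z x + hinner H z y"
  by (metis add_closed complex_cnj_add inner_add inner_cnj)

lemma inner_scale_right [simp]:
  "\<lbrakk>x \<in> C; z \<in> C\<rbrakk> \<Longrightarrow> hinner H z (hscale H a x) = cnj a * hinner H z x"
  by (metis scale_closed complex_cnj_mult inner_scale inner_cnj)

lemma inner_diff_left [simp]:
  "\<lbrakk>x \<in> C; y \<in> C; z \<in> C\<rbrakk> \<Longrightarrow> hinner H (hdiff H x y) z = hinner H x z - hinner H y z"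
  by (simp add: hdiff_def)

lemma inner_diff_right [simp]:
  "\<lbrakk>x \<in> C; y \<in> C; z \<in> C\<rbrakk> \<Longrightarrow> hinner H z (hdiff H x y) = hinner H z x - hinner H z y"
  by (simp add: hdiff_def)

lemma inner_zero_left [simp]: "x \<in> C \<Longrightarrow> hinner H (hzero H) x = 0"
  by (metis diff_self inner_diff_left diff_self zero_closed cancel_comm_monoid_add_class.diff_cancel)

lemma inner_zero_right [simp]: "x \<in> C \<Longrightarrow> hinner H x (hzero H) = 0"
  by (metis complex_cnj_zero inner_cnj inner_zero_left zero_closed)

lemma inner_self_zero: "x \<in> C \<Longrightarrow> hinner H x x = 0 \<Longrightarrow> x = hzero H"
  using inner_pos by fastforce

lemma Im_inner_self [simp]: "x \<in> C \<Longrightarrow> Im (hinner H x x) = 0"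
  using arg_cong[OF inner_cnj[of x x], of Im] by simp

lemma Re_inner_self_ge [simp]: "x \<in> C \<Longrightarrow> 0 \<le> Re (hinner H x x)"
  using inner_pos[of x] by (cases "x = hzero H") auto

lemma hnorm_sq: "x \<in> C \<Longrightarrow> (hnorm H x)\<^sup>2 = Re (hinner H x x)"
  by (simp add: hnorm_def)

lemma inner_self: "x \<in> C \<Longrightarrow> hinner H x x = complex_of_real ((hnorm H x)\<^sup>2)"
  by (simp add: hnorm_sq complex_eq_iff)

lemma hnorm_ge [simp]: "x \<in> C \<Longrightarrow> 0 \<le> hnorm H x"
  by (simp add: hnorm_def)

lemma hnorm_zero [simp]: "hnorm H (hzero H) = 0"
  by (simp add: hnorm_def)

lemma hnorm_eq_0: "x \<in> C \<Longrightarrow> hnorm H x = 0 \<longleftrightarrow> x = hzero H"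
  using inner_self_zero inner_self by fastforce

lemma hdiff_eq_0: assumes "x \<in> C" "y \<in> C" shows "hdiff H x y = hzero H \<longleftrightarrow> x = y"
proof
  assume *: "hdiff H x y = hzero H"
  have m: "hscale H (-1) y \<in> C" using assms by simp
  have "hadd H y (hscale H (-1) y) = hzero H" using diff_self assms by (simp add: hdiff_def)
  then have "x = hadd H x (hadd H (hscale H (-1) y) y)"
    using add_zero assms add_commute by (metis scale_closed)
  also have "\<dots> = hadd H (hdiff H x y) y" using add_assoc m assms by (simp add: hdiff_def)
  also have "\<dots> = y" using * add_zero add_commute assms by (metis zero_closed)
  finally show "x = y" .
qed (use diff_self assms in auto)

lemma inner_ext:
  assumes "x \<in> C" "y \<in> C" "\<And>z. z \<in> C \<Longrightarrow> hinner H x z = hinner H y z"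
  shows "x = y"
proof -
  have "hinner H (hdiff H x y) (hdiff H x y) = 0" using assms(1,2) assms(3)[of x] assms(3)[of y] by simp
  then have "hdiff H x y = hzero H" using inner_self_zero assms(1,2) by simp
  then show ?thesis using hdiff_eq_0 assms(1,2) by simp
qed

lemma scale_zero [simp]: "x \<in> C \<Longrightarrow> hscale H 0 x = hzero H"
  by (rule inner_ext) auto

lemma scale_hzero [simp]: "hscale H a (hzero H) = hzero H"
  by (rule inner_ext) auto

lemma diff_add_cancel: "x \<in> C \<Longrightarrow> y \<in> C \<Longrightarrow> hadd H (hdiff H x y) y = x"
  by (rule inner_ext) auto

lemma hdiff_zero [simp]: "x \<in> C \<Longrightarrow> hdiff H x (hzero H) = x"
  by (rule inner_ext) auto

text \<open>
  The coefficient \<open>c = \<langle>z, k\<rangle> / \<parallel>k\<parallel>\<^sup>2\<close> removes the component of \<open>z\<close> along \<open>k\<close>. Both the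
  Cauchy-Schwarz inequality and the orthogonality of minimizers are read off from what
  remains.
\<close>

lemma subtract_component:
  assumes z: "z \<in> C" and k: "k \<in> C" "k \<noteq> hzero H"
  obtains c where "(hnorm H (hdiff H z (hscale H c k)))\<^sup>2 = (hnorm H z)\<^sup>2 - (cmod (hinner H z k))\<^sup>2 / (hnorm H k)\<^sup>2"
proof -
  define n where "n = (hnorm H k)\<^sup>2"
  have n: "n > 0" using k inner_pos by (simp add: n_def hnorm_sq)
  have kk: "hinner H k k = n" using inner_self k n_def by simp
  define c where "c = hinner H z k / n"
  have "hinner H (hdiff H z (hscale H c k)) (hdiff H z (hscale H c k))
     = hinner H z z - cnj c * hinner H z k - c * (hinner H k z - cnj c * n)"
    using z k by (simp add: kk algebra_simps)
  also have "\<dots> = hinner H z z - (hinner H z k * cnj (hinner H z k)) / n"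
    using n z k inner_cnj[of z k] by (simp add: c_def field_simps power2_eq_square)
  also have "\<dots> = complex_of_real ((hnorm H z)\<^sup>2 - (cmod (hinner H z k))\<^sup>2 / n)"
    using inner_self[OF z] by (simp add: complex_norm_square[symmetric])
  finally have "(hnorm H (hdiff H z (hscale H c k)))\<^sup>2 = (hnorm H z)\<^sup>2 - (cmod (hinner H z k))\<^sup>2 / n"
    unfolding inner_self[OF diff_closed[OF z scale_closed[OF k(1)]]] of_real_eq_iff .
  then show thesis using that unfolding n_def by blast
qed

lemma Cauchy_Schwarz:
  assumes "x \<in> C" "y \<in> C" shows "cmod (hinner H x y) \<le> hnorm H x * hnorm H y"
proof (cases "y = hzero H")
  case False
  then have n: "0 < (hnorm H y)\<^sup>2" using assms inner_pos by (simp add: hnorm_sq)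
  obtain c where c: "(hnorm H (hdiff H x (hscale H c y)))\<^sup>2 = (hnorm H x)\<^sup>2 - (cmod (hinner H x y))\<^sup>2 / (hnorm H y)\<^sup>2"
    using subtract_component[OF assms False] .
  then have "(cmod (hinner H x y))\<^sup>2 / (hnorm H y)\<^sup>2 \<le> (hnorm H x)\<^sup>2" by (metis zero_le_power2 diff_ge_0_iff_ge)
  then have "(cmod (hinner H x y))\<^sup>2 \<le> (hnorm H x * hnorm H y)\<^sup>2"
    using n by (simp add: pos_divide_le_eq power_mult_distrib)
  then show ?thesis using assms by (meson hnorm_ge mult_nonneg_nonneg power2_le_imp_le)
qed (use assms in auto)

lemma hnorm_scale [simp]: "x \<in> C \<Longrightarrow> hnorm H (hscale H a x) = cmod a * hnorm H x"
proof -
  assume x: "x \<in> C"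
  have "hinner H (hscale H a x) (hscale H a x) = (a * cnj a) * hinner H x x" using x by simp
  also have "\<dots> = of_real ((cmod a)\<^sup>2 * (hnorm H x)\<^sup>2)"
    by (simp add: complex_norm_square[symmetric] inner_self x)
  finally have "(hnorm H (hscale H a x))\<^sup>2 = (cmod a * hnorm H x)\<^sup>2"
    using x by (simp add: hnorm_sq power_mult_distrib)
  then show ?thesis using x by (simp add: power2_eq_iff_nonneg)
qed

lemma hnorm_triangle: assumes "x \<in> C" "y \<in> C" shows "hnorm H (hadd H x y) \<le> hnorm H x + hnorm H y"
proof -
  have "(hnorm H (hadd H x y))\<^sup>2 = (hnorm H x)\<^sup>2 + (hnorm H y)\<^sup>2 + 2 * Re (hinner H x y)"
    using assms inner_cnj[of x y] by (simp add: hnorm_sq)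
  also have "Re (hinner H x y) \<le> hnorm H x * hnorm H y"
    using Cauchy_Schwarz[OF assms] complex_Re_le_cmod order_trans by blast
  finally have "(hnorm H (hadd H x y))\<^sup>2 \<le> (hnorm H x + hnorm H y)\<^sup>2"
    by (simp add: power2_sum)
  then show ?thesis using assms by (meson add_nonneg_nonneg hnorm_ge power2_le_imp_le)
qed

lemma hnorm_diff_commute: assumes "x \<in> C" "y \<in> C" shows "hnorm H (hdiff H x y) = hnorm H (hdiff H y x)"
proof -
  have "hdiff H x y = hscale H (-1) (hdiff H y x)" by (rule inner_ext) (use assms in auto)
  then show ?thesis using assms by simp
qed

lemma hnorm_triangle_diff: assumes "x \<in> C" "y \<in> C" "z \<in> C"
  shows "hnorm H (hdiff H x z) \<le> hnorm H (hdiff H x y) + hnorm H (hdiff H y z)"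
proof -
  have "hdiff H x z = hadd H (hdiff H x y) (hdiff H y z)" by (rule inner_ext) (use assms in auto)
  then show ?thesis using hnorm_triangle assms by (metis diff_closed)
qed

lemma parallelogram: assumes "x \<in> C" "y \<in> C"
  shows "(hnorm H (hadd H x y))\<^sup>2 + (hnorm H (hdiff H x y))\<^sup>2 = 2 * (hnorm H x)\<^sup>2 + 2 * (hnorm H y)\<^sup>2"
  using assms by (simp add: hnorm_sq)

lemma hlim_inner:
  assumes "hlim H X x" "\<And>n. X n \<in> C" "x \<in> C" "hlim H Y y" "\<And>n. Y n \<in> C" "y \<in> C"
  shows "(\<lambda>n. hinner H (X n) (Y n)) \<longlonglongrightarrow> hinner H x y"
proof -
  have b: "cmod (hinner H (X n) (Y n) - hinner H x y)
     \<le> hnorm H (hdiff H (X n) x) * hnorm H (hdiff H (Y n) y)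
      + hnorm H (hdiff H (X n) x) * hnorm H y + hnorm H x * hnorm H (hdiff H (Y n) y)" for n
  proof -
    have "hinner H (X n) (Y n) - hinner H x y = hinner H (hdiff H (X n) x) (hdiff H (Y n) y)
      + hinner H (hdiff H (X n) x) y + hinner H x (hdiff H (Y n) y)"
      using assms by (simp add: algebra_simps)
    also have "cmod \<dots> \<le> cmod (hinner H (hdiff H (X n) x) (hdiff H (Y n) y))
      + cmod (hinner H (hdiff H (X n) x) y) + cmod (hinner H x (hdiff H (Y n) y))"
      by (meson norm_triangle_ineq order_trans add_mono order_refl)
    also have "\<dots> \<le> hnorm H (hdiff H (X n) x) * hnorm H (hdiff H (Y n) y)
      + hnorm H (hdiff H (X n) x) * hnorm H y + hnorm H x * hnorm H (hdiff H (Y n) y)"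
      using assms by (intro add_mono Cauchy_Schwarz) auto
    finally show ?thesis .
  qed
  have "(\<lambda>n. hnorm H (hdiff H (X n) x) * hnorm H (hdiff H (Y n) y)
      + hnorm H (hdiff H (X n) x) * hnorm H y + hnorm H x * hnorm H (hdiff H (Y n) y))
     \<longlonglongrightarrow> 0 * 0 + 0 * hnorm H y + hnorm H x * 0"
    using assms unfolding hlim_def by (intro tendsto_intros) auto
  then have l: "(\<lambda>n. hnorm H (hdiff H (X n) x) * hnorm H (hdiff H (Y n) y)
      + hnorm H (hdiff H (X n) x) * hnorm H y + hnorm H x * hnorm H (hdiff H (Y n) y)) \<longlonglongrightarrow> 0"
    by simp
  have "(\<lambda>n. hinner H (X n) (Y n) - hinner H x y) \<longlonglongrightarrow> 0"
    by (rule tendsto_0_le[OF l b])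
  then show ?thesis using LIM_zero_iff by blast
qed

lemma hlim_const [simp]: "x \<in> C \<Longrightarrow> hlim H (\<lambda>n. x) x"
  by (simp add: hlim_def diff_self)

lemma hlim_inner_left:
  "\<lbrakk>hlim H X x; \<And>n. X n \<in> C; x \<in> C; y \<in> C\<rbrakk> \<Longrightarrow> (\<lambda>n. hinner H (X n) y) \<longlonglongrightarrow> hinner H x y"
  by (rule hlim_inner) auto

lemma hlim_norm:
  assumes "hlim H X x" "\<And>n. X n \<in> C" "x \<in> C" shows "(\<lambda>n. hnorm H (X n)) \<longlonglongrightarrow> hnorm H x"
proof -
  have "(\<lambda>n. sqrt (Re (hinner H (X n) (X n)))) \<longlonglongrightarrow> sqrt (Re (hinner H x x))"
    by (intro tendsto_intros hlim_inner assms)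
  then show ?thesis by (simp add: hnorm_def)
qed

lemma hlim_unique:
  assumes "hlim H X x" "hlim H X y" "\<And>n. X n \<in> C" "x \<in> C" "y \<in> C" shows "x = y"
proof (rule inner_ext)
  fix z assume "z \<in> C"
  then show "hinner H x z = hinner H y z"
    using hlim_inner_left[of X x z] hlim_inner_left[of X y z] assms LIMSEQ_unique by blast
qed (use assms in auto)

lemma hlim_add:
  assumes "hlim H X x" "\<And>n. X n \<in> C" "x \<in> C" "hlim H Y y" "\<And>n. Y n \<in> C" "y \<in> C"
  shows "hlim H (\<lambda>n. hadd H (X n) (Y n)) (hadd H x y)"
proof -
  have "hdiff H (hadd H (X n) (Y n)) (hadd H x y) = hadd H (hdiff H (X n) x) (hdiff H (Y n) y)" for n
    by (rule inner_ext) (use assms in auto)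
  then have b: "norm (hnorm H (hdiff H (hadd H (X n) (Y n)) (hadd H x y)))
     \<le> hnorm H (hdiff H (X n) x) + hnorm H (hdiff H (Y n) y)" for n
    using hnorm_triangle assms by simp
  have l: "(\<lambda>n. hnorm H (hdiff H (X n) x) + hnorm H (hdiff H (Y n) y)) \<longlonglongrightarrow> 0"
    using assms(1,4) unfolding hlim_def by (rule tendsto_add_zero)
  show ?thesis unfolding hlim_def by (rule tendsto_0_le[OF l b])
qed

lemma hlim_scale:
  assumes "hlim H X x" "\<And>n. X n \<in> C" "x \<in> C"
  shows "hlim H (\<lambda>n. hscale H a (X n)) (hscale H a x)"
proof -
  have "hdiff H (hscale H a (X n)) (hscale H a x) = hscale H a (hdiff H (X n) x)" for n
    by (rule inner_ext) (use assms in \<open>auto simp: algebra_simps\<close>)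
  then show ?thesis using assms tendsto_mult_right_zero[of "\<lambda>n. hnorm H (hdiff H (X n) x)" _ "cmod a"]
    by (simp add: hlim_def)
qed

lemma hlim_diff:
  assumes "hlim H X x" "\<And>n. X n \<in> C" "x \<in> C" "hlim H Y y" "\<And>n. Y n \<in> C" "y \<in> C"
  shows "hlim H (\<lambda>n. hdiff H (X n) (Y n)) (hdiff H x y)"
  unfolding hdiff_def using assms by (intro hlim_add hlim_scale) auto

text \<open>A Lipschitz image of a convergent sequence is Cauchy.\<close>

lemma dominated_converges:
  assumes X: "hlim H X x" "\<And>n. X n \<in> C" "x \<in> C" and Y: "\<And>n. Y n \<in> C"
    and le: "\<And>m n. hnorm H (hdiff H (Y m) (Y n)) \<le> K * hnorm H (hdiff H (X m) (X n))"
  shows "\<exists>z\<in>C. hlim H Y z"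
proof (rule complete[OF Y])
  show "hCauchy H Y" unfolding hCauchy_def
  proof (intro allI impI)
    fix e :: real assume e: "e > 0"
    have "(\<lambda>n. \<bar>K\<bar> * hnorm H (hdiff H (X n) x)) \<longlonglongrightarrow> 0"
      using X(1) unfolding hlim_def by (rule tendsto_mult_right_zero)
    then have "\<forall>\<^sub>F n in sequentially. \<bar>K\<bar> * hnorm H (hdiff H (X n) x) < e / 2"
      using e by (intro order_tendstoD(2)) auto
    then obtain N where N: "\<And>n. n \<ge> N \<Longrightarrow> \<bar>K\<bar> * hnorm H (hdiff H (X n) x) < e / 2" by (auto simp: eventually_sequentially)
    have "hnorm H (hdiff H (Y m) (Y n)) < e" if "m \<ge> N" "n \<ge> N" for m n
    proof -
      have "hnorm H (hdiff H (Y m) (Y n)) \<le> \<bar>K\<bar> * hnorm H (hdiff H (X m) (X n))"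
        by (rule order_trans[OF le mult_right_mono[OF abs_ge_self]]) (use X(2) in simp)
      also have "\<dots> \<le> \<bar>K\<bar> * (hnorm H (hdiff H (X m) x) + hnorm H (hdiff H (X n) x))"
        using hnorm_triangle_diff[OF X(2,3,2), of m n] hnorm_diff_commute[OF X(3,2), of n] by (intro mult_left_mono) auto
      also have "\<dots> < e" using N[OF that(1)] N[OF that(2)] by (simp add: distrib_left)
      finally show ?thesis .
    qed
    then show "\<exists>N. \<forall>m\<ge>N. \<forall>n\<ge>N. hnorm H (hdiff H (Y m) (Y n)) < e" by blast
  qed
qed

lemma hsubspace_simps:
  assumes "hsubspace H K"
  shows "hzero H \<in> K" "x \<in> K \<Longrightarrow> x \<in> C" "x \<in> K \<Longrightarrow> y \<in> K \<Longrightarrow> hadd H x y \<in> K"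
    "x \<in> K \<Longrightarrow> hscale H a x \<in> K" "x \<in> K \<Longrightarrow> y \<in> K \<Longrightarrow> hdiff H x y \<in> K"
  using assms by (auto simp: hsubspace_def hdiff_def)

end

lemma hsum_hnorm_le:
  assumes "hilbert_space H" "hilbert_space K" "x \<in> hcarrier H" "y \<in> hcarrier K"
  shows "hnorm H x \<le> hnorm (hsum H K) (x, y)" "hnorm K y \<le> hnorm (hsum H K) (x, y)"
    "hnorm (hsum H K) (x, y) \<le> hnorm H x + hnorm K y"
proof -
  interpret H: hilbert_space H by fact
  interpret K: hilbert_space K by fact
  show "hnorm H x \<le> hnorm (hsum H K) (x, y)" "hnorm K y \<le> hnorm (hsum H K) (x, y)"
    using assms by (simp_all add: hnorm_def)
  have "hnorm (hsum H K) (x, y) = sqrt ((hnorm H x)\<^sup>2 + (hnorm K y)\<^sup>2)"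
    using assms by (simp add: H.hnorm_sq K.hnorm_sq) (simp add: hnorm_def)
  also have "\<dots> \<le> hnorm H x + hnorm K y"
    using sqrt_sum_squares_le_sum[of "hnorm H x" "hnorm K y"] assms by simp
  finally show "hnorm (hsum H K) (x, y) \<le> hnorm H x + hnorm K y" .
qed

lemma hsum_hlim_iff:
  assumes "hilbert_space H" "hilbert_space K" "\<And>n. X n \<in> hcarrier H \<times> hcarrier K" "x \<in> hcarrier H \<times> hcarrier K"
  shows "hlim (hsum H K) X x \<longleftrightarrow> hlim H (\<lambda>n. fst (X n)) (fst x) \<and> hlim K (\<lambda>n. snd (X n)) (snd x)"
proof -
  interpret H: hilbert_space H by fact
  interpret K: hilbert_space K by fact
  have c: "fst (X n) \<in> hcarrier H" "snd (X n) \<in> hcarrier K" "fst x \<in> hcarrier H" "snd x \<in> hcarrier K" for n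
    using assms(3)[of n] assms(4) by (auto simp: mem_Times_iff)
  note le = hsum_hnorm_le[OF assms(1,2), of "hdiff H (fst (X n)) (fst x)" "hdiff K (snd (X n)) (snd x)" for n]
  show ?thesis
  proof
    assume *: "hlim (hsum H K) X x"
    then have l: "(\<lambda>n. hnorm (hsum H K) (hdiff H (fst (X n)) (fst x), hdiff K (snd (X n)) (snd x))) \<longlonglongrightarrow> 0"
      by (simp add: hlim_def)
    have "hlim H (\<lambda>n. fst (X n)) (fst x)" unfolding hlim_def
      by (rule tendsto_0_le[OF l]) (use le c in simp)
    moreover have "hlim K (\<lambda>n. snd (X n)) (snd x)" unfolding hlim_def
      by (rule tendsto_0_le[OF l]) (use le c in simp)
    ultimately show "hlim H (\<lambda>n. fst (X n)) (fst x) \<and> hlim K (\<lambda>n. snd (X n)) (snd x)" by simp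
  next
    assume *: "hlim H (\<lambda>n. fst (X n)) (fst x) \<and> hlim K (\<lambda>n. snd (X n)) (snd x)"
    then have "(\<lambda>n. hnorm H (hdiff H (fst (X n)) (fst x)) + hnorm K (hdiff K (snd (X n)) (snd x))) \<longlonglongrightarrow> 0"
      unfolding hlim_def by (intro tendsto_add_zero) auto
    moreover have "norm (hnorm (hsum H K) (hdiff (hsum H K) (X n) x)) \<le>
        hnorm H (hdiff H (fst (X n)) (fst x)) + hnorm K (hdiff K (snd (X n)) (snd x))" for n
      using le[of n] c H.hnorm_ge[of "hdiff H (fst (X n)) (fst x)"] by simp
    ultimately show "hlim (hsum H K) X x" unfolding hlim_def
      by (rule tendsto_0_le)
  qed
qed

lemma hilbert_space_hsum:
  assumes "hilbert_space H" "hilbert_space K" shows "hilbert_space (hsum H K)"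
proof -
  interpret H: hilbert_space H by fact
  interpret K: hilbert_space K by fact
  note le = hsum_hnorm_le[OF assms]
  show ?thesis
  proof
    fix x assume "x \<in> hcarrier (hsum H K)" "x \<noteq> hzero (hsum H K)"
    then show "0 < Re (hinner (hsum H K) x x)"
      using H.inner_pos K.inner_pos H.Re_inner_self_ge K.Re_inner_self_ge
      by (cases x) (auto intro: add_pos_nonneg add_nonneg_pos)
  next
    fix X assume X: "\<And>n. X n \<in> hcarrier (hsum H K)" and Ca: "hCauchy (hsum H K) X"
    have c: "fst (X n) \<in> hcarrier H" "snd (X n) \<in> hcarrier K" for n
      using X[of n] by auto
    have le1: "hnorm H (hdiff H (fst (X m)) (fst (X n))) \<le> hnorm (hsum H K) (hdiff (hsum H K) (X m) (X n))"
       "hnorm K (hdiff K (snd (X m)) (snd (X n))) \<le> hnorm (hsum H K) (hdiff (hsum H K) (X m) (X n))" for m n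
      using le[of "hdiff H (fst (X m)) (fst (X n))" "hdiff K (snd (X m)) (snd (X n))"] c by auto
    have "hCauchy H (\<lambda>n. fst (X n))" "hCauchy K (\<lambda>n. snd (X n))"
      using Ca le1 unfolding hCauchy_def by (meson le_less_trans)+
    then obtain x y where "x \<in> hcarrier H" "hlim H (\<lambda>n. fst (X n)) x" "y \<in> hcarrier K" "hlim K (\<lambda>n. snd (X n)) y"
      using H.complete K.complete c by metis
    then show "\<exists>x\<in>hcarrier (hsum H K). hlim (hsum H K) X x"
      using hsum_hlim_iff[OF assms, of X "(x,y)"] X by auto
  next
    fix x y assume "x \<in> hcarrier (hsum H K)" "y \<in> hcarrier (hsum H K)"
    then show "hinner (hsum H K) y x = cnj (hinner (hsum H K) x y)"
      using H.inner_cnj[of "fst x" "fst y"] K.inner_cnj[of "snd x" "snd y"] by auto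
  qed (auto simp: H.add_assoc K.add_assoc H.add_zero K.add_zero
      H.diff_self K.diff_self H.scale_add_right K.scale_add_right H.scale_add_left K.scale_add_left
      H.scale_scale K.scale_scale H.scale_one K.scale_one algebra_simps
      intro: H.add_commute K.add_commute)
qed

context hilbert_space
begin

section \<open>Orthogonal projection\<close>

lemma minimizer_orthogonal:
  assumes "z \<in> C" "k \<in> C" and min: "\<And>c. (hnorm H z)\<^sup>2 \<le> (hnorm H (hdiff H z (hscale H c k)))\<^sup>2"
  shows "hinner H z k = 0"
proof (cases "k = hzero H")
  case False
  then have n: "0 < (hnorm H k)\<^sup>2" using assms inner_pos by (simp add: hnorm_sq)
  obtain c where "(hnorm H (hdiff H z (hscale H c k)))\<^sup>2 = (hnorm H z)\<^sup>2 - (cmod (hinner H z k))\<^sup>2 / (hnorm H k)\<^sup>2"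
    using subtract_component[OF assms(1,2) False] .
  then have "(cmod (hinner H z k))\<^sup>2 / (hnorm H k)\<^sup>2 \<le> 0" using min[of c] by simp
  then show ?thesis using n by (simp add: divide_le_0_iff)
qed (use assms in auto)

text \<open>
  A sequence in \<open>K\<close> that minimizes the distance to \<open>x\<close> is Cauchy by the parallelogram law.
  Its limit \<open>y\<close> need not lie in \<open>K\<close>, which may fail to be closed, but \<open>x - y\<close> is
  orthogonal to \<open>K\<close> all the same. This serves for projections onto closed subspaces as
  well as for proofs that subspaces are dense.
\<close>

theorem best_approximation:
  assumes K: "hsubspace H K" and x: "x \<in> C"
  obtains k y where "\<And>n. k n \<in> K" "y \<in> C" "hlim H k y" "\<And>z. z \<in> K \<Longrightarrow> hinner H (hdiff H x y) z = 0"
proof -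
  note sub = hsubspace_simps[OF K]
  let ?D = "(\<lambda>k. (hnorm H (hdiff H x k))\<^sup>2) ` K"
  define d where "d = Inf ?D"
  have bdd: "bdd_below ?D" by (rule bdd_belowI2[of _ 0]) simp
  have d: "d \<le> (hnorm H (hdiff H x k))\<^sup>2" if "k \<in> K" for k
    unfolding d_def by (rule cINF_lower[OF bdd that])
  have "\<exists>k\<in>K. (hnorm H (hdiff H x k))\<^sup>2 < d + 1 / Suc n" for n
    using cInf_lessD[of ?D "d + 1 / Suc n"] sub(1) unfolding d_def by force
  then obtain k where k: "\<And>n. k n \<in> K" "\<And>n. (hnorm H (hdiff H x (k n)))\<^sup>2 < d + 1 / Suc n"
    by metis
  have kC: "k n \<in> C" for n using sub(2) k(1) by simp
  have diff: "(hnorm H (hdiff H (k m) (k n)))\<^sup>2 \<le> 2 / Suc m + 2 / Suc n" for m n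
  proof -
    let ?u = "hdiff H x (k n)" and ?v = "hdiff H x (k m)"
    let ?h = "hscale H (1/2) (hadd H (k m) (k n))"
    have "hadd H ?u ?v = hscale H 2 (hdiff H x ?h)" by (rule inner_ext) (use x kC in \<open>auto simp: algebra_simps\<close>)
    then have "(hnorm H (hadd H ?u ?v))\<^sup>2 = 4 * (hnorm H (hdiff H x ?h))\<^sup>2"
      using x kC by (simp add: power_mult_distrib)
    moreover have "d \<le> (hnorm H (hdiff H x ?h))\<^sup>2" using d[OF sub(4)[OF sub(3)[OF k(1) k(1)]]] .
    moreover have "hdiff H ?u ?v = hdiff H (k m) (k n)" by (rule inner_ext) (use x kC in auto)
    ultimately show ?thesis using parallelogram[of ?u ?v] k(2)[of m] k(2)[of n] x kC by simp
  qed
  have "hCauchy H k" unfolding hCauchy_def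
  proof (intro allI impI)
    fix e :: real assume e: "e > 0"
    obtain N where N: "4 / Suc N < e\<^sup>2"
      using reals_Archimedean[of "e\<^sup>2/4"] e by (auto simp: field_simps)
    have "hnorm H (hdiff H (k m) (k n)) < e" if "m \<ge> N" "n \<ge> N" for m n
    proof -
      have "2 / real (Suc m) \<le> 2 / Suc N" "2 / real (Suc n) \<le> 2 / Suc N"
        using that by (auto intro!: divide_left_mono)
      then have "(hnorm H (hdiff H (k m) (k n)))\<^sup>2 < e\<^sup>2" using diff[of m n] N by simp
      then show ?thesis using e by (simp add: power_less_imp_less_base)
    qed
    then show "\<exists>N. \<forall>m\<ge>N. \<forall>n\<ge>N. hnorm H (hdiff H (k m) (k n)) < e" by blast
  qed
  then obtain y where y: "y \<in> C" "hlim H k y" using complete kC by blast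
  have "(\<lambda>n. (hnorm H (hdiff H x (k n)))\<^sup>2) \<longlonglongrightarrow> (hnorm H (hdiff H x y))\<^sup>2"
    by (intro tendsto_power hlim_norm hlim_diff hlim_const y kC x diff_closed)
  moreover have "(\<lambda>n. d + 1 / Suc n) \<longlonglongrightarrow> d + 0"
    by (intro tendsto_add tendsto_const) (use LIMSEQ_inverse_real_of_nat in \<open>simp add: inverse_eq_divide\<close>)
  ultimately have le: "(hnorm H (hdiff H x y))\<^sup>2 \<le> d"
    using LIMSEQ_le[where X = "\<lambda>n. (hnorm H (hdiff H x (k n)))\<^sup>2" and Y = "\<lambda>n. d + 1 / Suc n"] k(2)
    by (force intro: less_imp_le)
  have "hinner H (hdiff H x y) z = 0" if z: "z \<in> K" for z
  proof (rule minimizer_orthogonal)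
    fix c
    have "hdiff H (hdiff H x (k n)) (hscale H c z) = hdiff H x (hadd H (k n) (hscale H c z))" for n
      by (rule inner_ext) (use x kC z sub in auto)
    then have "d \<le> (hnorm H (hdiff H (hdiff H x (k n)) (hscale H c z)))\<^sup>2" for n
      using d[OF sub(3)[OF k(1) sub(4)[OF z]]] by simp
    moreover have "(\<lambda>n. (hnorm H (hdiff H (hdiff H x (k n)) (hscale H c z)))\<^sup>2)
        \<longlonglongrightarrow> (hnorm H (hdiff H (hdiff H x y) (hscale H c z)))\<^sup>2"
      by (intro tendsto_power hlim_norm hlim_diff hlim_const y kC x diff_closed scale_closed sub(2)[OF z])
    ultimately have "d \<le> (hnorm H (hdiff H (hdiff H x y) (hscale H c z)))\<^sup>2" by (intro LIMSEQ_le_const) auto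
    then show "(hnorm H (hdiff H x y))\<^sup>2 \<le> (hnorm H (hdiff H (hdiff H x y) (hscale H c z)))\<^sup>2" using le by simp
  qed (use x y z sub in auto)
  then show thesis using that k(1) y by blast
qed

lemma hdense_obtain_seq:
  assumes "hdense H K" "K \<subseteq> C" "v \<in> C"
  obtains X where "\<And>n. X n \<in> K" "hlim H X v" "\<And>n. hnorm H (hdiff H v (X n)) < (1/2)^n"
proof -
  have "\<exists>k\<in>K. hnorm H (hdiff H v k) < (1/2)^n" for n :: nat
    using assms unfolding hdense_def by simp
  then obtain X where X: "\<And>n. X n \<in> K" "\<And>n. hnorm H (hdiff H v (X n)) < (1/2)^n" by metis
  have "hlim H X v" unfolding hlim_def
  proof (rule tendsto_0_le)
    show "(\<lambda>n. (1/2::real)^n) \<longlonglongrightarrow> 0" by (simp add: LIMSEQ_realpow_zero)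
    have XC: "X n \<in> C" for n using X(1) assms(2) by blast
    show "norm (hnorm H (hdiff H (X n) v)) \<le> (1/2)^n" for n
      using X(2)[of n] hnorm_diff_commute[OF assms(3) XC[of n]] XC[of n] assms(3) by (simp add: less_imp_le)
  qed
  then show thesis using that X by blast
qed

lemma hdense_orth_zero:
  assumes "hdense H K" "K \<subseteq> C" "v \<in> C" "\<And>k. k \<in> K \<Longrightarrow> hinner H k v = 0"
  shows "v = hzero H"
proof -
  obtain X where X: "\<And>n. X n \<in> K" "hlim H X v" using hdense_obtain_seq[OF assms(1,2,3)] by metis
  have "(\<lambda>n. hinner H (X n) v) \<longlonglongrightarrow> hinner H v v"
    by (rule hlim_inner_left) (use X assms in auto)
  then have "hinner H v v = 0" using assms(4) X LIMSEQ_unique by (simp add: tendsto_const_iff)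
  then show ?thesis using inner_self_zero assms by blast
qed

lemma hdense_ext:
  assumes "hdense H K" "K \<subseteq> C" "v \<in> C" "w \<in> C" "\<And>k. k \<in> K \<Longrightarrow> hinner H v k = hinner H w k"
  shows "v = w"
proof -
  have "hdiff H v w = hzero H"
  proof (rule hdense_orth_zero[OF assms(1,2)])
    fix k assume "k \<in> K"
    then have "hinner H (hdiff H v w) k = 0" using assms by (auto simp: subset_iff)
    then show "hinner H k (hdiff H v w) = 0" using inner_cnj \<open>k \<in> K\<close> assms
      by (metis complex_cnj_zero diff_closed subsetD)
  qed (use assms in auto)
  then show ?thesis using hdiff_eq_0 assms by blast
qed

lemma hdense_subspaceI:
  assumes K: "hsubspace H K" and orth: "\<And>v. \<lbrakk>v \<in> C; \<And>k. k \<in> K \<Longrightarrow> hinner H v k = 0\<rbrakk> \<Longrightarrow> v = hzero H"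
  shows "hdense H K"
  unfolding hdense_def
proof (intro ballI allI impI)
  fix x and e :: real assume x: "x \<in> C" and e: "e > 0"
  obtain k y where k: "\<And>n. k n \<in> K" and y: "y \<in> C" "hlim H k y"
    and o: "\<And>z. z \<in> K \<Longrightarrow> hinner H (hdiff H x y) z = 0" using best_approximation[OF K x] by metis
  have kC: "k n \<in> C" for n using k hsubspace_simps(2)[OF K] by blast
  have "x = y" using orth[OF diff_closed[OF x y(1)] o] hdiff_eq_0[OF x y(1)] by simp
  then have "\<forall>\<^sub>F n in sequentially. hnorm H (hdiff H (k n) x) < e"
    using y(2) e unfolding hlim_def by (intro order_tendstoD(2)) auto
  then obtain n where "hnorm H (hdiff H (k n) x) < e" by (auto simp: eventually_sequentially)
  then show "\<exists>y\<in>K. hnorm H (hdiff H x y) < e" using k hnorm_diff_commute[OF x kC] by metis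
qed

lemma closed_projection:
  assumes K: "hsubspace H K" "hclosed H K" and x: "x \<in> C"
  obtains y where "y \<in> K" "\<And>k. k \<in> K \<Longrightarrow> hinner H (hdiff H x y) k = 0"
proof -
  obtain k y where k: "\<And>n. k n \<in> K" and y: "y \<in> C" "hlim H k y"
    and o: "\<And>z. z \<in> K \<Longrightarrow> hinner H (hdiff H x y) z = 0" using best_approximation[OF K(1) x] by metis
  have "y \<in> K" using K(2) k y unfolding hclosed_def by blast
  then show thesis using that o by blast
qed

definition orthocomplement :: "'v set \<Rightarrow> 'v set" where
  "orthocomplement K = {v \<in> C. \<forall>k\<in>K. hinner H v k = 0}"

lemma orthocomplement_closed_subspace:
  assumes K: "K \<subseteq> C"
  shows "hsubspace H (orthocomplement K)" "hclosed H (orthocomplement K)"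
proof -
  show "hsubspace H (orthocomplement K)" using K by (auto simp: hsubspace_def orthocomplement_def subset_iff)
  show "hclosed H (orthocomplement K)" unfolding hclosed_def
  proof (intro allI ballI impI)
    fix X x assume x: "x \<in> C" and X: "(\<forall>n. X n \<in> orthocomplement K) \<and> hlim H X x"
    have "hinner H x k = 0" if k: "k \<in> K" for k
    proof -
      have "(\<lambda>n. hinner H (X n) k) \<longlonglongrightarrow> hinner H x k"
        by (rule hlim_inner_left) (use X x k K in \<open>auto simp: orthocomplement_def\<close>)
      moreover have "hinner H (X n) k = 0" for n using X k by (simp add: orthocomplement_def)
      ultimately show ?thesis by (simp add: LIMSEQ_const_iff)
    qed
    then show "x \<in> orthocomplement K" using x by (simp add: orthocomplement_def)
  qed
qed

theorem riesz_representation: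
  assumes add: "\<And>x y. x \<in> C \<Longrightarrow> y \<in> C \<Longrightarrow> \<phi> (hadd H x y) = \<phi> x + \<phi> y"
    and scale: "\<And>a x. x \<in> C \<Longrightarrow> \<phi> (hscale H a x) = a * \<phi> x"
    and bound: "\<And>x. x \<in> C \<Longrightarrow> cmod (\<phi> x) \<le> k * hnorm H x"
  obtains y where "y \<in> C" "\<And>x. x \<in> C \<Longrightarrow> \<phi> x = hinner H x y"
proof -
  let ?N = "{x \<in> C. \<phi> x = 0}"
  have diff: "\<phi> (hdiff H x y) = \<phi> x - \<phi> y" if "x \<in> C" "y \<in> C" for x y
    using that by (simp add: hdiff_def add scale)
  have \<phi>0: "\<phi> (hzero H) = 0" using bound[of "hzero H"] by simp
  show thesis
  proof (cases "\<exists>x0\<in>C. \<phi> x0 \<noteq> 0")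
    case True
    then obtain x0 where x0: "x0 \<in> C" "\<phi> x0 \<noteq> 0" by blast
    have sub: "hsubspace H ?N" by (auto simp: hsubspace_def add scale \<phi>0)
    have "hclosed H ?N" unfolding hclosed_def
    proof (intro allI ballI impI)
      fix X x assume x: "x \<in> C" and X: "(\<forall>n. X n \<in> ?N) \<and> hlim H X x"
      have "(\<lambda>n. k * hnorm H (hdiff H (X n) x)) \<longlonglongrightarrow> 0"
        using X unfolding hlim_def by (intro tendsto_mult_right_zero) auto
      moreover have "norm (\<phi> x) \<le> k * hnorm H (hdiff H (X n) x)" for n
        using bound[of "hdiff H (X n) x"] X x diff[of "X n" x] by auto
      ultimately have "(\<lambda>n::nat. \<phi> x) \<longlonglongrightarrow> 0" by (rule tendsto_0_le)
      then show "x \<in> ?N" using x by (simp add: LIMSEQ_const_iff)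
    qed
    then obtain p where p: "p \<in> ?N" "\<And>k. k \<in> ?N \<Longrightarrow> hinner H (hdiff H x0 p) k = 0"
      using closed_projection[OF sub _ x0(1)] by blast
    define z where "z = hdiff H x0 p"
    have z: "z \<in> C" "\<phi> z \<noteq> 0" using p x0 diff by (auto simp: z_def)
    then have "z \<noteq> hzero H" using \<phi>0 by auto
    then have nz: "hinner H z z \<noteq> 0" using z inner_self_zero by blast
    have cz: "cnj (hinner H z z) = hinner H z z" using inner_cnj[of z z] z by simp
    define y where "y = hscale H (cnj (\<phi> z) / hinner H z z) z"
    have "\<phi> x = hinner H x y" if x: "x \<in> C" for x
    proof -
      have "hdiff H x (hscale H (\<phi> x / \<phi> z) z) \<in> ?N" using x z diff scale by simp
      then have "hinner H z (hdiff H x (hscale H (\<phi> x / \<phi> z) z)) = 0" using p z_def by blast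
      then have "hinner H z x = cnj (\<phi> x / \<phi> z) * hinner H z z" using x z by simp
      then have "hinner H x z = \<phi> x / \<phi> z * hinner H z z" using inner_cnj[of z x] x z cz by simp
      then show ?thesis using x z nz cz by (simp add: y_def)
    qed
    moreover have "y \<in> C" using z(1) by (simp add: y_def)
    ultimately show thesis using that by metis
  next
    case False
    then show thesis using that[of "hzero H"] by auto
  qed
qed

section \<open>Bounded operators and adjoints\<close>

lemma linear_op_iff:
  "linear_op H T \<longleftrightarrow> (\<forall>x y. T x = Some y \<longrightarrow> x \<in> C \<and> y \<in> C) \<and> T (hzero H) = Some (hzero H)
    \<and> (\<forall>x y x' y'. T x = Some y \<longrightarrow> T x' = Some y' \<longrightarrow> T (hadd H x x') = Some (hadd H y y'))
    \<and> (\<forall>a x y. T x = Some y \<longrightarrow> T (hscale H a x) = Some (hscale H a y))"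
  unfolding linear_op_def hsubspace_def by (auto simp: Map.graph_def subset_iff)

lemma linear_opD:
  assumes "linear_op H T"
  shows "T x = Some y \<Longrightarrow> x \<in> C" "T x = Some y \<Longrightarrow> y \<in> C" "T (hzero H) = Some (hzero H)"
    "T x = Some y \<Longrightarrow> T x' = Some y' \<Longrightarrow> T (hadd H x x') = Some (hadd H y y')"
    "T x = Some y \<Longrightarrow> T (hscale H a x) = Some (hscale H a y)"
    "T x = Some y \<Longrightarrow> T x' = Some y' \<Longrightarrow> T (hdiff H x x') = Some (hdiff H y y')"
  using assms by (auto simp: linear_op_iff hdiff_def)

lemma bounded_opsI:
  assumes "linear_op H T" "dom T = C" "\<And>x. x \<in> C \<Longrightarrow> hnorm H (ap T x) \<le> k * hnorm H x"
  shows "T \<in> bounded_ops H"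
  using assms by (auto simp: bounded_ops_def)

lemma mk_op_ap [simp]: "x \<in> C \<Longrightarrow> ap (mk_op H f) x = f x"
  by (simp add: mk_op_def)

lemma mk_op_bounded:
  assumes "\<And>x. x \<in> C \<Longrightarrow> f x \<in> C" "\<And>x y. x \<in> C \<Longrightarrow> y \<in> C \<Longrightarrow> f (hadd H x y) = hadd H (f x) (f y)"
    "\<And>a x. x \<in> C \<Longrightarrow> f (hscale H a x) = hscale H a (f x)"
    "\<And>x. x \<in> C \<Longrightarrow> hnorm H (f x) \<le> k * hnorm H x"
  shows "mk_op H f \<in> bounded_ops H"
proof (rule bounded_opsI[where k = k])
  have "f (hzero H) = hzero H" using assms(4)[of "hzero H"] assms(1) hnorm_eq_0 hnorm_ge
    by (metis hnorm_zero mult_zero_right order_antisym zero_closed)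
  then show "linear_op H (mk_op H f)" using assms by (auto simp: linear_op_iff mk_op_def split: if_splits)
qed (use assms in \<open>auto simp: mk_op_def dom_def\<close>)

lemma bounded_opsD:
  assumes "T \<in> bounded_ops H"
  shows "linear_op H T" "dom T = C" "x \<in> C \<Longrightarrow> T x = Some (ap T x)" "x \<in> C \<Longrightarrow> ap T x \<in> C"
    "x \<in> C \<Longrightarrow> y \<in> C \<Longrightarrow> ap T (hadd H x y) = hadd H (ap T x) (ap T y)"
    "x \<in> C \<Longrightarrow> ap T (hscale H a x) = hscale H a (ap T x)"
    "x \<in> C \<Longrightarrow> y \<in> C \<Longrightarrow> ap T (hdiff H x y) = hdiff H (ap T x) (ap T y)"
    "ap T (hzero H) = hzero H"
    "\<exists>k\<ge>0. \<forall>x\<in>C. hnorm H (ap T x) \<le> k * hnorm H x"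
    "x \<notin> C \<Longrightarrow> T x = None"
proof -
  show l: "linear_op H T" and d: "dom T = C" using assms by (auto simp: bounded_ops_def)
  show s: "T x = Some (ap T x)" if "x \<in> C" for x using d that by (metis domD option.sel)
  show "x \<in> C \<Longrightarrow> ap T x \<in> C" using s linear_opD[OF l] by metis
  show "x \<in> C \<Longrightarrow> y \<in> C \<Longrightarrow> ap T (hadd H x y) = hadd H (ap T x) (ap T y)"
    using s linear_opD(4)[OF l] by (metis option.sel)
  show "x \<in> C \<Longrightarrow> ap T (hscale H a x) = hscale H a (ap T x)"
    using s linear_opD(5)[OF l] by (metis option.sel)
  show "x \<in> C \<Longrightarrow> y \<in> C \<Longrightarrow> ap T (hdiff H x y) = hdiff H (ap T x) (ap T y)"
    using s linear_opD(6)[OF l] by (metis option.sel)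
  show "ap T (hzero H) = hzero H" using linear_opD(3)[OF l] by simp
  obtain k where k: "\<forall>x\<in>C. hnorm H (ap T x) \<le> k * hnorm H x" using assms by (auto simp: bounded_ops_def)
  have "hnorm H (ap T x) \<le> \<bar>k\<bar> * hnorm H x" if "x \<in> C" for x
    using k that mult_right_mono[of k "\<bar>k\<bar>" "hnorm H x"] by fastforce
  then show "\<exists>k\<ge>0. \<forall>x\<in>C. hnorm H (ap T x) \<le> k * hnorm H x" by (metis abs_ge_zero)
  show "x \<notin> C \<Longrightarrow> T x = None" using d by auto
qed

lemma op_eqI:
  assumes "A \<in> bounded_ops H" "B \<in> bounded_ops H" "\<And>x. x \<in> C \<Longrightarrow> ap A x = ap B x"
  shows "A = B"
proof
  fix x show "A x = B x" using assms bounded_opsD(3,10) by (cases "x \<in> C") metis+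
qed

lemma ap_comp [simp]: "B \<in> bounded_ops H \<Longrightarrow> x \<in> C \<Longrightarrow> ap (A \<circ>\<^sub>m B) x = ap A (ap B x)"
  using map_comp_simps(2)[of B x "ap B x" A] bounded_opsD(3)[of B x] by simp

lemma comp_bounded: assumes "A \<in> bounded_ops H" "B \<in> bounded_ops H" shows "A \<circ>\<^sub>m B \<in> bounded_ops H"
proof -
  note a = bounded_opsD[OF assms(1)] and b = bounded_opsD[OF assms(2)]
  obtain k l where k: "k \<ge> 0" "\<forall>x\<in>C. hnorm H (ap A x) \<le> k * hnorm H x" and l: "\<forall>x\<in>C. hnorm H (ap B x) \<le> l * hnorm H x"
    using a(9) b(9) by blast
  have "mk_op H (\<lambda>x. ap A (ap B x)) \<in> bounded_ops H"
  proof (rule mk_op_bounded[where k = "k * l"])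
    fix x assume x: "x \<in> C"
    have "hnorm H (ap A (ap B x)) \<le> k * hnorm H (ap B x)" using k b x by blast
    also have "\<dots> \<le> k * (l * hnorm H x)" using k l x by (intro mult_left_mono) auto
    finally show "hnorm H (ap A (ap B x)) \<le> k * l * hnorm H x" by (simp add: mult.assoc)
  qed (simp_all add: a(4-6) b(4-6))
  moreover have "mk_op H (\<lambda>x. ap A (ap B x)) = A \<circ>\<^sub>m B"
  proof
    fix x show "mk_op H (\<lambda>x. ap A (ap B x)) x = (A \<circ>\<^sub>m B) x"
      using a(3)[of "ap B x"] b(3,4,10)[of x] by (cases "x \<in> C") (auto simp: mk_op_def map_comp_simps)
  qed
  ultimately show ?thesis by simp
qed

lemma scalar_op_eq: "scalar_op H c = mk_op H (hscale H c)"
  by (simp add: scalar_op_def mk_op_def)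

lemma scalar_op_ap [simp]: "x \<in> C \<Longrightarrow> ap (scalar_op H c) x = hscale H c x"
  by (simp add: scalar_op_eq)

lemma scalar_bounded [simp]: "scalar_op H c \<in> bounded_ops H"
  unfolding scalar_op_eq by (rule mk_op_bounded[where k = "cmod c"]) (auto simp: scale_add_right scale_scale mult.commute)

lemma orth_proj_eqI:
  assumes K: "hsubspace H K" and x: "x \<in> C" and y: "y \<in> K" "\<And>k. k \<in> K \<Longrightarrow> hinner H (hdiff H x y) k = 0"
  shows "orth_proj H K x = Some y"
proof -
  note sub = hsubspace_simps[OF K]
  have "z = y" if z: "z \<in> K" "\<forall>k\<in>K. hinner H (hdiff H x z) k = 0" for z
  proof -
    have d: "hdiff H z y \<in> K" by (rule sub(5)[OF z(1) y(1)])
    have "hinner H (hdiff H z y) (hdiff H z y) = hinner H (hdiff H x y) (hdiff H z y) - hinner H (hdiff H x z) (hdiff H z y)"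
      using x sub(2)[OF z(1)] sub(2)[OF y(1)] by simp
    then show ?thesis using y(2)[OF d] z(2) d inner_self_zero[OF sub(2)[OF d]] hdiff_eq_0 sub(2)[OF z(1)] sub(2)[OF y(1)] by simp
  qed
  then have "(THE y. y \<in> K \<and> (\<forall>k\<in>K. hinner H (hdiff H x y) k = 0)) = y" using y by (intro the_equality) blast+
  then show ?thesis using x by (simp add: orth_proj_def)
qed

lemma orth_proj:
  assumes K: "hsubspace H K" "hclosed H K"
  shows "x \<in> C \<Longrightarrow> ap (orth_proj H K) x \<in> K" "x \<in> C \<Longrightarrow> k \<in> K \<Longrightarrow> hinner H (hdiff H x (ap (orth_proj H K) x)) k = 0"
    "orth_proj H K \<in> bounded_ops H" "x \<in> C \<Longrightarrow> hnorm H (ap (orth_proj H K) x) \<le> 1 * hnorm H x"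
    "k \<in> K \<Longrightarrow> ap (orth_proj H K) k = k"
proof -
  note sub = hsubspace_simps[OF K(1)] and eqI = orth_proj_eqI[OF K(1)]
  have ex: "ap (orth_proj H K) x \<in> K \<and> (\<forall>k\<in>K. hinner H (hdiff H x (ap (orth_proj H K) x)) k = 0)" if x: "x \<in> C" for x
  proof -
    obtain y where "y \<in> K" "\<And>k. k \<in> K \<Longrightarrow> hinner H (hdiff H x y) k = 0"
      using closed_projection[OF K x] by blast
    then show ?thesis using eqI[OF x] by simp
  qed
  show m: "ap (orth_proj H K) x \<in> K" if "x \<in> C" for x using ex that by blast
  show o: "hinner H (hdiff H x (ap (orth_proj H K) x)) k = 0" if "x \<in> C" "k \<in> K" for x k using ex that by blast
  note mC = sub(2)[OF m]
  show n: "hnorm H (ap (orth_proj H K) x) \<le> 1 * hnorm H x" if x: "x \<in> C" for x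
  proof (rule le_of_mult_le)
    let ?y = "ap (orth_proj H K) x"
    have "hinner H x ?y = hinner H ?y ?y" using o[OF x m[OF x]] x mC[OF x] by simp
    then have "(hnorm H ?y)\<^sup>2 = Re (hinner H x ?y)" using hnorm_sq[OF mC[OF x]] by simp
    also have "\<dots> \<le> hnorm H x * hnorm H ?y" using order_trans[OF complex_Re_le_cmod Cauchy_Schwarz[OF x mC[OF x]]] .
    finally show "hnorm H ?y * hnorm H ?y \<le> (1 * hnorm H x) * hnorm H ?y" by (simp add: power2_eq_square)
  qed (use x in simp)
  show "ap (orth_proj H K) k = k" if "k \<in> K" for k
    using eqI[OF sub(2)[OF that] that] sub(2) that by (simp add: diff_self)
  have "orth_proj H K = mk_op H (ap (orth_proj H K))" by (auto simp: orth_proj_def mk_op_def fun_eq_iff)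
  moreover have "mk_op H (ap (orth_proj H K)) \<in> bounded_ops H"
  proof (rule mk_op_bounded[OF mC _ _ n])
    fix x y assume x: "x \<in> C" and y: "y \<in> C"
    have "hinner H (hdiff H (hadd H x y) (hadd H (ap (orth_proj H K) x) (ap (orth_proj H K) y))) k = 0" if "k \<in> K" for k
      using o[OF x that] o[OF y that] x y mC sub(2)[OF that] by simp
    from eqI[OF add_closed[OF x y] sub(3)[OF m[OF x] m[OF y]] this]
    show "ap (orth_proj H K) (hadd H x y) = hadd H (ap (orth_proj H K) x) (ap (orth_proj H K) y)" by simp
  next
    fix a x assume x: "x \<in> C"
    have "hinner H (hdiff H (hscale H a x) (hscale H a (ap (orth_proj H K) x))) k = 0" if "k \<in> K" for k
      using o[OF x that] x mC sub(2)[OF that] by (simp add: right_diff_distrib[symmetric])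
    from eqI[OF scale_closed[OF x] sub(4)[OF m[OF x]] this]
    show "ap (orth_proj H K) (hscale H a x) = hscale H a (ap (orth_proj H K) x)" by simp
  qed
  ultimately show "orth_proj H K \<in> bounded_ops H" by simp
qed

text \<open>
  Riesz representation in the second variable. Adjoints and weak limits of operators are
  obtained in this way.
\<close>

lemma form_operator:
  assumes "\<And>x y z. \<lbrakk>x \<in> C; y \<in> C; z \<in> C\<rbrakk> \<Longrightarrow> b (hadd H x y) z = b x z + b y z"
    "\<And>a x z. \<lbrakk>x \<in> C; z \<in> C\<rbrakk> \<Longrightarrow> b (hscale H a x) z = a * b x z"
    "\<And>x y z. \<lbrakk>x \<in> C; y \<in> C; z \<in> C\<rbrakk> \<Longrightarrow> b z (hadd H x y) = b z x + b z y"
    "\<And>a x z. \<lbrakk>x \<in> C; z \<in> C\<rbrakk> \<Longrightarrow> b z (hscale H a x) = cnj a * b z x"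
    "\<And>x y. \<lbrakk>x \<in> C; y \<in> C\<rbrakk> \<Longrightarrow> cmod (b x y) \<le> k * hnorm H x * hnorm H y"
  obtains A where "A \<in> bounded_ops H" "\<And>x y. \<lbrakk>x \<in> C; y \<in> C\<rbrakk> \<Longrightarrow> hinner H (ap A x) y = b x y"
proof -
  have "\<exists>w\<in>C. \<forall>y\<in>C. hinner H w y = b x y" if x: "x \<in> C" for x
  proof -
    have "cmod (cnj (b x y)) \<le> k * hnorm H x * hnorm H y" if "y \<in> C" for y
      using assms(5)[OF x that] by simp
    note bd = this
    obtain w where w: "w \<in> C" "\<And>y. y \<in> C \<Longrightarrow> cnj (b x y) = hinner H y w"
      by (rule riesz_representation[of "\<lambda>y. cnj (b x y)" "k * hnorm H x"]) (use assms(3,4) x bd in simp_all)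
    have "hinner H w y = b x y" if "y \<in> C" for y
    proof -
      have "hinner H w y = cnj (cnj (b x y))" unfolding w(2)[OF that] by (rule inner_cnj[OF that w(1)])
      then show ?thesis by simp
    qed
    then show ?thesis using w by blast
  qed
  then obtain f where f: "\<And>x. x \<in> C \<Longrightarrow> f x \<in> C" "\<And>x y. x \<in> C \<Longrightarrow> y \<in> C \<Longrightarrow> hinner H (f x) y = b x y"
    by metis
  have "mk_op H f \<in> bounded_ops H"
  proof (rule mk_op_bounded[where k = k])
    fix x assume x: "x \<in> C"
    have "(hnorm H (f x))\<^sup>2 = cmod (b x (f x))" using f x inner_self[of "f x"] by (metis norm_of_real abs_power2 real_norm_def)
    also have "\<dots> \<le> k * hnorm H x * hnorm H (f x)" using assms f x by blast
    finally have *: "hnorm H (f x) * hnorm H (f x) \<le> (k * hnorm H x) * hnorm H (f x)" by (simp add: power2_eq_square)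
    have "0 \<le> k * hnorm H x * hnorm H x" using assms(5)[OF x x] norm_ge_zero order_trans by blast
    then have "0 \<le> k * hnorm H x" using hnorm_ge[OF x] by (cases "hnorm H x = 0") (auto simp: zero_le_mult_iff)
    then show "hnorm H (f x) \<le> k * hnorm H x" by (rule le_of_mult_le[OF *])
  next
    fix x y assume "x \<in> C" "y \<in> C"
    then show "f (hadd H x y) = hadd H (f x) (f y)" by (intro inner_ext) (simp_all add: f assms(1))
  next
    fix a x assume "x \<in> C"
    then show "f (hscale H a x) = hscale H a (f x)" by (intro inner_ext) (simp_all add: f assms(2))
  qed (simp add: f)
  then show thesis using that[of "mk_op H f"] f by simp
qed

lemma adjoint_at_unique:
  assumes T: "hdense H (dom T)" "dom T \<subseteq> C" and "adjoint_at H T y z" "adjoint_at H T y z'"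
  shows "z = z'"
proof -
  have "hinner H z k = hinner H z' k" if "k \<in> dom T" for k
    using assms(3,4) that inner_cnj T(2) unfolding adjoint_at_def by (metis subsetD)
  then show ?thesis using hdense_ext[OF T] assms(3,4) unfolding adjoint_at_def by blast
qed

lemma op_adjoint_iff:
  assumes T: "hdense H (dom T)" "dom T \<subseteq> C"
  shows "op_adjoint H T y = Some z \<longleftrightarrow> adjoint_at H T y z"
proof -
  have "(THE z. adjoint_at H T y z) = z" if "adjoint_at H T y z" for z
    using adjoint_at_unique[OF T] that by blast
  then show ?thesis unfolding op_adjoint_def by (auto split: if_splits)
qed

lemma hdense_C [simp]: "hdense H C"
  unfolding hdense_def by (metis diff_self hnorm_zero)

lemma adjoint_bounded:
  assumes A: "A \<in> bounded_ops H"
  shows "op_adjoint H A \<in> bounded_ops H"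
    "\<And>x y. x \<in> C \<Longrightarrow> y \<in> C \<Longrightarrow> hinner H (ap A x) y = hinner H x (ap (op_adjoint H A) y)"
proof -
  note a = bounded_opsD[OF A]
  obtain k where k: "k \<ge> 0" "\<forall>x\<in>C. hnorm H (ap A x) \<le> k * hnorm H x" using a(9) by blast
  obtain B where B: "B \<in> bounded_ops H" "\<And>x y. \<lbrakk>x \<in> C; y \<in> C\<rbrakk> \<Longrightarrow> hinner H (ap B x) y = hinner H x (ap A y)"
  proof (rule form_operator[of "\<lambda>x y. hinner H x (ap A y)" k])
    fix x y assume xy: "x \<in> C" "y \<in> C"
    have "cmod (hinner H x (ap A y)) \<le> hnorm H x * hnorm H (ap A y)" by (rule Cauchy_Schwarz[OF xy(1) a(4)[OF xy(2)]])
    also have "\<dots> \<le> hnorm H x * (k * hnorm H y)" using k xy by (intro mult_left_mono) auto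
    finally show "cmod (hinner H x (ap A y)) \<le> k * hnorm H x * hnorm H y" by (simp add: mult_ac)
  qed (simp_all add: a(4-6))
  note b = bounded_opsD[OF B(1)]
  have adj: "hinner H (ap A x) y = hinner H x (ap B y)" if "x \<in> C" "y \<in> C" for x y
    using B(2)[of y x] inner_cnj[of "ap B y" x] inner_cnj[of y "ap A x"] that a b by simp
  have "op_adjoint H A = B"
  proof
    fix y
    have it: "op_adjoint H A y = Some z \<longleftrightarrow> adjoint_at H A y z" for z
      by (rule op_adjoint_iff) (use a in auto)
    show "op_adjoint H A y = B y"
    proof (cases "y \<in> C")
      case True
      then have "adjoint_at H A y (ap B y)" using adj b a by (auto simp: adjoint_at_def)
      then show ?thesis using it b(3) True by metis
    next
      case False
      then have "op_adjoint H A y = None" using it by (cases "op_adjoint H A y") (auto simp: adjoint_at_def)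
      then show ?thesis using b(10) False by simp
    qed
  qed
  then show "op_adjoint H A \<in> bounded_ops H" "\<And>x y. x \<in> C \<Longrightarrow> y \<in> C \<Longrightarrow> hinner H (ap A x) y = hinner H x (ap (op_adjoint H A) y)"
    using B adj by auto
qed

lemma adjoint_eqI:
  assumes "A \<in> bounded_ops H" "B \<in> bounded_ops H"
    "\<And>x y. x \<in> C \<Longrightarrow> y \<in> C \<Longrightarrow> hinner H (ap A x) y = hinner H x (ap B y)"
  shows "op_adjoint H A = B"
proof (rule op_eqI)
  note a = adjoint_bounded[OF assms(1)]
  fix y assume y: "y \<in> C"
  show "ap (op_adjoint H A) y = ap B y"
  proof (rule inner_ext)
    fix z assume z: "z \<in> C"
    have "hinner H z (ap (op_adjoint H A) y) = hinner H z (ap B y)" using a(2) assms(3) y z by metis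
    then show "hinner H (ap (op_adjoint H A) y) z = hinner H (ap B y) z"
      using inner_cnj a(1) assms(2) bounded_opsD(4) y z by metis
  qed (use a assms y bounded_opsD in auto)
qed (use adjoint_bounded assms in auto)

lemma adjoint_adjoint: "A \<in> bounded_ops H \<Longrightarrow> op_adjoint H (op_adjoint H A) = A"
proof (rule adjoint_eqI)
  fix x y assume *: "A \<in> bounded_ops H" "x \<in> C" "y \<in> C"
  note a = adjoint_bounded[OF *(1)]
  show "hinner H (ap (op_adjoint H A) x) y = hinner H x (ap A y)"
    using a(2)[of y x] inner_cnj * a(1) bounded_opsD(4) by metis
qed (use adjoint_bounded in auto)

lemma op_lin_ap [simp]: "x \<in> C \<Longrightarrow> ap (op_lin H c A d B) x = hadd H (hscale H c (ap A x)) (hscale H d (ap B x))"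
  by (simp add: op_lin_def)

lemma op_lin_bound:
  assumes A: "ap A x \<in> C" "hnorm H (ap A x) \<le> k * hnorm H x" and B: "ap B x \<in> C" "hnorm H (ap B x) \<le> l * hnorm H x" and x: "x \<in> C"
  shows "hnorm H (ap (op_lin H c A d B) x) \<le> (cmod c * k + cmod d * l) * hnorm H x"
proof -
  have "hnorm H (ap (op_lin H c A d B) x) \<le> cmod c * hnorm H (ap A x) + cmod d * hnorm H (ap B x)"
    using hnorm_triangle[of "hscale H c (ap A x)" "hscale H d (ap B x)"] A(1) B(1) x by simp
  also have "\<dots> \<le> cmod c * (k * hnorm H x) + cmod d * (l * hnorm H x)"
    using A(2) B(2) by (intro add_mono mult_left_mono) auto
  finally show ?thesis by (simp add: algebra_simps)
qed

lemma op_lin_bounded: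
  assumes A: "A \<in> bounded_ops H" and B: "B \<in> bounded_ops H" shows "op_lin H c A d B \<in> bounded_ops H"
proof -
  note a = bounded_opsD(4-6)[OF A] and b = bounded_opsD(4-6)[OF B]
  obtain k l where k: "\<forall>x\<in>C. hnorm H (ap A x) \<le> k * hnorm H x" and l: "\<forall>x\<in>C. hnorm H (ap B x) \<le> l * hnorm H x"
    using bounded_opsD(9)[OF A] bounded_opsD(9)[OF B] by blast
  show ?thesis unfolding op_lin_def
  proof (rule mk_op_bounded[where k = "cmod c * k + cmod d * l"])
    fix x y assume xy: "x \<in> C" "y \<in> C"
    show "hadd H (hscale H c (ap A (hadd H x y))) (hscale H d (ap B (hadd H x y)))
      = hadd H (hadd H (hscale H c (ap A x)) (hscale H d (ap B x))) (hadd H (hscale H c (ap A y)) (hscale H d (ap B y)))"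
      by (rule inner_ext) (use xy a b in \<open>simp_all add: algebra_simps\<close>)
  next
    fix e x assume x: "x \<in> C"
    show "hadd H (hscale H c (ap A (hscale H e x))) (hscale H d (ap B (hscale H e x)))
      = hscale H e (hadd H (hscale H c (ap A x)) (hscale H d (ap B x)))"
      by (rule inner_ext) (use x a b in \<open>simp_all add: algebra_simps\<close>)
  next
    fix x assume x: "x \<in> C"
    show "hnorm H (hadd H (hscale H c (ap A x)) (hscale H d (ap B x))) \<le> (cmod c * k + cmod d * l) * hnorm H x"
      using op_lin_bound[of A x k B l c d] a(1) b(1) k l x by simp
  qed (use a(1) b(1) in simp)
qed

lemma hlim_ap:
  assumes A: "A \<in> bounded_ops H" and X: "hlim H X x" "\<And>n. X n \<in> C" "x \<in> C"
  shows "hlim H (\<lambda>n. ap A (X n)) (ap A x)"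
proof -
  note a = bounded_opsD[OF A]
  obtain k where k: "k \<ge> 0" "\<forall>x\<in>C. hnorm H (ap A x) \<le> k * hnorm H x" using a(9) by blast
  have "norm (hnorm H (hdiff H (ap A (X n)) (ap A x))) \<le> k * hnorm H (hdiff H (X n) x)" for n
    using k(2) X(2,3) a(4)[OF diff_closed[OF X(2)[of n] X(3)]] by (simp add: a(7)[symmetric])
  moreover have "(\<lambda>n. k * hnorm H (hdiff H (X n) x)) \<longlonglongrightarrow> 0"
    using X(1) unfolding hlim_def by (intro tendsto_mult_right_zero) auto
  ultimately show ?thesis unfolding hlim_def by (rule tendsto_0_le[rotated])
qed

section \<open>Commutants\<close>

lemma commutant_iff:
  assumes "X \<subseteq> bounded_ops H"
  shows "A \<in> commutant H X \<longleftrightarrow> A \<in> bounded_ops H \<and> (\<forall>B\<in>X. \<forall>x\<in>C. ap A (ap B x) = ap B (ap A x))"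
proof -
  have "A \<circ>\<^sub>m B = B \<circ>\<^sub>m A \<longleftrightarrow> (\<forall>x\<in>C. ap A (ap B x) = ap B (ap A x))"
    if A: "A \<in> bounded_ops H" and B: "B \<in> bounded_ops H" for B
    using op_eqI[OF comp_bounded[OF A B] comp_bounded[OF B A]] ap_comp[OF A] ap_comp[OF B] by metis
  then show ?thesis using assms by (auto simp: commutant_def)
qed

lemma commutant_bounded: "commutant H X \<subseteq> bounded_ops H"
  by (auto simp: commutant_def)

lemma commutant_antimono: "X \<subseteq> Y \<Longrightarrow> commutant H Y \<subseteq> commutant H X"
  by (auto simp: commutant_def)

lemma subset_bicommutant: "X \<subseteq> bounded_ops H \<Longrightarrow> X \<subseteq> commutant H (commutant H X)"
  by (auto simp: commutant_def)

lemma tricommutant: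
  "X \<subseteq> bounded_ops H \<Longrightarrow> commutant H (commutant H (commutant H X)) = commutant H X"
  using subset_bicommutant commutant_antimono commutant_bounded by (metis subset_antisym)

lemma commutant_adjoint:
  assumes X: "X \<subseteq> bounded_ops H" "\<And>B. B \<in> X \<Longrightarrow> op_adjoint H B \<in> X" and A: "A \<in> commutant H X"
  shows "op_adjoint H A \<in> commutant H X"
proof -
  have Ab: "A \<in> bounded_ops H" using A commutant_bounded by blast
  note ad = adjoint_bounded[OF Ab] and a = bounded_opsD[OF Ab]
  have "ap (op_adjoint H A) (ap B x) = ap B (ap (op_adjoint H A) x)" if B: "B \<in> X" and x: "x \<in> C" for B x
  proof (rule inner_ext)
    have Bb: "B \<in> bounded_ops H" using X B by blast
    note bd = adjoint_bounded[OF Bb] and b = bounded_opsD[OF Bb] and b' = bounded_opsD[OF adjoint_bounded(1)[OF Bb]]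
    note a' = bounded_opsD[OF ad(1)]
    have sw: "hinner H (ap (op_adjoint H A) u) z = hinner H u (ap A z)"
      "hinner H (ap B u) z = hinner H u (ap (op_adjoint H B) z)" if "u \<in> C" "z \<in> C" for u z
      using ad(2)[OF that(2,1)] bd(2)[OF that] inner_cnj[OF a(4)[OF that(2)] that(1)]
        inner_cnj[OF that(2) a'(4)[OF that(1)]] by simp_all
    fix z assume z: "z \<in> C"
    have "ap A (ap (op_adjoint H B) z) = ap (op_adjoint H B) (ap A z)"
      using A X B z commutant_iff[OF X(1)] by blast
    then show "hinner H (ap (op_adjoint H A) (ap B x)) z = hinner H (ap B (ap (op_adjoint H A) x)) z"
      using sw x z a(4) a'(4) b(4) b'(4) by simp
  qed (use x B X(1) bounded_opsD(4)[OF ad(1)] bounded_opsD(4) in \<open>simp_all add: subset_iff\<close>)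
  then show ?thesis using commutant_iff[OF X(1)] ad by blast
qed

lemma commutant_op_lin:
  assumes X: "X \<subseteq> bounded_ops H" and A: "A \<in> commutant H X" and B: "B \<in> commutant H X"
  shows "op_lin H c A d B \<in> commutant H X"
proof -
  note ab = A[unfolded commutant_iff[OF X]] B[unfolded commutant_iff[OF X]]
  show ?thesis unfolding commutant_iff[OF X]
  proof (intro conjI ballI op_lin_bounded)
    fix Y x assume Y: "Y \<in> X" and x: "x \<in> C"
    note y = bounded_opsD(4-6)[OF subsetD[OF X Y]] and m = bounded_opsD(4)[OF ab(1)[THEN conjunct1]] bounded_opsD(4)[OF ab(2)[THEN conjunct1]]
    show "ap (op_lin H c A d B) (ap Y x) = ap Y (ap (op_lin H c A d B) x)"
      using ab Y x y m by simp
  qed (use ab in blast)+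
qed

lemma vna_bicommutant:
  assumes "X \<subseteq> bounded_ops H" "\<And>B. B \<in> X \<Longrightarrow> op_adjoint H B \<in> X"
  shows "von_neumann_algebra H (commutant H (commutant H X))"
  unfolding von_neumann_algebra_def
proof (intro conjI ballI)
  show "commutant H (commutant H (commutant H (commutant H X))) = commutant H (commutant H X)"
    using tricommutant[OF commutant_bounded] .
  fix A assume "A \<in> commutant H (commutant H X)"
  then show "op_adjoint H A \<in> commutant H (commutant H X)"
    using commutant_adjoint[OF commutant_bounded] commutant_adjoint[OF assms] by blast
qed (rule commutant_bounded)

lemma generated_vna_eq:
  assumes X: "X \<subseteq> bounded_ops H"
  shows "generated_vna H X = commutant H (commutant H (X \<union> op_adjoint H ` X))"
    "von_neumann_algebra H (generated_vna H X)"
proof -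
  let ?Y = "X \<union> op_adjoint H ` X"
  have Y: "?Y \<subseteq> bounded_ops H" "\<And>B. B \<in> ?Y \<Longrightarrow> op_adjoint H B \<in> ?Y"
    using X adjoint_bounded(1) adjoint_adjoint by (auto simp: subset_iff)
  note v = vna_bicommutant[OF Y]
  show eq: "generated_vna H X = commutant H (commutant H ?Y)" unfolding generated_vna_def
  proof (rule hull_unique)
    show "X \<subseteq> commutant H (commutant H ?Y)" using subset_bicommutant[OF Y(1)] by blast
    fix M assume M: "X \<subseteq> M" "von_neumann_algebra H M"
    then have "?Y \<subseteq> M" by (auto simp: von_neumann_algebra_def)
    then have "commutant H (commutant H ?Y) \<subseteq> commutant H (commutant H M)" by (intro commutant_antimono)
    then show "commutant H (commutant H ?Y) \<subseteq> M" using M by (simp add: von_neumann_algebra_def)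
  qed (rule v)
  show "von_neumann_algebra H (generated_vna H X)" using v eq by simp
qed

lemma vna_memI:
  assumes "von_neumann_algebra H M" "A \<in> bounded_ops H"
    "\<And>U x. U \<in> commutant H M \<Longrightarrow> x \<in> C \<Longrightarrow> ap U (ap A x) = ap A (ap U x)"
  shows "A \<in> M"
proof -
  have "A \<in> commutant H (commutant H M)"
    using assms(2,3) unfolding commutant_iff[OF commutant_bounded] by metis
  then show ?thesis using assms(1) by (simp add: von_neumann_algebra_def)
qed

lemma vnaD:
  assumes "von_neumann_algebra H M"
  shows "A \<in> M \<Longrightarrow> A \<in> bounded_ops H" "A \<in> M \<Longrightarrow> op_adjoint H A \<in> M"
    "A \<in> M \<Longrightarrow> U \<in> commutant H M \<Longrightarrow> x \<in> C \<Longrightarrow> ap U (ap A x) = ap A (ap U x)"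
    "U \<in> commutant H M \<Longrightarrow> op_adjoint H U \<in> commutant H M"
    "U \<in> commutant H M \<Longrightarrow> U \<in> bounded_ops H"
proof -
  show b: "A \<in> M \<Longrightarrow> A \<in> bounded_ops H" "A \<in> M \<Longrightarrow> op_adjoint H A \<in> M" for A
    using assms by (auto simp: von_neumann_algebra_def)
  show "A \<in> M \<Longrightarrow> U \<in> commutant H M \<Longrightarrow> x \<in> C \<Longrightarrow> ap U (ap A x) = ap A (ap U x)"
    using commutant_iff[of M U] b by blast
  show "U \<in> commutant H M \<Longrightarrow> op_adjoint H U \<in> commutant H M" using commutant_adjoint[of M U] b by blast
  show "U \<in> commutant H M \<Longrightarrow> U \<in> bounded_ops H" by (auto simp: commutant_def)
qed

section \<open>Spectral resolutions and unitaries\<close>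

lemma projection_opD:
  assumes "projection_op H P"
  shows "P \<in> bounded_ops H" "x \<in> C \<Longrightarrow> ap P (ap P x) = ap P x"
    "x \<in> C \<Longrightarrow> y \<in> C \<Longrightarrow> hinner H (ap P x) y = hinner H x (ap P y)"
    "x \<in> C \<Longrightarrow> Re (hinner H (ap P x) x) = (hnorm H (ap P x))\<^sup>2"
proof -
  show b: "P \<in> bounded_ops H" using assms by (simp add: projection_op_def)
  have pp: "P \<circ>\<^sub>m P = P" and ad: "op_adjoint H P = P" using assms by (auto simp: projection_op_def)
  show i: "ap P (ap P x) = ap P x" if "x \<in> C" for x using ap_comp[OF b that, of P] pp by simp
  show s: "hinner H (ap P x) y = hinner H x (ap P y)" if "x \<in> C" "y \<in> C" for x y
    using adjoint_bounded(2)[OF b that] ad by simp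
  show "x \<in> C \<Longrightarrow> Re (hinner H (ap P x) x) = (hnorm H (ap P x))\<^sup>2"
    using s[of "ap P x" x] i bounded_opsD(4)[OF b] by (simp add: hnorm_sq)
qed

lemma pvm_proj:
  assumes "projection_valued_measure H E" "B \<in> sets borel" shows "projection_op H (E B)"
  using assms by (simp add: projection_valued_measure_def)

lemma pvm_empty:
  assumes E: "projection_valued_measure H E" and x: "x \<in> C" shows "hinner H (ap (E {}) x) x = 0"
proof -
  have "range (\<lambda>i::nat. {} :: real set) \<subseteq> sets borel \<and> disjoint_family (\<lambda>i::nat. {} :: real set)"
    by (auto simp: disjoint_family_on_def)
  then have "(\<lambda>i::nat. hinner H (ap (E {}) x) x) sums hinner H (ap (E (\<Union>i::nat. {})) x) x"
    using E x unfolding projection_valued_measure_def by blast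
  then have "(\<lambda>i::nat. hinner H (ap (E {}) x) x) \<longlonglongrightarrow> 0"
    by (intro summable_LIMSEQ_zero sums_summable)
  then show ?thesis by (simp add: LIMSEQ_const_iff)
qed

lemma sets_spectral_distr [simp, measurable_cong]: "sets (spectral_distr H E x) = sets borel"
  by (simp add: spectral_distr_def sets.sigma_sets_eq[of borel, simplified])

lemma emeasure_spectral_distr:
  assumes E: "projection_valued_measure H E" and x: "x \<in> C" and B: "B \<in> sets borel"
  shows "emeasure (spectral_distr H E x) B = ennreal (Re (hinner H (ap (E B) x) x))"
  unfolding spectral_distr_def
proof (rule emeasure_measure_of_sigma)
  show "sigma_algebra UNIV (sets borel)" using sets.sigma_algebra_axioms[of borel] by simp
  show "positive (sets borel) (\<lambda>B. ennreal (Re (hinner H (ap (E B) x) x)))"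
    by (simp add: positive_def pvm_empty[OF E x])
  have pos: "0 \<le> Re (hinner H (ap (E B) x) x)" if "B \<in> sets borel" for B
    using projection_opD(4)[OF pvm_proj[OF E that] x] by simp
  show "countably_additive (sets borel) (\<lambda>B. ennreal (Re (hinner H (ap (E B) x) x)))"
  proof (rule countably_additiveI)
    fix D :: "nat \<Rightarrow> real set" assume D: "range D \<subseteq> sets borel" "disjoint_family D"
    then have "(\<lambda>i. hinner H (ap (E (D i)) x) x) sums hinner H (ap (E (\<Union>i. D i)) x) x"
      using E x unfolding projection_valued_measure_def by blast
    then have "(\<lambda>i. Re (hinner H (ap (E (D i)) x) x)) sums Re (hinner H (ap (E (\<Union>i. D i)) x) x)"
      by (rule sums_Re)
    then show "(\<Sum>i. ennreal (Re (hinner H (ap (E (D i)) x) x))) = ennreal (Re (hinner H (ap (E (\<Union>i. D i)) x) x))"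
      using D pos by (intro suminf_ennreal_eq) auto
  qed
qed (rule B)

lemma polarization:
  assumes A: "linear_op H A" and x: "x \<in> dom A" and y: "y \<in> dom A"
  defines "q \<equiv> \<lambda>z. hinner H (ap A z) z"
  shows "4 * hinner H (ap A x) y = q (hadd H x y) - q (hadd H x (hscale H (-1) y))
      + \<i> * q (hadd H x (hscale H \<i> y)) - \<i> * q (hadd H x (hscale H (-\<i>) y))"
proof -
  obtain u v where uv: "A x = Some u" "A y = Some v" using x y by auto
  note l = linear_opD[OF A]
  have c: "x \<in> C" "y \<in> C" "u \<in> C" "v \<in> C" using uv l by blast+
  have "ap A (hadd H x (hscale H a y)) = hadd H u (hscale H a v)" for a
    using l(4)[OF uv(1) l(5)[OF uv(2)]] by simp
  moreover have "ap A (hadd H x y) = hadd H u v" using l(4)[OF uv] by simp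
  ultimately show ?thesis using c uv unfolding q_def by (simp add: algebra_simps)
qed

definition unitary :: "'v operator \<Rightarrow> bool" where
  "unitary U \<longleftrightarrow> U \<in> bounded_ops H
     \<and> (\<forall>x\<in>C. ap (op_adjoint H U) (ap U x) = x \<and> ap U (ap (op_adjoint H U) x) = x)"

lemma unitary_adjoint: assumes "unitary U" shows "unitary (op_adjoint H U)"
  using assms adjoint_bounded(1) adjoint_adjoint by (simp add: unitary_def)

text \<open>
  Since \<open>U\<close> is unitary and commutes with the spectral projections, \<open>U z\<close> and \<open>z\<close> have the
  same spectral distribution. Hence \<open>U\<close> preserves the domain and the quadratic form of
  \<open>A\<close>, and by polarization it commutes with \<open>A\<close>. For operators that are not unitary this
  would need an integral with respect to \<open>E\<close>.
\<close>

theorem unitary_commutes_with_resolved: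
  assumes A: "spectral_resolution H A E" and U: "unitary U"
    and UE: "\<And>B x. B \<in> sets borel \<Longrightarrow> x \<in> C \<Longrightarrow> ap U (ap (E B) x) = ap (E B) (ap U x)"
    and dd: "hdense H (dom A)" and Ax: "A x = Some y"
  shows "A (ap U x) = Some (ap U y)"
proof -
  have lin: "linear_op H A" and E: "projection_valued_measure H E"
    and dA: "dom A = {x \<in> C. integrable (spectral_distr H E x) (\<lambda>t. t\<^sup>2)}"
    and iA: "\<And>x. x \<in> dom A \<Longrightarrow> hinner H (ap A x) x = complex_of_real (LINT t|spectral_distr H E x. t)"
    using A by (auto simp: spectral_resolution_def)
  note l = linear_opD[OF lin]
  have Ub: "U \<in> bounded_ops H" using U by (simp add: unitary_def)
  note u = bounded_opsD[OF Ub] and ad = adjoint_bounded[OF Ub]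
  have UU: "ap (op_adjoint H U) (ap U z) = z" "ap U (ap (op_adjoint H U) z) = z" if "z \<in> C" for z
    using U that by (auto simp: unitary_def)
  have distr: "spectral_distr H E (ap U z) = spectral_distr H E z" if z: "z \<in> C" for z
    unfolding spectral_distr_def
  proof (rule measure_of_eq)
    fix B :: "real set" assume "B \<in> sigma_sets UNIV (sets borel)"
    then have B: "B \<in> sets borel" using sets.sigma_sets_eq[of "borel :: real measure"] by simp
    note EB = bounded_opsD(4)[OF projection_opD(1)[OF pvm_proj[OF E B]] z]
    have "hinner H (ap (E B) (ap U z)) (ap U z) = hinner H (ap (E B) z) z"
      using ad(2)[OF EB u(4)[OF z]] UE[OF B z] UU(1)[OF z] by simp
    then show "ennreal (Re (hinner H (ap (E B) (ap U z)) (ap U z))) = ennreal (Re (hinner H (ap (E B) z) z))" by simp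
  qed simp
  have dC: "dom A \<subseteq> C" using dA by auto
  have dU: "ap U z \<in> dom A" if "z \<in> dom A" for z using that distr u(4) unfolding dA by simp
  have q: "hinner H (ap A (ap U z)) (ap U z) = hinner H (ap A z) z" if z: "z \<in> dom A" for z
    unfolding iA[OF z] iA[OF dU[OF z]] distr[OF subsetD[OF dC z]] ..
  have form: "hinner H (ap A (ap U v)) (ap U w) = hinner H (ap A v) w" if v: "v \<in> dom A" and w: "w \<in> dom A" for v w
  proof -
    have c: "v \<in> C" "w \<in> C" using v w dC by blast+
    have sc: "hscale H a w \<in> dom A" for a using w l(5) by (auto simp: domIff)
    have dseq: "hadd H v z \<in> dom A" if "z \<in> dom A" for z using v that l(4) by (auto simp: domIff)
    have "hadd H (ap U v) (hscale H a (ap U w)) = ap U (hadd H v (hscale H a w))" for a using c u(5,6) by simp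
    moreover have "hadd H (ap U v) (ap U w) = ap U (hadd H v w)" using c u(5) by simp
    ultimately have "4 * hinner H (ap A (ap U v)) (ap U w) = 4 * hinner H (ap A v) w"
      unfolding polarization[OF lin v w] polarization[OF lin dU[OF v] dU[OF w]] by (simp only: q[OF dseq[OF sc]] q[OF dseq[OF w]])
    then show ?thesis by simp
  qed
  have x: "x \<in> dom A" "x \<in> C" "y \<in> C" using Ax l by auto
  obtain z where z: "A (ap U x) = Some z" using dU[OF x(1)] by blast
  then have zC: "z \<in> C" using l by blast
  have "ap (op_adjoint H U) z = y"
  proof (rule hdense_ext[OF dd dC])
    fix k assume k: "k \<in> dom A"
    have "hinner H (ap (op_adjoint H U) z) k = hinner H z (ap U k)"
      using adjoint_bounded(2)[OF ad(1) zC, of k] adjoint_adjoint[OF Ub] k dC by auto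
    then show "hinner H (ap (op_adjoint H U) z) k = hinner H y k" using form[OF x(1) k] z Ax by simp
  qed (use bounded_opsD(4)[OF ad(1) zC] x in auto)
  then show ?thesis using z UU(2)[OF zC] by simp
qed

section \<open>The projection onto the graph of a closed operator\<close>

lemma closed_opD: "closed_op H T \<Longrightarrow> linear_op H T" by (simp add: closed_op_def)

abbreviation "p11 T \<equiv> entry11 H (graph_proj H T)"
abbreviation "p12 T \<equiv> entry12 H (graph_proj H T)"
abbreviation "p21 T \<equiv> entry21 H (graph_proj H T)"
abbreviation "p22 T \<equiv> entry22 H (graph_proj H T)"

lemma contraction_entries:
  assumes P: "P \<in> bounded_ops (hsum H H)"
    and le: "\<And>x. x \<in> hcarrier (hsum H H) \<Longrightarrow> hnorm (hsum H H) (ap P x) \<le> 1 * hnorm (hsum H H) x"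
    and B: "B \<in> {entry11 H P, entry21 H P, entry12 H P, entry22 H P}"
  shows "B \<in> bounded_ops H" "x \<in> C \<Longrightarrow> hnorm H (ap B x) \<le> 1 * hnorm H x"
proof -
  interpret W: hilbert_space "hsum H H" by (rule hilbert_space_hsum) unfold_locales
  note p = W.bounded_opsD[OF P]
  \<comment> \<open>every entry is \<open>P\<close> between a coordinate inclusion and a coordinate projection\<close>
  have h: "mk_op H (\<lambda>x. \<pi> (ap P (\<iota> x))) \<in> bounded_ops H \<and> (\<forall>x\<in>C. hnorm H (\<pi> (ap P (\<iota> x))) \<le> 1 * hnorm H x)"
    if i: "\<iota> \<in> {\<lambda>x. (x, hzero H), \<lambda>x. (hzero H, x)}" and pi: "\<pi> \<in> {fst, snd}" for \<iota> :: "'v \<Rightarrow> 'v \<times> 'v" and \<pi>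
  proof -
    have c: "\<iota> x \<in> W.C" "hnorm (hsum H H) (\<iota> x) = hnorm H x" "\<iota> (hscale H a x) = hscale (hsum H H) a (\<iota> x)" if "x \<in> C" for x a
      using i that by (auto simp: hnorm_def)
    have ad: "\<iota> (hadd H x y) = hadd (hsum H H) (\<iota> x) (\<iota> y)" if "x \<in> C" "y \<in> C" for x y
      using i that by (auto simp: add_zero)
    have b: "hnorm H (\<pi> (ap P (\<iota> x))) \<le> 1 * hnorm H x" if x: "x \<in> C" for x
      using le[OF c(1)[OF x]] c(2)[OF x] p(4)[OF c(1)[OF x]] pi
        hsum_hnorm_le[OF hilbert_space_axioms hilbert_space_axioms, of "fst (ap P (\<iota> x))" "snd (ap P (\<iota> x))"] by auto
    have "mk_op H (\<lambda>x. \<pi> (ap P (\<iota> x))) \<in> bounded_ops H"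
    proof (rule mk_op_bounded[OF _ _ _ b])
      show "x \<in> C \<Longrightarrow> \<pi> (ap P (\<iota> x)) \<in> C" for x using p(4)[OF c(1)[of x]] pi by auto
    next
      fix x y assume xy: "x \<in> C" "y \<in> C"
      show "\<pi> (ap P (\<iota> (hadd H x y))) = hadd H (\<pi> (ap P (\<iota> x))) (\<pi> (ap P (\<iota> y)))"
        unfolding ad[OF xy] p(5)[OF c(1)[OF xy(1)] c(1)[OF xy(2)]] using pi by auto
    next
      fix a x assume x: "x \<in> C"
      show "\<pi> (ap P (\<iota> (hscale H a x))) = hscale H a (\<pi> (ap P (\<iota> x)))"
        unfolding c(3)[OF x] p(6)[OF c(1)[OF x]] using pi by auto
    qed
    then show ?thesis using b by blast
  qed
  define q where "q = ap P"
  have "P (x, hzero H) = (if x \<in> C then Some (q (x, hzero H)) else None)"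
    "P (hzero H, x) = (if x \<in> C then Some (q (hzero H, x)) else None)" for x
    using p(3,10) unfolding q_def by auto
  then have e: "entry11 H P = mk_op H (\<lambda>x. fst (q (x, hzero H)))" "entry21 H P = mk_op H (\<lambda>x. snd (q (x, hzero H)))"
    "entry12 H P = mk_op H (\<lambda>x. fst (q (hzero H, x)))" "entry22 H P = mk_op H (\<lambda>x. snd (q (hzero H, x)))"
    by (auto simp: entry11_def entry12_def entry21_def entry22_def mk_op_def fun_eq_iff)
  have "mk_op H f \<in> bounded_ops H \<and> (\<forall>x\<in>C. hnorm H (ap (mk_op H f) x) \<le> 1 * hnorm H x)"
    if "mk_op H f \<in> bounded_ops H \<and> (\<forall>x\<in>C. hnorm H (f x) \<le> 1 * hnorm H x)" for f using that by simp
  note h = this[OF h]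
  have "B \<in> bounded_ops H \<and> (\<forall>x\<in>C. hnorm H (ap B x) \<le> 1 * hnorm H x)"
    using B h[OF insertI1 insertI1] h[OF insertI1 insertI2[OF insertI1]]
      h[OF insertI2[OF insertI1] insertI1] h[OF insertI2[OF insertI1] insertI2[OF insertI1]]
    unfolding e q_def by (elim insertE emptyE) (hypsubst, assumption)+
  then show "B \<in> bounded_ops H" "x \<in> C \<Longrightarrow> hnorm H (ap B x) \<le> 1 * hnorm H x" by blast+
qed

context
  fixes T assumes T: "closed_op H T"
begin

lemma graph_closed: "hsubspace (hsum H H) (Map.graph T)" "hclosed (hsum H H) (Map.graph T)"
  using T by (auto simp: closed_op_def linear_op_def)

lemma graph_proj:
  assumes x: "x \<in> C" and y: "y \<in> C"
  obtains u v where "graph_proj H T (x, y) = Some (u, v)" "T u = Some v"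
    "\<And>a b. T a = Some b \<Longrightarrow> hinner H x a + hinner H y b = hinner H u a + hinner H v b"
proof -
  interpret W: hilbert_space "hsum H H" by (rule hilbert_space_hsum) unfold_locales
  note P = W.orth_proj[OF graph_closed]
  have xy: "(x, y) \<in> W.C" using x y by simp
  obtain u v where uv: "ap (graph_proj H T) (x, y) = (u, v)" by force
  then have Tu: "T u = Some v" using P(1)[OF xy] by (simp add: graph_proj_def Map.graph_def)
  have "hinner H x a + hinner H y b = hinner H u a + hinner H v b" if ab: "T a = Some b" for a b
  proof -
    have c: "u \<in> C" "v \<in> C" "a \<in> C" "b \<in> C" using Tu ab linear_opD[OF closed_opD[OF T]] by blast+
    have "hinner (hsum H H) (hdiff (hsum H H) (x, y) (u, v)) (a, b) = 0"
      using P(2)[OF xy, of "(a, b)"] uv ab by (simp add: graph_proj_def Map.graph_def)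
    then show ?thesis using c x y by (simp add: algebra_simps)
  qed
  then show thesis using that Tu uv W.bounded_opsD(3)[OF P(3) xy] by (simp add: graph_proj_def)
qed

lemma graph_proj_eqI:
  assumes x: "x \<in> C" and y: "y \<in> C" and uv: "T u = Some v"
    and o: "\<And>a b. T a = Some b \<Longrightarrow> hinner H x a + hinner H y b = hinner H u a + hinner H v b"
  shows "graph_proj H T (x, y) = Some (u, v)"
proof -
  interpret W: hilbert_space "hsum H H" by (rule hilbert_space_hsum) unfold_locales
  note l = linear_opD(1,2)[OF closed_opD[OF T]]
  have c: "u \<in> C" "v \<in> C" using uv l by blast+
  show ?thesis unfolding graph_proj_def
  proof (rule W.orth_proj_eqI[OF graph_closed(1)])
    fix k assume "k \<in> Map.graph T"
    then obtain a b where k: "k = (a, b)" "T a = Some b" by (auto simp: Map.graph_def)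
    have "a \<in> C" "b \<in> C" using k(2) l by blast+
    then show "hinner (hsum H H) (hdiff (hsum H H) (x, y) (u, v)) k = 0"
      using o[OF k(2)] c x y k(1) by (simp add: algebra_simps)
  qed (use x y uv in \<open>auto simp: Map.graph_def\<close>)
qed

text \<open>
  The first column sends \<open>x\<close> to the pair \<open>(u, T u)\<close> in the graph with \<open>(x - u, - T u)\<close>
  orthogonal to the graph. For densely defined \<open>T\<close> this means \<open>u = (1 + T* T)^(-1) x\<close>.
\<close>

lemma graph_proj_col1:
  assumes x: "x \<in> C"
  shows "T (ap (p11 T) x) = Some (ap (p21 T) x)"
    "T a = Some b \<Longrightarrow> hinner H x a = hinner H (ap (p11 T) x) a + hinner H (ap (p21 T) x) b"
proof -
  obtain u v where uv: "graph_proj H T (x, hzero H) = Some (u, v)" "T u = Some v"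
    and o: "\<And>a b. T a = Some b \<Longrightarrow> hinner H x a + hinner H (hzero H) b = hinner H u a + hinner H v b"
    using graph_proj[OF x zero_closed] by metis
  have e: "ap (p11 T) x = u" "ap (p21 T) x = v" using uv by (simp_all add: entry11_def entry21_def)
  show "T (ap (p11 T) x) = Some (ap (p21 T) x)" using e uv by simp
  assume ab: "T a = Some b"
  then have "b \<in> C" using linear_opD(2)[OF closed_opD[OF T]] by blast
  then show "hinner H x a = hinner H (ap (p11 T) x) a + hinner H (ap (p21 T) x) b" using o[OF ab] e by simp
qed

lemma graph_proj_col2:
  assumes x: "x \<in> C"
  shows "T (ap (p12 T) x) = Some (ap (p22 T) x)"
    "T a = Some b \<Longrightarrow> hinner H x b = hinner H (ap (p12 T) x) a + hinner H (ap (p22 T) x) b"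
proof -
  obtain u v where uv: "graph_proj H T (hzero H, x) = Some (u, v)" "T u = Some v"
    and o: "\<And>a b. T a = Some b \<Longrightarrow> hinner H (hzero H) a + hinner H x b = hinner H u a + hinner H v b"
    using graph_proj[OF zero_closed x] by metis
  have e: "ap (p12 T) x = u" "ap (p22 T) x = v" using uv by (simp_all add: entry12_def entry22_def)
  show "T (ap (p12 T) x) = Some (ap (p22 T) x)" using e uv by simp
  assume ab: "T a = Some b"
  then have "a \<in> C" using linear_opD(1)[OF closed_opD[OF T]] by blast
  then show "hinner H x b = hinner H (ap (p12 T) x) a + hinner H (ap (p22 T) x) b" using o[OF ab] e by simp
qed

lemma col1_unique:
  assumes x: "x \<in> C" and uv: "T u = Some v"
    and o: "\<And>a b. T a = Some b \<Longrightarrow> hinner H x a = hinner H u a + hinner H v b"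
  shows "ap (p11 T) x = u" "ap (p21 T) x = v"
proof -
  have "graph_proj H T (x, hzero H) = Some (u, v)"
    by (rule graph_proj_eqI[OF x zero_closed uv]) (use o linear_opD(2)[OF closed_opD[OF T]] in auto)
  then show "ap (p11 T) x = u" "ap (p21 T) x = v" by (simp_all add: entry11_def entry21_def)
qed

lemma col2_unique:
  assumes x: "x \<in> C" and uv: "T u = Some v"
    and o: "\<And>a b. T a = Some b \<Longrightarrow> hinner H x b = hinner H u a + hinner H v b"
  shows "ap (p12 T) x = u" "ap (p22 T) x = v"
proof -
  have "graph_proj H T (hzero H, x) = Some (u, v)"
    by (rule graph_proj_eqI[OF zero_closed x uv]) (use o linear_opD(1)[OF closed_opD[OF T]] in auto)
  then show "ap (p12 T) x = u" "ap (p22 T) x = v" by (simp_all add: entry12_def entry22_def)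
qed

lemma entries_contractive:
  shows entries_bounded: "p11 T \<in> bounded_ops H" "p21 T \<in> bounded_ops H" "p12 T \<in> bounded_ops H" "p22 T \<in> bounded_ops H"
    and entries_bound: "x \<in> C \<Longrightarrow> hnorm H (ap (p11 T) x) \<le> 1 * hnorm H x" "x \<in> C \<Longrightarrow> hnorm H (ap (p21 T) x) \<le> 1 * hnorm H x"
    "x \<in> C \<Longrightarrow> hnorm H (ap (p12 T) x) \<le> 1 * hnorm H x" "x \<in> C \<Longrightarrow> hnorm H (ap (p22 T) x) \<le> 1 * hnorm H x"
proof -
  interpret W: hilbert_space "hsum H H" by (rule hilbert_space_hsum) unfold_locales
  note P = W.orth_proj(3,4)[OF graph_closed, folded graph_proj_def]
  note e = contraction_entries[OF P]
  show "p11 T \<in> bounded_ops H" "p21 T \<in> bounded_ops H" "p12 T \<in> bounded_ops H" "p22 T \<in> bounded_ops H"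
    "x \<in> C \<Longrightarrow> hnorm H (ap (p11 T) x) \<le> 1 * hnorm H x" "x \<in> C \<Longrightarrow> hnorm H (ap (p21 T) x) \<le> 1 * hnorm H x"
    "x \<in> C \<Longrightarrow> hnorm H (ap (p12 T) x) \<le> 1 * hnorm H x" "x \<in> C \<Longrightarrow> hnorm H (ap (p22 T) x) \<le> 1 * hnorm H x"
    by (rule e; blast)+
qed

lemma entries_closed:
  assumes x: "x \<in> C"
  shows "ap (p11 T) x \<in> C" "ap (p21 T) x \<in> C" "ap (p12 T) x \<in> C" "ap (p22 T) x \<in> C"
  using entries_bounded[THEN bounded_opsD(4)] x by blast+

end

text \<open>The kernel of \<open>p11 T\<close> is the orthogonal complement of the domain.\<close>

lemma densely_defined_iff_p11:
  assumes T: "closed_op H T"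
  shows "densely_defined H T \<longleftrightarrow> (\<forall>x\<in>C. ap (p11 T) x = hzero H \<longrightarrow> x = hzero H)"
proof
  note l = linear_opD[OF closed_opD[OF T]]
  have dC: "dom T \<subseteq> C" using l by blast
  assume d: "densely_defined H T"
  show "\<forall>x\<in>C. ap (p11 T) x = hzero H \<longrightarrow> x = hzero H"
  proof (intro ballI impI)
    fix x assume x: "x \<in> C" and z: "ap (p11 T) x = hzero H"
    then have z2: "ap (p21 T) x = hzero H" using graph_proj_col1(1)[OF T x] l(3) by simp
    have "hinner H x k = hinner H (hzero H) k" if "k \<in> dom T" for k
      using that graph_proj_col1(2)[OF T x] z z2 l(1,2) by (auto simp: domIff)
    then show "x = hzero H" using hdense_ext[OF _ dC x zero_closed] d by (simp add: densely_defined_def)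
  qed
next
  note l = linear_opD[OF closed_opD[OF T]]
  assume inj: "\<forall>x\<in>C. ap (p11 T) x = hzero H \<longrightarrow> x = hzero H"
  have sub: "hsubspace H (dom T)" unfolding hsubspace_def
    using l by (auto simp: domIff)
  show "densely_defined H T" unfolding densely_defined_def
  proof (rule hdense_subspaceI[OF sub])
    fix v assume v: "v \<in> C" "\<And>k. k \<in> dom T \<Longrightarrow> hinner H v k = 0"
    have "ap (p11 T) v = hzero H"
      by (rule col1_unique(1)[OF T v(1) l(3)]) (use v l(1,2) in auto)
    then show "v = hzero H" using inj v by blast
  qed
qed

text \<open>
  \<open>U\<close> and its adjoint leave the graph invariant, hence also its orthogonal complement, so
  that \<open>U\<close> acting on both coordinates commutes with the projection.
\<close>

lemma commute_entries:
  assumes T: "closed_op H T" and U: "U \<in> bounded_ops H"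
    and inv: "\<And>x y. T x = Some y \<Longrightarrow> T (ap U x) = Some (ap U y)"
      "\<And>x y. T x = Some y \<Longrightarrow> T (ap (op_adjoint H U) x) = Some (ap (op_adjoint H U) y)"
    and x: "x \<in> C" and P: "P \<in> {p11 T, p12 T, p21 T, p22 T}"
  shows "ap U (ap P x) = ap P (ap U x)"
proof -
  note l = linear_opD[OF closed_opD[OF T]]
  note u = bounded_opsD(4)[OF U]
  have lC: "a \<in> C" "b \<in> C" if "T a = Some b" for a b using that l by blast+
  note ad = adjoint_bounded(2)[OF U] and e = entries_closed[OF T x]
  have 1: "ap (p11 T) (ap U x) = ap U (ap (p11 T) x)" "ap (p21 T) (ap U x) = ap U (ap (p21 T) x)"
    by (rule col1_unique[OF T u[OF x] inv(1)[OF graph_proj_col1(1)[OF T x]]],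
        simp add: ad x e lC graph_proj_col1(2)[OF T x inv(2)])+
  have 2: "ap (p12 T) (ap U x) = ap U (ap (p12 T) x)" "ap (p22 T) (ap U x) = ap U (ap (p22 T) x)"
    by (rule col2_unique[OF T u[OF x] inv(1)[OF graph_proj_col2(1)[OF T x]]],
        simp add: ad x e lC graph_proj_col2(2)[OF T x inv(2)])+
  show ?thesis using P 1 2 by auto
qed

end

section \<open>Induction over bounded Borel functions\<close>

text \<open>
  Bernstein polynomials lead from powers to continuous functions, these to the indicators
  of half lines, a Dynkin argument to the indicators of Borel sets, and monotone limits to
  everything else. All the limits are pointwise and bounded; under such limits the
  operators of the functional calculus converge weakly.
\<close>

lemma bounded_borel_induct:
  fixes P :: "(real \<Rightarrow> real) \<Rightarrow> bool"
  assumes power: "\<And>j. P (\<lambda>t. t ^ j)"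
    and lin: "\<And>f g a b. P f \<Longrightarrow> P g \<Longrightarrow> P (\<lambda>t. a * f t + b * g t)"
    and lim: "\<And>f g K. (\<And>n. P (f n)) \<Longrightarrow> (\<And>n. f n \<in> borel_measurable borel) \<Longrightarrow> g \<in> borel_measurable borel
       \<Longrightarrow> (\<And>n t. t \<in> {0..1} \<Longrightarrow> \<bar>f n t\<bar> \<le> K) \<Longrightarrow> (\<And>t. t \<in> {0..1} \<Longrightarrow> (\<lambda>n. f n t) \<longlonglongrightarrow> g t) \<Longrightarrow> P g"
    and h: "h \<in> borel_measurable borel" "\<And>t. t \<in> {0..1} \<Longrightarrow> \<bar>h t\<bar> \<le> K"
  shows "P h"
proof -
  have one: "P (\<lambda>t. 1)" using power[of 0] by simp
  have cmul: "P (\<lambda>t. a * f t)" if "P f" for a f using lin[OF that that, of a 0] by simp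
  have zero: "P (\<lambda>t. 0)" using cmul[OF one, of 0] by simp
  have psum: "P (\<lambda>t. \<Sum>k<n. f k t)" if "\<And>k. P (f k)" for n and f :: "nat \<Rightarrow> real \<Rightarrow> real"
  proof (induction n)
    case (Suc n)
    then show ?case using lin[OF Suc that[of n], of 1 1] by simp
  qed (simp add: zero)
  have bern: "P (\<lambda>t. t ^ a * (1 - t) ^ b)" for a b
  proof (induction b arbitrary: a)
    case (Suc b)
    then show ?case using lin[OF Suc[of a] Suc[of "Suc a"], of 1 "-1"] by (simp add: algebra_simps)
  qed (simp add: power)
  have cont: "P f" if f: "continuous_on UNIV f" for f
  proof -
    define B where "B n t = (\<Sum>k\<le>n. f (k/n) * Bernstein n k t)" for n t
    have PB: "P (B n)" for n
    proof -
      have "P (\<lambda>t. \<Sum>k<Suc n. (f (k/n) * (n choose k)) * (t ^ k * (1 - t) ^ (n - k)))"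
        by (intro psum cmul bern)
      then show ?thesis by (simp add: B_def[abs_def] Bernstein_def lessThan_Suc_atMost mult.assoc)
    qed
    have c01: "continuous_on {0..1} f" using f continuous_on_subset by blast
    have "\<exists>N. \<forall>n t. N \<le> n \<and> t \<in> {0..1} \<longrightarrow> \<bar>f t - B n t\<bar> < 1 / Suc m" for m
      unfolding B_def by (rule Bernstein_Weierstrass[OF c01]) simp
    then obtain N where N: "\<And>m t. t \<in> {0..1} \<Longrightarrow> \<bar>f t - B (N m) t\<bar> < 1 / Suc m" by (metis order_refl)
    have "bounded (f ` {0..1})" by (intro compact_imp_bounded compact_continuous_image c01) simp
    then obtain K where K: "\<And>t. t \<in> {0..1} \<Longrightarrow> \<bar>f t\<bar> \<le> K" unfolding bounded_iff by force
    show ?thesis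
    proof (rule lim[of "\<lambda>m. B (N m)" f "K + 1"])
      show "B (N m) \<in> borel_measurable borel" for m
        unfolding B_def[abs_def] Bernstein_def by measurable
      show "f \<in> borel_measurable borel" using f by (rule borel_measurable_continuous_onI)
      fix m and t :: real assume t: "t \<in> {0..1}"
      have "1 / real (Suc m) \<le> 1" by simp
      then show "\<bar>B (N m) t\<bar> \<le> K + 1" using N[OF t, of m] K[OF t] by linarith
    next
      fix t :: real assume t: "t \<in> {0..1}"
      have "(\<lambda>m. B (N m) t - f t) \<longlonglongrightarrow> 0"
      proof (rule tendsto_0_le)
        show "(\<lambda>n. 1 / real (Suc n)) \<longlonglongrightarrow> 0" using LIMSEQ_inverse_real_of_nat by (simp add: inverse_eq_divide)
        show "norm (B (N m) t - f t) \<le> 1 / real (Suc m)" for m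
          using N[OF t, of m] by (simp add: abs_minus_commute)
      qed
      then show "(\<lambda>m. B (N m) t) \<longlonglongrightarrow> f t" using LIM_zero_iff by blast
    qed (rule PB)
  qed
  have atm: "P (indicator {..a})" for a :: real
  proof (rule lim[of "\<lambda>m t. max 0 (min 1 (1 - real m * (t - a)))" _ 1])
    show "P (\<lambda>t. max 0 (min 1 (1 - real m * (t - a))))" for m
      by (intro cont continuous_intros)
    fix t :: real
    show "(\<lambda>m. max 0 (min 1 (1 - real m * (t - a)))) \<longlonglongrightarrow> indicator {..a} t"
    proof (cases "t \<le> a")
      case True
      then have "max 0 (min 1 (1 - real m * (t - a))) = 1" for m by (auto simp: mult_nonneg_nonpos)
      then show ?thesis using True by simp
    next
      case False
      then obtain M where M: "1 < real M * (t - a)" using reals_Archimedean3[of "t - a"] by auto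
      have "max 0 (min 1 (1 - real m * (t - a))) = 0" if "m \<ge> M" for m
      proof -
        have "real M * (t - a) \<le> real m * (t - a)" using that False by (intro mult_right_mono) auto
        then show ?thesis using M by simp
      qed
      then have "\<forall>\<^sub>F m in sequentially. max 0 (min 1 (1 - real m * (t - a))) = indicator {..a} t"
        using False eventually_sequentially by auto
      then show ?thesis by (rule tendsto_eventually)
    qed
  qed auto
  have ind: "P (indicator B)" if "B \<in> sets borel" for B :: "real set"
  proof -
    have "Int_stable (range atMost :: real set set)" by (auto simp: Int_stable_def)
    moreover have "range atMost \<subseteq> Pow (UNIV :: real set)" by simp
    moreover have "B \<in> sigma_sets UNIV (range atMost)" using that by (simp add: borel_eq_atMost)
    ultimately show ?thesis
    proof (induction rule: sigma_sets_induct_disjoint)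
      case (compl A)
      have "indicator (UNIV - A) = (\<lambda>t. 1 * 1 + (-1) * indicator A t :: real)" by (auto simp: indicator_def fun_eq_iff)
      then show ?case using lin[OF one compl(2), of 1 "-1"] by simp
    next
      case (union A)
      have Ab: "A i \<in> sets borel" for i using union(2) by (auto simp: borel_eq_atMost)
      show ?case
      proof (rule lim[of "\<lambda>n t. \<Sum>i<n. indicator (A i) t" _ 1])
        show "P (\<lambda>t. \<Sum>i<n. indicator (A i) t)" for n by (intro psum union)
        fix n and t :: real
        have "(\<Sum>i<n. indicator (A i) t :: real) = indicator (\<Union>i<n. A i) t"
          using union(1) by (subst indicator_UN_disjoint) (auto simp: disjoint_family_on_def)
        then show "\<bar>\<Sum>i<n. indicator (A i) t :: real\<bar> \<le> 1" by (simp add: indicator_def)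
      next
        fix t :: real
        have "(\<lambda>i. indicator (A i) t :: real) sums indicator (\<Union>i. A i) t"
          using union(1) by (intro indicator_sums) (auto simp: disjoint_family_on_def)
        then show "(\<lambda>n. \<Sum>i<n. indicator (A i) t :: real) \<longlonglongrightarrow> indicator (\<Union>i. A i) t" by (simp add: sums_def)
      qed (use Ab in measurable)
    qed (auto simp: zero atm)
  qed
  have nonneg: "P u" if "u \<in> borel_measurable borel" "\<And>t. 0 \<le> u t" "\<And>t. u t \<le> K" for u and K :: real
    using that
  proof (induction arbitrary: K rule: borel_measurable_induct_real)
    case (set A) then show ?case using ind by simp
  next
    case (mult u c)
    show ?case
    proof (cases "c = 0")
      case False
      then have "u t \<le> K / c" for t using mult(1) mult(5)[of t] by (simp add: field_simps)
      then show ?thesis using mult(4)[of "K/c"] cmul by blast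
    qed (simp add: zero)
  next
    case (add u v)
    have "u t \<le> K" "v t \<le> K" for t using add.hyps(2)[of t] add.hyps(4)[of t] add.prems[of t] by linarith+
    then show ?case using lin[OF add.IH(2)[of K] add.IH(1)[of K], of 1 1] by simp
  next
    case (seq U)
    have le: "U i t \<le> u t" for i t
      using incseq_le[of "\<lambda>i. U i t" "u t"] seq.hyps(3,4) by (auto simp: incseq_def le_fun_def)
    then have UK: "U i t \<le> K" for i t using seq.prems[of t] order_trans by blast
    then have "P (U i)" for i using seq.IH by blast
    moreover have "\<bar>U i t\<bar> \<le> K" for i t using seq.hyps(2)[of i t] UK[of i t] by simp
    ultimately show ?case using lim[of U u K] seq.hyps(1,4) that(1) by simp
  qed
  \<comment> \<open>shift to a nonnegative function; the constant sequence \<open>g - K\<close> then converges to \<open>h\<close> on the unit interval\<close>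
  define g where "g t = (if t \<in> {0..1} then h t + K else 0)" for t
  have gm: "g \<in> borel_measurable borel" unfolding g_def[abs_def] using h(1) by measurable
  have "0 \<le> g t" "g t \<le> 2 * \<bar>K\<bar>" for t using h(2)[of t] unfolding g_def by auto
  then have "P g" using nonneg[OF gm] by blast
  then have Ph: "P (\<lambda>t. 1 * g t + (-K) * 1)" using lin one by blast
  show ?thesis
  proof (rule lim[of "\<lambda>n t. 1 * g t + (-K) * 1" h K])
    show "(\<lambda>t. 1 * g t + (-K) * 1) \<in> borel_measurable borel" using gm by measurable
  qed (use Ph h in \<open>auto simp: g_def\<close>)
qed

section \<open>Moments of a positive contraction\<close>

lemma sum_Pascal:
  fixes f :: "nat \<Rightarrow> 'a::comm_ring_1"
  shows "(\<Sum>k\<le>Suc n. of_nat (Suc n choose k) * f k)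
    = (\<Sum>k\<le>n. of_nat (n choose k) * f k) + (\<Sum>k\<le>n. of_nat (n choose k) * f (Suc k))"
proof -
  have "(\<Sum>k\<le>Suc n. of_nat (Suc n choose k) * f k) = f 0 + (\<Sum>k\<le>n. of_nat (Suc n choose Suc k) * f (Suc k))"
    by (simp add: sum.atMost_Suc_shift del: sum.atMost_Suc binomial_Suc_Suc)
  also have "(\<Sum>k\<le>n. of_nat (Suc n choose Suc k) * f (Suc k))
    = (\<Sum>k\<le>n. of_nat (n choose Suc k) * f (Suc k)) + (\<Sum>k\<le>n. of_nat (n choose k) * f (Suc k))"
    by (simp add: algebra_simps sum.distrib)
  also have "f 0 + ((\<Sum>k\<le>n. of_nat (n choose Suc k) * f (Suc k)) + (\<Sum>k\<le>n. of_nat (n choose k) * f (Suc k)))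
    = (\<Sum>k\<le>Suc n. of_nat (n choose k) * f k) + (\<Sum>k\<le>n. of_nat (n choose k) * f (Suc k))"
    by (simp add: sum.atMost_Suc_shift add.assoc del: sum.atMost_Suc)
  finally show ?thesis by (simp add: binomial_eq_0)
qed

text \<open>
  The ratio of falling factorials \<open>k (k - 1) \<dots> (k - j + 1) / (n (n - 1) \<dots> (n - j + 1))\<close>.
  Against the Bernstein weights of degree \<open>n\<close> it integrates to exactly the moment of order
  \<open>j\<close>, and for large \<open>n\<close> it is close to \<open>(k / n) ^ j\<close>, the integrand of that moment at the
  node \<open>k / n\<close>.
\<close>

definition falling_ratio :: "nat \<Rightarrow> nat \<Rightarrow> nat \<Rightarrow> real" where
  "falling_ratio j n k = (\<Prod>i<j. (real k - real i) / (real n - real i))"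

lemma falling_ratio_Suc:
  "falling_ratio (Suc j) (Suc n) (Suc k) = real (Suc k) / real (Suc n) * falling_ratio j n k"
  by (simp add: falling_ratio_def prod.lessThan_Suc_shift del: prod.lessThan_Suc)

lemma falling_ratio_Suc_0: "falling_ratio (Suc j) n 0 = 0"
  by (simp add: falling_ratio_def prod.lessThan_Suc_shift del: prod.lessThan_Suc)

lemma falling_ratio_approx:
  assumes "k \<le> n" "2 * j < n"
  shows "\<bar>falling_ratio j n k - (real k / real n) ^ j\<bar> \<le> real j * (real j / (real n - real j))"
proof -
  have n: "real n - real j > 0" "real n > 0" using assms by auto
  have "(real k / real n) ^ j = (\<Prod>i<j. real k / real n)" by simp
  then have "\<bar>falling_ratio j n k - (real k / real n) ^ j\<bar>
     = norm ((\<Prod>i<j. (real k - real i) / (real n - real i)) - (\<Prod>i<j. real k / real n))"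
    by (simp add: falling_ratio_def)
  also have "\<dots> \<le> (\<Sum>i<j. norm ((real k - real i) / (real n - real i) - real k / real n))"
  proof (rule norm_prod_diff)
    fix i assume "i \<in> {..<j}"
    then have i: "i < j" by simp
    have "\<bar>real k - real i\<bar> \<le> real n - real i" using assms i by auto
    then show "norm ((real k - real i) / (real n - real i)) \<le> 1" using assms i by (simp add: abs_divide)
    show "norm (real k / real n) \<le> 1" using assms by simp
  qed
  also have "\<dots> \<le> (\<Sum>i<j. real j / (real n - real j))"
  proof (rule sum_mono)
    fix i assume "i \<in> {..<j}"
    then have i: "i < j" by simp
    have ni: "real n - real i > 0" using assms i by auto
    have "(real k - real i) / (real n - real i) - real k / real n = - (real i * (real n - real k)) / (real n * (real n - real i))"
      using ni n by (simp add: field_simps)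
    also have "norm \<dots> = real i / (real n - real i) * ((real n - real k) / real n)"
      using ni n assms by (simp add: abs_mult)
    also have "\<dots> \<le> real j / (real n - real j) * 1"
      using i n assms by (intro mult_mono frac_le) auto
    finally show "norm ((real k - real i) / (real n - real i) - real k / real n) \<le> real j / (real n - real j)" by simp
  qed
  also have "\<dots> = real j * (real j / (real n - real j))" by simp
  finally show ?thesis .
qed

text \<open>
  Selfadjoint operators with \<open>0 \<le> R \<le> 1\<close>. Applied to \<open>R\<close>, the Bernstein polynomials are
  positive operators, and at a unit vector \<open>x\<close> their quadratic forms are probabilities on
  the nodes \<open>k / n\<close>. As \<open>n\<close> grows these distributions converge along a subsequence to a
  measure with the moments \<open>\<langle>R\<^sup>j x, x\<rangle>\<close> (Hausdorff).
\<close>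

locale unit_selfadjoint = hilbert_space H for H :: "'v hilbert_struct" +
  fixes R :: "'v operator"
  assumes R_bounded: "R \<in> bounded_ops H"
    and R_selfadjoint: "x \<in> hcarrier H \<Longrightarrow> y \<in> hcarrier H \<Longrightarrow> hinner H (ap R x) y = hinner H x (ap R y)"
    and R_pos: "x \<in> hcarrier H \<Longrightarrow> 0 \<le> Re (hinner H (ap R x) x)"
    and R_le: "x \<in> hcarrier H \<Longrightarrow> Re (hinner H (ap R x) x) \<le> Re (hinner H x x)"
begin

definition "r = ap R"
definition "s x = hdiff H x (r x)"

lemma r_eq: "ap R x = r x" by (simp add: r_def)
lemma R_closed [simp]: "x \<in> C \<Longrightarrow> r x \<in> C" using bounded_opsD(4)[OF R_bounded] by (simp add: r_def)
lemma r_selfadjoint: "x \<in> C \<Longrightarrow> y \<in> C \<Longrightarrow> hinner H (r x) y = hinner H x (r y)" by (simp add: r_def R_selfadjoint)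
lemma s_closed [simp]: "x \<in> C \<Longrightarrow> s x \<in> C" by (simp add: s_def)
lemma Rk_closed [simp]: "x \<in> C \<Longrightarrow> (r ^^ k) x \<in> C" by (induction k) auto
lemma sk_closed [simp]: "x \<in> C \<Longrightarrow> (s ^^ k) x \<in> C" by (induction k) auto

lemma s_selfadjoint: "x \<in> C \<Longrightarrow> y \<in> C \<Longrightarrow> hinner H (s x) y = hinner H x (s y)"
  by (simp add: s_def r_selfadjoint)

lemma Rs_commute: "x \<in> C \<Longrightarrow> r (s x) = s (r x)"
  by (simp add: s_def r_def bounded_opsD(4,7)[OF R_bounded])

lemma Rk_selfadjoint: "x \<in> C \<Longrightarrow> y \<in> C \<Longrightarrow> hinner H ((r ^^ k) x) y = hinner H x ((r ^^ k) y)"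
  by (induction k arbitrary: x y) (simp_all add: r_selfadjoint funpow_swap1)

lemma sk_selfadjoint: "x \<in> C \<Longrightarrow> y \<in> C \<Longrightarrow> hinner H ((s ^^ k) x) y = hinner H x ((s ^^ k) y)"
  by (induction k arbitrary: x y) (simp_all add: s_selfadjoint funpow_swap1)

lemma Rk_s_commute: "x \<in> C \<Longrightarrow> (r ^^ k) (s x) = s ((r ^^ k) x)"
  by (induction k) (simp_all add: Rs_commute)

lemma Rk_sk_commute: "x \<in> C \<Longrightarrow> (r ^^ k) ((s ^^ m) x) = (s ^^ m) ((r ^^ k) x)"
  by (induction m) (simp_all add: Rk_s_commute)

lemma R_sk_commute: "x \<in> C \<Longrightarrow> r ((s ^^ m) x) = (s ^^ m) (r x)"
  using Rk_sk_commute[of x 1 m] by simp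

text \<open>\<open>R (1 - R) = (1 - R) R (1 - R) + R (1 - R) R\<close> is a sum of positive operators.\<close>

lemma monomial_pos_mixed: "x \<in> C \<Longrightarrow> 0 \<le> Re (hinner H (r (s x)) x)"
proof -
  assume x: "x \<in> C"
  have "hinner H (r (s x)) x = hinner H (r (s x)) (r x) + hinner H (r (s x)) (s x)"
    using x by (simp add: s_def)
  moreover have "hinner H (r (s x)) (r x) = hinner H (r x) (r x) - hinner H (r (r x)) (r x)"
    using x by (simp add: Rs_commute) (simp add: s_def)
  ultimately show ?thesis using R_pos[of "s x"] R_le[of "r x"] x by (simp add: r_eq)
qed

text \<open>
  Half of the factors move to the other side of the inner product. What remains between
  them is one of \<open>1\<close>, \<open>R\<close>, \<open>1 - R\<close> and \<open>R (1 - R)\<close>.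
\<close>

lemma monomial_pos:
  assumes x: "x \<in> C" shows "0 \<le> Re (hinner H ((r ^^ k) ((s ^^ m) x)) x)"
proof -
  have half: "l = l div 2 + (l mod 2 + l div 2)" "l mod 2 < 2" for l :: nat by presburger+
  obtain i a where i: "k = i + (a + i)" "a < 2" using half by blast
  obtain j b where j: "m = j + (b + j)" "b < 2" using half by blast
  define y where "y = (r ^^ i) ((s ^^ j) x)"
  have y: "y \<in> C" using x by (simp add: y_def)
  have "(r ^^ k) ((s ^^ m) x) = (r ^^ i) ((s ^^ j) ((r ^^ a) ((s ^^ b) y)))"
    using x by (simp add: y_def i j funpow_add Rk_sk_commute)
  then have "hinner H ((r ^^ k) ((s ^^ m) x)) x = hinner H ((r ^^ a) ((s ^^ b) y)) y"
    using x y by (simp add: Rk_selfadjoint sk_selfadjoint y_def[symmetric]) (simp add: y_def Rk_sk_commute)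
  moreover have "0 \<le> Re (hinner H ((r ^^ a) ((s ^^ b) y)) y)"
  proof -
    have "a = 0 \<or> a = 1" "b = 0 \<or> b = 1" using i j by auto
    then show ?thesis using y R_pos[OF y] R_le[OF y] monomial_pos_mixed[OF y] by (auto simp: s_def r_eq)
  qed
  ultimately show ?thesis by simp
qed

text \<open>
  The Bernstein polynomial of degree \<open>n\<close> and index \<open>k\<close>, applied to \<open>R\<close>, as a sesquilinear
  form.
\<close>

definition bernstein :: "nat \<Rightarrow> nat \<Rightarrow> 'v \<Rightarrow> 'v \<Rightarrow> complex" where
  "bernstein n k x y = of_nat (n choose k) * hinner H ((r ^^ k) ((s ^^ (n - k)) x)) y"

lemma bernstein_total: "x \<in> C \<Longrightarrow> y \<in> C \<Longrightarrow> (\<Sum>k\<le>n. bernstein n k x y) = hinner H x y"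
proof (induction n arbitrary: x)
  case (Suc n)
  have "(\<Sum>k\<le>Suc n. bernstein (Suc n) k x y) = (\<Sum>k\<le>n. bernstein n k (s x) y) + (\<Sum>k\<le>n. bernstein n k (r x) y)"
    unfolding bernstein_def using sum_Pascal[of n "\<lambda>k. hinner H ((r ^^ k) ((s ^^ (Suc n - k)) x)) y"] Suc(2)
    by (simp add: Suc_diff_le funpow_swap1 R_sk_commute del: binomial_Suc_Suc sum.atMost_Suc)
  then show ?case using Suc by (simp add: s_def)
qed (simp add: bernstein_def)

text \<open>
  The factor \<open>k / n\<close> of the falling ratio cancels against the binomial coefficient and
  leaves the weights of degree \<open>n - 1\<close> at the vector \<open>R x\<close>.
\<close>

lemma bernstein_moment:
  "x \<in> C \<Longrightarrow> y \<in> C \<Longrightarrow> j \<le> n \<Longrightarrow>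
     (\<Sum>k\<le>n. of_real (falling_ratio j n k) * bernstein n k x y) = hinner H ((r ^^ j) x) y"
proof (induction j arbitrary: n x)
  case 0
  then show ?case by (simp add: falling_ratio_def bernstein_total)
next
  case (Suc j)
  then obtain m where m: "n = Suc m" "j \<le> m" by (metis Suc_le_D Suc_le_mono)
  have tm: "of_real (falling_ratio (Suc j) (Suc m) (Suc k)) * bernstein (Suc m) (Suc k) x y
     = of_real (falling_ratio j m k) * bernstein m k (r x) y" if "k \<le> m" for k
  proof -
    have "real (Suc k) / real (Suc m) * real (Suc m choose Suc k) = real (m choose k)"
      using Suc_times_binomial[of k m] by (simp add: field_simps del: binomial_Suc_Suc of_nat_Suc flip: of_nat_mult)
    then have "complex_of_real (real (Suc k) / real (Suc m)) * of_nat (Suc m choose Suc k) = of_nat (m choose k)"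
      by (metis of_real_mult of_real_of_nat_eq)
    moreover have "(r ^^ Suc k) ((s ^^ (Suc m - Suc k)) x) = (r ^^ k) ((s ^^ (m - k)) (r x))"
      using Suc(2) by (simp add: funpow_swap1 R_sk_commute)
    moreover have "of_real (falling_ratio (Suc j) (Suc m) (Suc k)) * bernstein (Suc m) (Suc k) x y
       = (complex_of_real (real (Suc k) / real (Suc m)) * of_nat (Suc m choose Suc k))
         * (of_real (falling_ratio j m k) * hinner H ((r ^^ Suc k) ((s ^^ (Suc m - Suc k)) x)) y)"
      unfolding bernstein_def falling_ratio_Suc of_real_mult by (simp only: mult_ac)
    ultimately show ?thesis unfolding bernstein_def by (simp only: mult_ac)
  qed
  have "(\<Sum>k\<le>n. of_real (falling_ratio (Suc j) n k) * bernstein n k x y)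
    = (\<Sum>k\<le>m. of_real (falling_ratio (Suc j) (Suc m) (Suc k)) * bernstein (Suc m) (Suc k) x y)"
    unfolding m by (simp add: sum.atMost_Suc_shift falling_ratio_Suc_0 del: sum.atMost_Suc)
  also have "\<dots> = (\<Sum>k\<le>m. of_real (falling_ratio j m k) * bernstein m k (r x) y)"
    using tm by (intro sum.cong) auto
  also have "\<dots> = hinner H ((r ^^ j) (r x)) y" using Suc m by simp
  finally show ?case by (simp add: funpow_swap1)
qed

lemma inner_Rj_real: "x \<in> C \<Longrightarrow> hinner H ((r ^^ j) x) x = of_real (Re (hinner H ((r ^^ j) x) x))"
  using inner_cnj[of "(r ^^ j) x" x] Rk_selfadjoint[of x x j] by (simp add: complex_eq_iff)

lemma falling_ratio_uniform:
  "(\<lambda>n. real j * (real j / (real (n + 2 * j + 1) - real j))) \<longlonglongrightarrow> 0"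
proof -
  have "(\<lambda>n. real j * (real j / (real n + real (j + 1)))) \<longlonglongrightarrow> real j * 0"
    by (intro tendsto_mult tendsto_const real_tendsto_divide_at_top)
       (auto intro!: filterlim_tendsto_add_at_top filterlim_real_sequentially simp: add.commute[of "real _"])
  then show ?thesis by (simp add: algebra_simps)
qed

lemma unit_moment_measure:
  assumes x: "x \<in> C" and nx: "hnorm H x = 1"
  obtains \<mu> :: "real measure" where "prob_space \<mu>" "sets \<mu> = sets borel" "AE t in \<mu>. t \<in> {0..1}"
    "\<And>j. (LINT t|\<mu>. t ^ j) = Re (hinner H ((r ^^ j) x) x)"
proof -
  \<comment> \<open>degree \<open>Suc n\<close>, so that the nodes \<open>k / Suc n\<close> make sense for all \<open>n\<close>\<close>
  define p where "p n k = Re (bernstein (Suc n) k x x)" for n k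
  have p0: "0 \<le> p n k" for n k using monomial_pos[OF x] by (simp add: p_def bernstein_def)
  have p_sum: "(\<Sum>k\<le>Suc n. p n k) = 1" for n
  proof -
    have "(\<Sum>k\<le>Suc n. p n k) = Re (\<Sum>k\<le>Suc n. bernstein (Suc n) k x x)" by (simp add: p_def)
    then show ?thesis using bernstein_total[OF x x] hnorm_sq[OF x] nx by simp
  qed
  define N where "N n = point_measure {..Suc n} (\<lambda>k. ennreal (p n k))" for n
  define M where "M n = distr (N n) borel (\<lambda>k. real k / real (Suc n))" for n
  have psN: "prob_space (N n)" for n
    unfolding N_def
  proof (rule prob_space_point_measure)
    show "(\<Sum>k\<in>{..Suc n}. ennreal (p n k)) = 1" using p0 p_sum by (simp add: sum_ennreal del: sum.atMost_Suc)
  qed (use p0 in auto)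
  have spN: "space (N n) = {..Suc n}" "sets (N n) = Pow {..Suc n}" for n
    by (simp_all add: N_def space_point_measure sets_point_measure)
  have mN: "f \<in> N n \<rightarrow>\<^sub>M borel" for f :: "nat \<Rightarrow> real" and n
    by (rule measurableI) (auto simp: spN)
  have rdM: "real_distribution (M n)" for n
  proof -
    interpret prob_space "N n" by (rule psN)
    show ?thesis unfolding M_def by (rule real_distribution_distr) (use mN in auto)
  qed
  have intM: "(LINT t|M n. f t) = (\<Sum>k\<le>Suc n. p n k * f (real k / real (Suc n)))" if "f \<in> borel_measurable borel" for f :: "real \<Rightarrow> real" and n
  proof -
    have "(LINT t|M n. f t) = (LINT k|N n. f (real k / real (Suc n)))"
      unfolding M_def by (rule integral_distr) (use mN that in auto)
    also have "\<dots> = (\<Sum>k\<le>Suc n. p n k *\<^sub>R f (real k / real (Suc n)))"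
      unfolding N_def by (rule lebesgue_integral_point_measure_finite) (use p0 in auto)
    finally show ?thesis by simp
  qed
  have tight: "tight M" unfolding tight_def
  proof (intro conjI allI impI rdM)
    fix e :: real assume e: "e > 0"
    have "measure (M n) {-1<..1} = 1" for n
    proof -
      interpret prob_space "N n" by (rule psN)
      have "(\<lambda>k. real k / real (Suc n)) -` {-1<..1} \<inter> space (N n) = space (N n)"
        by (auto simp: spN) (smt (verit) divide_nonneg_pos of_nat_0_le_iff of_nat_0_less_iff zero_less_Suc)
      then show ?thesis unfolding M_def using mN prob_space by (simp add: measure_distr)
    qed
    then show "\<exists>a b. a < b \<and> (\<forall>n. 1 - e < measure (M n) {a<..b})" using e by (intro exI[of _ "-1"] exI[of _ 1]) auto
  qed
  obtain q L where q: "strict_mono (q :: nat \<Rightarrow> nat)" and L: "real_distribution L" and wc: "weak_conv_m (M \<circ> id \<circ> q) L"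
    using tight_imp_convergent_subsubsequence[OF tight strict_mono_id] by blast
  interpret L: real_distribution L by (rule L)
  \<comment> \<open>all nodes lie in \<open>{0..1}\<close>, so this retraction keeps the moments while it makes the powers bounded\<close>
  define cl where "cl t = max 0 (min 1 t)" for t :: real
  have cl: "cl \<in> borel_measurable borel" "cl t \<in> {0..1}" for t unfolding cl_def by auto
  have clm: "cl \<in> L \<rightarrow>\<^sub>M borel" using cl by (simp cong: measurable_cong_sets)
  define \<mu> where "\<mu> = distr L borel cl"
  have mom: "(LINT t|\<mu>. t ^ j) = Re (hinner H ((r ^^ j) x) x)" for j
  proof -
    have e1: "(LINT t|\<mu>. t ^ j) = (LINT t|L. cl t ^ j)"
      unfolding \<mu>_def by (rule integral_distr[OF clm]) simp
    have "(\<lambda>n. LINT t|(M \<circ> id \<circ> q) n. cl t ^ j) \<longlonglongrightarrow> (LINT t|L. cl t ^ j)"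
    proof (rule weak_conv_imp_integral_bdd_continuous_conv[OF _ _ wc])
      show "isCont (\<lambda>t. cl t ^ j) t" for t unfolding cl_def by (intro continuous_intros)
      show "norm (cl t ^ j) \<le> 1" for t using cl(2)[of t] by (simp add: power_abs power_le_one)
    qed (use L rdM in auto)
    then have lim1: "(\<lambda>n. LINT t|M (q n). cl t ^ j) \<longlonglongrightarrow> (LINT t|L. cl t ^ j)" by simp
    define h where "h = Re (hinner H ((r ^^ j) x) x)"
    have est: "\<bar>(LINT t|M n. cl t ^ j) - h\<bar> \<le> real j * (real j / (real (Suc n) - real j))" if n: "2 * j < Suc n" for n
    proof -
      have "(\<Sum>k\<le>Suc n. falling_ratio j (Suc n) k * p n k) = Re (\<Sum>k\<le>Suc n. of_real (falling_ratio j (Suc n) k) * bernstein (Suc n) k x x)"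
        by (simp add: p_def)
      also have "\<dots> = h" using bernstein_moment[OF x x, of j "Suc n"] n by (simp add: h_def)
      finally have hs: "h = (\<Sum>k\<le>Suc n. falling_ratio j (Suc n) k * p n k)" by simp
      have "(LINT t|M n. cl t ^ j) = (\<Sum>k\<le>Suc n. p n k * cl (real k / real (Suc n)) ^ j)"
        using intM[of "\<lambda>t. cl t ^ j" n] cl(1) by simp
      also have "\<dots> = (\<Sum>k\<le>Suc n. p n k * (real k / real (Suc n)) ^ j)"
        by (intro sum.cong refl) (simp add: cl_def)
      finally have "(LINT t|M n. cl t ^ j) - h
          = (\<Sum>k\<le>Suc n. p n k * ((real k / real (Suc n)) ^ j - falling_ratio j (Suc n) k))"
        unfolding hs by (simp add: algebra_simps sum_subtractf del: sum.atMost_Suc)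
      also have "\<bar>\<dots>\<bar> \<le> (\<Sum>k\<le>Suc n. \<bar>p n k * ((real k / real (Suc n)) ^ j - falling_ratio j (Suc n) k)\<bar>)"
        by (rule sum_abs)
      also have "\<dots> \<le> (\<Sum>k\<le>Suc n. p n k * (real j * (real j / (real (Suc n) - real j))))"
      proof (rule sum_mono)
        fix k assume "k \<in> {..Suc n}"
        then have "\<bar>(real k / real (Suc n)) ^ j - falling_ratio j (Suc n) k\<bar> \<le> real j * (real j / (real (Suc n) - real j))"
          using falling_ratio_approx[of k "Suc n" j] n by (simp add: abs_minus_commute)
        then show "\<bar>p n k * ((real k / real (Suc n)) ^ j - falling_ratio j (Suc n) k)\<bar> \<le> p n k * (real j * (real j / (real (Suc n) - real j)))"
          unfolding abs_mult abs_of_nonneg[OF p0] by (rule mult_left_mono[OF _ p0])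
      qed
      also have "\<dots> = real j * (real j / (real (Suc n) - real j))"
        unfolding sum_distrib_right[symmetric] p_sum by simp
      finally show ?thesis .
    qed
    have "(\<lambda>n. (LINT t|M (n + 2 * j). cl t ^ j) - h) \<longlonglongrightarrow> 0"
    proof (rule tendsto_0_le[OF falling_ratio_uniform])
      show "norm ((LINT t|M (n + 2 * j). cl t ^ j) - h) \<le> real j * (real j / (real (n + 2 * j + 1) - real j))" for n
        using est[of "n + 2 * j"] by (simp add: add_ac)
    qed
    then have "(\<lambda>n. LINT t|M (n + 2 * j). cl t ^ j) \<longlonglongrightarrow> h" using LIM_zero_iff by blast
    then have "(\<lambda>n. LINT t|M n. cl t ^ j) \<longlonglongrightarrow> h" by (rule LIMSEQ_offset)
    from LIMSEQ_subseq_LIMSEQ[OF this q] have "(\<lambda>n. LINT t|M (q n). cl t ^ j) \<longlonglongrightarrow> h" by (simp add: o_def)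
    then show ?thesis using LIMSEQ_unique[OF lim1] e1 h_def by simp
  qed
  show thesis
  proof (rule that[of \<mu>])
    show "prob_space \<mu>" unfolding \<mu>_def by (rule L.prob_space_distr[OF clm])
    show "sets \<mu> = sets borel" by (simp add: \<mu>_def)
    show "AE t in \<mu>. t \<in> {0..1}" unfolding \<mu>_def using cl(2) by (subst AE_distr_iff[OF clm]) auto
  qed (rule mom)
qed

lemma moment_measure:
  assumes x: "x \<in> C"
  shows "\<exists>\<mu> :: real measure. finite_measure \<mu> \<and> sets \<mu> = sets borel \<and> (AE t in \<mu>. t \<in> {0..1}) \<and>
    (\<forall>j. (LINT t|\<mu>. t ^ j) = Re (hinner H ((r ^^ j) x) x))"
proof (cases "x = hzero H")
  case True
  have "(r ^^ j) (hzero H) = hzero H" for j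
    by (induction j) (simp_all add: r_def bounded_opsD(8)[OF R_bounded])
  then show ?thesis using True
    by (intro exI[of _ "null_measure borel"])
      (auto intro!: finite_measureI AE_I[of _ _ UNIV] simp: integral_null_measure)
next
  case False
  define c where "c = hnorm H x"
  have c: "c > 0" using False x hnorm_eq_0[OF x] hnorm_ge[OF x] by (simp add: c_def less_le)
  define u where "u = hscale H (complex_of_real (1 / c)) x"
  have u: "u \<in> C" "hnorm H u = 1" using x c by (auto simp: u_def c_def[symmetric] norm_divide)
  have "(r ^^ j) u = hscale H (complex_of_real (1 / c)) ((r ^^ j) x)" for j
    using x by (induction j) (simp_all add: u_def r_def bounded_opsD(6)[OF R_bounded] Rk_closed[unfolded r_def])
  then have uj: "hinner H ((r ^^ j) u) u = of_real (1 / c\<^sup>2) * hinner H ((r ^^ j) x) x" for j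
    using x by (simp add: u_def power2_eq_square)
  obtain \<mu> where m: "prob_space \<mu>" "sets \<mu> = sets borel" "AE t in \<mu>. t \<in> {0..1}"
    "\<And>j. (LINT t|\<mu>. t ^ j) = Re (hinner H ((r ^^ j) u) u)" using unit_moment_measure[OF u] by metis
  interpret prob_space \<mu> by (rule m)
  define \<nu> where "\<nu> = density \<mu> (\<lambda>t. ennreal (c\<^sup>2))"
  have "finite_measure \<nu>"
    by (rule finite_measureI) (simp add: \<nu>_def emeasure_density emeasure_space_1 ennreal_mult_less_top less_top[symmetric])
  moreover have "AE t in \<nu>. t \<in> {0..1}" unfolding \<nu>_def by (subst AE_density) (use m(3) in auto)
  moreover have "(LINT t|\<nu>. t ^ j) = Re (hinner H ((r ^^ j) x) x)" for j
  proof -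
    have "(\<lambda>t. t ^ j) \<in> borel_measurable \<mu>" by (simp add: m(2) cong: measurable_cong_sets)
    then have "(LINT t|\<nu>. t ^ j) = (LINT t|\<mu>. c\<^sup>2 * t ^ j)"
      unfolding \<nu>_def by (subst integral_density) auto
    then show ?thesis using c by (simp add: m(4) uj)
  qed
  ultimately show ?thesis using m(2) by (intro exI[of _ \<nu>]) (auto simp: \<nu>_def)
qed

end

section \<open>Borel functional calculus\<close>

lemma cmod_four: "cmod (a - b + \<i> * c - \<i> * d) \<le> cmod a + cmod b + cmod c + cmod d"
proof -
  have "cmod (a - b + \<i> * c - \<i> * d) \<le> cmod (a - b + \<i> * c) + cmod (\<i> * d)" by (rule norm_triangle_ineq4)
  moreover have "cmod (a - b + \<i> * c) \<le> cmod (a - b) + cmod (\<i> * c)" by (rule norm_triangle_ineq)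
  moreover have "cmod (a - b) \<le> cmod a + cmod b" by (rule norm_triangle_ineq4)
  ultimately show ?thesis by (simp add: norm_mult)
qed

context hilbert_space
begin

lemma quadratic_form_eq:
  assumes A: "A \<in> bounded_ops H" and B: "B \<in> bounded_ops H"
    and eq: "\<And>x. x \<in> C \<Longrightarrow> hinner H (ap A x) x = hinner H (ap B x) x"
  shows "A = B"
proof (rule op_eqI[OF A B])
  fix x assume x: "x \<in> C"
  show "ap A x = ap B x"
  proof (rule inner_ext)
    fix y assume y: "y \<in> C"
    have "4 * hinner H (ap A x) y = 4 * hinner H (ap B x) y"
      using polarization[OF bounded_opsD(1)[OF A], of x y] polarization[OF bounded_opsD(1)[OF B], of x y]
      by (simp add: x y bounded_opsD(2)[OF A] bounded_opsD(2)[OF B] eq)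
    then show "hinner H (ap A x) y = hinner H (ap B x) y" by simp
  qed (use x A B bounded_opsD(4) in auto)
qed

text \<open>Polarization at unit vectors: the four squared norms add up to eight.\<close>

lemma form_bound:
  assumes A: "A \<in> bounded_ops H" and K: "\<And>x. x \<in> C \<Longrightarrow> cmod (hinner H (ap A x) x) \<le> K * (hnorm H x)\<^sup>2"
    and x: "x \<in> C" and y: "y \<in> C"
  shows "cmod (hinner H (ap A x) y) \<le> 2 * K * hnorm H x * hnorm H y"
proof (cases "hnorm H x = 0 \<or> hnorm H y = 0")
  case True
  then have "x = hzero H \<or> y = hzero H" using hnorm_eq_0 x y by blast
  then show ?thesis using x y bounded_opsD(4)[OF A x] bounded_opsD(8)[OF A] by (elim disjE) simp_all
next
  case False
  note a = bounded_opsD[OF A]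
  have unit: "cmod (hinner H (ap A u) v) \<le> 2 * K" if u: "u \<in> C" "hnorm H u = 1" and v: "v \<in> C" "hnorm H v = 1" for u v
  proof -
    define q where "q c = hadd H u (hscale H c v)" for c
    have q: "q c \<in> C" for c using u v by (simp add: q_def)
    let ?Q = "\<lambda>c. hinner H (ap A (q c)) (q c)"
    have "4 * hinner H (ap A u) v = ?Q 1 - ?Q (-1) + \<i> * ?Q \<i> - \<i> * ?Q (-\<i>)"
      using polarization[OF a(1), of u v] u v by (simp add: a(2) q_def scale_one)
    then have "4 * cmod (hinner H (ap A u) v) = cmod (?Q 1 - ?Q (-1) + \<i> * ?Q \<i> - \<i> * ?Q (-\<i>))"
      by (metis norm_mult norm_numeral)
    also have "\<dots> \<le> cmod (?Q 1) + cmod (?Q (-1)) + cmod (?Q \<i>) + cmod (?Q (-\<i>))"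
      by (rule cmod_four)
    also have "\<dots> \<le> K * (hnorm H (q 1))\<^sup>2 + K * (hnorm H (q (-1)))\<^sup>2 + K * (hnorm H (q \<i>))\<^sup>2 + K * (hnorm H (q (-\<i>)))\<^sup>2"
      using K q by (intro add_mono) auto
    also have "\<dots> = K * ((hnorm H (q 1))\<^sup>2 + (hnorm H (q (-1)))\<^sup>2 + (hnorm H (q \<i>))\<^sup>2 + (hnorm H (q (-\<i>)))\<^sup>2)"
      by (simp add: algebra_simps)
    also have "(hnorm H (q 1))\<^sup>2 + (hnorm H (q (-1)))\<^sup>2 + (hnorm H (q \<i>))\<^sup>2 + (hnorm H (q (-\<i>)))\<^sup>2
       = 4 * (hnorm H u)\<^sup>2 + 4 * (hnorm H v)\<^sup>2"
      using u(1) v(1) by (simp add: hnorm_sq q) (simp add: q_def algebra_simps)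
    finally show ?thesis using u v by simp
  qed
  have p: "hnorm H x > 0" "hnorm H y > 0" using False hnorm_ge[OF x] hnorm_ge[OF y] by auto
  have "cmod (hinner H (ap A (hscale H (complex_of_real (1/hnorm H x)) x)) (hscale H (complex_of_real (1/hnorm H y)) y)) \<le> 2 * K"
    by (rule unit) (use x y p in \<open>auto simp: norm_divide\<close>)
  then show ?thesis using x y p by (simp add: a(4,6) norm_mult norm_divide field_simps)
qed

text \<open>
  By polarization the sesquilinear forms converge as well, and the limit is a bounded
  form.
\<close>

lemma weak_limit_operator:
  assumes A: "\<And>n. A n \<in> bounded_ops H"
    and conv: "\<And>x. x \<in> C \<Longrightarrow> (\<lambda>n. hinner H (ap (A n) x) x) \<longlonglongrightarrow> q x"
    and K: "\<And>n x. x \<in> C \<Longrightarrow> cmod (hinner H (ap (A n) x) x) \<le> K * (hnorm H x)\<^sup>2"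
  obtains B where "B \<in> bounded_ops H" "\<And>x y. x \<in> C \<Longrightarrow> y \<in> C \<Longrightarrow> (\<lambda>n. hinner H (ap (A n) x) y) \<longlonglongrightarrow> hinner H (ap B x) y"
proof -
  note a = bounded_opsD[OF A]
  define b where "b x y = (q (hadd H x y) - q (hadd H x (hscale H (-1) y))
      + \<i> * q (hadd H x (hscale H \<i> y)) - \<i> * q (hadd H x (hscale H (-\<i>) y))) / 4" for x y
  have lim: "(\<lambda>n. hinner H (ap (A n) x) y) \<longlonglongrightarrow> b x y" if xy: "x \<in> C" "y \<in> C" for x y
  proof -
    have eq: "hinner H (ap (A n) x) y = (hinner H (ap (A n) (hadd H x y)) (hadd H x y)
      - hinner H (ap (A n) (hadd H x (hscale H (-1) y))) (hadd H x (hscale H (-1) y))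
      + \<i> * hinner H (ap (A n) (hadd H x (hscale H \<i> y))) (hadd H x (hscale H \<i> y))
      - \<i> * hinner H (ap (A n) (hadd H x (hscale H (-\<i>) y))) (hadd H x (hscale H (-\<i>) y))) / 4" for n
      using polarization[OF a(1), of x n y, unfolded a(2)] xy by (subst eq_divide_eq) (simp add: mult.commute)
    show ?thesis unfolding b_def by (subst eq) (intro tendsto_intros conv; use xy in simp)
  qed
  have uniq: "b x y = c" if "x \<in> C" "y \<in> C" "(\<lambda>n. hinner H (ap (A n) x) y) \<longlonglongrightarrow> c" for x y c
    using lim LIMSEQ_unique that by blast
  obtain B where "B \<in> bounded_ops H" "\<And>x y. \<lbrakk>x \<in> C; y \<in> C\<rbrakk> \<Longrightarrow> hinner H (ap B x) y = b x y"
  proof (rule form_operator[of b "2 * K"])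
    fix x y z assume c: "x \<in> C" "y \<in> C" "z \<in> C"
    show "b (hadd H x y) z = b x z + b y z"
      by (rule uniq) (use c tendsto_add[OF lim[OF c(1,3)] lim[OF c(2,3)]] in \<open>simp_all add: a(4,5)\<close>)
    show "b z (hadd H x y) = b z x + b z y"
      by (rule uniq) (use c tendsto_add[OF lim[OF c(3,1)] lim[OF c(3,2)]] in \<open>simp_all add: a(4)\<close>)
  next
    fix k x z assume c: "x \<in> C" "z \<in> C"
    show "b (hscale H k x) z = k * b x z"
      by (rule uniq) (use c tendsto_mult_left[OF lim[OF c]] in \<open>simp_all add: a(4,6)\<close>)
    show "b z (hscale H k x) = cnj k * b z x"
      by (rule uniq) (use c tendsto_mult_left[OF lim[OF c(2,1)]] in \<open>simp_all add: a(4)\<close>)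
  next
    fix x y assume c: "x \<in> C" "y \<in> C"
    show "cmod (b x y) \<le> 2 * K * hnorm H x * hnorm H y"
      by (rule LIMSEQ_le_const2[OF tendsto_norm[OF lim[OF c]]]) (use form_bound[OF A K c] in auto)
  qed blast
  then show thesis using that[of B] lim by simp
qed

end

context unit_selfadjoint
begin

text \<open>The spectral measure of \<open>R\<close> at \<open>x\<close>.\<close>

definition mu :: "'v \<Rightarrow> real measure" where
  "mu x = (SOME \<mu>. finite_measure \<mu> \<and> sets \<mu> = sets borel \<and> (AE t in \<mu>. t \<in> {0..1}) \<and>
    (\<forall>j. (LINT t|\<mu>. t ^ j) = Re (hinner H ((r ^^ j) x) x)))"

lemma mu_props:
  assumes "x \<in> C"
  shows "finite_measure (mu x)" "sets (mu x) = sets borel" "AE t in mu x. t \<in> {0..1}"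
    "(LINT t|mu x. t ^ j) = Re (hinner H ((r ^^ j) x) x)"
  using someI_ex[OF moment_measure[OF assms]] unfolding mu_def[symmetric] by auto

lemma mu_space: "x \<in> C \<Longrightarrow> space (mu x) = UNIV"
  using sets_eq_imp_space_eq[OF mu_props(2)[of x]] by simp

lemma mu_mass: "x \<in> C \<Longrightarrow> measure (mu x) UNIV = (hnorm H x)\<^sup>2"
  using mu_props(4)[of x 0] mu_space[of x] by (simp add: hnorm_sq)

text \<open>
  The measures \<open>mu x\<close> live on the unit interval, so bounds are asked for only there.
\<close>

definition bdd :: "(real \<Rightarrow> real) \<Rightarrow> bool" where
  "bdd f \<longleftrightarrow> f \<in> borel_measurable borel \<and> (\<exists>K. \<forall>t\<in>{0..1}. \<bar>f t\<bar> \<le> K)"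

lemma bddI: "f \<in> borel_measurable borel \<Longrightarrow> (\<And>t. t \<in> {0..1} \<Longrightarrow> \<bar>f t\<bar> \<le> K) \<Longrightarrow> bdd f"
  unfolding bdd_def by blast

lemma bdd_bound: assumes "bdd f" obtains K where "\<And>t. t \<in> {0..1} \<Longrightarrow> \<bar>f t\<bar> \<le> K"
  using assms unfolding bdd_def by blast

lemma bdd_meas: "bdd f \<Longrightarrow> f \<in> borel_measurable borel" by (simp add: bdd_def)

lemma bdd_meas_mu: "bdd f \<Longrightarrow> x \<in> C \<Longrightarrow> f \<in> borel_measurable (mu x)"
  using bdd_meas mu_props(2)[of x] measurable_cong_sets by blast

lemma bdd_lin: assumes "bdd f" "bdd g" shows "bdd (\<lambda>t. a * f t + b * g t)"
proof -
  obtain K where K: "\<And>t. t \<in> {0..1} \<Longrightarrow> \<bar>f t\<bar> \<le> K" using bdd_bound[OF assms(1)] by blast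
  obtain L where L: "\<And>t. t \<in> {0..1} \<Longrightarrow> \<bar>g t\<bar> \<le> L" using bdd_bound[OF assms(2)] by blast
  note * = K L
  show ?thesis
  proof (rule bddI)
    show "(\<lambda>t. a * f t + b * g t) \<in> borel_measurable borel" using assms[THEN bdd_meas] by measurable
    fix t :: real assume t: "t \<in> {0..1}"
    have "\<bar>a * f t + b * g t\<bar> \<le> \<bar>a\<bar> * \<bar>f t\<bar> + \<bar>b\<bar> * \<bar>g t\<bar>"
      using abs_triangle_ineq[of "a * f t" "b * g t"] by (simp add: abs_mult)
    also have "\<dots> \<le> \<bar>a\<bar> * K + \<bar>b\<bar> * L" using *[OF t] by (intro add_mono mult_left_mono) auto
    finally show "\<bar>a * f t + b * g t\<bar> \<le> \<bar>a\<bar> * K + \<bar>b\<bar> * L" .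
  qed
qed

lemma bdd_mult: assumes "bdd f" "bdd g" shows "bdd (\<lambda>t. f t * g t)"
proof -
  obtain K where K: "\<And>t. t \<in> {0..1} \<Longrightarrow> \<bar>f t\<bar> \<le> K" using bdd_bound[OF assms(1)] by blast
  obtain L where L: "\<And>t. t \<in> {0..1} \<Longrightarrow> \<bar>g t\<bar> \<le> L" using bdd_bound[OF assms(2)] by blast
  note * = K L
  show ?thesis
  proof (rule bddI)
    show "(\<lambda>t. f t * g t) \<in> borel_measurable borel" using assms[THEN bdd_meas] by measurable
    fix t :: real assume t: "t \<in> {0..1}"
    have "0 \<le> K" using *(1)[OF t] by linarith
    then show "\<bar>f t * g t\<bar> \<le> K * L" unfolding abs_mult using *[OF t] by (intro mult_mono) auto
  qed
qed

lemma bdd_power [simp]: "bdd (\<lambda>t. t ^ j)"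
  by (rule bddI[of _ 1]) (auto simp: power_abs power_le_one)

lemma bdd_id [simp]: "bdd (\<lambda>t. t)" using bdd_power[of 1] by simp
lemma bdd_const [simp]: "bdd (\<lambda>t. c)" by (rule bddI[of _ "\<bar>c\<bar>"]) auto
lemma bdd_indicator [simp]: "B \<in> sets borel \<Longrightarrow> bdd (indicator B)"
  by (rule bddI[of _ 1]) (auto simp: indicator_def)

lemma bdd_integrable: assumes "bdd f" "x \<in> C" shows "integrable (mu x) f"
proof -
  obtain K where K: "\<And>t. t \<in> {0..1} \<Longrightarrow> \<bar>f t\<bar> \<le> K" using bdd_bound[OF assms(1)] by blast
  interpret finite_measure "mu x" using mu_props[OF assms(2)] by simp
  show ?thesis
    by (rule integrable_const_bound[of _ K]) (use mu_props(3)[OF assms(2)] K bdd_meas_mu assms in auto)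
qed

lemma integral_mu_bound:
  assumes "bdd f" "x \<in> C" "\<And>t. t \<in> {0..1} \<Longrightarrow> \<bar>f t\<bar> \<le> K"
  shows "\<bar>LINT t|mu x. f t\<bar> \<le> K * (hnorm H x)\<^sup>2"
proof -
  interpret finite_measure "mu x" using mu_props[OF assms(2)] by simp
  have "\<bar>LINT t|mu x. f t\<bar> \<le> (LINT t|mu x. \<bar>f t\<bar>)" by (rule integral_abs_bound)
  also have "\<dots> \<le> (LINT t|mu x. K)"
    by (rule integral_mono_AE) (use bdd_integrable[OF assms(1,2)] mu_props(3)[OF assms(2)] assms(3) in auto)
  also have "\<dots> = K * (hnorm H x)\<^sup>2" using assms(2) by (simp add: mu_space mu_mass)
  finally show ?thesis .
qed

lemma integral_mu_limit:
  assumes "\<And>n. bdd (f n)" "g \<in> borel_measurable borel" "\<And>n t. t \<in> {0..1} \<Longrightarrow> \<bar>f n t\<bar> \<le> K"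
    "\<And>t. t \<in> {0..1} \<Longrightarrow> (\<lambda>n. f n t) \<longlonglongrightarrow> g t" "x \<in> C"
  shows "(\<lambda>n. LINT t|mu x. f n t) \<longlonglongrightarrow> (LINT t|mu x. g t)"
proof (rule integral_dominated_convergence[where w = "\<lambda>t. K"])
  interpret finite_measure "mu x" using mu_props[OF assms(5)] by simp
  show "integrable (mu x) (\<lambda>t. K)" by simp
  show "g \<in> borel_measurable (mu x)" using assms(2) mu_props(2)[OF assms(5)] measurable_cong_sets by blast
  show "f n \<in> borel_measurable (mu x)" for n using bdd_meas_mu assms by blast
  show "AE t in mu x. (\<lambda>n. f n t) \<longlonglongrightarrow> g t" using mu_props(3)[OF assms(5)] assms(4) by auto
  show "AE t in mu x. norm (f n t) \<le> K" for n using mu_props(3)[OF assms(5)] assms(3) by auto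
qed

definition represents :: "'v operator \<Rightarrow> (real \<Rightarrow> real) \<Rightarrow> bool" where
  "represents A f \<longleftrightarrow> A \<in> bounded_ops H \<and> (\<forall>x\<in>C. hinner H (ap A x) x = complex_of_real (LINT t|mu x. f t))"

lemma represents_unique: "represents A f \<Longrightarrow> represents B f \<Longrightarrow> A = B"
  unfolding represents_def by (intro quadratic_form_eq) auto

lemma represents_limit:
  assumes A: "\<And>n. represents (A n) (f n)" and bdd: "\<And>n. bdd (f n)" and g: "g \<in> borel_measurable borel"
    and K: "\<And>n t. t \<in> {0..1} \<Longrightarrow> \<bar>f n t\<bar> \<le> K" and lim: "\<And>t. t \<in> {0..1} \<Longrightarrow> (\<lambda>n. f n t) \<longlonglongrightarrow> g t"
  obtains B where "represents B g" "\<And>x y. x \<in> C \<Longrightarrow> y \<in> C \<Longrightarrow> (\<lambda>n. hinner H (ap (A n) x) y) \<longlonglongrightarrow> hinner H (ap B x) y"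
proof -
  have Ab: "A n \<in> bounded_ops H" for n using A by (simp add: represents_def)
  have Aq: "hinner H (ap (A n) x) x = complex_of_real (LINT t|mu x. f n t)" if "x \<in> C" for n x
    using A that by (simp add: represents_def)
  have conv: "(\<lambda>n. hinner H (ap (A n) x) x) \<longlonglongrightarrow> complex_of_real (LINT t|mu x. g t)" if "x \<in> C" for x
    unfolding Aq[OF that] by (intro tendsto_of_real integral_mu_limit[OF bdd g K lim that])
  have bound: "cmod (hinner H (ap (A n) x) x) \<le> K * (hnorm H x)\<^sup>2" if "x \<in> C" for n x
    unfolding Aq[OF that] using integral_mu_bound[OF bdd that K] by simp
  obtain B where B: "B \<in> bounded_ops H" "\<And>x y. x \<in> C \<Longrightarrow> y \<in> C \<Longrightarrow> (\<lambda>n. hinner H (ap (A n) x) y) \<longlonglongrightarrow> hinner H (ap B x) y"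
    using weak_limit_operator[of A "\<lambda>x. complex_of_real (LINT t|mu x. g t)" K] Ab conv bound by metis
  have "represents B g" unfolding represents_def using B LIMSEQ_unique conv by blast
  then show thesis using that B by blast
qed

lemma bounded_power: "mk_op H (r ^^ j) \<in> bounded_ops H"
proof (induction j)
  case 0
  show ?case by (rule mk_op_bounded[where k = 1]) auto
next
  case (Suc j)
  have "R \<circ>\<^sub>m mk_op H (r ^^ j) = mk_op H (r ^^ Suc j)"
    using bounded_opsD(3)[OF R_bounded] by (auto simp: mk_op_def map_comp_def fun_eq_iff r_def Rk_closed[unfolded r_def])
  then show ?case using comp_bounded[OF R_bounded Suc] by (simp only:)
qed

lemma represents_power: "represents (mk_op H (r ^^ j)) (\<lambda>t. t ^ j)"
  unfolding represents_def using bounded_power mu_props(4) inner_Rj_real by auto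

lemma represents_lin:
  assumes "represents A f" "represents B g" "bdd f" "bdd g"
  shows "represents (op_lin H (of_real a) A (of_real b) B) (\<lambda>t. a * f t + b * g t)"
proof -
  have AB: "A \<in> bounded_ops H" "B \<in> bounded_ops H" using assms by (auto simp: represents_def)
  show ?thesis using assms bounded_opsD(4)[OF AB(1)] bounded_opsD(4)[OF AB(2)] op_lin_bounded[OF AB] bdd_integrable
    unfolding represents_def by (simp add: Bochner_Integration.integral_add)
qed

text \<open>The Borel functional calculus of \<open>R\<close>.\<close>

definition Phi :: "(real \<Rightarrow> real) \<Rightarrow> 'v operator" where
  "Phi f = (THE A. represents A f)"

text \<open>
  Powers are represented by powers of \<open>R\<close>, and the represented functions are closed under
  linear combinations and under bounded pointwise limits.
\<close>

lemma represents_exists: assumes "bdd f" shows "\<exists>A. represents A f"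
proof -
  have "f \<in> borel_measurable borel" using bdd_meas[OF assms] .
  moreover obtain K where "\<And>t. t \<in> {0..1} \<Longrightarrow> \<bar>f t\<bar> \<le> K" using bdd_bound[OF assms] by blast
  ultimately have K: "f \<in> borel_measurable borel" "\<And>t. t \<in> {0..1} \<Longrightarrow> \<bar>f t\<bar> \<le> K" by blast+
  have "bdd f \<and> (\<exists>A. represents A f)"
  proof (rule bounded_borel_induct[of "\<lambda>f. bdd f \<and> (\<exists>A. represents A f)" f K])
    show "bdd (\<lambda>t. t ^ j) \<and> (\<exists>A. represents A (\<lambda>t. t ^ j))" for j using represents_power by auto
    fix f g :: "real \<Rightarrow> real" and a b assume "bdd f \<and> (\<exists>A. represents A f)" "bdd g \<and> (\<exists>A. represents A g)"
    then show "bdd (\<lambda>t. a * f t + b * g t) \<and> (\<exists>A. represents A (\<lambda>t. a * f t + b * g t))"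
      using represents_lin bdd_lin by blast
  next
    fix f g and K :: real
    assume *: "\<And>n. bdd (f n) \<and> (\<exists>A. represents A (f n))" "g \<in> borel_measurable borel"
      "\<And>n t. t \<in> {0..1} \<Longrightarrow> \<bar>f n t\<bar> \<le> K" "\<And>t. t \<in> {0..1} \<Longrightarrow> (\<lambda>n. f n t) \<longlonglongrightarrow> g t"
    then obtain A where A: "\<And>n. represents (A n) (f n)" by metis
    have "bdd g"
    proof (rule bddI[OF *(2)])
      fix t :: real assume t: "t \<in> {0..1}"
      show "\<bar>g t\<bar> \<le> K" by (rule LIMSEQ_le_const2[OF tendsto_rabs[OF *(4)[OF t]]]) (use *(3)[OF t] in auto)
    qed
    moreover obtain B where "represents B g"
      using represents_limit[of A f g K] A *(1,2,3,4) by metis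
    ultimately show "bdd g \<and> (\<exists>A. represents A g)" by blast
  qed (use K in auto)
  then show ?thesis by blast
qed

lemma Phi_represents: "bdd f \<Longrightarrow> represents (Phi f) f"
  unfolding Phi_def using represents_exists represents_unique by (metis theI)

lemma Phi_eqI: "bdd f \<Longrightarrow> represents A f \<Longrightarrow> Phi f = A"
  using Phi_represents represents_unique by blast

lemma Phi_bounded: "bdd f \<Longrightarrow> Phi f \<in> bounded_ops H"
  using Phi_represents by (simp add: represents_def)

lemma Phi_closed [simp]: "bdd f \<Longrightarrow> x \<in> C \<Longrightarrow> ap (Phi f) x \<in> C"
  using Phi_bounded bounded_opsD(4) by blast

lemma Phi_quad: "bdd f \<Longrightarrow> x \<in> C \<Longrightarrow> hinner H (ap (Phi f) x) x = complex_of_real (LINT t|mu x. f t)"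
  using Phi_represents by (simp add: represents_def)

lemma Phi_power: "x \<in> C \<Longrightarrow> ap (Phi (\<lambda>t. t ^ j)) x = (r ^^ j) x"
  using Phi_eqI[OF bdd_power represents_power] by simp

lemma Phi_R: "Phi (\<lambda>t. t) = R"
  by (rule op_eqI[OF Phi_bounded R_bounded]) (use Phi_power[of _ 1] in \<open>simp_all add: r_def\<close>)

lemma Phi_one: "x \<in> C \<Longrightarrow> ap (Phi (\<lambda>t. 1)) x = x"
  using Phi_power[of x 0] by simp

lemma Phi_lin:
  assumes "bdd f" "bdd g" "x \<in> C"
  shows "ap (Phi (\<lambda>t. a * f t + b * g t)) x = hadd H (hscale H (of_real a) (ap (Phi f) x)) (hscale H (of_real b) (ap (Phi g) x))"
  using Phi_eqI[OF bdd_lin[OF assms(1,2)] represents_lin[OF Phi_represents Phi_represents]] assms by simp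

lemma Phi_limit:
  assumes "\<And>n. bdd (f n)" "g \<in> borel_measurable borel" "\<And>n t. t \<in> {0..1} \<Longrightarrow> \<bar>f n t\<bar> \<le> K"
    "\<And>t. t \<in> {0..1} \<Longrightarrow> (\<lambda>n. f n t) \<longlonglongrightarrow> g t"
  shows "bdd g" "x \<in> C \<Longrightarrow> y \<in> C \<Longrightarrow> (\<lambda>n. hinner H (ap (Phi (f n)) x) y) \<longlonglongrightarrow> hinner H (ap (Phi g) x) y"
proof -
  show bg: "bdd g"
  proof (rule bddI[OF assms(2)])
    fix t :: real assume t: "t \<in> {0..1}"
    show "\<bar>g t\<bar> \<le> K" by (rule LIMSEQ_le_const2[OF tendsto_rabs[OF assms(4)[OF t]]]) (use assms(3)[OF t] in auto)
  qed
  obtain B where B: "represents B g" "\<And>x y. x \<in> C \<Longrightarrow> y \<in> C \<Longrightarrow> (\<lambda>n. hinner H (ap (Phi (f n)) x) y) \<longlonglongrightarrow> hinner H (ap B x) y"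
    using represents_limit[of "\<lambda>n. Phi (f n)" f g K] Phi_represents assms by metis
  then show "x \<in> C \<Longrightarrow> y \<in> C \<Longrightarrow> (\<lambda>n. hinner H (ap (Phi (f n)) x) y) \<longlonglongrightarrow> hinner H (ap (Phi g) x) y"
    using Phi_eqI[OF bg B(1)] by simp
qed

lemma Phi_selfadjoint:
  assumes f: "bdd f" and x: "x \<in> C" and y: "y \<in> C"
  shows "hinner H (ap (Phi f) x) y = hinner H x (ap (Phi f) y)"
proof -
  note a = adjoint_bounded[OF Phi_bounded[OF f]]
  have "op_adjoint H (Phi f) = Phi f"
  proof (rule quadratic_form_eq[OF a(1) Phi_bounded[OF f]])
    fix z assume z: "z \<in> C"
    have "hinner H (ap (op_adjoint H (Phi f)) z) z = cnj (hinner H z (ap (op_adjoint H (Phi f)) z))"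
      by (rule inner_cnj) (use z a bounded_opsD(4) in auto)
    also have "\<dots> = cnj (complex_of_real (LINT t|mu z. f t))" unfolding a(2)[OF z z, symmetric] Phi_quad[OF f z] ..
    also have "\<dots> = hinner H (ap (Phi f) z) z" using Phi_quad[OF f z] by simp
    finally show "hinner H (ap (op_adjoint H (Phi f)) z) z = hinner H (ap (Phi f) z) z" .
  qed
  then show ?thesis using a(2)[OF x y] by simp
qed

lemma bdd_induct[consumes 1, case_names power lin lim]:
  assumes h: "bdd h"
    and power: "\<And>j. P (\<lambda>t. t ^ j)"
    and lin: "\<And>f g a b. bdd f \<Longrightarrow> bdd g \<Longrightarrow> P f \<Longrightarrow> P g \<Longrightarrow> P (\<lambda>t. a * f t + b * g t)"
    and lim: "\<And>f g K. (\<And>n. bdd (f n)) \<Longrightarrow> (\<And>n. P (f n)) \<Longrightarrow> bdd g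
       \<Longrightarrow> (\<And>n t. t \<in> {0..1} \<Longrightarrow> \<bar>f n t\<bar> \<le> K) \<Longrightarrow> (\<And>t. t \<in> {0..1} \<Longrightarrow> (\<lambda>n. f n t) \<longlonglongrightarrow> g t) \<Longrightarrow> P g"
  shows "P h"
proof -
  have "h \<in> borel_measurable borel" using bdd_meas[OF h] .
  moreover obtain K where "\<And>t. t \<in> {0..1} \<Longrightarrow> \<bar>h t\<bar> \<le> K" using bdd_bound[OF h] by blast
  ultimately have K: "h \<in> borel_measurable borel" "\<And>t. t \<in> {0..1} \<Longrightarrow> \<bar>h t\<bar> \<le> K" by blast+
  have "bdd h \<and> P h"
  proof (rule bounded_borel_induct[of "\<lambda>h. bdd h \<and> P h" h K])
    fix f g and K :: real
    assume *: "\<And>n. bdd (f n) \<and> P (f n)" "g \<in> borel_measurable borel"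
      "\<And>n t. t \<in> {0..1} \<Longrightarrow> \<bar>f n t\<bar> \<le> K" "\<And>t. t \<in> {0..1} \<Longrightarrow> (\<lambda>n. f n t) \<longlonglongrightarrow> g t"
    have "bdd g" by (rule Phi_limit(1)[of f g K]) (use * in auto)
    then show "bdd g \<and> P g" using lim[of f g K] * by blast
  qed (use K power lin bdd_lin in auto)
  then show ?thesis by blast
qed

lemma Phi_mult_power:
  assumes "bdd f" "x \<in> C" "y \<in> C"
  shows "hinner H (ap (Phi (\<lambda>t. f t * t ^ j)) x) y = hinner H (ap (Phi f) ((r ^^ j) x)) y"
  using assms
proof (induction f rule: bdd_induct)
  case (power i)
  then show ?case using Phi_power[of x "i + j"] Phi_power[of "(r ^^ j) x" i] by (simp add: power_add funpow_add)
next
  case (lin f g a b)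
  have "(\<lambda>t. (a * f t + b * g t) * t ^ j) = (\<lambda>t. a * (f t * t ^ j) + b * (g t * t ^ j))"
    by (auto simp: algebra_simps)
  then show ?case using lin by (simp add: Phi_lin bdd_mult)
next
  case (lim f g K)
  have "(\<lambda>n. hinner H (ap (Phi (\<lambda>t. f n t * t ^ j)) x) y) \<longlonglongrightarrow> hinner H (ap (Phi (\<lambda>t. g t * t ^ j)) x) y"
  proof (rule Phi_limit(2)[where K = K])
    fix n and t :: real assume t: "t \<in> {0..1}"
    have "\<bar>f n t\<bar> * \<bar>t ^ j\<bar> \<le> K * 1" using lim.hyps(3)[OF t, of n] t
      by (intro mult_mono) (auto simp: power_abs power_le_one intro: order_trans[OF abs_ge_zero])
    then show "\<bar>f n t * t ^ j\<bar> \<le> K" by (simp add: abs_mult)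
  qed (use lim bdd_mult bdd_meas in \<open>auto intro!: tendsto_mult\<close>)
  moreover have "(\<lambda>n. hinner H (ap (Phi (f n)) ((r ^^ j) x)) y) \<longlonglongrightarrow> hinner H (ap (Phi g) ((r ^^ j) x)) y"
    by (rule Phi_limit(2)[where K = K]) (use lim bdd_meas in auto)
  ultimately show ?case using lim LIMSEQ_unique by simp
qed

text \<open>
  Multiplicativity extends from powers to bounded Borel functions in one factor at a time.
  The factor that is fixed during a limit is moved to the other side of the inner product,
  so that weak limits suffice.
\<close>

lemma Phi_mult:
  assumes f: "bdd f" and g: "bdd g" and x: "x \<in> C"
  shows "ap (Phi (\<lambda>t. f t * g t)) x = ap (Phi f) (ap (Phi g) x)"
proof (rule inner_ext)
  fix y assume y: "y \<in> C"
  from g x y show "hinner H (ap (Phi (\<lambda>t. f t * g t)) x) y = hinner H (ap (Phi f) (ap (Phi g) x)) y"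
  proof (induction g rule: bdd_induct)
    case (power j)
    then show ?case using Phi_mult_power[OF f] Phi_power by simp
  next
    case (lin g h a b)
    have "(\<lambda>t. f t * (a * g t + b * h t)) = (\<lambda>t. a * (f t * g t) + b * (f t * h t))"
      by (auto simp: algebra_simps)
    then show ?case using lin f by (simp add: Phi_lin bdd_mult bounded_opsD(5,6)[OF Phi_bounded[OF f]])
  next
    case (lim g h K)
    obtain L where L: "\<And>t. t \<in> {0..1} \<Longrightarrow> \<bar>f t\<bar> \<le> L" using bdd_bound[OF f] by blast
    have "(\<lambda>n. hinner H (ap (Phi (\<lambda>t. f t * g n t)) x) y) \<longlonglongrightarrow> hinner H (ap (Phi (\<lambda>t. f t * h t)) x) y"
    proof (rule Phi_limit(2)[where K = "L * K"])
      fix n and t :: real assume t: "t \<in> {0..1}"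
      show "\<bar>f t * g n t\<bar> \<le> L * K" unfolding abs_mult using lim.hyps(3)[OF t, of n] L[OF t]
        by (intro mult_mono) (auto intro: order_trans[OF abs_ge_zero])
    qed (use f lim bdd_mult[OF f] bdd_meas in \<open>auto intro!: tendsto_mult\<close>)
    moreover have "(\<lambda>n. hinner H (ap (Phi (g n)) x) (ap (Phi f) y)) \<longlonglongrightarrow> hinner H (ap (Phi h) x) (ap (Phi f) y)"
      by (rule Phi_limit(2)[where K = K]) (use f lim bdd_meas in auto)
    then have "(\<lambda>n. hinner H (ap (Phi f) (ap (Phi (g n)) x)) y) \<longlonglongrightarrow> hinner H (ap (Phi f) (ap (Phi h) x)) y"
      using f lim by (simp add: Phi_selfadjoint)
    ultimately show ?case using lim LIMSEQ_unique by simp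
  qed
qed (use f g x bdd_mult in auto)

lemma Phi_cong:
  assumes "bdd f" "bdd g" "\<And>t. t \<in> {0..1} \<Longrightarrow> f t = g t" shows "Phi f = Phi g"
proof (rule Phi_eqI[OF assms(1)])
  have "(LINT t|mu x. g t) = (LINT t|mu x. f t)" if "x \<in> C" for x
    by (rule integral_cong_AE) (use bdd_meas_mu assms mu_props(3)[OF that] that in auto)
  then show "represents (Phi g) f" using Phi_represents[OF assms(2)] by (simp add: represents_def)
qed

lemma Phi_norm:
  assumes f: "bdd f" and x: "x \<in> C"
  shows "(hnorm H (ap (Phi f) x))\<^sup>2 = (LINT t|mu x. (f t)\<^sup>2)"
proof -
  have "hinner H (ap (Phi f) x) (ap (Phi f) x) = hinner H (ap (Phi (\<lambda>t. f t * f t)) x) x"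
    using Phi_mult[OF f f x] Phi_selfadjoint[OF f, of "ap (Phi f) x" x] f x by simp
  then have "hinner H (ap (Phi f) x) (ap (Phi f) x) = complex_of_real (LINT t|mu x. (f t)\<^sup>2)"
    unfolding Phi_quad[OF bdd_mult[OF f f] x] by (simp add: power2_eq_square)
  then show ?thesis using hnorm_sq[OF Phi_closed[OF f x]] by simp
qed

lemma Phi_commute:
  assumes U: "U \<in> bounded_ops H" and UR: "\<And>x. x \<in> C \<Longrightarrow> ap U (ap R x) = ap R (ap U x)"
    and f: "bdd f" and x: "x \<in> C"
  shows "ap U (ap (Phi f) x) = ap (Phi f) (ap U x)"
proof (rule inner_ext)
  note u = bounded_opsD[OF U] and a = adjoint_bounded[OF U] and v = bounded_opsD[OF adjoint_bounded(1)[OF U]]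
  have pow: "ap U ((r ^^ j) x) = (r ^^ j) (ap U x)" for j using x
    by (induction j) (simp_all add: r_def UR Rk_closed[unfolded r_def])
  fix y assume y: "y \<in> C"
  from f x y show "hinner H (ap U (ap (Phi f) x)) y = hinner H (ap (Phi f) (ap U x)) y"
  proof (induction f rule: bdd_induct)
    case (power j)
    then show ?case using Phi_power pow u(4) by simp
  next
    case (lin f g a b)
    then show ?case by (simp add: Phi_lin u(4,5,6))
  next
    case (lim f g K)
    have "(\<lambda>n. hinner H (ap (Phi (f n)) (ap U x)) y) \<longlonglongrightarrow> hinner H (ap (Phi g) (ap U x)) y"
      by (rule Phi_limit(2)[where K = K]) (use lim bdd_meas u(4) in auto)
    moreover have "(\<lambda>n. hinner H (ap (Phi (f n)) x) (ap (op_adjoint H U) y)) \<longlonglongrightarrow> hinner H (ap (Phi g) x) (ap (op_adjoint H U) y)"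
      by (rule Phi_limit(2)[where K = K]) (use lim bdd_meas v(4) in auto)
    then have "(\<lambda>n. hinner H (ap U (ap (Phi (f n)) x)) y) \<longlonglongrightarrow> hinner H (ap U (ap (Phi g) x)) y"
      using lim by (simp add: a(2))
    ultimately show ?case using lim LIMSEQ_unique by simp
  qed
qed (use U f x bounded_opsD(4) in auto)

text \<open>
  \<open>\<parallel>Phi f x\<parallel>\<^sup>2\<close> is the integral of \<open>f\<^sup>2\<close>, so the convergence is strong and not only weak.
\<close>

lemma Phi_strong_limit:
  assumes f: "\<And>n. bdd (f n)" and g: "g \<in> borel_measurable borel" and K: "\<And>n t. t \<in> {0..1} \<Longrightarrow> \<bar>f n t\<bar> \<le> K"
    and lim: "\<And>t. t \<in> {0..1} \<Longrightarrow> (\<lambda>n. f n t) \<longlonglongrightarrow> g t" and x: "x \<in> C"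
  shows "hlim H (\<lambda>n. ap (Phi (f n)) x) (ap (Phi g) x)"
proof -
  have bg: "bdd g" by (rule Phi_limit(1)[OF f g K lim])
  have gK: "\<bar>g t\<bar> \<le> K" if "t \<in> {0..1}" for t
    by (rule LIMSEQ_le_const2[OF tendsto_rabs[OF lim[OF that]]]) (use K[OF that] in auto)
  have d: "hdiff H (ap (Phi (f n)) x) (ap (Phi g) x) = ap (Phi (\<lambda>t. 1 * f n t + (-1) * g t)) x" for n
    unfolding Phi_lin[OF f bg x] by (rule inner_ext) (use f bg x in auto)
  have bd: "bdd (\<lambda>t. 1 * f n t + (-1) * g t)" for n using bdd_lin[OF f bg] .
  have "(\<lambda>n. LINT t|mu x. (1 * f n t + (-1) * g t)\<^sup>2) \<longlonglongrightarrow> (LINT t|mu x. 0)"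
  proof (rule integral_mu_limit[where K = "(2 * K)\<^sup>2", OF _ _ _ _ x])
    show "bdd (\<lambda>t. (1 * f n t + (-1) * g t)\<^sup>2)" for n using bdd_mult[OF bd bd] by (simp add: power2_eq_square)
    fix t :: real assume t: "t \<in> {0..1}"
    show "\<bar>(1 * f n t + (-1) * g t)\<^sup>2\<bar> \<le> (2 * K)\<^sup>2" for n
      unfolding abs_power2 using K[OF t, of n] gK[OF t] by (intro abs_le_square_iff[THEN iffD1]) auto
    have "(\<lambda>n. (1 * f n t + (-1) * g t)\<^sup>2) \<longlonglongrightarrow> (1 * g t + (-1) * g t)\<^sup>2"
      by (intro tendsto_intros lim t)
    then show "(\<lambda>n. (1 * f n t + (-1) * g t)\<^sup>2) \<longlonglongrightarrow> 0" by simp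
  qed simp
  then have "(\<lambda>n. (hnorm H (hdiff H (ap (Phi (f n)) x) (ap (Phi g) x)))\<^sup>2) \<longlonglongrightarrow> 0"
    unfolding d Phi_norm[OF bd x] by simp
  then have "(\<lambda>n. sqrt ((hnorm H (hdiff H (ap (Phi (f n)) x) (ap (Phi g) x)))\<^sup>2)) \<longlonglongrightarrow> sqrt 0"
    by (rule tendsto_real_sqrt)
  then show ?thesis unfolding hlim_def using f bg x by simp
qed

section \<open>Unitaries of a commutant\<close>

text \<open>The unitary is \<open>R + \<i> sqrt (1 - R R)\<close>.\<close>

lemma real_part_of_unitary:
  obtains u where "unitary u" "\<And>x. x \<in> C \<Longrightarrow> hscale H 2 (ap R x) = hadd H (ap u x) (ap (op_adjoint H u) x)"
    "\<And>W x. W \<in> bounded_ops H \<Longrightarrow> \<forall>x\<in>C. ap W (ap R x) = ap R (ap W x) \<Longrightarrow> x \<in> C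
      \<Longrightarrow> ap W (ap u x) = ap u (ap W x)"
proof -
  define q where "q t = sqrt (1 - t * t)" for t :: real
  have le1: "t * t \<le> 1" if "t \<in> {0..1}" for t :: real using that mult_le_one[of t t] by simp
  have q: "bdd q" by (rule bddI[of _ 1]) (use le1 in \<open>auto simp: q_def[abs_def]\<close>)
  define Q where "Q = Phi q"
  have Qb: "Q \<in> bounded_ops H" using Phi_bounded[OF q] by (simp add: Q_def)
  note m = bounded_opsD(4)[OF Qb] bounded_opsD(4)[OF R_bounded]
  note l = bounded_opsD(5,6)[OF Qb] bounded_opsD(5,6)[OF R_bounded]
  have comm: "ap W (ap Q x) = ap Q (ap W x)"
    if "W \<in> bounded_ops H" "\<And>x. x \<in> C \<Longrightarrow> ap W (ap R x) = ap R (ap W x)" "x \<in> C" for W x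
    unfolding Q_def by (rule Phi_commute[OF that(1,2) q that(3)])
  have QQ: "ap Q (ap Q x) = hdiff H x (ap R (ap R x))" if x: "x \<in> C" for x
  proof -
    have "Phi (\<lambda>t. q t * q t) = Phi (\<lambda>t. 1 * t ^ 0 + (-1) * t ^ 2)"
      by (rule Phi_cong[OF bdd_mult[OF q q] bdd_lin[OF bdd_power bdd_power]]) (use le1 in \<open>auto simp: q_def power2_eq_square\<close>)
    then have "ap Q (ap Q x) = ap (Phi (\<lambda>t. 1 * t ^ 0 + (-1) * t ^ 2)) x" using Phi_mult[OF q q x] by (simp add: Q_def)
    also have "\<dots> = hadd H (hscale H 1 ((r ^^ 0) x)) (hscale H (-1) ((r ^^ 2) x))"
      using Phi_lin[OF bdd_power bdd_power x, of 1 0 "-1" 2] unfolding Phi_power[OF x] by simp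
    finally show ?thesis using x by (simp add: scale_one hdiff_def numeral_2_eq_2 r_def)
  qed
  define u v where "u = op_lin H 1 R \<i> Q" and "v = op_lin H 1 R (-\<i>) Q"
  have uv: "u \<in> bounded_ops H" "v \<in> bounded_ops H" unfolding u_def v_def by (rule op_lin_bounded[OF R_bounded Qb])+
  have adj: "op_adjoint H u = v"
    by (rule adjoint_eqI[OF uv]) (use m R_selfadjoint Phi_selfadjoint[OF q] in \<open>simp add: u_def v_def Q_def\<close>)
  have RQ: "ap R (ap Q x) = ap Q (ap R x)" if "x \<in> C" for x by (rule comm[OF R_bounded refl that])
  have "ap v (ap u x) = x \<and> ap u (ap v x) = x" if x: "x \<in> C" for x
    by (intro conjI inner_ext) (use x m l QQ RQ in \<open>simp_all add: u_def v_def algebra_simps\<close>)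
  then have "unitary u" unfolding unitary_def adj using uv by blast
  moreover have "hscale H 2 (ap R x) = hadd H (ap u x) (ap v x)" if x: "x \<in> C" for x
    by (rule inner_ext) (use x m in \<open>simp_all add: u_def v_def algebra_simps\<close>)
  moreover have "ap W (ap u x) = ap u (ap W x)"
    if W: "W \<in> bounded_ops H" "\<forall>x\<in>C. ap W (ap R x) = ap R (ap W x)" and x: "x \<in> C" for W x
    using x W(2) comm[OF W(1) W(2)[rule_format] x] m bounded_opsD(4-6)[OF W(1)] by (simp add: u_def)
  ultimately show thesis using that[of u] adj by simp
qed

end

context hilbert_space
begin

text \<open>
  The unitaries span the commutant. An element \<open>U\<close> is a combination of the selfadjoint
  \<open>U + U*\<close> and \<open>\<i> (U - U*)\<close>, a selfadjoint \<open>s\<close> is a combination of \<open>1\<close> and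
  \<open>h = (1 + s / K) / 2\<close>, which lies between \<open>0\<close> and \<open>1\<close> when \<open>K\<close> bounds \<open>s\<close>, and \<open>h\<close> is
  the real part of a unitary in the commutant.
\<close>

theorem vna_memI_unitary:
  assumes M: "von_neumann_algebra H M" and P: "P \<in> bounded_ops H"
    and comm: "\<And>u x. u \<in> commutant H M \<Longrightarrow> unitary u \<Longrightarrow> x \<in> C \<Longrightarrow> ap u (ap P x) = ap P (ap u x)"
  shows "P \<in> M"
proof (rule vna_memI[OF M P])
  note Mb = vnaD(1)[OF M] and M'b = vnaD(5)[OF M]
  have Msub: "M \<subseteq> bounded_ops H" using Mb by blast
  note iff = commutant_iff[OF Msub] and lin = commutant_op_lin[OF Msub]
  note p = bounded_opsD(4-6)[OF P]
  have contraction: "ap h (ap P x) = ap P (ap h x)"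
    if h: "h \<in> commutant H M" "unit_selfadjoint H h" and x: "x \<in> C" for h x
  proof -
    interpret h: unit_selfadjoint H h by (rule h(2))
    obtain u where u: "unitary u" and e: "\<And>x. x \<in> C \<Longrightarrow> hscale H 2 (ap h x) = hadd H (ap u x) (ap (op_adjoint H u) x)"
      and c: "\<And>W x. W \<in> bounded_ops H \<Longrightarrow> \<forall>x\<in>C. ap W (ap h x) = ap h (ap W x) \<Longrightarrow> x \<in> C
        \<Longrightarrow> ap W (ap u x) = ap u (ap W x)" by (rule h.real_part_of_unitary) (rule that)
    have uM: "u \<in> commutant H M"
      unfolding iff using u c[OF Mb] h(1)[unfolded iff] by (auto simp: unitary_def)
    note m = bounded_opsD(4)[OF M'b[OF uM] x] bounded_opsD(4)[OF M'b[OF vnaD(4)[OF M uM]] x]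
    have "hscale H 2 (ap h (ap P x)) = ap P (hscale H 2 (ap h x))"
      using e[OF p(1)[OF x]] e[OF x] comm[OF uM u x] comm[OF vnaD(4)[OF M uM] unitary_adjoint[OF u] x] p(2)[OF m] by simp
    then have "hscale H (1/2) (hscale H 2 (ap h (ap P x))) = hscale H (1/2) (hscale H 2 (ap P (ap h x)))"
      using p(3) bounded_opsD(4)[OF M'b[OF h(1)] x] by simp
    then show ?thesis using bounded_opsD(4)[OF M'b[OF h(1)]] p(1) x by (simp add: scale_scale scale_one)
  qed
  have selfadjoint: "ap s (ap P x) = ap P (ap s x)"
    if s: "s \<in> commutant H M" "\<And>x y. x \<in> C \<Longrightarrow> y \<in> C \<Longrightarrow> hinner H (ap s x) y = hinner H x (ap s y)" and x: "x \<in> C" for s x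
  proof -
    note sb = M'b[OF s(1)]
    note sC = bounded_opsD(4)[OF sb]
    obtain k where k: "k \<ge> 0" "\<forall>x\<in>C. hnorm H (ap s x) \<le> k * hnorm H x" using bounded_opsD(9)[OF sb] by blast
    \<comment> \<open>the bound must not vanish\<close>
    define K where "K = k + 1"
    have K: "K > 0" using k by (simp add: K_def)
    have sK: "cmod (hinner H (ap s y) y) \<le> K * Re (hinner H y y)" if y: "y \<in> C" for y
    proof -
      have "cmod (hinner H (ap s y) y) \<le> hnorm H (ap s y) * hnorm H y" by (rule Cauchy_Schwarz[OF sC[OF y] y])
      also have "\<dots> \<le> K * hnorm H y * hnorm H y"
        using k y mult_right_mono[of k K "hnorm H y"] by (intro mult_right_mono) (auto simp: K_def intro: order_trans)
      finally show ?thesis using hnorm_sq[OF y] by (simp add: power2_eq_square mult.assoc)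
    qed
    define h where "h = op_lin H (1/2) (scalar_op H 1) (of_real (1 / (2 * K))) s"
    have one: "scalar_op H 1 \<in> commutant H M" unfolding iff using Mb bounded_opsD(4,6)[OF Mb] by simp
    have h: "h \<in> commutant H M" unfolding h_def by (rule lin[OF one s(1)])
    have hq: "Re (hinner H (ap h y) y) = Re (hinner H y y) / 2 + Re (hinner H (ap s y) y) / (2 * K)" if "y \<in> C" for y
      using that sC by (simp add: h_def)
    have b: "\<bar>Re (hinner H (ap s y) y) / (2 * K)\<bar> \<le> Re (hinner H y y) / 2" if y: "y \<in> C" for y
      using order_trans[OF abs_Re_le_cmod sK[OF y]] K by (simp add: field_simps)
    have "unit_selfadjoint H h"
    proof
      show "h \<in> bounded_ops H" by (rule M'b[OF h])
      show "hinner H (ap h y) z = hinner H y (ap h z)" if "y \<in> C" "z \<in> C" for y z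
        using that s(2)[OF that] sC by (simp add: h_def)
      show "0 \<le> Re (hinner H (ap h y) y)" "Re (hinner H (ap h y) y) \<le> Re (hinner H y y)" if "y \<in> C" for y
        using hq[OF that] b[OF that] by linarith+
    qed
    then have "ap h (ap P x) = ap P (ap h x)" by (rule contraction[OF h _ x])
    then have e: "hadd H (hscale H (1/2) (ap P x)) (hscale H (of_real (1/(2*K))) (ap s (ap P x)))
       = hadd H (hscale H (1/2) (ap P x)) (hscale H (of_real (1/(2*K))) (ap P (ap s x)))"
      using x p sC by (simp add: h_def scale_one)
    show ?thesis
    proof (rule inner_ext)
      fix z assume z: "z \<in> C"
      show "hinner H (ap s (ap P x)) z = hinner H (ap P (ap s x)) z"
        using arg_cong[OF e, of "\<lambda>w. hinner H w z"] z x p(1) sC K by simp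
    qed (use x p(1) sC in auto)
  qed
  fix U x assume U: "U \<in> commutant H M" and x: "x \<in> C"
  note Ub = M'b[OF U] and U' = vnaD(4)[OF M U]
  note ad = adjoint_bounded[OF Ub] and m = bounded_opsD(4)[OF Ub] bounded_opsD(4)[OF adjoint_bounded(1)[OF Ub]]
  have ad': "hinner H (ap (op_adjoint H U) y) z = hinner H y (ap U z)" if "y \<in> C" "z \<in> C" for y z
    using adjoint_bounded(2)[OF ad(1) that] adjoint_adjoint[OF Ub] by simp
  let ?s = "op_lin H 1 U 1 (op_adjoint H U)" and ?t = "op_lin H \<i> U (-\<i>) (op_adjoint H U)"
  have "ap ?s (ap P x) = ap P (ap ?s x)" "ap ?t (ap P x) = ap P (ap ?t x)"
    by (rule selfadjoint[OF lin[OF U U'] _ x]; use m ad(2) ad' in \<open>simp add: algebra_simps\<close>)+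
  then have e: "hadd H (ap U (ap P x)) (ap (op_adjoint H U) (ap P x)) = hadd H (ap P (ap U x)) (ap P (ap (op_adjoint H U) x))"
    "hadd H (hscale H \<i> (ap U (ap P x))) (hscale H (-\<i>) (ap (op_adjoint H U) (ap P x)))
      = hadd H (hscale H \<i> (ap P (ap U x))) (hscale H (-\<i>) (ap P (ap (op_adjoint H U) x)))"
    using x p m by (simp_all add: scale_one)
  have cancel: "a = c" if "a + b = c + d" "\<i> * a + \<i> * d = \<i> * c + \<i> * b" for a b c d :: complex
  proof -
    have "\<i> * (a + d) = \<i> * (c + b)" using that(2) by (simp only: distrib_left)
    then have "a + d = c + b" by simp
    then have "2 * a = 2 * c" using that(1) by algebra
    then show ?thesis by simp
  qed
  show "ap U (ap P x) = ap P (ap U x)"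
  proof (rule inner_ext)
    fix z assume z: "z \<in> C"
    note E = arg_cong[OF e(1), of "\<lambda>w. hinner H w z"] arg_cong[OF e(2), of "\<lambda>w. hinner H w z"]
    show "hinner H (ap U (ap P x)) z = hinner H (ap P (ap U x)) z"
    proof (rule cancel)
      show "hinner H (ap U (ap P x)) z + hinner H (ap (op_adjoint H U) (ap P x)) z
        = hinner H (ap P (ap U x)) z + hinner H (ap P (ap (op_adjoint H U) x)) z" using E(1) z x p(1) m by simp
      show "\<i> * hinner H (ap U (ap P x)) z + \<i> * hinner H (ap P (ap (op_adjoint H U) x)) z
        = \<i> * hinner H (ap P (ap U x)) z + \<i> * hinner H (ap (op_adjoint H U) (ap P x)) z"
        using E(2) z x p(1) m by (simp add: algebra_simps)
    qed
  qed (use x p(1) m in auto)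
qed

text \<open>
  The unitaries of the commutant commute with \<open>V\<close> and with the spectral projections of
  \<open>A\<close>, hence with \<open>A\<close>, so they map the graph of \<open>T = V A\<close> onto itself and commute with its
  projection.
\<close>

theorem affiliated_imp_entries:
  assumes M: "von_neumann_algebra H M" and aff: "affiliated H M T"
  shows "p11 T \<in> M" "p12 T \<in> M" "p21 T \<in> M" "p22 T \<in> M"
proof -
  from aff obtain V A E where T: "closed_op H T" and pd: "polar_decomposition H T V A"
    and sr: "spectral_resolution H A E" and V: "V \<in> M" and E: "\<And>B. B \<in> sets borel \<Longrightarrow> E B \<in> M"
    unfolding affiliated_def by blast
  have TVA: "T = V \<circ>\<^sub>m A" and dd: "hdense H (dom A)" and lA: "linear_op H A"
    using pd by (auto simp: polar_decomposition_def positive_selfadjoint_def densely_defined_def)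
  note v = bounded_opsD(3)[OF vnaD(1)[OF M V]]
  have inv: "T (ap U x) = Some (ap U y)" if U: "U \<in> commutant H M" "unitary U" and xy: "T x = Some y" for U x y
  proof -
    obtain z where z: "A x = Some z" "V z = Some y"
      using xy TVA by (auto simp: map_comp_def split: option.splits)
    have zC: "z \<in> C" using linear_opD(2)[OF lA z(1)] .
    have "A (ap U x) = Some (ap U z)"
      by (rule unitary_commutes_with_resolved[OF sr U(2) vnaD(3)[OF M E U(1)] dd z(1)])
    moreover have "V (ap U z) = Some (ap U y)"
      using v[OF bounded_opsD(4)[OF vnaD(5)[OF M U(1)] zC]] vnaD(3)[OF M V U(1) zC] z(2) by simp
    ultimately show ?thesis by (simp add: TVA map_comp_def)
  qed
  have "P \<in> M" if P: "P \<in> {p11 T, p12 T, p21 T, p22 T}" for P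
  proof (rule vna_memI_unitary[OF M])
    show "P \<in> bounded_ops H" using P entries_bounded[OF T] by auto
    fix U x assume U: "U \<in> commutant H M" "unitary U" and x: "x \<in> C"
    show "ap U (ap P x) = ap P (ap U x)"
      by (rule commute_entries[OF T vnaD(5)[OF M U(1)] inv[OF U] inv[OF vnaD(4)[OF M U(1)] unitary_adjoint[OF U(2)]] x P])
  qed
  then show "p11 T \<in> M" "p12 T \<in> M" "p21 T \<in> M" "p22 T \<in> M" by auto
qed

end

section \<open>The polar decomposition of a closed operator\<close>

text \<open>
  For \<open>R = (1 + T* T)^(-1)\<close> the absolute value of \<open>T\<close> is \<open>modulus R\<close>, and its phase is the
  limit of \<open>T R\<close> times \<open>weight n R\<close>. The functions \<open>weight n\<close> truncate
  \<open>1 / sqrt (t (1 - t))\<close> near the end points, where it is unbounded.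
\<close>

definition modulus :: "real \<Rightarrow> real" where "modulus t = sqrt (1 / t - 1)"
definition cutoff :: "nat \<Rightarrow> real \<Rightarrow> real" where "cutoff n = indicator {1 / Suc n..1 - 1 / Suc n}"
definition weight :: "nat \<Rightarrow> real \<Rightarrow> real" where "weight n t = cutoff n t / (sqrt t * sqrt (1 - t))"

lemma map_eqI: "(\<And>x y. f x = Some y \<longleftrightarrow> g x = Some y) \<Longrightarrow> f = g"
  by (metis ext not_Some_eq)

lemma (in hilbert_space) closed_op_limit:
  assumes T: "closed_op H T" and XY: "\<And>n. T (X n) = Some (Y n)"
    and X: "hlim H X x" and Y: "hlim H Y y" and c: "x \<in> C" "y \<in> C"
  shows "T x = Some y"
proof -
  have XYC: "X n \<in> C" "Y n \<in> C" for n using linear_opD(1,2)[OF closed_opD[OF T] XY] by blast+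
  have "hlim (hsum H H) (\<lambda>n. (X n, Y n)) (x, y)"
    by (subst hsum_hlim_iff) (use hilbert_space_axioms XYC c X Y in auto)
  moreover have "(X n, Y n) \<in> Map.graph T" for n using XY by (simp add: Map.graph_def)
  moreover have "hclosed (hsum H H) (Map.graph T)" using T by (simp add: closed_op_def)
  ultimately have "(x, y) \<in> Map.graph T"
    unfolding hclosed_def using c by (elim allE[of _ "\<lambda>n. (X n, Y n)"] ballE[of _ _ "(x, y)"]) auto
  then show ?thesis by (simp add: Map.graph_def)
qed

lemma (in hilbert_space) zero_add: "x \<in> C \<Longrightarrow> hadd H (hzero H) x = x"
  using add_zero add_commute[of "hzero H" x] by simp

lemma modulus_measurable [measurable]: "modulus \<in> borel_measurable borel" unfolding modulus_def[abs_def] by measurable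
lemma cutoff_measurable [measurable]: "cutoff n \<in> borel_measurable borel" unfolding cutoff_def by measurable
lemma weight_measurable [measurable]: "weight n \<in> borel_measurable borel" unfolding weight_def[abs_def] by measurable

lemma cutoff_eq_1: "cutoff n t = 1 \<Longrightarrow> 0 < t \<and> t < 1 \<and> 1 / real (Suc n) \<le> t \<and> t \<le> 1 - 1 / real (Suc n)"
proof -
  assume "cutoff n t = 1"
  then have "1 / real (Suc n) \<le> t" "t \<le> 1 - 1 / real (Suc n)"
    by (auto simp: cutoff_def indicator_def simp del: of_nat_Suc split: if_splits)
  moreover have "0 < 1 / real (Suc n)" by simp
  ultimately show ?thesis by linarith
qed

lemma cutoff_cases: "cutoff n t = 0 \<or> cutoff n t = 1" by (auto simp: cutoff_def indicator_def)

lemma cutoff_mono: "m \<le> n \<Longrightarrow> cutoff m t \<le> cutoff n t"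
proof -
  assume "m \<le> n"
  then have "1 / real (Suc n) \<le> 1 / real (Suc m)" by (intro divide_left_mono) auto
  then show ?thesis by (auto simp: cutoff_def indicator_def simp del: of_nat_Suc)
qed

lemma modulus_cos: "t \<in> {0<..1} \<Longrightarrow> sqrt t * modulus t = sqrt (1 - t)"
  by (simp add: modulus_def real_sqrt_mult[symmetric] right_diff_distrib)

lemma inverse_Suc_eventually_le: assumes "0 < (e::real)" shows "\<forall>\<^sub>F n in sequentially. 1 / real (Suc n) \<le> e"
proof -
  have "(\<lambda>n. 1 / real (Suc n)) \<longlonglongrightarrow> 0" using LIMSEQ_inverse_real_of_nat by (simp add: inverse_eq_divide)
  then have "\<forall>\<^sub>F n in sequentially. 1 / real (Suc n) < e" using assms by (rule order_tendstoD)
  then show ?thesis by (rule eventually_mono) simp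
qed

lemma cutoff_lim: "(\<lambda>n. cutoff n t) \<longlonglongrightarrow> indicator {0<..<1} t"
proof (cases "0 < t \<and> t < 1")
  case True
  then have "\<forall>\<^sub>F n in sequentially. 1 / real (Suc n) \<le> t \<and> 1 / real (Suc n) \<le> 1 - t"
    using inverse_Suc_eventually_le[of t] inverse_Suc_eventually_le[of "1 - t"] by (intro eventually_conj) auto
  then have "\<forall>\<^sub>F n in sequentially. cutoff n t = indicator {0<..<1} t"
    using True by (auto simp: cutoff_def indicator_def simp del: of_nat_Suc elim!: eventually_mono)
  then show ?thesis by (rule tendsto_eventually)
next
  case False
  then have "cutoff n t = 0" for n using cutoff_eq_1[of n t] cutoff_cases[of n t] by auto
  then show ?thesis using False by (auto simp: indicator_def)
qed

lemma weight_bound: "\<bar>weight n t\<bar> \<le> real (Suc n) * real (Suc n)"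
proof (cases "cutoff n t = 1")
  case True
  define e where "e = 1 / real (Suc n)"
  have e: "0 < e" "e \<le> t" "t \<le> 1 - e" "0 < t" "t < 1" using cutoff_eq_1[OF True] by (auto simp: e_def)
  have le: "u \<le> sqrt u" if "0 \<le> u" "u \<le> 1" for u :: real
    using that by (intro real_le_rsqrt) (simp add: power2_eq_square mult_left_le)
  have "e * e \<le> sqrt t * sqrt (1 - t)" using e le[of t] le[of "1 - t"] by (intro mult_mono) auto
  moreover have "0 < e * e" using e by simp
  ultimately have "1 / (sqrt t * sqrt (1 - t)) \<le> 1 / (e * e)" by (intro divide_left_mono) auto
  moreover have "0 \<le> sqrt t * sqrt (1 - t)" using e by simp
  ultimately show ?thesis using True by (simp add: weight_def e_def)
qed (use cutoff_cases[of n t] in \<open>auto simp: weight_def\<close>)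

lemma weight_cancel: "weight n t * (sqrt t * sqrt (1 - t)) = cutoff n t"
  using cutoff_cases[of n t] cutoff_eq_1[of n t] by (auto simp: weight_def)

locale closed_densely_defined = hilbert_space H for H :: "'v hilbert_struct" +
  fixes T :: "'v operator"
  assumes T_closed: "closed_op H T" and T_dense: "densely_defined H T"
begin

text \<open>In terms of \<open>R\<close> this is \<open>T R\<close>.\<close>

definition "S = ap (p21 T)"

lemma T_lin: "linear_op H T" using T_closed by (rule closed_opD)

lemma p11_selfadjoint:
  assumes x: "x \<in> C" and y: "y \<in> C"
  shows "hinner H (ap (p11 T) x) y = hinner H x (ap (p11 T) y)"
    "hinner H x (ap (p11 T) y) = hinner H (ap (p11 T) x) (ap (p11 T) y) + hinner H (S x) (S y)"
proof -
  have e: "hinner H x (ap (p11 T) y) = hinner H (ap (p11 T) x) (ap (p11 T) y) + hinner H (S x) (S y)"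
    if x: "x \<in> C" and y: "y \<in> C" for x y
    using graph_proj_col1(2)[OF T_closed x graph_proj_col1(1)[OF T_closed y]] by (simp add: S_def)
  show "hinner H x (ap (p11 T) y) = hinner H (ap (p11 T) x) (ap (p11 T) y) + hinner H (S x) (S y)" using e x y by blast
  note c = entries_closed[OF T_closed]
  have "hinner H (ap (p11 T) x) y = cnj (hinner H y (ap (p11 T) x))" using inner_cnj c x y by blast
  also have "\<dots> = cnj (hinner H (ap (p11 T) y) (ap (p11 T) x)) + cnj (hinner H (S y) (S x))" using e[OF y x] by simp
  also have "\<dots> = hinner H (ap (p11 T) x) (ap (p11 T) y) + hinner H (S x) (S y)"
    using inner_cnj[of "ap (p11 T) y" "ap (p11 T) x"] inner_cnj[of "S y" "S x"] c x y by (simp add: S_def)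
  also have "\<dots> = hinner H x (ap (p11 T) y)" using e[OF x y] by simp
  finally show "hinner H (ap (p11 T) x) y = hinner H x (ap (p11 T) y)" .
qed

sublocale unit_selfadjoint H "p11 T"
proof
  note c = entries_closed[OF T_closed]
  show "p11 T \<in> bounded_ops H" using entries_bounded[OF T_closed] by blast
  show "hinner H (ap (p11 T) x) y = hinner H x (ap (p11 T) y)" if "x \<in> C" "y \<in> C" for x y
    using p11_selfadjoint(1) that .
  fix x assume x: "x \<in> C"
  have "hinner H (ap (p11 T) x) x = hinner H (ap (p11 T) x) (ap (p11 T) x) + hinner H (S x) (S x)"
    using p11_selfadjoint[OF x x] by simp
  then show "0 \<le> Re (hinner H (ap (p11 T) x) x)" using c x by (simp add: S_def)
  have "Re (hinner H (ap (p11 T) x) x) \<le> cmod (hinner H (ap (p11 T) x) x)" by (rule complex_Re_le_cmod)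
  also have "\<dots> \<le> hnorm H (ap (p11 T) x) * hnorm H x" using Cauchy_Schwarz c x by blast
  also have "\<dots> \<le> hnorm H x * hnorm H x" using entries_bound(1)[OF T_closed x] x by (intro mult_right_mono) auto
  also have "\<dots> = Re (hinner H x x)" using hnorm_sq[OF x] by (simp add: power2_eq_square)
  finally show "Re (hinner H (ap (p11 T) x) x) \<le> Re (hinner H x x)" .
qed

lemma S_bounded: "p21 T \<in> bounded_ops H" using entries_bounded[OF T_closed] by blast
lemma S_closed [simp]: "x \<in> C \<Longrightarrow> S x \<in> C" using bounded_opsD(4)[OF S_bounded] by (simp add: S_def)
lemma S_lin: "x \<in> C \<Longrightarrow> y \<in> C \<Longrightarrow> S (hadd H x y) = hadd H (S x) (S y)"
  "x \<in> C \<Longrightarrow> S (hscale H a x) = hscale H a (S x)"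
  "x \<in> C \<Longrightarrow> y \<in> C \<Longrightarrow> S (hdiff H x y) = hdiff H (S x) (S y)"
  using bounded_opsD(5-7)[OF S_bounded] by (simp_all add: S_def)

lemma T_R: "x \<in> C \<Longrightarrow> T (r x) = Some (S x)"
  using graph_proj_col1(1)[OF T_closed] by (simp add: r_def S_def)

lemma inner_RS: "x \<in> C \<Longrightarrow> T a = Some b \<Longrightarrow> hinner H x a = hinner H (r x) a + hinner H (S x) b"
  using graph_proj_col1(2)[OF T_closed] by (simp add: r_def S_def)

lemma SS: "x \<in> C \<Longrightarrow> y \<in> C \<Longrightarrow> hinner H (S x) (S y) = hinner H x (r y) - hinner H (r x) (r y)"
  using p11_selfadjoint(2)[of x y] by (simp add: r_def)

lemma R_inj: "x \<in> C \<Longrightarrow> r x = hzero H \<Longrightarrow> x = hzero H"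
  using T_dense densely_defined_iff_p11[OF T_closed] by (simp add: r_def)

lemma Phi_id: "ap (Phi (\<lambda>t. t)) x = r x" by (simp add: Phi_R r_def)

lemma Phi_R_mult: "bdd f \<Longrightarrow> x \<in> C \<Longrightarrow> r (ap (Phi f) x) = ap (Phi (\<lambda>t. t * f t)) x"
  using Phi_mult[OF bdd_id, of f x] Phi_R by (simp add: r_def)

lemma Phi_mult_R: "bdd f \<Longrightarrow> x \<in> C \<Longrightarrow> ap (Phi f) (r x) = ap (Phi (\<lambda>t. f t * t)) x"
  using Phi_mult[OF _ bdd_id, of f x] Phi_R by (simp add: r_def)

lemma bdd_cutoff [simp]: "bdd (cutoff n)" by (rule bddI[of _ 1]) (auto simp: cutoff_def indicator_def)
lemma bdd_weight [simp]: "bdd (weight n)" by (rule bddI[OF weight_measurable weight_bound])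

text \<open>\<open>R\<close> is injective, so no vector has spectral mass at \<open>0\<close>.\<close>

lemma Phi_support: "bdd f \<Longrightarrow> bdd g \<Longrightarrow> (\<And>t. t \<in> {0<..1} \<Longrightarrow> f t = g t) \<Longrightarrow> x \<in> C \<Longrightarrow> ap (Phi f) x = ap (Phi g) x"
proof -
  assume f: "bdd f" and g: "bdd g" and eq: "\<And>t. t \<in> {0<..1} \<Longrightarrow> f t = g t" and x: "x \<in> C"
  define d where "d t = 1 * f t + (-1) * g t" for t
  have d: "bdd d" unfolding d_def by (rule bdd_lin[OF f g])
  have bt: "bdd (\<lambda>t. t * d t)" by (rule bdd_mult[OF bdd_id d])
  have "Phi (\<lambda>t. t * d t) = Phi (\<lambda>t. 0 * 1 + 0 * 1)"
  proof (rule Phi_cong[OF bt])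
    fix t :: real assume "t \<in> {0..1}"
    then show "t * d t = 0 * 1 + 0 * 1" using eq[of t] by (cases "t = 0") (auto simp: d_def)
  qed simp
  then have "r (ap (Phi d) x) = hzero H"
    using Phi_R_mult[OF d x] Phi_lin[of "\<lambda>t. 1" "\<lambda>t. 1" x 0 0] Phi_one x add_zero by simp
  then have "ap (Phi d) x = hzero H" using R_inj Phi_closed[OF d x] by blast
  moreover have "ap (Phi d) x = hdiff H (ap (Phi f) x) (ap (Phi g) x)"
    unfolding d_def Phi_lin[OF f g x] by (rule inner_ext) (use f g x in auto)
  ultimately show ?thesis using hdiff_eq_0 f g x by simp
qed

lemma mu_AE_pos: "x \<in> C \<Longrightarrow> AE t in mu x. t \<in> {0<..1}"
proof -
  assume x: "x \<in> C"
  interpret finite_measure "mu x" using mu_props(1)[OF x] .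
  have "ap (Phi (indicator {0})) x = ap (Phi (\<lambda>t. 0)) x" by (rule Phi_support) (use x in auto)
  then have "hinner H (ap (Phi (indicator {0})) x) x = hinner H (ap (Phi (\<lambda>t. 0)) x) x" by simp
  then have "(LINT t|mu x. indicator {0} t) = (0::real)" using x by (simp add: Phi_quad)
  then have "measure (mu x) {0} = 0" using mu_props(2)[OF x] mu_space[OF x] by simp
  then have "AE t in mu x. t \<notin> {0}"
    by (intro AE_not_in) (auto simp: null_sets_def mu_props(2)[OF x] emeasure_eq_measure)
  then show ?thesis using mu_props(3)[OF x] by eventually_elim auto
qed

section \<open>The absolute value as a tangent\<close>

lemma bdd_sqrt [simp]: "bdd sqrt" "bdd (\<lambda>t. sqrt (1 - t))"
  by (rule bddI[of _ 1]; simp)+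

text \<open>
  \<open>cosine\<close> is \<open>(1 + T* T)^(-1/2)\<close>, and \<open>sine\<close> is its product with the absolute value \<open>A\<close>
  of \<open>T\<close>. The graph of \<open>A\<close> consists of the pairs \<open>(cosine w, sine w)\<close>, which reduces
  everything about \<open>A\<close> to two commuting bounded operators.
\<close>

definition cosine :: "'v \<Rightarrow> 'v" where "cosine = ap (Phi sqrt)"
definition sine :: "'v \<Rightarrow> 'v" where "sine = ap (Phi (\<lambda>t. sqrt (1 - t)))"

lemma trig_closed [simp]: "x \<in> C \<Longrightarrow> cosine x \<in> C" "x \<in> C \<Longrightarrow> sine x \<in> C"
  by (simp_all add: cosine_def sine_def)

lemma trig_linear:
  "x \<in> C \<Longrightarrow> y \<in> C \<Longrightarrow> cosine (hadd H x y) = hadd H (cosine x) (cosine y)"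
  "x \<in> C \<Longrightarrow> cosine (hscale H a x) = hscale H a (cosine x)"
  "x \<in> C \<Longrightarrow> y \<in> C \<Longrightarrow> cosine (hdiff H x y) = hdiff H (cosine x) (cosine y)"
  "x \<in> C \<Longrightarrow> y \<in> C \<Longrightarrow> sine (hadd H x y) = hadd H (sine x) (sine y)"
  "x \<in> C \<Longrightarrow> sine (hscale H a x) = hscale H a (sine x)"
  "x \<in> C \<Longrightarrow> y \<in> C \<Longrightarrow> sine (hdiff H x y) = hdiff H (sine x) (sine y)"
  using Phi_bounded[OF bdd_sqrt(1)] Phi_bounded[OF bdd_sqrt(2)] by (simp_all add: bounded_opsD(5-7) cosine_def sine_def)

lemma trig_selfadjoint:
  "x \<in> C \<Longrightarrow> y \<in> C \<Longrightarrow> hinner H (cosine x) y = hinner H x (cosine y)"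
  "x \<in> C \<Longrightarrow> y \<in> C \<Longrightarrow> hinner H (sine x) y = hinner H x (sine y)"
  by (simp_all add: cosine_def sine_def Phi_selfadjoint)

lemma trig_Phi:
  assumes f: "bdd f" and x: "x \<in> C"
  shows "cosine (ap (Phi f) x) = ap (Phi (\<lambda>t. f t * sqrt t)) x" "ap (Phi f) (cosine x) = ap (Phi (\<lambda>t. f t * sqrt t)) x"
    "sine (ap (Phi f) x) = ap (Phi (\<lambda>t. f t * sqrt (1 - t))) x" "ap (Phi f) (sine x) = ap (Phi (\<lambda>t. f t * sqrt (1 - t))) x"
  using Phi_mult[OF f bdd_sqrt(1) x] Phi_mult[OF bdd_sqrt(1) f x] Phi_mult[OF f bdd_sqrt(2) x] Phi_mult[OF bdd_sqrt(2) f x]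
  by (simp_all add: cosine_def sine_def mult.commute)

lemma trig_commute: "x \<in> C \<Longrightarrow> cosine (sine x) = sine (cosine x)"
  unfolding sine_def using trig_Phi(1,2)[OF bdd_sqrt(2)] by simp

lemma cos_cos: "x \<in> C \<Longrightarrow> cosine (cosine x) = r x"
  using trig_Phi(1)[OF bdd_sqrt(1)] Phi_cong[OF bdd_mult[OF bdd_sqrt(1) bdd_sqrt(1)] bdd_id] by (simp add: cosine_def Phi_id)

lemma trig_zero: "cosine (hzero H) = hzero H" "sine (hzero H) = hzero H"
  using trig_linear(2,5)[OF zero_closed, of 0] unfolding scale_zero[OF zero_closed] scale_zero[OF trig_closed(1)[OF zero_closed]]
    scale_zero[OF trig_closed(2)[OF zero_closed]] by blast+

lemma sin_sin:
  assumes x: "x \<in> C" shows "sine (sine x) = hdiff H x (r x)"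
proof -
  have "Phi (\<lambda>t. sqrt (1 - t) * sqrt (1 - t)) = Phi (\<lambda>t. 1 * t ^ 0 + (-1) * t ^ 1)"
    by (rule Phi_cong[OF bdd_mult[OF bdd_sqrt(2) bdd_sqrt(2)] bdd_lin[OF bdd_power bdd_power]]) simp
  then have "sine (sine x) = ap (Phi (\<lambda>t. 1 * t ^ 0 + (-1) * t ^ 1)) x" using trig_Phi(3)[OF bdd_sqrt(2) x] by (simp add: sine_def)
  also have "\<dots> = hadd H (hscale H 1 ((r ^^ 0) x)) (hscale H (-1) ((r ^^ 1) x))"
    using Phi_lin[OF bdd_power bdd_power x, of 1 0 "-1" 1] unfolding Phi_power[OF x] by simp
  finally show ?thesis using x by (simp add: scale_one hdiff_def)
qed

lemma cos_inj: assumes x: "x \<in> C" and "cosine x = hzero H" shows "x = hzero H"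
  using R_inj[OF x] cos_cos[OF x] assms(2) trig_zero by simp

definition A :: "'v operator" where
  "A x = (if \<exists>z. x \<in> C \<and> z \<in> C \<and> sine x = cosine z then Some (THE z. z \<in> C \<and> sine x = cosine z) else None)"

lemma A_iff: "A x = Some z \<longleftrightarrow> x \<in> C \<and> z \<in> C \<and> sine x = cosine z"
proof -
  have u: "z = z'" if "z \<in> C" "z' \<in> C" "sine x = cosine z" "sine x = cosine z'" for z z'
    using cos_inj[of "hdiff H z z'"] that trig_linear(3)[of z z'] hdiff_eq_0[of z z'] diff_self by simp
  have eq: "(THE z. z \<in> C \<and> sine x = cosine z) = z" if "z \<in> C" "sine x = cosine z" for z
    by (rule the_equality) (use that u in blast)+
  show ?thesis
  proof
    assume "A x = Some z"
    then obtain z' where z': "x \<in> C" "z' \<in> C" "sine x = cosine z'" "z = (THE z. z \<in> C \<and> sine x = cosine z)"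
      unfolding A_def by (auto split: if_splits)
    have "z = z'" unfolding z'(4) by (rule eq[OF z'(2,3)])
    then show "x \<in> C \<and> z \<in> C \<and> sine x = cosine z" using z'(1-3) by blast
  next
    assume z: "x \<in> C \<and> z \<in> C \<and> sine x = cosine z"
    then have "\<exists>z. x \<in> C \<and> z \<in> C \<and> sine x = cosine z" by blast
    then show "A x = Some z" unfolding A_def using eq z by (simp only: if_True)
  qed
qed

text \<open>The vector \<open>w = cosine x + sine z\<close> is found from \<open>cosine\<^sup>2 + sine\<^sup>2 = 1\<close>.\<close>

lemma A_cos: "A x = Some z \<longleftrightarrow> (\<exists>w\<in>C. x = cosine w \<and> z = sine w)"
proof
  assume "A x = Some z"
  then have c: "x \<in> C" "z \<in> C" and e: "sine x = cosine z" using A_iff by blast+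
  let ?w = "hadd H (cosine x) (sine z)"
  have "cosine ?w = hadd H (r x) (sine (sine x))"
    using c by (simp add: trig_linear cos_cos trig_commute e[symmetric])
  also have "\<dots> = x" by (rule inner_ext) (use c in \<open>simp_all add: sin_sin\<close>)
  finally have 1: "cosine ?w = x" .
  have "sine ?w = hadd H (cosine (cosine z)) (sine (sine z))"
    using c by (simp add: trig_linear trig_commute[symmetric] e)
  also have "\<dots> = z" by (rule inner_ext) (use c in \<open>simp_all add: sin_sin cos_cos\<close>)
  finally show "\<exists>w\<in>C. x = cosine w \<and> z = sine w" using 1 c by (intro bexI[of _ ?w]) auto
qed (auto simp: A_iff trig_commute)

lemma A_linear: "linear_op H A"
  by (auto simp: linear_op_iff A_iff trig_linear trig_zero)

lemma A_dom: "dom A \<subseteq> C" using A_iff by blast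

lemma A_dense: "hdense H (dom A)"
proof (rule hdense_subspaceI)
  show "hsubspace H (dom A)" using linear_opD[OF A_linear] by (auto simp: hsubspace_def domIff)
  fix v assume v: "v \<in> C" and o: "\<And>k. k \<in> dom A \<Longrightarrow> hinner H v k = 0"
  have "hinner H (cosine v) w = 0" if w: "w \<in> C" for w
    using o[of "cosine w"] A_cos w trig_selfadjoint(1)[OF v w] by auto
  then have "cosine v = hzero H" using inner_self_zero v by simp
  then show "v = hzero H" by (rule cos_inj[OF v])
qed

lemma A_positive_selfadjoint: "positive_selfadjoint H A"
  unfolding positive_selfadjoint_def densely_defined_def
proof (intro conjI ballI A_linear A_dense)
  have "op_adjoint H A y = Some z \<longleftrightarrow> A y = Some z" for y z
  proof -
    have "op_adjoint H A y = Some z \<longleftrightarrow> y \<in> C \<and> z \<in> C \<and> (\<forall>x\<in>dom A. hinner H (ap A x) y = hinner H x z)"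
      using op_adjoint_iff[OF A_dense A_dom] by (simp add: adjoint_at_def)
    also have "\<dots> \<longleftrightarrow> y \<in> C \<and> z \<in> C \<and> (\<forall>w\<in>C. hinner H (sine w) y = hinner H (cosine w) z)"
    proof -
      have "dom A = cosine ` C" using A_cos by (auto simp: dom_def image_iff)
      moreover have "ap A (cosine w) = sine w" if "w \<in> C" for w using A_cos that by (metis option.sel)
      ultimately show ?thesis by simp
    qed
    also have "\<dots> \<longleftrightarrow> y \<in> C \<and> z \<in> C \<and> (\<forall>w\<in>C. hinner H w (sine y) = hinner H w (cosine z))"
      using trig_selfadjoint by auto
    also have "\<dots> \<longleftrightarrow> A y = Some z"
    proof -
      have "sine y = cosine z" if c: "y \<in> C" "z \<in> C" "\<forall>w\<in>C. hinner H w (sine y) = hinner H w (cosine z)"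
      proof (rule inner_ext)
        fix w assume "w \<in> C"
        then show "hinner H (sine y) w = hinner H (cosine z) w"
          using c inner_cnj[of w "sine y"] inner_cnj[of w "cosine z"] by simp
      qed (use c in auto)
      then show ?thesis unfolding A_iff by auto
    qed
    finally show ?thesis .
  qed
  then show "op_adjoint H A = A" by (rule map_eqI)
  fix x assume "x \<in> dom A"
  then obtain w where w: "w \<in> C" "x = cosine w" "A x = Some (sine w)" using A_cos by blast
  have b: "bdd (\<lambda>t. sqrt (1 - t) * sqrt t)" by (rule bdd_mult[OF bdd_sqrt(2,1)])
  have "hinner H (sine w) x = hinner H (ap (Phi (\<lambda>t. sqrt (1 - t) * sqrt t)) w) w"
    using trig_Phi(1)[OF bdd_sqrt(2) w(1)] w trig_selfadjoint(1)[of "sine w" w] by (simp add: sine_def)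
  also have "0 \<le> Re \<dots>"
  proof -
    have "AE t in mu w. 0 \<le> sqrt (1 - t) * sqrt t" using mu_props(3)[OF w(1)] by eventually_elim simp
    then show ?thesis unfolding Phi_quad[OF b w(1)] by (simp add: Bochner_Integration.integral_nonneg_AE)
  qed
  finally show "0 \<le> Re (hinner H (ap A x) x)" using w(3) by simp
qed

lemma T_dom: "dom T \<subseteq> C" using linear_opD(1)[OF T_lin] by blast

text \<open>\<open>T* T = R^(-1) - 1\<close>, written without inverses.\<close>

lemma TT_iff: "(op_adjoint H T \<circ>\<^sub>m T) x = Some z \<longleftrightarrow> x \<in> C \<and> z \<in> C \<and> x = r (hadd H x z)"
proof -
  have adj: "op_adjoint H T y = Some z \<longleftrightarrow> adjoint_at H T y z" for y z
    by (rule op_adjoint_iff) (use T_dense T_dom in \<open>auto simp: densely_defined_def\<close>)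
  show ?thesis
  proof
    assume "(op_adjoint H T \<circ>\<^sub>m T) x = Some z"
    then obtain y where y: "T x = Some y" "adjoint_at H T y z"
      using adj by (auto simp: map_comp_def split: option.splits)
    have c: "x \<in> C" "y \<in> C" "z \<in> C" using y linear_opD(1,2)[OF T_lin] by (auto simp: adjoint_at_def)
    have "ap (p11 T) (hadd H x z) = x"
    proof (rule col1_unique(1)[OF T_closed _ y(1)])
      fix a b assume ab: "T a = Some b"
      then have abC: "a \<in> C" "b \<in> C" using linear_opD(1,2)[OF T_lin] by blast+
      have "hinner H b y = hinner H a z" using y(2) ab unfolding adjoint_at_def by force
      then have "hinner H y b = hinner H z a" using inner_cnj abC c by metis
      then show "hinner H (hadd H x z) a = hinner H x a + hinner H y b" using abC c by simp
    qed (use c in auto)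
    then show "x \<in> C \<and> z \<in> C \<and> x = r (hadd H x z)" using c by (simp add: r_def)
  next
    assume *: "x \<in> C \<and> z \<in> C \<and> x = r (hadd H x z)"
    define w where "w = hadd H x z"
    have w: "w \<in> C" "x = r w" using * by (auto simp: w_def)
    have Tx: "T x = Some (S w)" using T_R[OF w(1)] w(2) by simp
    have "adjoint_at H T (S w) z" unfolding adjoint_at_def
    proof (intro conjI ballI)
      fix a assume "a \<in> dom T"
      then obtain b where b: "T a = Some b" by blast
      then have abC: "a \<in> C" "b \<in> C" using linear_opD(1,2)[OF T_lin] by blast+
      have "hinner H w a = hinner H (r w) a + hinner H (S w) b" by (rule inner_RS[OF w(1) b])
      moreover have "hinner H w a = hinner H x a + hinner H z a" unfolding w_def using * abC by simp
      ultimately have "hinner H z a = hinner H (S w) b" using w by simp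
      then show "hinner H (ap T a) (S w) = hinner H a z"
        using b inner_cnj[of z a] inner_cnj[of "S w" b] abC * w by simp
    qed (use * w in auto)
    then show "(op_adjoint H T \<circ>\<^sub>m T) x = Some z" using adj Tx by (simp add: map_comp_def)
  qed
qed

lemma A_square: "A \<circ>\<^sub>m A = op_adjoint H T \<circ>\<^sub>m T"
proof (rule map_eqI, unfold TT_iff)
  fix x z
  have "(A \<circ>\<^sub>m A) x = Some z \<longleftrightarrow> (\<exists>y. A x = Some y \<and> A y = Some z)" by (auto simp: map_comp_def split: option.splits)
  also have "\<dots> \<longleftrightarrow> x \<in> C \<and> z \<in> C \<and> x = r (hadd H x z)"
  proof
    assume "\<exists>y. A x = Some y \<and> A y = Some z"
    then obtain y where y: "y \<in> C" "sine x = cosine y" "sine y = cosine z" and c: "x \<in> C" "z \<in> C" using A_iff by blast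
    have "sine (sine x) = cosine (cosine z)" using y c by (simp add: trig_commute[symmetric])
    then have e: "hdiff H x (r x) = r z" using c by (simp add: sin_sin cos_cos)
    have "x = hadd H (r x) (hdiff H x (r x))" by (rule inner_ext) (use c in auto)
    then show "x \<in> C \<and> z \<in> C \<and> x = r (hadd H x z)"
      using c e bounded_opsD(5)[OF R_bounded] by (simp add: r_def)
  next
    assume *: "x \<in> C \<and> z \<in> C \<and> x = r (hadd H x z)"
    define u where "u = hadd H x z"
    have u: "u \<in> C" "x = r u" "x \<in> C" "z \<in> C" using * by (simp_all add: u_def)
    have "sine x = sine (cosine (cosine u))" unfolding cos_cos[OF u(1)] u(2)[symmetric] ..
    also have "\<dots> = cosine (cosine (sine u))"
      unfolding trig_commute[OF trig_closed(1)[OF u(1)], symmetric] trig_commute[OF u(1), symmetric] ..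
    finally have 1: "sine x = cosine (cosine (sine u))" .
    have 2: "sine (cosine (sine u)) = cosine z"
    proof -
      have "sine (cosine (sine u)) = cosine (hdiff H u (r u))"
        unfolding trig_commute[OF trig_closed(2)[OF u(1)], symmetric] sin_sin[OF u(1)] ..
      also have "hdiff H u (r u) = z" unfolding u(2)[symmetric] unfolding u_def by (rule inner_ext) (use u(3,4) in simp_all)
      finally show ?thesis .
    qed
    show "\<exists>y. A x = Some y \<and> A y = Some z"
      by (rule exI[of _ "cosine (sine u)"]) (simp add: A_iff 1 2 u(1,3,4))
  qed
  finally show "(A \<circ>\<^sub>m A) x = Some z \<longleftrightarrow> x \<in> C \<and> z \<in> C \<and> x = r (hadd H x z)" .
qed

section \<open>The spectral measure of the absolute value\<close>

definition E :: "real set \<Rightarrow> 'v operator" where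
  "E B = Phi (indicator (modulus -` B))"

lemma modulus_vimage: "B \<in> sets borel \<Longrightarrow> modulus -` B \<in> sets borel"
  using measurable_sets_borel[OF modulus_measurable] by simp

lemma bdd_modulus_vimage [simp]: "B \<in> sets borel \<Longrightarrow> bdd (indicator (modulus -` B))"
  using bdd_indicator modulus_vimage by blast

lemma Phi_indicator_projection:
  assumes B: "B \<in> sets borel"
  shows "projection_op H (Phi (indicator B))"
proof -
  have bdd: "bdd (indicator B)" using B by simp
  note b = Phi_bounded[OF bdd]
  have "(\<lambda>t. indicator B t * indicator B t :: real) = indicator B" by (auto simp: indicator_def)
  then have "Phi (indicator B) \<circ>\<^sub>m Phi (indicator B) = Phi (indicator B)"
    using Phi_mult[OF bdd bdd] by (intro op_eqI comp_bounded b) (simp add: b)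
  moreover have "op_adjoint H (Phi (indicator B)) = Phi (indicator B)"
    by (rule adjoint_eqI[OF b b]) (rule Phi_selfadjoint[OF bdd])
  ultimately show ?thesis using b by (simp add: projection_op_def)
qed

lemma E_pvm: "projection_valued_measure H E"
  unfolding projection_valued_measure_def
proof (intro conjI ballI allI impI; (elim conjE)?)
  fix B :: "real set" assume B: "B \<in> sets borel"
  show "projection_op H (E B)" unfolding E_def by (rule Phi_indicator_projection[OF modulus_vimage[OF B]])
next
  have "indicator (modulus -` UNIV) = (\<lambda>t. 1 :: real)" by auto
  then show "E UNIV = scalar_op H 1" unfolding E_def
    by (intro op_eqI Phi_bounded) (simp_all add: Phi_one scale_one)
next
  fix B D :: "real set" assume B: "B \<in> sets borel" and D: "D \<in> sets borel"
  have "(\<lambda>t. indicator (modulus -` B) t * indicator (modulus -` D) t :: real) = indicator (modulus -` (B \<inter> D))"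
    by (auto simp: indicator_def)
  then show "E (B \<inter> D) = E B \<circ>\<^sub>m E D" unfolding E_def
    using Phi_mult[OF bdd_modulus_vimage[OF B] bdd_modulus_vimage[OF D]] B D
    by (intro op_eqI comp_bounded Phi_bounded) (simp_all add: Phi_bounded del: vimage_Int)
next
  fix B :: "nat \<Rightarrow> real set" and x y
  assume B: "range B \<subseteq> sets borel" "disjoint_family B" and x: "x \<in> C" and y: "y \<in> C"
  have Bi: "B i \<in> sets borel" for i using B by blast
  have sb: "bdd (\<lambda>t. \<Sum>i<n. indicator (modulus -` B i) t)" for n
  proof (induction n)
    case (Suc n)
    then show ?case using bdd_lin[OF Suc bdd_modulus_vimage[OF Bi[of n]], of 1 1] by simp
  qed simp
  have sum: "hinner H (ap (Phi (\<lambda>t. \<Sum>i<n. indicator (modulus -` B i) t)) x) y = (\<Sum>i<n. hinner H (ap (E (B i)) x) y)" for n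
  proof (induction n)
    case 0
    then show ?case using Phi_lin[of "\<lambda>t. 1" "\<lambda>t. 1" x 0 0] Phi_one x y by simp
  next
    case (Suc n)
    then show ?case using Phi_lin[OF sb[of n] bdd_modulus_vimage[OF Bi[of n]] x, of 1 1] sb[of n] Bi x y
      by (simp add: E_def)
  qed
  have dis: "disjoint_family (\<lambda>i. modulus -` B i)" using B(2) by (auto simp: disjoint_family_on_def)
  have lim: "(\<lambda>n. hinner H (ap (Phi (\<lambda>t. \<Sum>i<n. indicator (modulus -` B i) t)) x) y) \<longlonglongrightarrow> hinner H (ap (E (\<Union>i. B i)) x) y"
    unfolding E_def
  proof (rule Phi_limit(2)[where K = 1])
    show "(indicator (modulus -` (\<Union>i. B i)) :: real \<Rightarrow> real) \<in> borel_measurable borel"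
      by (rule bdd_meas[OF bdd_modulus_vimage]) (use Bi in auto)
    fix t :: real
    have "(\<lambda>i. indicator (modulus -` B i) t :: real) sums indicator (\<Union>i. modulus -` B i) t"
      using dis by (intro indicator_sums) (auto simp: disjoint_family_on_def)
    then show "(\<lambda>n. \<Sum>i<n. indicator (modulus -` B i) t) \<longlonglongrightarrow> (indicator (modulus -` (\<Union>i. B i)) t :: real)"
      by (simp add: sums_def vimage_UN)
    fix n
    have "(\<Sum>i<n. indicator (modulus -` B i) t :: real) = indicator (\<Union>i<n. modulus -` B i) t"
      using dis by (subst indicator_UN_disjoint) (auto simp: disjoint_family_on_def)
    then show "\<bar>\<Sum>i<n. indicator (modulus -` B i) t :: real\<bar> \<le> 1" by (simp add: indicator_def)
  qed (use sb x y in auto)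
  then show "(\<lambda>i. hinner H (ap (E (B i)) x) y) sums hinner H (ap (E (\<Union>i. B i)) x) y"
    unfolding sum sums_def .
qed

lemma modulus_measurable_mu: "x \<in> C \<Longrightarrow> modulus \<in> borel_measurable (mu x)"
  using modulus_measurable mu_props(2)[of x] measurable_cong_sets by blast

lemma spectral_distr_E:
  assumes x: "x \<in> C"
  shows "spectral_distr H E x = distr (mu x) borel modulus"
proof (rule measure_eqI)
  fix B assume "B \<in> sets (spectral_distr H E x)"
  then have B: "B \<in> sets borel" by simp
  interpret finite_measure "mu x" using mu_props(1)[OF x] .
  have "emeasure (spectral_distr H E x) B = ennreal (LINT t|mu x. indicator (modulus -` B) t)"
    unfolding emeasure_spectral_distr[OF E_pvm x B] E_def Phi_quad[OF bdd_modulus_vimage[OF B] x] by simp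
  also have "\<dots> = emeasure (mu x) (modulus -` B)"
    using modulus_vimage[OF B] mu_props(2)[OF x] mu_space[OF x] by (simp add: emeasure_eq_measure)
  also have "\<dots> = emeasure (distr (mu x) borel modulus) B"
    using modulus_measurable_mu[OF x] B mu_space[OF x] by (simp add: emeasure_distr)
  finally show "emeasure (spectral_distr H E x) B = emeasure (distr (mu x) borel modulus) B" .
qed simp

text \<open>\<open>\<langle>f(R) cosine w, cosine w\<rangle> = \<langle>f(R) R w, w\<rangle>\<close>, since \<open>cosine\<^sup>2 = R\<close>.\<close>

lemma mu_cosine:
  assumes w: "w \<in> C" shows "mu (cosine w) = density (mu w) (\<lambda>t. ennreal t)"
proof (rule measure_eqI)
  have x: "cosine w \<in> C" using w by simp
  show "sets (mu (cosine w)) = sets (density (mu w) (\<lambda>t. ennreal t))" using mu_props(2) x w by simp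
  fix B assume "B \<in> sets (mu (cosine w))"
  then have B: "B \<in> sets borel" using mu_props(2)[OF x] by simp
  interpret finite_measure "mu (cosine w)" using mu_props(1)[OF x] .
  have bi: "bdd (\<lambda>t. indicator B t * t)" by (rule bdd_mult) (use B in auto)
  have "hinner H (ap (Phi (indicator B)) (cosine w)) (cosine w) = hinner H (ap (Phi (\<lambda>t. indicator B t * t)) w) w"
  proof -
    have "cosine (ap (Phi (indicator B)) (cosine w)) = ap (Phi (indicator B)) (r w)"
      using trig_Phi(1,2)[OF bdd_indicator[OF B], of "cosine w"] x cos_cos[OF w] by simp
    also have "\<dots> = ap (Phi (\<lambda>t. indicator B t * t)) w" by (rule Phi_mult_R[OF bdd_indicator[OF B] w])
    finally show ?thesis using trig_selfadjoint(1)[of "ap (Phi (indicator B)) (cosine w)" w] w B by simp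
  qed
  then have eq: "(LINT t|mu (cosine w). indicator B t) = (LINT t|mu w. indicator B t * t)"
    using Phi_quad[OF bdd_indicator[OF B] x] Phi_quad[OF bi w] by simp
  have "emeasure (mu (cosine w)) B = ennreal (LINT t|mu w. indicator B t * t)"
    using eq B mu_props(2)[OF x] mu_space[OF x] by (simp add: emeasure_eq_measure)
  also have "\<dots> = (\<integral>\<^sup>+t. ennreal (indicator B t * t) \<partial>mu w)"
    by (rule nn_integral_eq_integral[symmetric, OF bdd_integrable[OF bi w]])
       (use mu_props(3)[OF w] in \<open>auto elim!: eventually_mono\<close>)
  also have "\<dots> = emeasure (density (mu w) (\<lambda>t. ennreal t)) B"
    using B mu_props(2)[OF w] by (subst emeasure_density) (auto intro!: nn_integral_cong simp: indicator_def cong: measurable_cong_sets)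
  finally show "emeasure (mu (cosine w)) B = emeasure (density (mu w) (\<lambda>t. ennreal t)) B" .
qed

lemma mu_cosine_integral:
  assumes w: "w \<in> C" and g: "g \<in> borel_measurable borel"
  shows "integrable (mu (cosine w)) g \<longleftrightarrow> integrable (mu w) (\<lambda>t. t * g t)" "(LINT t|mu (cosine w). g t) = (LINT t|mu w. t * g t)"
proof -
  have m: "g \<in> borel_measurable (mu w)" "(\<lambda>t. t) \<in> borel_measurable (mu w)"
    using g mu_props(2)[OF w] by (simp_all cong: measurable_cong_sets)
  have pos: "AE t in mu w. 0 \<le> t" using mu_props(3)[OF w] by eventually_elim simp
  show "integrable (mu (cosine w)) g \<longleftrightarrow> integrable (mu w) (\<lambda>t. t * g t)"
    unfolding mu_cosine[OF w] using integrable_density[OF m pos] by simp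
  show "(LINT t|mu (cosine w). g t) = (LINT t|mu w. t * g t)"
    unfolding mu_cosine[OF w] using integral_density[OF m pos] by simp
qed

text \<open>
  For \<open>x = cosine w\<close> the integral becomes that of \<open>1 - t\<close> against \<open>mu w\<close>. Conversely, if
  the integral is finite, the vectors \<open>y n\<close> obtained from \<open>x\<close> by truncations of the
  modulus form a Cauchy sequence, and their limit \<open>z\<close> satisfies \<open>cosine z = sine x\<close>.
\<close>

lemma A_dom_integrable:
  assumes x: "x \<in> C" shows "x \<in> dom A \<longleftrightarrow> integrable (mu x) (\<lambda>t. (modulus t)\<^sup>2)"
proof
  assume "x \<in> dom A"
  then obtain w where w: "w \<in> C" "x = cosine w" using A_cos by blast
  have b: "bdd (\<lambda>t. t * (modulus t)\<^sup>2)"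
  proof (rule bddI[of _ 1])
    fix t :: real assume t: "t \<in> {0..1}"
    show "\<bar>t * (modulus t)\<^sup>2\<bar> \<le> 1" using t by (cases "t = 0") (auto simp: modulus_def field_simps)
  qed simp
  then show "integrable (mu x) (\<lambda>t. (modulus t)\<^sup>2)"
    unfolding w(2) using mu_cosine_integral(1)[OF w(1), of "\<lambda>t. (modulus t)\<^sup>2"] bdd_integrable[OF b w(1)] by simp
next
  assume i: "integrable (mu x) (\<lambda>t. (modulus t)\<^sup>2)"
  define g where "g n t = cutoff n t * modulus t" for n t
  have gb: "bdd (g n)" for n
  proof (rule bddI[of _ "real (Suc n)"])
    show "g n \<in> borel_measurable borel" unfolding g_def[abs_def] by measurable
    fix t :: real
    show "\<bar>g n t\<bar> \<le> real (Suc n)"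
    proof (cases "cutoff n t = 1")
      case True
      then have t: "0 < t" "t < 1" "1 / real (Suc n) \<le> t" using cutoff_eq_1 by auto
      then have "1 / t \<le> real (Suc n)" by (simp add: field_simps)
      also have "\<dots> \<le> (real (Suc n))\<^sup>2" by (simp add: power2_eq_square)
      finally have "modulus t \<le> sqrt ((real (Suc n))\<^sup>2)" unfolding modulus_def by (intro real_sqrt_le_mono) simp
      then show ?thesis using True t by (simp add: g_def modulus_def)
    qed (use cutoff_cases[of n t] in \<open>auto simp: g_def\<close>)
  qed
  define y where "y n = ap (Phi (g n)) x" for n
  have yC: "y n \<in> C" for n using gb x by (simp add: y_def)
  define a where "a n = (LINT t|mu x. (modulus t)\<^sup>2 * (1 - cutoff n t))" for n
  have fmx: "modulus \<in> borel_measurable (mu x)" "cutoff n \<in> borel_measurable (mu x)" for n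
    using mu_props(2)[OF x] modulus_measurable cutoff_measurable measurable_cong_sets by blast+
  have le: "norm ((modulus t)\<^sup>2 * (1 - cutoff n t)) \<le> (modulus t)\<^sup>2" for n t using cutoff_cases[of n t] by auto
  have ia: "integrable (mu x) (\<lambda>t. (modulus t)\<^sup>2 * (1 - cutoff n t))" for n
    by (rule Bochner_Integration.integrable_bound[OF i]) (use fmx le in auto)
  have "a \<longlonglongrightarrow> (LINT t|mu x. 0)"
    unfolding a_def
  proof (rule integral_dominated_convergence[OF _ _ i])
    show "AE t in mu x. (\<lambda>n. (modulus t)\<^sup>2 * (1 - cutoff n t)) \<longlonglongrightarrow> 0"
      using mu_AE_pos[OF x]
    proof eventually_elim
      case (elim t)
      have "(\<lambda>n. (modulus t)\<^sup>2 * (1 - cutoff n t)) \<longlonglongrightarrow> (modulus t)\<^sup>2 * (1 - indicator {0<..<1} t)"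
        by (intro tendsto_intros cutoff_lim)
      moreover have "(modulus t)\<^sup>2 * (1 - indicator {0<..<1} t) = 0" using elim by (cases "t = 1") (auto simp: modulus_def)
      ultimately show ?case by simp
    qed
  qed (use fmx le in auto)
  then have a0: "a \<longlonglongrightarrow> 0" by simp
  have step: "(hnorm H (hdiff H (y m) (y n)))\<^sup>2 \<le> a (min m n)" for m n
  proof -
    have b: "bdd (\<lambda>t. 1 * g m t + (-1) * g n t)" by (rule bdd_lin[OF gb gb])
    have "hdiff H (y m) (y n) = ap (Phi (\<lambda>t. 1 * g m t + (-1) * g n t)) x"
      unfolding Phi_lin[OF gb gb x] using yC[of m] by (simp add: y_def scale_one hdiff_def)
    then have "(hnorm H (hdiff H (y m) (y n)))\<^sup>2 = (LINT t|mu x. (1 * g m t + (-1) * g n t)\<^sup>2)"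
      using Phi_norm[OF b x] by simp
    also have "\<dots> \<le> a (min m n)" unfolding a_def
    proof (rule integral_mono[OF _ ia])
      show "integrable (mu x) (\<lambda>t. (1 * g m t + (-1) * g n t)\<^sup>2)"
        using bdd_integrable[OF bdd_mult[OF b b] x] by (simp add: power2_eq_square)
      fix t
      show "(1 * g m t + (-1) * g n t)\<^sup>2 \<le> (modulus t)\<^sup>2 * (1 - cutoff (min m n) t)"
        using cutoff_cases[of m t] cutoff_cases[of n t] cutoff_cases[of "min m n" t] cutoff_mono[of "min m n" m t] cutoff_mono[of "min m n" n t]
        by (auto simp: g_def)
    qed
    finally show ?thesis .
  qed
  have "hCauchy H y" unfolding hCauchy_def
  proof (intro allI impI)
    fix e :: real assume e: "e > 0"
    then have "\<forall>\<^sub>F n in sequentially. a n < e\<^sup>2" using order_tendstoD(2)[OF a0] by simp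
    then obtain N where N: "\<And>n. n \<ge> N \<Longrightarrow> a n < e\<^sup>2" by (auto simp: eventually_sequentially)
    have "hnorm H (hdiff H (y m) (y n)) < e" if "m \<ge> N" "n \<ge> N" for m n
      using order_le_less_trans[OF step N[of "min m n"]] that e by (auto intro: power_less_imp_less_base)
    then show "\<exists>N. \<forall>m\<ge>N. \<forall>n\<ge>N. hnorm H (hdiff H (y m) (y n)) < e" by blast
  qed
  then obtain z where z: "z \<in> C" "hlim H y z" using complete[of y, OF yC] by blast
  have "hlim H (\<lambda>n. cosine (y n)) (cosine z)"
    unfolding cosine_def by (rule hlim_ap[OF Phi_bounded[OF bdd_sqrt(1)] z(2) yC z(1)])
  moreover have "cosine (y n) = ap (Phi (\<lambda>t. cutoff n t * sqrt (1 - t))) x" for n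
  proof -
    have "(\<lambda>t. g n t * sqrt t) = (\<lambda>t. cutoff n t * sqrt (1 - t))"
    proof
      fix t
      show "g n t * sqrt t = cutoff n t * sqrt (1 - t)"
        using cutoff_cases[of n t] cutoff_eq_1[of n t] modulus_cos[of t] by (auto simp: g_def mult.commute)
    qed
    then show ?thesis unfolding y_def trig_Phi(1)[OF gb x] by simp
  qed
  moreover have "hlim H (\<lambda>n. ap (Phi (\<lambda>t. cutoff n t * sqrt (1 - t))) x) (ap (Phi (\<lambda>t. indicator {0<..<1} t * sqrt (1 - t))) x)"
  proof (rule Phi_strong_limit[where K = 1, OF bdd_mult[OF bdd_cutoff bdd_sqrt(2)] _ _ _ x])
    show "\<bar>cutoff n t * sqrt (1 - t)\<bar> \<le> 1" if "t \<in> {0..1}" for n and t :: real using that cutoff_cases[of n t] by auto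
  qed (auto intro!: tendsto_intros cutoff_lim)
  moreover have "ap (Phi (\<lambda>t. indicator {0<..<1} t * sqrt (1 - t))) x = sine x"
    unfolding sine_def by (rule Phi_support[OF bdd_mult[OF bdd_indicator bdd_sqrt(2)] bdd_sqrt(2) _ x]) (auto simp: indicator_def)
  ultimately have l: "hlim H (\<lambda>n. cosine (y n)) (cosine z)" "hlim H (\<lambda>n. cosine (y n)) (sine x)" by simp_all
  have "cosine z = sine x" by (rule hlim_unique[OF l]) (use z(1) x yC in simp_all)
  then have "A x = Some z" unfolding A_iff using z(1) x by simp
  then show "x \<in> dom A" by blast
qed

lemma A_spectral_resolution: "spectral_resolution H A E"
  unfolding spectral_resolution_def
proof (intro conjI ballI A_linear E_pvm)
  have "integrable (spectral_distr H E x) (\<lambda>t. t\<^sup>2) \<longleftrightarrow> integrable (mu x) (\<lambda>t. (modulus t)\<^sup>2)" if "x \<in> C" for x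
    unfolding spectral_distr_E[OF that] by (rule integrable_distr_eq[OF modulus_measurable_mu[OF that]]) simp
  then show "dom A = {x \<in> C. integrable (spectral_distr H E x) (\<lambda>t. t\<^sup>2)}"
    using A_dom A_dom_integrable by blast
  fix x assume "x \<in> dom A"
  then obtain w where w: "w \<in> C" "x = cosine w" "A x = Some (sine w)" using A_cos by blast
  have b: "bdd (\<lambda>t. sqrt (1 - t) * sqrt t)" by (rule bdd_mult[OF bdd_sqrt(2,1)])
  have "hinner H (sine w) x = hinner H (ap (Phi (\<lambda>t. sqrt (1 - t) * sqrt t)) w) w"
    using trig_Phi(1)[OF bdd_sqrt(2) w(1)] w trig_selfadjoint(1)[of "sine w" w] by (simp add: sine_def)
  also have "\<dots> = complex_of_real (LINT t|mu w. sqrt (1 - t) * sqrt t)" by (rule Phi_quad[OF b w(1)])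
  also have "(LINT t|mu w. sqrt (1 - t) * sqrt t) = (LINT t|mu w. t * modulus t)"
  proof (rule integral_cong_AE)
    show "AE t in mu w. sqrt (1 - t) * sqrt t = t * modulus t"
      using mu_AE_pos[OF w(1)]
    proof eventually_elim
      case (elim t)
      have "sqrt (1 - t) * sqrt t = (sqrt t * sqrt t) * modulus t" unfolding modulus_cos[OF elim, symmetric] by (simp only: mult_ac)
      then show ?case using elim by simp
    qed
    show "(\<lambda>t. t * modulus t) \<in> borel_measurable (mu w)" "(\<lambda>t. sqrt (1 - t) * sqrt t) \<in> borel_measurable (mu w)"
      using mu_props(2)[OF w(1)] by (simp_all cong: measurable_cong_sets)
  qed
  also have "\<dots> = (LINT t|spectral_distr H E x. t)"
    unfolding w(2) mu_cosine_integral(2)[OF w(1) modulus_measurable, symmetric] spectral_distr_E[OF trig_closed(1)[OF w(1)]]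
    by (rule integral_distr[OF modulus_measurable_mu[OF trig_closed(1)[OF w(1)]], symmetric]) simp
  finally show "hinner H (ap A x) x = complex_of_real (LINT t|spectral_distr H E x. t)" using w(3) by simp
qed

section \<open>The phase\<close>

text \<open>
  The eigenspace of \<open>R\<close> at \<open>1\<close> is the kernel of \<open>T\<close>, so \<open>Q\<close> projects onto the initial
  space of the phase.
\<close>

abbreviation "Q \<equiv> Phi (indicator {0<..<1})"

lemma bdd_Q [simp]: "bdd (indicator {0<..<1})" by simp

lemma Q_lim: "x \<in> C \<Longrightarrow> hlim H (\<lambda>n. ap (Phi (cutoff n)) x) (ap Q x)"
  by (rule Phi_strong_limit[where K = 1]) (use cutoff_lim in \<open>auto simp: cutoff_def indicator_def\<close>)

text \<open>Formally the phase is \<open>T A^(-1) = S R^(-1/2) (1 - R)^(-1/2)\<close>.\<close>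

abbreviation "Vn n x \<equiv> S (ap (Phi (weight n)) x)"

text \<open>\<open>S* S = R - R\<^sup>2\<close>, so that the weights leave only the cut-offs.\<close>

lemma Vn_inner:
  assumes x: "x \<in> C" and y: "y \<in> C"
  shows "hinner H (Vn n x) (Vn m y) = hinner H (ap (Phi (cutoff n)) x) (ap (Phi (cutoff m)) y)"
proof -
  have sc: "sine (cosine (ap (Phi (weight k)) z)) = ap (Phi (cutoff k)) z" if "z \<in> C" for k z
  proof -
    have b: "bdd (\<lambda>t. weight k t * sqrt t)" by (rule bdd_mult[OF bdd_weight bdd_sqrt(1)])
    have "sine (cosine (ap (Phi (weight k)) z)) = ap (Phi (\<lambda>t. weight k t * sqrt t * sqrt (1 - t))) z"
      unfolding trig_Phi(1)[OF bdd_weight that] trig_Phi(3)[OF b that] ..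
    then show ?thesis using weight_cancel[of k] by (simp add: mult.assoc)
  qed
  let ?u = "ap (Phi (weight n)) x" and ?v = "ap (Phi (weight m)) y"
  have u: "?u \<in> C" "?v \<in> C" using x y by auto
  have "hinner H (Vn n x) (Vn m y) = hinner H ?u (hdiff H (r ?v) (r (r ?v)))"
    using SS[OF u] u r_selfadjoint[OF u(1), of "r ?v"] by simp
  also have "hdiff H (r ?v) (r (r ?v)) = cosine (sine (sine (cosine ?v)))"
    using u by (simp add: sin_sin trig_linear cos_cos) (simp add: cos_cos[symmetric])
  also have "hinner H ?u \<dots> = hinner H (sine (cosine ?u)) (sine (cosine ?v))"
    using u by (simp add: trig_selfadjoint)
  finally show ?thesis using sc x y by simp
qed

lemma Vn_diff:
  assumes x: "x \<in> C"
  shows "hnorm H (hdiff H (Vn n x) (Vn m x)) = hnorm H (hdiff H (ap (Phi (cutoff n)) x) (ap (Phi (cutoff m)) x))"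
proof -
  have "hinner H (hdiff H (Vn n x) (Vn m x)) (hdiff H (Vn n x) (Vn m x))
    = hinner H (hdiff H (ap (Phi (cutoff n)) x) (ap (Phi (cutoff m)) x)) (hdiff H (ap (Phi (cutoff n)) x) (ap (Phi (cutoff m)) x))"
    using x Vn_inner[OF x x] by simp
  then show ?thesis by (simp add: hnorm_def)
qed

lemma Vn_converges: "x \<in> C \<Longrightarrow> \<exists>z\<in>C. hlim H (\<lambda>n. Vn n x) z"
proof -
  assume x: "x \<in> C"
  show ?thesis by (rule dominated_converges[OF Q_lim[OF x], where K = 1]) (use x Vn_diff[OF x] in simp_all)
qed

definition Vlim :: "'v \<Rightarrow> 'v" where "Vlim x = (SOME z. z \<in> C \<and> hlim H (\<lambda>n. Vn n x) z)"
definition V :: "'v operator" where "V = mk_op H Vlim"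

lemma Vlim: "x \<in> C \<Longrightarrow> Vlim x \<in> C" "x \<in> C \<Longrightarrow> hlim H (\<lambda>n. Vn n x) (Vlim x)"
  using someI_ex[of "\<lambda>z. z \<in> C \<and> hlim H (\<lambda>n. Vn n x) z"] Vn_converges[of x] unfolding Vlim_def by blast+

lemma Vlim_eqI: "x \<in> C \<Longrightarrow> z \<in> C \<Longrightarrow> hlim H (\<lambda>n. Vn n x) z \<Longrightarrow> Vlim x = z"
  using hlim_unique[OF Vlim(2)[of x]] Vlim(1) by simp

lemma Vlim_inner: "x \<in> C \<Longrightarrow> y \<in> C \<Longrightarrow> hinner H (Vlim x) (Vlim y) = hinner H (ap Q x) y"
proof -
  assume x: "x \<in> C" and y: "y \<in> C"
  have "(\<lambda>n. hinner H (Vn n x) (Vn n y)) \<longlonglongrightarrow> hinner H (Vlim x) (Vlim y)"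
    by (rule hlim_inner) (use Vlim x y in auto)
  moreover have "(\<lambda>n. hinner H (ap (Phi (cutoff n)) x) (ap (Phi (cutoff n)) y)) \<longlonglongrightarrow> hinner H (ap Q x) (ap Q y)"
    by (rule hlim_inner) (use Q_lim x y in auto)
  ultimately have "hinner H (Vlim x) (Vlim y) = hinner H (ap Q x) (ap Q y)"
    using Vn_inner[OF x y] LIMSEQ_unique by simp
  then show ?thesis using projection_opD(2,3)[OF Phi_indicator_projection] x y by simp
qed

lemma Vn_lin: "x \<in> C \<Longrightarrow> y \<in> C \<Longrightarrow> Vn n (hadd H x y) = hadd H (Vn n x) (Vn n y)"
  "x \<in> C \<Longrightarrow> Vn n (hscale H a x) = hscale H a (Vn n x)"
  using S_lin bounded_opsD(5,6)[OF Phi_bounded[OF bdd_weight]] by simp_all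

lemma V_bounded: "V \<in> bounded_ops H"
  unfolding V_def
proof (rule mk_op_bounded[where k = 1])
  fix x y assume c: "x \<in> C" "y \<in> C"
  show "Vlim (hadd H x y) = hadd H (Vlim x) (Vlim y)"
    by (rule Vlim_eqI) (use c hlim_add[OF Vlim(2)[OF c(1)] _ Vlim(1)[OF c(1)] Vlim(2)[OF c(2)] _ Vlim(1)[OF c(2)]]
        in \<open>simp_all add: Vlim(1) Vn_lin\<close>)
next
  fix a x assume c: "x \<in> C"
  show "Vlim (hscale H a x) = hscale H a (Vlim x)"
    by (rule Vlim_eqI) (use c hlim_scale[OF Vlim(2)[OF c] _ Vlim(1)[OF c]] in \<open>simp_all add: Vlim(1) Vn_lin\<close>)
next
  fix x assume c: "x \<in> C"
  have "(hnorm H (Vlim x))\<^sup>2 = (hnorm H (ap Q x))\<^sup>2"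
    using Vlim_inner[OF c c] projection_opD(4)[OF Phi_indicator_projection c] by (simp add: hnorm_sq Vlim(1) c)
  also have "\<dots> \<le> 1 * (hnorm H x)\<^sup>2"
  proof -
    have "\<bar>LINT t|mu x. indicator {0<..<1} t\<bar> \<le> 1 * (hnorm H x)\<^sup>2"
      by (rule integral_mu_bound[OF bdd_Q c]) (simp add: indicator_def)
    then show ?thesis using projection_opD(4)[OF Phi_indicator_projection c, of "{0<..<1}"] Phi_quad[OF bdd_Q c] by simp
  qed
  finally show "hnorm H (Vlim x) \<le> 1 * hnorm H x" using c power2_le_imp_le[of "hnorm H (Vlim x)" "hnorm H x"] by simp
qed (rule Vlim(1))

lemma V_ap: "x \<in> C \<Longrightarrow> ap V x = Vlim x" by (simp add: V_def)

lemma VV: assumes x: "x \<in> C" shows "ap (op_adjoint H V) (ap V x) = ap Q x"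
proof (rule inner_ext)
  note a = adjoint_bounded[OF V_bounded] and v = bounded_opsD(4)[OF V_bounded]
  show "ap (op_adjoint H V) (ap V x) \<in> C" "ap Q x \<in> C" using bounded_opsD(4)[OF a(1) v[OF x]] x by auto
  fix y assume y: "y \<in> C"
  show "hinner H (ap (op_adjoint H V) (ap V x)) y = hinner H (ap Q x) y"
    using adjoint_bounded(2)[OF a(1) v[OF x] y] adjoint_adjoint[OF V_bounded] Vlim_inner[OF x y] x y by (simp add: V_ap)
qed

lemma V_partial_isometry: "partial_isometry H V"
proof -
  note a = adjoint_bounded[OF V_bounded]
  have "op_adjoint H V \<circ>\<^sub>m V = Q"
    by (rule op_eqI[OF comp_bounded[OF a(1) V_bounded] Phi_bounded[OF bdd_Q]]) (simp add: VV V_bounded)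
  then show ?thesis using V_bounded Phi_indicator_projection[of "{0<..<1}"] by (simp add: partial_isometry_def)
qed

lemma T_fixed: "x \<in> C \<Longrightarrow> r x = x \<longleftrightarrow> T x = Some (hzero H)"
proof
  assume x: "x \<in> C"
  { assume e: "r x = x"
    have "hinner H (S x) (S x) = 0" using SS[OF x x] x e by simp
    then have "S x = hzero H" using inner_self_zero x by simp
    then show "T x = Some (hzero H)" using T_R[OF x] e by simp }
  { assume T0: "T x = Some (hzero H)"
    show "r x = x" unfolding r_def
      by (rule col1_unique(1)[OF T_closed x T0]) (use linear_opD(2)[OF T_lin] in auto) }
qed

lemma sine_Q:
  assumes x: "x \<in> C" shows "sine (ap Q x) = sine x" "ap Q (sine x) = sine x"
proof -
  have "ap (Phi (\<lambda>t. indicator {0<..<1} t * sqrt (1 - t))) x = sine x"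
    unfolding sine_def by (rule Phi_support[OF bdd_mult[OF bdd_Q bdd_sqrt(2)] bdd_sqrt(2) _ x]) (auto simp: indicator_def)
  then show "sine (ap Q x) = sine x" "ap Q (sine x) = sine x" using trig_Phi(3,4)[OF bdd_Q x] by simp_all
qed

lemma sine_zero_iff: "x \<in> C \<Longrightarrow> sine x = hzero H \<longleftrightarrow> r x = x"
proof
  assume x: "x \<in> C"
  show "r x = x" if "sine x = hzero H" using sin_sin[OF x] that hdiff_eq_0[OF x, of "r x"] x by (simp add: trig_zero)
  assume "r x = x"
  then have "sine (sine x) = hzero H" using sin_sin[OF x] diff_self x by simp
  then have "hinner H (sine x) (sine x) = 0" using trig_selfadjoint(2)[of x "sine x"] x by simp
  then show "sine x = hzero H" using inner_self_zero x by simp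
qed

lemma Q_zero_iff: "x \<in> C \<Longrightarrow> ap Q x = hzero H \<longleftrightarrow> r x = x"
proof
  assume x: "x \<in> C"
  show "r x = x" if "ap Q x = hzero H" using sine_Q(1)[OF x] that trig_zero(2) sine_zero_iff[OF x] by simp
  assume "r x = x"
  then have s: "sine x = hzero H" using sine_zero_iff[OF x] by simp
  have "ap (Phi (cutoff n)) x = hzero H" for n
  proof -
    have "(\<lambda>t. weight n t * sqrt t * sqrt (1 - t)) = cutoff n" using weight_cancel by (simp add: mult.assoc)
    then have "ap (Phi (cutoff n)) x = ap (Phi (\<lambda>t. weight n t * sqrt t)) (sine x)"
      using trig_Phi(4)[OF bdd_mult[OF bdd_weight bdd_sqrt(1)] x] by simp
    then show ?thesis using s bounded_opsD(8)[OF Phi_bounded[OF bdd_mult[OF bdd_weight bdd_sqrt(1)]]] by simp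
  qed
  then show "ap Q x = hzero H" using hlim_unique[OF Q_lim[OF x] , of "hzero H"] x by simp
qed

lemma V_kernel: "op_kernel H V = op_kernel H T"
proof -
  have "V x = Some (hzero H) \<longleftrightarrow> T x = Some (hzero H)" for x
  proof (cases "x \<in> C")
    case True
    have "V x = Some (hzero H) \<longleftrightarrow> Vlim x = hzero H" using True by (simp add: V_def mk_op_def)
    also have "\<dots> \<longleftrightarrow> ap Q x = hzero H"
    proof -
      have "(hnorm H (Vlim x))\<^sup>2 = (hnorm H (ap Q x))\<^sup>2"
        using Vlim_inner[OF True True] projection_opD(4)[OF Phi_indicator_projection True] by (simp add: hnorm_sq Vlim(1) True)
      then have "hnorm H (Vlim x) = 0 \<longleftrightarrow> hnorm H (ap Q x) = 0" by (metis power_eq_0_iff zero_power2)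
      then show ?thesis using hnorm_eq_0 Vlim(1) True by simp
    qed
    also have "\<dots> \<longleftrightarrow> T x = Some (hzero H)" using Q_zero_iff T_fixed True by simp
    finally show ?thesis .
  next
    case False
    then show ?thesis using linear_opD(1)[OF T_lin] by (auto simp: V_def mk_op_def)
  qed
  then show ?thesis by (simp add: op_kernel_def)
qed

text \<open>
  On the initial space of the phase this is \<open>T R = S\<close> in the limit; on the kernel of \<open>T\<close>
  both sides vanish.
\<close>

lemma T_cos:
  assumes w: "w \<in> C" shows "T (cosine w) = Some (ap V (sine w))"
proof -
  have Qw: "ap Q w \<in> C" using w by simp
  have 1: "T (cosine (ap Q w)) = Some (ap V (sine w))"
  proof (rule closed_op_limit[OF T_closed])
    show "T (cosine (ap (Phi (cutoff n)) w)) = Some (Vn n (sine w))" for n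
    proof -
      have b: "bdd (\<lambda>t. weight n t * sqrt (1 - t))" "bdd (\<lambda>t. weight n t * sqrt (1 - t) * sqrt t)" using bdd_mult by simp_all
      have "r (ap (Phi (weight n)) (sine w)) = ap (Phi (\<lambda>t. weight n t * sqrt (1 - t) * sqrt t * sqrt t)) w"
        unfolding trig_Phi(4)[OF bdd_weight w] cos_cos[OF Phi_closed[OF b(1) w], symmetric] trig_Phi(1)[OF b(1) w] trig_Phi(1)[OF b(2) w] ..
      also have "(\<lambda>t. weight n t * sqrt (1 - t) * sqrt t * sqrt t) = (\<lambda>t. cutoff n t * sqrt t)"
        using weight_cancel[of n] by (simp add: mult_ac fun_eq_iff)
      also have "ap (Phi (\<lambda>t. cutoff n t * sqrt t)) w = cosine (ap (Phi (cutoff n)) w)" by (rule trig_Phi(1)[OF bdd_cutoff w, symmetric])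
      finally show ?thesis using T_R[of "ap (Phi (weight n)) (sine w)"] w by simp
    qed
    show "hlim H (\<lambda>n. cosine (ap (Phi (cutoff n)) w)) (cosine (ap Q w))"
      unfolding cosine_def by (rule hlim_ap[OF Phi_bounded[OF bdd_sqrt(1)] Q_lim[OF w]]) (use w in auto)
    show "hlim H (\<lambda>n. Vn n (sine w)) (ap V (sine w))" using Vlim(2) w by (simp add: V_ap)
  qed (use w Vlim(1) in \<open>simp_all add: V_ap\<close>)
  let ?v = "hdiff H w (ap Q w)"
  have v: "?v \<in> C" "sine ?v = hzero H" using w sine_Q(1)[OF w] diff_self by (simp_all add: trig_linear)
  have "r (cosine ?v) = cosine ?v"
    using sine_zero_iff[of "cosine ?v"] v trig_commute[OF v(1)] trig_linear(2)[OF zero_closed, of 0] by simp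
  then have 2: "T (cosine ?v) = Some (hzero H)" using T_fixed v by simp
  have "hadd H (cosine ?v) (cosine (ap Q w)) = cosine w"
    using trig_linear(1)[OF v(1) Qw] diff_add_cancel[OF w Qw] by simp
  then show ?thesis using linear_opD(4)[OF T_lin 2 1] zero_add[of "ap V (sine w)"] Vlim(1) w by (simp add: V_ap)
qed

lemma T_eq_VA: "T = V \<circ>\<^sub>m A"
proof (rule map_eqI)
  fix x y
  note v = bounded_opsD(3,4)[OF V_bounded] and a = adjoint_bounded[OF V_bounded]
  have "(V \<circ>\<^sub>m A) x = Some y \<longleftrightarrow> (\<exists>w\<in>C. x = cosine w \<and> y = ap V (sine w))"
  proof -
    have "(V \<circ>\<^sub>m A) x = Some y \<longleftrightarrow> (\<exists>z. A x = Some z \<and> V z = Some y)" by (auto simp: map_comp_def split: option.splits)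
    also have "\<dots> \<longleftrightarrow> (\<exists>w\<in>C. x = cosine w \<and> V (sine w) = Some y)" using A_cos by auto
    finally show ?thesis using v(1) trig_closed(2) by auto
  qed
  also have "\<dots> \<longleftrightarrow> T x = Some y"
  proof
    assume "\<exists>w\<in>C. x = cosine w \<and> y = ap V (sine w)"
    then show "T x = Some y" using T_cos by blast
  next
    assume xy: "T x = Some y"
    have c: "x \<in> C" "y \<in> C" using linear_opD(1,2)[OF T_lin xy] .
    let ?y = "ap (op_adjoint H V) y"
    have yC: "?y \<in> C" by (rule bounded_opsD(4)[OF a(1) c(2)])
    \<comment> \<open>with this \<open>w\<close>, the difference of \<open>(x, y)\<close> and \<open>(cosine w, V (sine w))\<close> is orthogonal to all \<open>(R u, S u)\<close>\<close>
    define w where "w = hadd H (cosine x) (sine ?y)"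
    have w: "w \<in> C" using c yC by (simp add: w_def)
    let ?x' = "hdiff H x (cosine w)" and ?y' = "hdiff H y (ap V (sine w))"
    have T': "T ?x' = Some ?y'" by (rule linear_opD(6)[OF T_lin xy T_cos[OF w]])
    have C': "?x' \<in> C" "?y' \<in> C" using linear_opD(1,2)[OF T_lin T'] .
    have "hinner H u ?x' = 0" if u: "u \<in> C" for u
    proof -
      have Su: "S u = ap V (sine (cosine u))" using T_R[OF u] T_cos[of "cosine u"] u by (simp add: cos_cos)
      have adj: "ap (op_adjoint H V) ?y' = hdiff H ?y (sine w)"
        using bounded_opsD(7)[OF a(1) c(2) v(2)[OF trig_closed(2)[OF w]]] VV[of "sine w"] w by (simp add: sine_Q)
      have "hinner H u ?x' = hinner H (r u) ?x' + hinner H (S u) ?y'" by (rule inner_RS[OF u T'])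
      also have "\<dots> = hinner H (cosine u) (cosine ?x') + hinner H (cosine u) (sine (hdiff H ?y (sine w)))"
        unfolding Su using a(2)[OF _ C'(2), of "sine (cosine u)"] u C' c w yC trig_selfadjoint
        by (simp add: adj cos_cos[symmetric] trig_linear)
      also have "\<dots> = hinner H (cosine u) (hadd H (cosine ?x') (sine (hdiff H ?y (sine w))))" using u C' yC w by simp
      also have "hadd H (cosine ?x') (sine (hdiff H ?y (sine w))) = hzero H"
        by (rule inner_ext) (use c w yC in \<open>simp_all add: trig_linear cos_cos sin_sin\<close>, simp add: w_def)
      finally show ?thesis using u by simp
    qed
    then have "?x' = hzero H" using inner_self_zero C'(1) by blast
    moreover from this have "?y' = hzero H" using T' linear_opD(3)[OF T_lin] by simp
    ultimately have "x = cosine w" "y = ap V (sine w)" using hdiff_eq_0 c w v(2) by simp_all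
    then show "\<exists>w\<in>C. x = cosine w \<and> y = ap V (sine w)" using w by blast
  qed
  finally show "T x = Some y \<longleftrightarrow> (V \<circ>\<^sub>m A) x = Some y" by blast
qed

lemma T_polar_decomposition: "polar_decomposition H T V A"
  unfolding polar_decomposition_def
  using A_positive_selfadjoint A_square V_partial_isometry T_eq_VA V_kernel by blast

text \<open>
  The spectral projections are Borel functions of \<open>R = p11 T\<close>, and the phase is a strong
  limit of products of \<open>p21 T\<close> with such functions. All of these commute with the
  commutant of \<open>M\<close>.
\<close>

theorem entries_imp_affiliated:
  assumes M: "von_neumann_algebra H M" and p11: "p11 T \<in> M" and p21: "p21 T \<in> M"
  shows "affiliated H M T"
proof -
  have UR: "ap U (ap (p11 T) x) = ap (p11 T) (ap U x)" "ap U (S x) = S (ap U x)" if "U \<in> commutant H M" "x \<in> C" for U x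
    using vnaD(3)[OF M p11] vnaD(3)[OF M p21] that by (simp_all add: S_def)
  have UPhi: "ap U (ap (Phi f) x) = ap (Phi f) (ap U x)" if "U \<in> commutant H M" "x \<in> C" "bdd f" for U x f
    by (rule Phi_commute[OF vnaD(5)[OF M that(1)] UR(1)[OF that(1)] that(3,2)])
  have "E B \<in> M" if B: "B \<in> sets borel" for B
    unfolding E_def by (rule vna_memI[OF M Phi_bounded]) (use B UPhi in auto)
  moreover have "V \<in> M"
  proof (rule vna_memI[OF M V_bounded])
    fix U x assume U: "U \<in> commutant H M" and x: "x \<in> C"
    have Ub: "U \<in> bounded_ops H" by (rule vnaD(5)[OF M U])
    note u = bounded_opsD(4)[OF Ub]
    have "hlim H (\<lambda>n. ap U (Vn n x)) (ap U (Vlim x))"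
      by (rule hlim_ap[OF Ub Vlim(2)]) (use x Vlim(1) in auto)
    then have "Vlim (ap U x) = ap U (Vlim x)"
      using x u Vlim(1) UR(2)[OF U] UPhi[OF U] by (intro Vlim_eqI) auto
    then show "ap U (ap V x) = ap V (ap U x)" using x u by (simp add: V_ap)
  qed
  ultimately show ?thesis unfolding affiliated_def
    using T_closed T_dense T_polar_decomposition A_spectral_resolution by blast
qed

end

section \<open>Density of a star algebra in its bicommutant\<close>

text \<open>
  The sum of \<open>n\<close> copies of \<open>H\<close>. Entries from \<open>n\<close> on are zero, which makes equality of
  tuples equality of functions.
\<close>

definition htuple :: "nat \<Rightarrow> 'v hilbert_struct \<Rightarrow> (nat \<Rightarrow> 'v) hilbert_struct" where
  "htuple n H = \<lparr>
     hcarrier = {f. (\<forall>i<n. f i \<in> hcarrier H) \<and> (\<forall>i\<ge>n. f i = hzero H)},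
     hzero = (\<lambda>i. hzero H),
     hadd = (\<lambda>f g i. hadd H (f i) (g i)),
     hscale = (\<lambda>a f i. hscale H a (f i)),
     hinner = (\<lambda>f g. \<Sum>i<n. hinner H (f i) (g i))\<rparr>"

text \<open>The conjugate space, in which \<open>a \<mapsto> a* x\<close> is linear.\<close>

definition hconj :: "'v hilbert_struct \<Rightarrow> 'v hilbert_struct" where
  "hconj H = \<lparr>hcarrier = hcarrier H, hzero = hzero H, hadd = hadd H,
     hscale = (\<lambda>a. hscale H (cnj a)), hinner = (\<lambda>x y. hinner H y x)\<rparr>"

lemma htuple_simps [simp]:
  "hcarrier (htuple n H) = {f. (\<forall>i<n. f i \<in> hcarrier H) \<and> (\<forall>i\<ge>n. f i = hzero H)}"
  "hzero (htuple n H) = (\<lambda>i. hzero H)"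
  "hadd (htuple n H) f g = (\<lambda>i. hadd H (f i) (g i))"
  "hscale (htuple n H) a f = (\<lambda>i. hscale H a (f i))"
  "hinner (htuple n H) f g = (\<Sum>i<n. hinner H (f i) (g i))"
  "hdiff (htuple n H) f g = (\<lambda>i. hdiff H (f i) (g i))"
  by (simp_all add: htuple_def hdiff_def)

lemma hconj_simps [simp]:
  "hcarrier (hconj H) = hcarrier H" "hzero (hconj H) = hzero H" "hadd (hconj H) = hadd H"
  "hscale (hconj H) a = hscale H (cnj a)" "hinner (hconj H) x y = hinner H y x"
  "hdiff (hconj H) = hdiff H" "hnorm (hconj H) = hnorm H"
  by (simp_all add: hconj_def hdiff_def hnorm_def fun_eq_iff)

lemma hilbert_space_hconj:
  assumes "hilbert_space H" shows "hilbert_space (hconj H)"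
proof -
  interpret hilbert_space H by fact
  show ?thesis
  proof
    fix x y assume "x \<in> hcarrier (hconj H)" "y \<in> hcarrier (hconj H)"
    then show "hinner (hconj H) y x = cnj (hinner (hconj H) x y)" using inner_cnj[of y x] by simp
  next
    fix X assume "\<And>n. X n \<in> hcarrier (hconj H)" "hCauchy (hconj H) X"
    then show "\<exists>x\<in>hcarrier (hconj H). hlim (hconj H) X x"
      using complete[of X] by (simp add: hCauchy_def hlim_def)
  qed (auto simp: add_assoc add_zero diff_self scale_add_right scale_add_left scale_scale scale_one
       inner_pos intro: add_commute)
qed

lemma htuple_carrier: "hilbert_space H \<Longrightarrow> f \<in> hcarrier (htuple n H) \<Longrightarrow> f i \<in> hcarrier H"
  using hilbert_space.zero_closed[of H] by (cases "i < n") auto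

lemma htuple_hnorm_sq:
  assumes "hilbert_space H" "\<And>i. f i \<in> hcarrier H"
  shows "(hnorm (htuple n H) f)\<^sup>2 = (\<Sum>i<n. (hnorm H (f i))\<^sup>2)"
proof -
  interpret hilbert_space H by fact
  have "0 \<le> (\<Sum>i<n. Re (hinner H (f i) (f i)))" using assms(2) by (intro sum_nonneg) auto
  then show ?thesis using assms(2) by (simp add: hnorm_def)
qed

lemma htuple_hnorm_le:
  assumes "hilbert_space H" "\<And>i. f i \<in> hcarrier H" "i < n"
  shows "hnorm H (f i) \<le> hnorm (htuple n H) f"
proof (rule power2_le_imp_le)
  interpret hilbert_space H by fact
  show "(hnorm H (f i))\<^sup>2 \<le> (hnorm (htuple n H) f)\<^sup>2"
    unfolding htuple_hnorm_sq[OF assms(1,2)] using assms(3)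
    by (intro member_le_sum[where f = "\<lambda>i. (hnorm H (f i))\<^sup>2"]) auto
  show "0 \<le> hnorm (htuple n H) f"
    unfolding hnorm_def using assms(2) by (auto intro!: sum_nonneg)
qed

lemma htuple_hnorm_ge:
  assumes "hilbert_space H" "\<And>i. f i \<in> hcarrier H" shows "0 \<le> hnorm (htuple n H) f"
proof -
  interpret hilbert_space H by fact
  have "0 \<le> (\<Sum>i<n. Re (hinner H (f i) (f i)))" using assms(2) by (intro sum_nonneg) auto
  then show ?thesis by (simp add: hnorm_def)
qed

lemma hilbert_space_htuple:
  assumes "hilbert_space H" shows "hilbert_space (htuple n H)"
proof -
  interpret hilbert_space H by fact
  have c: "f i \<in> C" if "f \<in> hcarrier (htuple n H)" for f i using htuple_carrier[OF assms that] .
  show ?thesis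
  proof
    fix x y assume "x \<in> hcarrier (htuple n H)" "y \<in> hcarrier (htuple n H)"
    then have "hinner H (y i) (x i) = cnj (hinner H (x i) (y i))" for i using c inner_cnj by blast
    then show "hinner (htuple n H) y x = cnj (hinner (htuple n H) x y)" by simp
  next
    fix x assume x: "x \<in> hcarrier (htuple n H)" "x \<noteq> hzero (htuple n H)"
    then obtain i where i: "x i \<noteq> hzero H" by (metis ext htuple_simps(2))
    then have "i < n" using x by (cases "i < n") auto
    moreover have "0 < Re (hinner H (x i) (x i))" using inner_pos c x(1) i by blast
    ultimately have "0 < (\<Sum>i<n. Re (hinner H (x i) (x i)))"
      using c x(1) by (intro sum_pos2[of _ i]) auto
    then show "0 < Re (hinner (htuple n H) x x)" by simp
  next
    fix X assume X: "\<And>k. X k \<in> hcarrier (htuple n H)" and Ca: "hCauchy (htuple n H) X"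
    have cX: "X k i \<in> C" for k i using c X by blast
    have "\<exists>z\<in>C. hlim H (\<lambda>k. X k i) z" if i: "i < n" for i
    proof (rule complete)
      have "hnorm H (hdiff H (X k i) (X l i)) \<le> hnorm (htuple n H) (hdiff (htuple n H) (X k) (X l))" for k l
        using htuple_hnorm_le[OF assms _ i, of "\<lambda>i. hdiff H (X k i) (X l i)"] cX by simp
      then show "hCauchy H (\<lambda>k. X k i)" using Ca unfolding hCauchy_def by (meson le_less_trans)
    qed (rule cX)
    then obtain z where z: "\<And>i. i < n \<Longrightarrow> z i \<in> C" "\<And>i. i < n \<Longrightarrow> hlim H (\<lambda>k. X k i) (z i)" by metis
    define y where "y i = (if i < n then z i else hzero H)" for i
    have y: "y \<in> hcarrier (htuple n H)" "\<And>i. y i \<in> C" using z by (auto simp: y_def)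
    have "(\<lambda>k. \<Sum>i<n. (hnorm H (hdiff H (X k i) (y i)))\<^sup>2) \<longlonglongrightarrow> (\<Sum>i<n. 0\<^sup>2)"
      using z by (intro tendsto_sum tendsto_power) (auto simp: hlim_def y_def)
    then have "(\<lambda>k. (hnorm (htuple n H) (hdiff (htuple n H) (X k) y))\<^sup>2) \<longlonglongrightarrow> 0"
      using htuple_hnorm_sq[OF assms, of "\<lambda>i. hdiff H (X k i) (y i)" n for k] cX y by simp
    then have "(\<lambda>k. sqrt ((hnorm (htuple n H) (hdiff (htuple n H) (X k) y))\<^sup>2)) \<longlonglongrightarrow> sqrt 0"
      by (rule tendsto_real_sqrt)
    moreover have "0 \<le> hnorm (htuple n H) (hdiff (htuple n H) (X k) y)" for k
      using htuple_hnorm_ge[OF assms, of "\<lambda>i. hdiff H (X k i) (y i)" n] cX y(2) by simp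
    ultimately have "hlim (htuple n H) X y" unfolding hlim_def by simp
    then show "\<exists>x\<in>hcarrier (htuple n H). hlim (htuple n H) X x" using y by blast
  next
    show "hzero (htuple n H) \<in> hcarrier (htuple n H)" by simp
  next
    fix x y z assume "x \<in> hcarrier (htuple n H)" "y \<in> hcarrier (htuple n H)" "z \<in> hcarrier (htuple n H)"
    then have "x i \<in> C" "y i \<in> C" "z i \<in> C" for i using c by blast+
    then show "hadd (htuple n H) (hadd (htuple n H) x y) z = hadd (htuple n H) x (hadd (htuple n H) y z)"
      "hinner (htuple n H) (hadd (htuple n H) x y) z = hinner (htuple n H) x z + hinner (htuple n H) y z"
      by (simp_all add: add_assoc sum.distrib)
  next
    fix x y assume xy: "x \<in> hcarrier (htuple n H)" "y \<in> hcarrier (htuple n H)"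
    then have C: "x i \<in> C" "y i \<in> C" for i using c by blast+
    show "hadd (htuple n H) x y = hadd (htuple n H) y x" using add_commute[OF C] by simp
    fix a
    show "hscale (htuple n H) a (hadd (htuple n H) x y) = hadd (htuple n H) (hscale (htuple n H) a x) (hscale (htuple n H) a y)"
      "hinner (htuple n H) (hscale (htuple n H) a x) y = a * hinner (htuple n H) x y"
      using C by (simp_all add: scale_add_right sum_distrib_left)
    show "hadd (htuple n H) x y \<in> hcarrier (htuple n H)" using xy add_zero by simp
  next
    fix x a b assume x: "x \<in> hcarrier (htuple n H)"
    then have C: "x i \<in> C" for i using c by blast
    show "hadd (htuple n H) x (hzero (htuple n H)) = x" "hdiff (htuple n H) x x = hzero (htuple n H)"
      "hscale (htuple n H) (a + b) x = hadd (htuple n H) (hscale (htuple n H) a x) (hscale (htuple n H) b x)"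
      "hscale (htuple n H) a (hscale (htuple n H) b x) = hscale (htuple n H) (a * b) x" "hscale (htuple n H) 1 x = x"
      using C by (simp_all add: add_zero diff_self scale_add_left scale_scale scale_one)
    show "hscale (htuple n H) a x \<in> hcarrier (htuple n H)" using x by simp
  qed
qed

context hilbert_space
begin

definition star_algebra :: "'v operator set \<Rightarrow> bool" where
  "star_algebra \<A> \<longleftrightarrow> \<A> \<subseteq> bounded_ops H \<and> scalar_op H 1 \<in> \<A> \<and> (\<forall>a\<in>\<A>. op_adjoint H a \<in> \<A>)
     \<and> (\<forall>a\<in>\<A>. \<forall>b\<in>\<A>. a \<circ>\<^sub>m b \<in> \<A>) \<and> (\<forall>a\<in>\<A>. \<forall>b\<in>\<A>. \<forall>c d. op_lin H c a d b \<in> \<A>)"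

definition lift_op :: "'v operator \<Rightarrow> (nat \<Rightarrow> 'v) \<Rightarrow> nat \<Rightarrow> 'v" where
  "lift_op a f = (\<lambda>i. ap a (f i))"

lemma lift_op:
  assumes a: "a \<in> bounded_ops H" and f: "f \<in> hcarrier (htuple m H)"
  shows "lift_op a f \<in> hcarrier (htuple m H)"
    "g \<in> hcarrier (htuple m H) \<Longrightarrow> lift_op a (hadd (htuple m H) f g) = hadd (htuple m H) (lift_op a f) (lift_op a g)"
    "g \<in> hcarrier (htuple m H) \<Longrightarrow> lift_op a (hdiff (htuple m H) f g) = hdiff (htuple m H) (lift_op a f) (lift_op a g)"
    "g \<in> hcarrier (htuple m H) \<Longrightarrow> hinner (htuple m H) (lift_op a f) g = hinner (htuple m H) f (lift_op (op_adjoint H a) g)"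
proof -
  note c = htuple_carrier[OF hilbert_space_axioms, of _ m]
  note fC = c[OF f]
  show "lift_op a f \<in> hcarrier (htuple m H)" using bounded_opsD(4,8)[OF a] f by (simp add: lift_op_def)
  assume g: "g \<in> hcarrier (htuple m H)"
  note gC = c[OF g]
  show "lift_op a (hadd (htuple m H) f g) = hadd (htuple m H) (lift_op a f) (lift_op a g)"
    "lift_op a (hdiff (htuple m H) f g) = hdiff (htuple m H) (lift_op a f) (lift_op a g)"
    "hinner (htuple m H) (lift_op a f) g = hinner (htuple m H) f (lift_op (op_adjoint H a) g)"
    by (simp_all add: lift_op_def bounded_opsD(5,7)[OF a] adjoint_bounded(2)[OF a] fC gC)
qed

text \<open>The entries of \<open>P\<close>, seen as a matrix over \<open>H\<close>, lie in the commutant of \<open>\<A>\<close>.\<close>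

lemma bicommutant_lifts:
  assumes \<A>: "\<A> \<subseteq> bounded_ops H" and A: "A \<in> commutant H (commutant H \<A>)"
    and P: "P \<in> bounded_ops (htuple m H)"
    and comm: "\<And>a f. a \<in> \<A> \<Longrightarrow> f \<in> hcarrier (htuple m H) \<Longrightarrow> ap P (lift_op a f) = lift_op a (ap P f)"
    and f: "f \<in> hcarrier (htuple m H)"
  shows "ap P (lift_op A f) = lift_op A (ap P f)"
proof -
  let ?K = "htuple m H"
  interpret K: hilbert_space ?K by (rule hilbert_space_htuple) (rule hilbert_space_axioms)
  note KC = htuple_carrier[OF hilbert_space_axioms] and P = K.bounded_opsD[OF P]
  have Ab: "A \<in> bounded_ops H" using A commutant_bounded by blast
  note AC = bounded_opsD(4)[OF Ab]
  obtain k where k: "\<forall>f\<in>K.C. hnorm ?K (ap P f) \<le> k * hnorm ?K f" using P(9) by blast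
  define e where "e j x = (\<lambda>i. if i = j then x else hzero H)" for j :: nat and x
  have eC: "e j x \<in> K.C" if "j < m" "x \<in> C" for j x using that by (auto simp: e_def)
  have e_lift: "lift_op a (e j x) = e j (ap a x)" if "a \<in> bounded_ops H" for a j x
    using bounded_opsD(8)[OF that] by (auto simp: lift_op_def e_def)
  have entry: "ap A (ap P (e j x) i) = ap P (e j (ap A x)) i" if i: "i < m" and j: "j < m" and x: "x \<in> C" for i j x
  proof -
    define p where "p = mk_op H (\<lambda>x. ap P (e j x) i)"
    have pb: "p \<in> bounded_ops H" unfolding p_def
    proof (rule mk_op_bounded[where k = k])
      fix x y assume c: "x \<in> C" "y \<in> C"
      have "e j (hadd H x y) = hadd ?K (e j x) (e j y)" using add_zero by (auto simp: e_def)
      then show "ap P (e j (hadd H x y)) i = hadd H (ap P (e j x) i) (ap P (e j y) i)" using P(5) eC j c by simp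
    next
      fix c x assume c: "x \<in> C"
      have "e j (hscale H c x) = hscale ?K c (e j x)" by (auto simp: e_def)
      then show "ap P (e j (hscale H c x)) i = hscale H c (ap P (e j x) i)" using P(6) eC j c by simp
    next
      fix x assume c: "x \<in> C"
      show "ap P (e j x) i \<in> C" using KC P(4) eC j c by blast
      have "(hnorm H (e j x l))\<^sup>2 = (if l = j then (hnorm H x)\<^sup>2 else 0)" for l by (simp add: e_def)
      then have "(hnorm ?K (e j x))\<^sup>2 = (\<Sum>l<m. if l = j then (hnorm H x)\<^sup>2 else 0)"
        using htuple_hnorm_sq[OF hilbert_space_axioms KC[OF eC[OF j c]], of m] by simp
      then have "hnorm ?K (e j x) = hnorm H x" using K.hnorm_ge[OF eC[OF j c]] c j by (simp add: power2_eq_iff_nonneg)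
      then show "hnorm H (ap P (e j x) i) \<le> k * hnorm H x"
        using order_trans[OF htuple_hnorm_le[OF hilbert_space_axioms KC[OF P(4)[OF eC[OF j c]]] i] k[rule_format, OF eC[OF j c]]] by simp
    qed
    have pap: "ap p x = ap P (e j x) i" if "x \<in> C" for x using that by (simp add: p_def)
    have "p \<in> commutant H \<A>"
      unfolding commutant_iff[OF \<A>]
    proof (intro conjI ballI pb)
      fix a x assume a: "a \<in> \<A>" and x: "x \<in> C"
      note ab = subsetD[OF \<A> a]
      have "ap P (e j (ap a x)) = lift_op a (ap P (e j x))" using comm[OF a eC[OF j x]] e_lift[OF ab] by simp
      then show "ap p (ap a x) = ap a (ap p x)"
        using pap[OF x] pap[OF bounded_opsD(4)[OF ab x]] by (simp add: lift_op_def)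
    qed
    then have "ap A (ap p x) = ap p (ap A x)" using A x commutant_iff[OF commutant_bounded] by blast
    then show ?thesis using pap x AC[OF x] by simp
  qed
  have single: "ap P (lift_op A (e j x)) = lift_op A (ap P (e j x))" if j: "j < m" and x: "x \<in> C" for j x
  proof
    fix i
    have out: "g i = hzero H" if "\<not> i < m" "g \<in> K.C" for g using that by simp
    show "ap P (lift_op A (e j x)) i = lift_op A (ap P (e j x)) i"
      using entry[OF _ j x, of i] out[OF _ P(4)[OF eC[OF j x]]] out[OF _ P(4)[OF eC[OF j AC[OF x]]]] bounded_opsD(8)[OF Ab]
      by (cases "i < m") (simp_all add: e_lift[OF Ab], simp_all add: lift_op_def)
  qed
  let ?g = "\<lambda>k i. if i < k then f i else hzero H"
  have "ap P (lift_op A (?g k)) = lift_op A (ap P (?g k))" if "k \<le> m" for k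
    using that
  proof (induction k)
    case 0
    have "lift_op A (hzero ?K) = hzero ?K" using bounded_opsD(8)[OF Ab] by (simp add: lift_op_def)
    then show ?case using P(8) by simp
  next
    case (Suc k)
    have g: "?g k \<in> K.C" using Suc.prems f by auto
    have ek: "e k (f k) \<in> K.C" by (rule eC[OF _ KC[OF f]]) (use Suc.prems in simp)
    have split: "?g (Suc k) = hadd ?K (?g k) (e k (f k))"
      using KC[OF f] add_zero zero_add by (auto simp: e_def fun_eq_iff less_Suc_eq)
    show ?case unfolding split P(5)[OF g ek] lift_op(2)[OF Ab g ek] lift_op(2)[OF Ab P(4)[OF g] P(4)[OF ek]]
        P(5)[OF lift_op(1)[OF Ab g] lift_op(1)[OF Ab ek]] using Suc single[OF _ KC[OF f]] by simp
  qed
  moreover have "?g m = f" using f by (auto simp: fun_eq_iff)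
  ultimately show ?thesis by (metis order_refl)
qed

text \<open>
  Von Neumann's density argument: the projection onto the closed subspace generated by the
  tuples \<open>a u\<close> commutes with \<open>\<A>\<close>, hence with \<open>A\<close>, so \<open>A u\<close> belongs to it while \<open>v\<close> is
  orthogonal to it. The closed subspace is taken as a double orthocomplement.
\<close>

lemma bicommutant_functional:
  fixes m :: nat and u v :: "nat \<Rightarrow> 'v"
  assumes \<A>: "star_algebra \<A>" and A: "A \<in> commutant H (commutant H \<A>)"
    and u: "\<And>i. i < m \<Longrightarrow> u i \<in> C" and v: "\<And>i. i < m \<Longrightarrow> v i \<in> C"
    and vanish: "\<And>a. a \<in> \<A> \<Longrightarrow> (\<Sum>i<m. hinner H (ap a (u i)) (v i)) = 0"
  shows "(\<Sum>i<m. hinner H (ap A (u i)) (v i)) = 0"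
proof -
  let ?K = "htuple m H"
  interpret K: hilbert_space ?K by (rule hilbert_space_htuple) (rule hilbert_space_axioms)
  note KC = htuple_carrier[OF hilbert_space_axioms]
  have \<A>b: "\<A> \<subseteq> bounded_ops H" and ad: "\<And>a. a \<in> \<A> \<Longrightarrow> op_adjoint H a \<in> \<A>" and one: "scalar_op H 1 \<in> \<A>"
    and comp: "\<And>a b. a \<in> \<A> \<Longrightarrow> b \<in> \<A> \<Longrightarrow> a \<circ>\<^sub>m b \<in> \<A>" using \<A> by (auto simp: star_algebra_def)
  note ab = subsetD[OF \<A>b]
  have Ab: "A \<in> bounded_ops H" using A commutant_bounded by blast
  define u' where "u' i = (if i < m then u i else hzero H)" for i
  define v' where "v' i = (if i < m then v i else hzero H)" for i
  have u': "u' \<in> K.C" and v': "v' \<in> K.C" using u v by (auto simp: u'_def v'_def)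
  define N\<^sub>0 where "N\<^sub>0 = (\<lambda>a. lift_op a u') ` \<A>"
  define N where "N = K.orthocomplement (K.orthocomplement N\<^sub>0)"
  have N0C: "N\<^sub>0 \<subseteq> K.C" using lift_op(1)[OF ab u'] by (auto simp: N\<^sub>0_def)
  have oC: "K.orthocomplement X \<subseteq> K.C" for X by (auto simp: K.orthocomplement_def)
  note N = K.orthocomplement_closed_subspace[OF oC[of N\<^sub>0], folded N_def] and NC = oC[of "K.orthocomplement N\<^sub>0", folded N_def]
  have o1: "lift_op a f \<in> K.orthocomplement N\<^sub>0" if a: "a \<in> \<A>" and f: "f \<in> K.orthocomplement N\<^sub>0" for a f
  proof -
    have fC: "f \<in> K.C" using f oC by blast
    have "hinner ?K (lift_op a f) (lift_op b u') = 0" if b: "b \<in> \<A>" for b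
    proof -
      have "lift_op (op_adjoint H a) (lift_op b u') = lift_op (op_adjoint H a \<circ>\<^sub>m b) u'"
        using ap_comp[OF ab[OF b]] KC[OF u'] by (simp add: lift_op_def)
      moreover have "lift_op (op_adjoint H a \<circ>\<^sub>m b) u' \<in> N\<^sub>0" using comp[OF ad[OF a] b] by (auto simp: N\<^sub>0_def)
      ultimately show ?thesis
        using f lift_op(4)[OF ab[OF a] fC lift_op(1)[OF ab[OF b] u']] unfolding K.orthocomplement_def by (simp only: mem_Collect_eq)
    qed
    then show ?thesis using lift_op(1)[OF ab[OF a] fC] unfolding K.orthocomplement_def N\<^sub>0_def by blast
  qed
  have o2: "lift_op a f \<in> N" if a: "a \<in> \<A>" and f: "f \<in> N" for a f
  proof -
    have fC: "f \<in> K.C" using f NC by blast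
    have "hinner ?K (lift_op a f) g = 0" if g: "g \<in> K.orthocomplement N\<^sub>0" for g
      unfolding lift_op(4)[OF ab[OF a] fC subsetD[OF oC g]]
      using f o1[OF ad[OF a] g] unfolding N_def K.orthocomplement_def[of "K.orthocomplement N\<^sub>0"] by blast
    then show ?thesis using lift_op(1)[OF ab[OF a] fC] unfolding N_def K.orthocomplement_def[of "K.orthocomplement N\<^sub>0"] by blast
  qed
  let ?P = "orth_proj ?K N"
  note P = K.orth_proj[OF N]
  note PC = K.bounded_opsD(4)[OF P(3)]
  have "ap ?P (lift_op a f) = lift_op a (ap ?P f)" if a: "a \<in> \<A>" and f: "f \<in> K.C" for a f
  proof -
    have "?P (lift_op a f) = Some (lift_op a (ap ?P f))"
    proof (rule K.orth_proj_eqI[OF N(1) lift_op(1)[OF ab[OF a] f] o2[OF a P(1)[OF f]]])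
      fix k assume k: "k \<in> N"
      show "hinner ?K (hdiff ?K (lift_op a f) (lift_op a (ap ?P f))) k = 0"
        unfolding lift_op(3)[OF ab[OF a] f PC[OF f], symmetric] lift_op(4)[OF ab[OF a] K.diff_closed[OF f PC[OF f]] subsetD[OF NC k]]
        by (rule P(2)[OF f o2[OF ad[OF a] k]])
    qed
    then show ?thesis by simp
  qed
  from bicommutant_lifts[OF \<A>b A P(3) this u'] have PA: "ap ?P (lift_op A u') = lift_op A (ap ?P u')" .
  have "u' = lift_op (scalar_op H 1) u'" using KC[OF u'] by (simp add: lift_op_def scale_one)
  then have "u' \<in> N\<^sub>0" using one unfolding N\<^sub>0_def by blast
  then have "hinner ?K u' f = 0" if "f \<in> K.orthocomplement N\<^sub>0" for f
    using that K.inner_cnj[OF _ u', of f] oC unfolding K.orthocomplement_def by (metis (mono_tags, lifting) complex_cnj_zero mem_Collect_eq)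
  then have "u' \<in> N" using u' unfolding N_def K.orthocomplement_def[of "K.orthocomplement N\<^sub>0"] by blast
  then have "lift_op A u' \<in> N" using PA P(1)[OF lift_op(1)[OF Ab u']] P(5) by simp
  moreover have "hinner ?K v' k = 0" if k: "k \<in> N\<^sub>0" for k
  proof -
    obtain a where a: "a \<in> \<A>" "k = lift_op a u'" using k by (auto simp: N\<^sub>0_def)
    have "hinner ?K (lift_op a u') v' = 0" using vanish[OF a(1)] by (simp add: lift_op_def u'_def v'_def)
    then show ?thesis using K.inner_cnj[OF _ v'] N0C k a(2) by (metis complex_cnj_zero subsetD)
  qed
  then have "v' \<in> K.orthocomplement N\<^sub>0" using v' by (simp only: K.orthocomplement_def mem_Collect_eq) blast
  ultimately have "hinner ?K (lift_op A u') v' = 0" unfolding N_def K.orthocomplement_def[of "K.orthocomplement N\<^sub>0"] by blast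
  then show ?thesis by (simp add: lift_op_def u'_def v'_def)
qed

lemma sum_split_add: "(\<Sum>i<n + (k::nat). g i) = (\<Sum>i<n. g i) + (\<Sum>i<k. g (n + i) :: complex)"
  by (induction k) (simp_all add: add.assoc)

text \<open>
  In the sum of the tuples and the conjugate tuples, the pairs \<open>(a x, a* x)\<close> form a
  subspace. A vector orthogonal to it is a functional that vanishes on \<open>\<A>\<close>, hence on \<open>A\<close>;
  so \<open>(A x, A* x)\<close> is its own best approximation.
\<close>

theorem strong_star_approximation:
  fixes n :: nat and x :: "nat \<Rightarrow> 'v" and e :: real
  assumes \<A>: "star_algebra \<A>" and A: "A \<in> commutant H (commutant H \<A>)"
    and x: "\<And>i. i < n \<Longrightarrow> x i \<in> C" and e: "e > 0"
  obtains a where "a \<in> \<A>" "\<And>i. i < n \<Longrightarrow> hnorm H (hdiff H (ap A (x i)) (ap a (x i))) < e"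
    "\<And>i. i < n \<Longrightarrow> hnorm H (hdiff H (ap (op_adjoint H A) (x i)) (ap (op_adjoint H a) (x i))) < e"
proof -
  let ?K = "htuple n H"
  have hK: "hilbert_space ?K" by (rule hilbert_space_htuple) (rule hilbert_space_axioms)
  interpret K: hilbert_space ?K by (rule hK)
  interpret K': hilbert_space "hconj ?K" by (rule hilbert_space_hconj[OF hK])
  let ?W = "hsum ?K (hconj ?K)"
  interpret W: hilbert_space ?W by (rule hilbert_space_hsum) unfold_locales
  have KC: "f i \<in> C" if "f \<in> K.C" for f i using htuple_carrier[OF hilbert_space_axioms that] .
  have \<A>b: "a \<in> bounded_ops H" if "a \<in> \<A>" for a using \<A> that by (auto simp: star_algebra_def)
  have Ab: "A \<in> bounded_ops H" using A commutant_bounded by blast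
  define x' where "x' i = (if i < n then x i else hzero H)" for i
  have x': "x' \<in> K.C" "\<And>i. x' i \<in> C" using x by (auto simp: x'_def)
  have liftC: "lift_op a x' \<in> K.C" if "a \<in> bounded_ops H" for a by (rule lift_op(1)[OF that x'(1)])
  define w where "w a = (lift_op a x', lift_op (op_adjoint H a) x')" for a
  have wC: "w a \<in> W.C" if "a \<in> bounded_ops H" for a
    using liftC[OF that] liftC[OF adjoint_bounded(1)[OF that]] by (simp add: w_def)
  define L where "L = w ` \<A>"
  have LC: "L \<subseteq> W.C" unfolding L_def using wC[OF \<A>b] by blast
  have comb: "hadd ?W (hscale ?W c p) (hscale ?W d q) \<in> L" if pq: "p \<in> L" "q \<in> L" for p q c d
  proof -
    obtain a b where ab: "a \<in> \<A>" "p = w a" "b \<in> \<A>" "q = w b" using pq by (auto simp: L_def)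
    note bab = \<A>b[OF ab(1)] \<A>b[OF ab(3)]
    note a = bounded_opsD(4)[OF bab(1)] and b = bounded_opsD(4)[OF bab(2)]
    note a' = bounded_opsD(4)[OF adjoint_bounded(1)[OF bab(1)]] and b' = bounded_opsD(4)[OF adjoint_bounded(1)[OF bab(2)]]
    define f where "f = op_lin H c a d b"
    define g where "g = op_lin H (cnj c) (op_adjoint H a) (cnj d) (op_adjoint H b)"
    have f: "f \<in> \<A>" using \<A> ab by (auto simp: star_algebra_def f_def)
    have g: "g \<in> bounded_ops H" unfolding g_def by (intro op_lin_bounded adjoint_bounded bab)
    have "op_adjoint H f = g"
    proof (rule adjoint_eqI[OF \<A>b[OF f] g])
      fix y z assume yz: "y \<in> C" "z \<in> C"
      show "hinner H (ap f y) z = hinner H y (ap g z)"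
        using yz a b a' b' adjoint_bounded(2)[OF bab(1)] adjoint_bounded(2)[OF bab(2)] by (simp add: f_def g_def)
    qed
    then have "hadd ?W (hscale ?W c p) (hscale ?W d q) = w f"
      using x' by (simp add: ab w_def lift_op_def f_def g_def)
    then show ?thesis using f by (auto simp: L_def)
  qed
  have sub: "hsubspace ?W L" unfolding hsubspace_def
  proof (intro conjI ballI allI LC)
    have "scalar_op H 1 \<in> \<A>" using \<A> by (simp add: star_algebra_def)
    then have u0: "w (scalar_op H 1) \<in> L" by (auto simp: L_def)
    then have "w (scalar_op H 1) \<in> W.C" using LC by blast
    then show "hzero ?W \<in> L" using comb[OF u0 u0, of 0 0] W.scale_zero W.add_zero[OF W.zero_closed] by metis
    fix p assume p: "p \<in> L"
    then have pC: "p \<in> W.C" using LC by blast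
    { fix q assume q: "q \<in> L"
      then have qC: "q \<in> W.C" using LC by blast
      show "hadd ?W p q \<in> L" using comb[OF p q, of 1 1] W.scale_one[OF pC] W.scale_one[OF qC] by metis }
    fix c
    show "hscale ?W c p \<in> L" using comb[OF p p, of c 0] W.scale_zero[OF pC] W.add_zero[OF W.scale_closed[OF pC]] by metis
  qed
  obtain k p where k: "\<And>i. k i \<in> L" and pC: "p \<in> W.C" and kp: "hlim ?W k p"
    and p: "\<And>l. l \<in> L \<Longrightarrow> hinner ?W (hdiff ?W (w A) p) l = 0"
    using W.best_approximation[OF sub wC[OF Ab]] by metis
  have dC: "hdiff ?W (w A) p \<in> W.C" using W.diff_closed[OF wC[OF Ab] pC] .
  have kC: "k i \<in> W.C" for i using k LC by blast
  obtain y z where yz: "hdiff ?W (w A) p = (y, z)" by (cases "hdiff ?W (w A) p")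
  have yzC: "y \<in> K.C" "z \<in> K.C" using dC unfolding yz by auto
  have yzi: "y i \<in> C" "z i \<in> C" for i using KC yzC by blast+
  \<comment> \<open>the functional given by \<open>(y, z)\<close>, in terms of \<open>a\<close> alone: the adjoint moves to the other side\<close>
  have form: "hinner ?W (y, z) (w a) = cnj (\<Sum>i<n + n. hinner H (ap a (if i < n then x i else z (i - n))) (if i < n then y i else x (i - n)))"
    if a: "a \<in> bounded_ops H" for a
  proof -
    note ad = adjoint_bounded(2)[OF a] and ab = bounded_opsD(4)[OF a]
    have "hinner ?W (y, z) (w a) = (\<Sum>i<n. hinner H (y i) (ap a (x i))) + (\<Sum>i<n. hinner H (ap (op_adjoint H a) (x i)) (z i))"
      by (simp add: w_def lift_op_def x'_def)
    also have "(\<Sum>i<n. hinner H (y i) (ap a (x i))) = (\<Sum>i<n. cnj (hinner H (ap a (x i)) (y i)))"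
      by (intro sum.cong refl inner_cnj) (use x yzi ab in auto)
    also have "(\<Sum>i<n. hinner H (ap (op_adjoint H a) (x i)) (z i)) = (\<Sum>i<n. cnj (hinner H (ap a (z i)) (x i)))"
    proof (intro sum.cong refl)
      fix i assume "i \<in> {..<n}"
      then have xi: "x i \<in> C" using x by simp
      show "hinner H (ap (op_adjoint H a) (x i)) (z i) = cnj (hinner H (ap a (z i)) (x i))"
        unfolding ad[OF yzi(2) xi] by (rule inner_cnj) (use xi yzi bounded_opsD(4)[OF adjoint_bounded(1)[OF a]] in auto)
    qed
    finally show ?thesis by (simp add: sum_split_add)
  qed
  have "(\<Sum>i<n + n. hinner H (ap A (if i < n then x i else z (i - n))) (if i < n then y i else x (i - n))) = 0"
  proof (rule bicommutant_functional[OF \<A> A])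
    fix a assume a: "a \<in> \<A>"
    have "w a \<in> L" using a by (auto simp: L_def)
    then have "hinner ?W (y, z) (w a) = 0" using p unfolding yz by blast
    then show "(\<Sum>i<n + n. hinner H (ap a (if i < n then x i else z (i - n))) (if i < n then y i else x (i - n))) = 0"
      unfolding form[OF \<A>b[OF a]] by (simp only: complex_cnj_zero_iff)
  qed (use x yzi in auto)
  then have "hinner ?W (hdiff ?W (w A) p) (w A) = 0" unfolding yz form[OF Ab] by (simp only: complex_cnj_zero)
  moreover have "hinner ?W (hdiff ?W (w A) p) p = 0"
  proof -
    have "(\<lambda>i. hinner ?W (hdiff ?W (w A) p) (k i)) \<longlonglongrightarrow> hinner ?W (hdiff ?W (w A) p) p"
      by (rule W.hlim_inner[OF W.hlim_const[OF dC] dC dC kp kC pC])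
    then show ?thesis unfolding p[OF k] by (simp only: LIMSEQ_const_iff)
  qed
  ultimately have "hinner ?W (hdiff ?W (w A) p) (hdiff ?W (w A) p) = 0"
    using W.inner_diff_right[OF wC[OF Ab] pC dC] by simp
  then have "hdiff ?W (w A) p = hzero ?W" using W.inner_self_zero[OF dC] by blast
  then have "w A = p" using W.hdiff_eq_0[OF wC[OF Ab] pC] by simp
  then have "\<forall>\<^sub>F i in sequentially. hnorm ?W (hdiff ?W (k i) (w A)) < e"
    using kp e unfolding hlim_def by (intro order_tendstoD(2)) auto
  then obtain i where "hnorm ?W (hdiff ?W (k i) (w A)) < e" by (auto simp: eventually_sequentially)
  then obtain l where l: "l \<in> L" "hnorm ?W (hdiff ?W (w A) l) < e"
    using k W.hnorm_diff_commute[OF kC wC[OF Ab]] by metis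
  then obtain a where a: "a \<in> \<A>" "l = w a" by (auto simp: L_def)
  have Aa: "lift_op A x' \<in> K.C" "lift_op a x' \<in> K.C" "lift_op (op_adjoint H A) x' \<in> K.C" "lift_op (op_adjoint H a) x' \<in> K.C"
    using liftC Ab \<A>b[OF a(1)] adjoint_bounded(1) by blast+
  have "hnorm ?K (hdiff ?K (lift_op A x') (lift_op a x')) < e" "hnorm ?K (hdiff ?K (lift_op (op_adjoint H A) x') (lift_op (op_adjoint H a) x')) < e"
    using hsum_hnorm_le(1,2)[OF hK hilbert_space_hconj[OF hK], of "hdiff ?K (lift_op A x') (lift_op a x')" "hdiff ?K (lift_op (op_adjoint H A) x') (lift_op (op_adjoint H a) x')"]
      l(2) K.diff_closed[OF Aa(1,2)] K.diff_closed[OF Aa(3,4)]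
    unfolding a(2) w_def hsum_simps(6) fst_conv snd_conv hconj_simps by linarith+
  moreover have "hnorm H (hdiff H (lift_op b x' i) (lift_op c x' i)) \<le> hnorm ?K (hdiff ?K (lift_op b x') (lift_op c x'))"
    if "b \<in> bounded_ops H" "c \<in> bounded_ops H" "i < n" for b c i
    using htuple_hnorm_le[OF hilbert_space_axioms, of "\<lambda>i. hdiff H (lift_op b x' i) (lift_op c x' i)" i n] that
      KC[OF liftC] by simp
  ultimately have "hnorm H (hdiff H (lift_op A x' i) (lift_op a x' i)) < e"
    "hnorm H (hdiff H (lift_op (op_adjoint H A) x' i) (lift_op (op_adjoint H a) x' i)) < e" if "i < n" for i
    using that Ab \<A>b[OF a(1)] adjoint_bounded(1) by (meson le_less_trans)+
  then show thesis using that[OF a(1)] by (simp add: lift_op_def x'_def)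
qed

end

section \<open>The Hilbert space of square integrable fields\<close>

lemma (in hilbert_space) summable_steps_converge:
  assumes X: "\<And>n. X n \<in> C" and s: "summable (\<lambda>k. hnorm H (hdiff H (X (Suc k)) (X k)))"
  shows "\<exists>z\<in>C. hlim H X z"
proof (rule complete[OF X])
  let ?d = "\<lambda>k. hnorm H (hdiff H (X (Suc k)) (X k))"
  have step: "hnorm H (hdiff H (X (m + j)) (X m)) \<le> (\<Sum>k=m..<m + j. ?d k)" for m j
  proof (induction j)
    case (Suc j)
    have "hnorm H (hdiff H (X (m + Suc j)) (X m)) \<le> ?d (m + j) + hnorm H (hdiff H (X (m + j)) (X m))"
      using hnorm_triangle_diff[of "X (m + Suc j)" "X (m + j)" "X m"] X by simp
    then show ?case using Suc by simp
  qed (simp add: diff_self X)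
  show "hCauchy H X" unfolding hCauchy_def
  proof (intro allI impI)
    fix e :: real assume e: "e > 0"
    then obtain N where N: "\<And>m n. m \<ge> N \<Longrightarrow> norm (sum ?d {m..<n}) < e" using s unfolding summable_Cauchy by blast
    have le: "hnorm H (hdiff H (X n) (X m)) < e" if "m \<ge> N" "m \<le> n" for m n
      using step[of m "n - m"] N[OF that(1), of n] that(2) by simp
    have "hnorm H (hdiff H (X m) (X n)) < e" if "m \<ge> N" "n \<ge> N" for m n
      using le[of m n] le[of n m] that hnorm_diff_commute[OF X X, of m n] by (cases "m \<le> n") auto
    then show "\<exists>N. \<forall>m\<ge>N. \<forall>n\<ge>N. hnorm H (hdiff H (X m) (X n)) < e" by blast
  qed
qed

lemma half_power_sq: "((1/2)^k)\<^sup>2 = (1/4 :: real)^k"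
proof -
  have "((1/2 :: real)^k)\<^sup>2 = ((1/2)\<^sup>2)^k" by (simp only: power_mult[symmetric] mult.commute)
  then show ?thesis by (simp add: power2_eq_square)
qed

lemma AE_summable_of_integrals:
  fixes f :: "nat \<Rightarrow> 'z \<Rightarrow> real"
  assumes f: "\<And>n. integrable M (f n)" "\<And>n x. 0 \<le> f n x" and le: "\<And>n. (LINT x|M. f n x) \<le> b n" and b: "summable b"
  shows "AE x in M. summable (\<lambda>n. f n x)"
proof -
  have [measurable]: "f n \<in> borel_measurable M" for n using f by simp
  have b0: "0 \<le> b n" for n using le[of n] Bochner_Integration.integral_nonneg[of M "f n"] f(2) by (meson order_trans)
  have "(\<integral>\<^sup>+x. (\<Sum>n. ennreal (f n x)) \<partial>M) = (\<Sum>n. \<integral>\<^sup>+x. ennreal (f n x) \<partial>M)"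
    by (rule nn_integral_suminf) simp
  also have "\<dots> \<le> (\<Sum>n. ennreal (b n))"
    using le f by (intro suminf_le) (auto simp: nn_integral_eq_integral ennreal_leI)
  also have "\<dots> < \<infinity>" using suminf_ennreal2[OF b0 b] by simp
  finally have "(\<integral>\<^sup>+x. (\<Sum>n. ennreal (f n x)) \<partial>M) \<noteq> \<infinity>" by simp
  then have "AE x in M. (\<Sum>n. ennreal (f n x)) \<noteq> \<infinity>"
    by (intro nn_integral_noteq_infinite) auto
  then show ?thesis by eventually_elim (use f(2) in \<open>auto intro!: summable_suminf_not_top\<close>)
qed

locale hilbert_field = measurable_hilbert_field \<omega> H S + sigma_finite_measure \<omega>
  for \<omega> :: "'z measure" and H :: "'z \<Rightarrow> 'v hilbert_struct" and S :: "('z \<Rightarrow> 'v) set" +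
  assumes space_UNIV: "space \<omega> = UNIV"
begin

sublocale fib: hilbert_space "H t" for t by (rule fibre)

lemma S_C [simp]: "x \<in> S \<Longrightarrow> x t \<in> fib.C t" by (rule vector_field)

lemma S_I:
  assumes "\<And>t. v t \<in> fib.C t" "\<And>x. x \<in> S \<Longrightarrow> (\<lambda>t. hinner (H t) (x t) (v t)) \<in> borel_measurable \<omega>"
  shows "v \<in> S" using maximal assms by blast

lemma S_add [simp]: "x \<in> S \<Longrightarrow> y \<in> S \<Longrightarrow> (\<lambda>t. hadd (H t) (x t) (y t)) \<in> S"
  by (rule S_I) (auto intro!: borel_measurable_add inner_measurable)

lemma S_scale: "x \<in> S \<Longrightarrow> \<phi> \<in> borel_measurable \<omega> \<Longrightarrow> (\<lambda>t. hscale (H t) (\<phi> t) (x t)) \<in> S"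
proof (rule S_I)
  fix y assume x: "x \<in> S" and y: "y \<in> S" and p: "\<phi> \<in> borel_measurable \<omega>"
  have "(\<lambda>t. cnj (\<phi> t) * hinner (H t) (y t) (x t)) \<in> borel_measurable \<omega>"
    using inner_measurable[OF y x] p borel_measurable_continuous_on[OF continuous_on_cnj[OF continuous_on_id], of \<phi> \<omega>]
    by (intro borel_measurable_times) auto
  then show "(\<lambda>t. hinner (H t) (y t) (hscale (H t) (\<phi> t) (x t))) \<in> borel_measurable \<omega>" using x y by simp
qed simp

lemma S_const_scale [simp]: "x \<in> S \<Longrightarrow> (\<lambda>t. hscale (H t) c (x t)) \<in> S"
  using S_scale[of x "\<lambda>t. c"] by simp

lemma S_zero [simp]: "(\<lambda>t. hzero (H t)) \<in> S"
  by (rule S_I) auto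

lemma S_diff [simp]: "x \<in> S \<Longrightarrow> y \<in> S \<Longrightarrow> (\<lambda>t. hdiff (H t) (x t) (y t)) \<in> S"
  unfolding hdiff_def by simp

lemma S_norm: "x \<in> S \<Longrightarrow> (\<lambda>t. hnorm (H t) (x t)) \<in> borel_measurable \<omega>"
proof -
  assume "x \<in> S"
  then have [measurable]: "(\<lambda>t. hinner (H t) (x t) (x t)) \<in> borel_measurable \<omega>" by (simp add: inner_measurable)
  show ?thesis unfolding hnorm_def by measurable
qed

lemma S_norm_sq: "x \<in> S \<Longrightarrow> (\<lambda>t. (hnorm (H t) (x t))\<^sup>2) \<in> borel_measurable \<omega>"
  using S_norm by simp

lemma S_lim:
  assumes X: "\<And>n. X n \<in> S" and v: "\<And>t. v t \<in> fib.C t" and l: "\<And>t. hlim (H t) (\<lambda>n. X n t) (v t)"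
  shows "v \<in> S"
proof (rule S_I[OF v])
  fix y assume y: "y \<in> S"
  show "(\<lambda>t. hinner (H t) (y t) (v t)) \<in> borel_measurable \<omega>"
  proof (rule borel_measurable_LIMSEQ_metric)
    show "(\<lambda>t. hinner (H t) (y t) (X n t)) \<in> borel_measurable \<omega>" for n by (rule inner_measurable[OF y X])
    show "(\<lambda>n. hinner (H t) (y t) (X n t)) \<longlonglongrightarrow> hinner (H t) (y t) (v t)" for t
      by (rule fib.hlim_inner) (use X v l y in auto)
  qed
qed

lemma S_choice:
  fixes k :: "'z \<Rightarrow> nat"
  assumes X: "\<And>n. X n \<in> S" and k: "k \<in> \<omega> \<rightarrow>\<^sub>M count_space UNIV"
  shows "(\<lambda>t. X (k t) t) \<in> S"
proof (rule S_I)
  fix y assume y: "y \<in> S"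
  show "(\<lambda>t. hinner (H t) (y t) (X (k t) t)) \<in> borel_measurable \<omega>"
    by (rule measurable_compose_countable[OF inner_measurable[OF y X] k])
qed (use X in simp)

lemma S_if: assumes "x \<in> S" "y \<in> S" "A \<in> sets \<omega>" shows "(\<lambda>t. if t \<in> A then x t else y t) \<in> S"
proof (rule S_I)
  fix z assume z: "z \<in> S"
  have "(\<lambda>t. if t \<in> A then hinner (H t) (z t) (x t) else hinner (H t) (z t) (y t)) \<in> borel_measurable \<omega>"
    using assms space_UNIV by (intro measurable_If inner_measurable z) auto
  then show "(\<lambda>t. hinner (H t) (z t) (if t \<in> A then x t else y t)) \<in> borel_measurable \<omega>"
    by (simp add: if_distrib)
qed (use assms in auto)

abbreviation "L2 \<equiv> sq_integrable_fields \<omega> H S"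

lemma L2_iff: "x \<in> L2 \<longleftrightarrow> x \<in> S \<and> integrable \<omega> (\<lambda>t. (hnorm (H t) (x t))\<^sup>2)"
  by (simp add: sq_integrable_fields_def)

lemma L2_S [simp]: "x \<in> L2 \<Longrightarrow> x \<in> S" by (simp add: L2_iff)
lemma L2_integrable: "x \<in> L2 \<Longrightarrow> integrable \<omega> (\<lambda>t. (hnorm (H t) (x t))\<^sup>2)" by (simp add: L2_iff)

lemma L2_bound:
  assumes x: "x \<in> S" and y: "y \<in> L2" and K: "AE t in \<omega>. hnorm (H t) (x t) \<le> K * hnorm (H t) (y t)"
  shows "x \<in> L2"
proof -
  have "integrable \<omega> (\<lambda>t. (hnorm (H t) (x t))\<^sup>2)"
  proof (rule Bochner_Integration.integrable_bound)
    show "integrable \<omega> (\<lambda>t. K\<^sup>2 * (hnorm (H t) (y t))\<^sup>2)" using L2_integrable[OF y] by simp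
    show "AE t in \<omega>. norm ((hnorm (H t) (x t))\<^sup>2) \<le> norm (K\<^sup>2 * (hnorm (H t) (y t))\<^sup>2)"
      using K
    proof eventually_elim
      case (elim t)
      then have "(hnorm (H t) (x t))\<^sup>2 \<le> (K * hnorm (H t) (y t))\<^sup>2" using x by (intro power_mono) auto
      then show ?case by (simp add: power_mult_distrib)
    qed
  qed (rule S_norm_sq[OF x])
  then show ?thesis using x L2_iff by blast
qed

lemma L2_add [simp]: assumes x: "x \<in> L2" and y: "y \<in> L2" shows "(\<lambda>t. hadd (H t) (x t) (y t)) \<in> L2"
proof -
  have "integrable \<omega> (\<lambda>t. (hnorm (H t) (hadd (H t) (x t) (y t)))\<^sup>2)"
  proof (rule Bochner_Integration.integrable_bound)
    show "integrable \<omega> (\<lambda>t. 2 * (hnorm (H t) (x t))\<^sup>2 + 2 * (hnorm (H t) (y t))\<^sup>2)"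
      using L2_integrable[OF x] L2_integrable[OF y] by simp
    show "AE t in \<omega>. norm ((hnorm (H t) (hadd (H t) (x t) (y t)))\<^sup>2) \<le> norm (2 * (hnorm (H t) (x t))\<^sup>2 + 2 * (hnorm (H t) (y t))\<^sup>2)"
    proof (rule AE_I2)
      fix t
      have "(hnorm (H t) (hadd (H t) (x t) (y t)))\<^sup>2 \<le> 2 * (hnorm (H t) (x t))\<^sup>2 + 2 * (hnorm (H t) (y t))\<^sup>2"
        using fib.parallelogram[of "x t" t "y t", OF S_C[OF L2_S[OF x]] S_C[OF L2_S[OF y]]]
          zero_le_power2[of "hnorm (H t) (hdiff (H t) (x t) (y t))"] by linarith
      then show "norm ((hnorm (H t) (hadd (H t) (x t) (y t)))\<^sup>2) \<le> norm (2 * (hnorm (H t) (x t))\<^sup>2 + 2 * (hnorm (H t) (y t))\<^sup>2)"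
        by simp
    qed
  qed (use x y S_norm_sq[OF S_add] in simp)
  then show ?thesis using x y L2_iff S_add by blast
qed

lemma L2_scale [simp]: "x \<in> L2 \<Longrightarrow> (\<lambda>t. hscale (H t) c (x t)) \<in> L2"
  by (rule L2_bound[of _ x "cmod c"]) auto

lemma L2_scale_bounded:
  "x \<in> L2 \<Longrightarrow> \<phi> \<in> borel_measurable \<omega> \<Longrightarrow> (\<And>t. cmod (\<phi> t) \<le> K) \<Longrightarrow> (\<lambda>t. hscale (H t) (\<phi> t) (x t)) \<in> L2"
  by (rule L2_bound[of _ x K]) (auto intro!: S_scale mult_right_mono)

lemma L2_zero [simp]: "(\<lambda>t. hzero (H t)) \<in> L2" by (simp add: L2_iff)

lemma L2_diff [simp]: "x \<in> L2 \<Longrightarrow> y \<in> L2 \<Longrightarrow> (\<lambda>t. hdiff (H t) (x t) (y t)) \<in> L2"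
  unfolding hdiff_def by simp

lemma inner_AM_GM:
  "a \<in> fib.C t \<Longrightarrow> b \<in> fib.C t \<Longrightarrow> cmod (hinner (H t) a b) \<le> (hnorm (H t) a)\<^sup>2 + (hnorm (H t) b)\<^sup>2"
proof -
  assume ab: "a \<in> fib.C t" "b \<in> fib.C t"
  have "0 \<le> (hnorm (H t) a - hnorm (H t) b)\<^sup>2" by simp
  then have "2 * (hnorm (H t) a * hnorm (H t) b) \<le> (hnorm (H t) a)\<^sup>2 + (hnorm (H t) b)\<^sup>2" by (simp add: power2_diff)
  moreover have "0 \<le> hnorm (H t) a * hnorm (H t) b" using ab by simp
  ultimately show ?thesis using fib.Cauchy_Schwarz[OF ab] by linarith
qed

lemma L2_inner_integrable:
  assumes x: "x \<in> L2" and y: "y \<in> L2" shows "integrable \<omega> (\<lambda>t. hinner (H t) (x t) (y t))"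
proof (rule Bochner_Integration.integrable_bound)
  show "integrable \<omega> (\<lambda>t. (hnorm (H t) (x t))\<^sup>2 + (hnorm (H t) (y t))\<^sup>2)"
    using L2_integrable[OF x] L2_integrable[OF y] by simp
  show "AE t in \<omega>. norm (hinner (H t) (x t) (y t)) \<le> norm ((hnorm (H t) (x t))\<^sup>2 + (hnorm (H t) (y t))\<^sup>2)"
    using inner_AM_GM x y by (intro AE_I2) simp
qed (use x y inner_measurable in simp)

abbreviation "DI \<equiv> direct_integral \<omega> H S"
abbreviation "cls \<equiv> dint_class \<omega> H S"

lemma cls_iff: "y \<in> cls x \<longleftrightarrow> y \<in> L2 \<and> (AE t in \<omega>. y t = x t)"
  by (simp add: dint_class_def)

lemma cls_self: "x \<in> L2 \<Longrightarrow> x \<in> cls x" by (simp add: cls_iff)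

lemma cls_cong: "AE t in \<omega>. x t = y t \<Longrightarrow> cls x = cls y"
  unfolding dint_class_def by (intro Collect_cong conj_cong refl) (auto elim!: eventually_elim2)

lemma cls_eqD: "x \<in> L2 \<Longrightarrow> cls x = cls y \<Longrightarrow> AE t in \<omega>. x t = y t"
  using cls_self[of x] cls_iff[of x y] by simp

lemma rep_cls: "x \<in> L2 \<Longrightarrow> dint_rep (cls x) \<in> L2" "x \<in> L2 \<Longrightarrow> AE t in \<omega>. dint_rep (cls x) t = x t"
proof -
  have *: "dint_rep (cls x) \<in> cls x" if "x \<in> L2"
    unfolding dint_rep_def by (rule someI[of "\<lambda>y. y \<in> cls x", OF cls_self[OF that]])
  show "x \<in> L2 \<Longrightarrow> dint_rep (cls x) \<in> L2" "x \<in> L2 \<Longrightarrow> AE t in \<omega>. dint_rep (cls x) t = x t"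
    using * unfolding cls_iff by blast+
qed

lemma DI_carrier: "hcarrier DI = cls ` L2" by (simp add: direct_integral_def)

lemma DI_mem [simp]: "x \<in> L2 \<Longrightarrow> cls x \<in> hcarrier DI" by (simp add: DI_carrier)

lemma DI_E: assumes "X \<in> hcarrier DI" obtains x where "x \<in> L2" "X = cls x"
  using assms by (auto simp: DI_carrier)

lemma DI_zero: "hzero DI = cls (\<lambda>t. hzero (H t))" by (simp add: direct_integral_def)

lemma DI_add: assumes "x \<in> L2" "y \<in> L2" shows "hadd DI (cls x) (cls y) = cls (\<lambda>t. hadd (H t) (x t) (y t))"
proof -
  have "AE t in \<omega>. hadd (H t) (dint_rep (cls x) t) (dint_rep (cls y) t) = hadd (H t) (x t) (y t)"
    using rep_cls(2)[OF assms(1)] rep_cls(2)[OF assms(2)] by eventually_elim simp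
  then show ?thesis by (simp add: direct_integral_def) (rule cls_cong)
qed

lemma DI_scale: assumes "x \<in> L2" shows "hscale DI c (cls x) = cls (\<lambda>t. hscale (H t) c (x t))"
proof -
  have "AE t in \<omega>. hscale (H t) c (dint_rep (cls x) t) = hscale (H t) c (x t)"
    using rep_cls(2)[OF assms(1)] by eventually_elim simp
  then show ?thesis by (simp add: direct_integral_def) (rule cls_cong)
qed

lemma DI_diff: assumes "x \<in> L2" "y \<in> L2" shows "hdiff DI (cls x) (cls y) = cls (\<lambda>t. hdiff (H t) (x t) (y t))"
  using assms DI_add[of x "\<lambda>t. hscale (H t) (-1) (y t)"] by (simp add: hdiff_def DI_scale)

lemma DI_inner: assumes "x \<in> L2" "y \<in> L2" shows "hinner DI (cls x) (cls y) = (LINT t|\<omega>. hinner (H t) (x t) (y t))"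
proof -
  have "(LINT t|\<omega>. hinner (H t) (dint_rep (cls x) t) (dint_rep (cls y) t)) = (LINT t|\<omega>. hinner (H t) (x t) (y t))"
  proof (rule integral_cong_AE)
    show "AE t in \<omega>. hinner (H t) (dint_rep (cls x) t) (dint_rep (cls y) t) = hinner (H t) (x t) (y t)"
      using rep_cls(2)[OF assms(1)] rep_cls(2)[OF assms(2)] by eventually_elim simp
  qed (use assms rep_cls(1) inner_measurable in auto)
  then show ?thesis by (simp add: direct_integral_def)
qed

lemma DI_norm: "x \<in> L2 \<Longrightarrow> hnorm DI (cls x) = sqrt (LINT t|\<omega>. (hnorm (H t) (x t))\<^sup>2)"
proof -
  assume x: "x \<in> L2"
  have "hinner DI (cls x) (cls x) = (LINT t|\<omega>. complex_of_real ((hnorm (H t) (x t))\<^sup>2))"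
    unfolding DI_inner[OF x x] using x by (intro Bochner_Integration.integral_cong refl fib.inner_self) simp
  also have "\<dots> = complex_of_real (LINT t|\<omega>. (hnorm (H t) (x t))\<^sup>2)" by (rule integral_complex_of_real)
  finally show ?thesis unfolding hnorm_def[of DI] by simp
qed

lemma DI_norm_ge: "x \<in> L2 \<Longrightarrow> 0 \<le> hnorm DI (cls x)"
  by (simp add: DI_norm)

lemma DI_norm_sq: "x \<in> L2 \<Longrightarrow> (hnorm DI (cls x))\<^sup>2 = (LINT t|\<omega>. (hnorm (H t) (x t))\<^sup>2)"
  by (simp add: DI_norm)

text \<open>
  The argument of Riesz and Fischer: a subsequence with fast decreasing steps converges in
  almost every fibre, and Fatou's lemma shows that the pointwise limit is the limit in
  mean.
\<close>

lemma DI_complete: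
  assumes X: "\<And>n. X n \<in> hcarrier DI" and Ca: "hCauchy DI X"
  shows "\<exists>x\<in>hcarrier DI. hlim DI X x"
proof -
  have "\<forall>n. \<exists>x\<in>L2. X n = cls x" using X DI_E by metis
  then obtain x where x: "\<And>n. x n \<in> L2" "\<And>n. X n = cls (x n)" by metis
  have nd: "(hnorm DI (hdiff DI (X m) (X n)))\<^sup>2 = (LINT t|\<omega>. (hnorm (H t) (hdiff (H t) (x m t) (x n t)))\<^sup>2)" for m n
    unfolding x(2) DI_diff[OF x(1) x(1)] by (rule DI_norm_sq) (use x in simp)
  have n0: "0 \<le> hnorm DI (hdiff DI (X m) (X n))" for m n
    unfolding x(2) DI_diff[OF x(1) x(1)] by (rule DI_norm_ge) (use x in simp)
  have "\<forall>k. \<exists>N. \<forall>m\<ge>N. \<forall>n\<ge>N. hnorm DI (hdiff DI (X m) (X n)) < (1/2)^k"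
    using Ca unfolding hCauchy_def by simp
  then obtain N where N: "\<And>k m n. m \<ge> N k \<Longrightarrow> n \<ge> N k \<Longrightarrow> hnorm DI (hdiff DI (X m) (X n)) < (1/2)^k" by metis
  have N2: "(LINT t|\<omega>. (hnorm (H t) (hdiff (H t) (x m t) (x n t)))\<^sup>2) \<le> (1/4)^k" if "m \<ge> N k" "n \<ge> N k" for k m n
  proof -
    have "(hnorm DI (hdiff DI (X m) (X n)))\<^sup>2 \<le> ((1/2)^k)\<^sup>2" using N[OF that] n0 by (intro power_mono) auto
    then show ?thesis unfolding nd half_power_sq .
  qed
  define r where "r k = (\<Sum>i\<le>k. N i)" for k
  have rN: "N k \<le> r j" if "k \<le> j" for k j
    unfolding r_def using that by (intro member_le_sum) auto
  define D where "D k t = hnorm (H t) (hdiff (H t) (x (r (Suc k)) t) (x (r k) t))" for k t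
  have Dm: "D k \<in> borel_measurable \<omega>" for k unfolding D_def[abs_def] by (rule S_norm) (use x in simp)
  have D0: "0 \<le> D k t" for k t unfolding D_def using x by simp
  have "AE t in \<omega>. summable (\<lambda>k. 2^k * (D k t)\<^sup>2)"
  proof (rule AE_summable_of_integrals)
    show "integrable \<omega> (\<lambda>t. 2^k * (D k t)\<^sup>2)" for k
      unfolding D_def using L2_integrable[OF L2_diff[OF x(1) x(1)]] by simp
    show "(LINT t|\<omega>. 2^k * (D k t)\<^sup>2) \<le> (1/2)^k" for k
    proof -
      have "(LINT t|\<omega>. 2^k * (D k t)\<^sup>2) \<le> 2^k * (1/4)^k"
        unfolding D_def using N2[of k "r (Suc k)" "r k"] rN by simp
      then show ?thesis by (simp add: power_mult_distrib[symmetric])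
    qed
    show "summable (\<lambda>k. (1/2::real)^k)" by (rule summable_geometric) simp
  qed simp
  then have "AE t in \<omega>. summable (\<lambda>k. D k t)"
  proof eventually_elim
    case (elim t)
    have "summable (\<lambda>k. (1/2::real)^k)" by (rule summable_geometric) simp
    then have "summable (\<lambda>k. 2^k * (D k t)\<^sup>2 + (1/2)^k)" using elim by (intro summable_add)
    then show ?case
    proof (rule summable_comparison_test'[where N = 0])
      fix k :: nat
      \<comment> \<open>\<open>2 D \<le> 2\<^sup>k D\<^sup>2 + 2\<^sup>-\<^sup>k\<close> turns square integrability of the steps into summability\<close>
      define s :: real where "s = sqrt (2^k)"
      have s: "s > 0" "s * s = 2^k" by (auto simp: s_def)
      have "0 \<le> (s * D k t - 1 / s)\<^sup>2" by simp
      also have "(s * D k t - 1 / s)\<^sup>2 = (s * s) * (D k t)\<^sup>2 + 1 / (s * s) - 2 * D k t"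
        using s(1) by (simp add: power2_eq_square field_simps)
      finally show "norm (D k t) \<le> 2^k * (D k t)\<^sup>2 + (1/2)^k" using D0[of k t] unfolding s(2) by (simp add: power_one_over)
    qed
  qed
  then obtain Z where Z: "\<And>t. t \<notin> Z \<Longrightarrow> summable (\<lambda>k. D k t)" "Z \<in> null_sets \<omega>"
    using space_UNIV by (auto elim!: AE_E3)
  have "\<exists>z\<in>fib.C t. hlim (H t) (\<lambda>k. x (r k) t) z" if "t \<notin> Z" for t
    using fib.summable_steps_converge[of "\<lambda>k. x (r k) t" t] Z(1)[OF that] x unfolding D_def by simp
  then obtain z where z: "\<And>t. t \<notin> Z \<Longrightarrow> z t \<in> fib.C t" "\<And>t. t \<notin> Z \<Longrightarrow> hlim (H t) (\<lambda>k. x (r k) t) (z t)"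
    by metis
  define y where "y t = (if t \<in> Z then hzero (H t) else z t)" for t
  have ZM: "Z \<in> sets \<omega>" using Z(2) by auto
  have y: "y \<in> S"
  proof (rule S_lim[of "\<lambda>k t. if t \<in> Z then hzero (H t) else x (r k) t"])
    show "(\<lambda>t. if t \<in> Z then hzero (H t) else x (r k) t) \<in> S" for k
      by (rule S_if) (use x ZM in auto)
    show "y t \<in> fib.C t" for t using z by (simp add: y_def)
    show "hlim (H t) (\<lambda>k. if t \<in> Z then hzero (H t) else x (r k) t) (y t)" for t using z by (simp add: y_def)
  qed
  have nZ: "AE t in \<omega>. t \<notin> Z" using Z(2) by (rule AE_not_in)
  have fatou: "(\<integral>\<^sup>+t. ennreal ((hnorm (H t) (hdiff (H t) (x n t) (y t)))\<^sup>2) \<partial>\<omega>) \<le> ennreal ((1/4)^k)" if n: "n \<ge> N k" for n k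
  proof -
    let ?f = "\<lambda>j t. ennreal ((hnorm (H t) (hdiff (H t) (x n t) (x (r j) t)))\<^sup>2)"
    have "AE t in \<omega>. ennreal ((hnorm (H t) (hdiff (H t) (x n t) (y t)))\<^sup>2) = liminf (\<lambda>j. ?f j t)"
      using nZ
    proof eventually_elim
      case (elim t)
      have "(\<lambda>j. ?f j t) \<longlonglongrightarrow> ennreal ((hnorm (H t) (hdiff (H t) (x n t) (y t)))\<^sup>2)"
        using elim x z[of t] by (intro tendsto_ennrealI tendsto_power fib.hlim_norm fib.hlim_diff) (auto simp: y_def)
      then show ?case by (rule lim_imp_Liminf[OF trivial_limit_sequentially, symmetric])
    qed
    then have "(\<integral>\<^sup>+t. ennreal ((hnorm (H t) (hdiff (H t) (x n t) (y t)))\<^sup>2) \<partial>\<omega>) = (\<integral>\<^sup>+t. liminf (\<lambda>j. ?f j t) \<partial>\<omega>)"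
      by (rule nn_integral_cong_AE)
    also have "\<dots> \<le> liminf (\<lambda>j. \<integral>\<^sup>+t. ?f j t \<partial>\<omega>)"
      by (rule nn_integral_liminf) (use x S_norm_sq[OF S_diff] in simp)
    also have "\<dots> \<le> liminf (\<lambda>j. ennreal ((1/4)^k))"
    proof (rule Liminf_mono)
      show "\<forall>\<^sub>F j in sequentially. (\<integral>\<^sup>+t. ?f j t \<partial>\<omega>) \<le> ennreal ((1/4)^k)"
      proof (rule eventually_sequentiallyI[of k])
        fix j assume "k \<le> j"
        have "(\<integral>\<^sup>+t. ?f j t \<partial>\<omega>) = ennreal (LINT t|\<omega>. (hnorm (H t) (hdiff (H t) (x n t) (x (r j) t)))\<^sup>2)"
          by (rule nn_integral_eq_integral) (use L2_integrable[OF L2_diff[OF x(1) x(1)]] in auto)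
        then show "(\<integral>\<^sup>+t. ?f j t \<partial>\<omega>) \<le> ennreal ((1/4)^k)"
          using N2[OF n rN[OF \<open>k \<le> j\<close>]] by (simp add: ennreal_leI)
      qed
    qed
    also have "\<dots> = ennreal ((1/4)^k)" by (simp add: Liminf_const)
    finally show ?thesis .
  qed
  have d: "(\<lambda>t. hdiff (H t) (x n t) (y t)) \<in> L2"
      "(LINT t|\<omega>. (hnorm (H t) (hdiff (H t) (x n t) (y t)))\<^sup>2) \<le> (1/4)^k" if n: "n \<ge> N k" for n k
  proof -
    have m: "(\<lambda>t. (hnorm (H t) (hdiff (H t) (x n t) (y t)))\<^sup>2) \<in> borel_measurable \<omega>"
      by (rule S_norm_sq) (use x y in simp)
    have i: "integrable \<omega> (\<lambda>t. (hnorm (H t) (hdiff (H t) (x n t) (y t)))\<^sup>2)"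
      using le_less_trans[OF fatou[OF n]] m by (intro integrableI_bounded) auto
    then show "(\<lambda>t. hdiff (H t) (x n t) (y t)) \<in> L2" using x y L2_iff by simp
    have "ennreal (LINT t|\<omega>. (hnorm (H t) (hdiff (H t) (x n t) (y t)))\<^sup>2) \<le> ennreal ((1/4)^k)"
      using fatou[OF n] nn_integral_eq_integral[OF i] by simp
    then show "(LINT t|\<omega>. (hnorm (H t) (hdiff (H t) (x n t) (y t)))\<^sup>2) \<le> (1/4)^k"
      by (subst (asm) ennreal_le_iff) auto
  qed
  have "y = (\<lambda>t. hdiff (H t) (x (N 0) t) (hdiff (H t) (x (N 0) t) (y t)))"
  proof
    fix t
    show "y t = hdiff (H t) (x (N 0) t) (hdiff (H t) (x (N 0) t) (y t))"
      by (rule fib.inner_ext[of _ t]) (use x y in auto)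
  qed
  then have yL: "y \<in> L2" using L2_diff[OF x(1) d(1)[OF order_refl]] by metis
  have "hlim DI X (cls y)" unfolding hlim_def
  proof (rule LIMSEQ_I)
    fix e :: real assume e: "e > 0"
    obtain k where k: "(1/2)^k < e" using real_arch_pow_inv[of e "1/2"] e by auto
    have "norm (hnorm DI (hdiff DI (X n) (cls y)) - 0) < e" if n: "n \<ge> N k" for n
    proof -
      have "(hnorm DI (hdiff DI (X n) (cls y)))\<^sup>2 \<le> (1/4)^k"
        unfolding x(2) DI_diff[OF x(1) yL] DI_norm_sq[OF d(1)[OF n]] by (rule d(2)[OF n])
      also have "(1/4::real)^k = ((1/2)^k)\<^sup>2" by (rule half_power_sq[symmetric])
      finally have "\<bar>hnorm DI (hdiff DI (X n) (cls y))\<bar> \<le> \<bar>(1/2)^k\<bar>" by (simp only: abs_le_square_iff)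
      then show ?thesis using k by simp
    qed
    then show "\<exists>no. \<forall>n\<ge>no. norm (hnorm DI (hdiff DI (X n) (cls y)) - 0) < e" by blast
  qed
  then show ?thesis using yL by (intro bexI[of _ "cls y"]) auto
qed

theorem hilbert_space_DI: "hilbert_space DI"
proof
  fix X Y Z :: "('z \<Rightarrow> 'v) set" and a b :: complex
  show "hzero DI \<in> hcarrier DI" by (simp add: DI_zero)
  assume "X \<in> hcarrier DI"
  then obtain x where x: "x \<in> L2" "X = cls x" by (rule DI_E)
  have xC: "x t \<in> fib.C t" for t using x by simp
  show "hscale DI a X \<in> hcarrier DI" using x by (simp add: DI_scale)
  show "hadd DI X (hzero DI) = X" using x xC by (simp add: DI_zero DI_add fib.add_zero)
  show "hdiff DI X X = hzero DI" using x xC by (simp add: DI_zero DI_diff fib.diff_self)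
  show "hscale DI (a + b) X = hadd DI (hscale DI a X) (hscale DI b X)"
    using x xC by (simp add: DI_scale DI_add fib.scale_add_left)
  show "hscale DI a (hscale DI b X) = hscale DI (a * b) X" using x xC by (simp add: DI_scale fib.scale_scale)
  show "hscale DI 1 X = X" using x xC by (simp add: DI_scale fib.scale_one)
  { assume n: "X \<noteq> hzero DI"
    have "(LINT t|\<omega>. (hnorm (H t) (x t))\<^sup>2) \<noteq> 0"
    proof
      assume "(LINT t|\<omega>. (hnorm (H t) (x t))\<^sup>2) = 0"
      then have "AE t in \<omega>. (hnorm (H t) (x t))\<^sup>2 = 0"
        using integral_nonneg_eq_0_iff_AE[OF L2_integrable[OF x(1)]] by simp
      then have "AE t in \<omega>. x t = hzero (H t)" using fib.hnorm_eq_0[OF xC] by simp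
      then show False using n cls_cong x DI_zero by simp
    qed
    moreover have "0 \<le> (LINT t|\<omega>. (hnorm (H t) (x t))\<^sup>2)" by simp
    ultimately have "0 < (LINT t|\<omega>. (hnorm (H t) (x t))\<^sup>2)" by linarith
    then have "0 < hnorm DI (cls x)" unfolding DI_norm[OF x(1)] by (simp only: real_sqrt_gt_0_iff)
    then show "0 < Re (hinner DI X X)" unfolding x(2) hnorm_def[of DI] by simp }
  assume "Y \<in> hcarrier DI"
  then obtain y where y: "y \<in> L2" "Y = cls y" by (rule DI_E)
  have yC: "y t \<in> fib.C t" for t using y by simp
  show "hadd DI X Y \<in> hcarrier DI" using x y by (simp add: DI_add)
  show "hadd DI X Y = hadd DI Y X" using x y fib.add_commute[OF xC yC] by (simp add: DI_add)
  show "hscale DI a (hadd DI X Y) = hadd DI (hscale DI a X) (hscale DI a Y)"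
    using x y xC yC by (simp add: DI_add DI_scale fib.scale_add_right)
  show "hinner DI Y X = cnj (hinner DI X Y)"
    unfolding x(2) y(2) DI_inner[OF x(1) y(1)] DI_inner[OF y(1) x(1)] Bochner_Integration.integral_cnj[symmetric]
    by (intro Bochner_Integration.integral_cong refl fib.inner_cnj xC yC)
  show "hinner DI (hscale DI a X) Y = a * hinner DI X Y"
    using x y xC yC by (simp add: DI_scale DI_inner)
  assume "Z \<in> hcarrier DI"
  then obtain z where z: "z \<in> L2" "Z = cls z" by (rule DI_E)
  have zC: "z t \<in> fib.C t" for t using z by simp
  show "hadd DI (hadd DI X Y) Z = hadd DI X (hadd DI Y Z)" using x y z xC yC zC by (simp add: DI_add fib.add_assoc)
  show "hinner DI (hadd DI X Y) Z = hinner DI X Z + hinner DI Y Z"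
    using x y z xC yC zC L2_inner_integrable by (simp add: DI_add DI_inner)
qed (rule DI_complete)

end

section \<open>Dense sequences of fields\<close>

text \<open>The complex numbers with rational real and imaginary part.\<close>

definition crat :: "rat \<Rightarrow> rat \<Rightarrow> complex" where "crat a b = Complex (of_rat a) (of_rat b)"

lemma crat_dense: assumes "e > 0" obtains a b where "cmod (c - crat a b) < e"
proof -
  obtain a where a: "Re c - e/2 < of_rat a" "of_rat a < Re c + e/2" using of_rat_dense[of "Re c - e/2" "Re c + e/2"] assms by auto
  obtain b where b: "Im c - e/2 < of_rat b" "of_rat b < Im c + e/2" using of_rat_dense[of "Im c - e/2" "Im c + e/2"] assms by auto
  have "cmod (c - crat a b) \<le> \<bar>Re (c - crat a b)\<bar> + \<bar>Im (c - crat a b)\<bar>" by (rule cmod_le)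
  also have "\<dots> < e" using a b by (simp add: crat_def abs_if)
  finally show thesis by (rule that)
qed

lemma crat_mult: "crat a b * crat c d = crat (a * c - b * d) (a * d + b * c)"
  by (simp add: crat_def complex_eq_iff of_rat_mult of_rat_diff of_rat_add)

text \<open>Combinations are indexed by lists because these can be enumerated.\<close>

primrec hcomb :: "'v hilbert_struct \<Rightarrow> (nat \<Rightarrow> 'v) \<Rightarrow> (rat \<times> rat \<times> nat) list \<Rightarrow> 'v" where
  "hcomb H y [] = hzero H"
| "hcomb H y (p # ps) = hadd H (hscale H (crat (fst p) (fst (snd p))) (y (snd (snd p)))) (hcomb H y ps)"

context hilbert_space
begin

lemma hcomb_C [simp]: "(\<And>n. y n \<in> C) \<Longrightarrow> hcomb H y ps \<in> C"
  by (induction ps) auto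

lemma hcomb_append: "(\<And>n. y n \<in> C) \<Longrightarrow> hcomb H y (ps @ qs) = hadd H (hcomb H y ps) (hcomb H y qs)"
  by (induction ps) (simp_all add: zero_add add_assoc)

lemma hcomb_scale: "(\<And>n. y n \<in> C) \<Longrightarrow>
  hscale H (crat a b) (hcomb H y ps) = hcomb H y (map (\<lambda>(c, d, n). (a * c - b * d, a * d + b * c, n)) ps)"
  by (induction ps) (auto simp: scale_add_right scale_scale crat_mult)

lemma hcomb_dense:
  fixes y :: "nat \<Rightarrow> 'v"
  assumes y: "\<And>n. y n \<in> C" and d: "hdense H (hsubspace H hull range y)"
  shows "hdense H (range (hcomb H y))"
proof -
  let ?R = "range (hcomb H y)"
  have RC: "?R \<subseteq> C" using y by auto
  define D where "D = {v \<in> C. \<forall>e>0. \<exists>k\<in>?R. hnorm H (hdiff H v k) < e}"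
  have approx: "\<exists>ps. hnorm H (hdiff H v (hcomb H y ps)) < e" if "v \<in> D" "e > 0" for v and e :: real
    using that by (auto simp: D_def)
  have RD: "?R \<subseteq> D"
  proof
    fix v assume v: "v \<in> ?R"
    then have "hnorm H (hdiff H v v) = 0" using diff_self[OF subsetD[OF RC v]] by simp
    then show "v \<in> D" unfolding D_def by (intro CollectI conjI allI impI subsetD[OF RC v] bexI[OF _ v]) (simp only:)
  qed
  have sub: "hsubspace H D" unfolding hsubspace_def
  proof (intro conjI ballI allI)
    show "hzero H \<in> D" using RD by (metis hcomb.simps(1) rangeI subsetD)
    fix v assume v: "v \<in> D"
    then have vC: "v \<in> C" by (simp add: D_def)
    { fix w assume w: "w \<in> D"
      then have wC: "w \<in> C" by (simp add: D_def)
      have "\<exists>k\<in>?R. hnorm H (hdiff H (hadd H v w) k) < e" if e: "e > 0" for e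
      proof -
        obtain ps qs where pq: "hnorm H (hdiff H v (hcomb H y ps)) < e/2" "hnorm H (hdiff H w (hcomb H y qs)) < e/2"
          using approx[OF v] approx[OF w] e by (meson half_gt_zero)
        have "hdiff H (hadd H v w) (hcomb H y (ps @ qs)) = hadd H (hdiff H v (hcomb H y ps)) (hdiff H w (hcomb H y qs))"
          by (rule inner_ext) (use vC wC y in \<open>simp_all add: hcomb_append\<close>)
        then have "hnorm H (hdiff H (hadd H v w) (hcomb H y (ps @ qs))) < e"
          using hnorm_triangle[of "hdiff H v (hcomb H y ps)" "hdiff H w (hcomb H y qs)"] pq vC wC y by simp
        then show ?thesis by blast
      qed
      then show "hadd H v w \<in> D" using vC wC by (simp add: D_def) }
    fix c
    have "\<exists>k\<in>?R. hnorm H (hdiff H (hscale H c v) k) < e" if e: "e > 0" for e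
    proof -
      have v1: "hnorm H v + 1 > 0" using hnorm_ge[OF vC] by simp
      have "e / (2 * (hnorm H v + 1)) > 0" using e v1 by simp
      then obtain a b where ab: "cmod (c - crat a b) < e / (2 * (hnorm H v + 1))" by (rule crat_dense)
      have c1: "cmod (crat a b) + 1 > 0" by (simp add: add_nonneg_pos)
      have "e / (2 * (cmod (crat a b) + 1)) > 0" using e c1 by simp
      then obtain ps where ps: "hnorm H (hdiff H v (hcomb H y ps)) < e / (2 * (cmod (crat a b) + 1))" using approx[OF v] by blast
      let ?q = "hcomb H y ps"
      have q: "?q \<in> C" using y by simp
      have "hdiff H (hscale H c v) (hscale H (crat a b) ?q) = hadd H (hscale H (c - crat a b) v) (hscale H (crat a b) (hdiff H v ?q))"
        by (rule inner_ext) (use vC q in \<open>simp_all add: algebra_simps\<close>)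
      then have "hnorm H (hdiff H (hscale H c v) (hscale H (crat a b) ?q)) \<le> cmod (c - crat a b) * hnorm H v + cmod (crat a b) * hnorm H (hdiff H v ?q)"
        using hnorm_triangle[of "hscale H (c - crat a b) v" "hscale H (crat a b) (hdiff H v ?q)"] vC q by simp
      also have "\<dots> < e/2 + e/2"
      proof (rule add_le_less_mono)
        have "cmod (c - crat a b) * hnorm H v \<le> cmod (c - crat a b) * (hnorm H v + 1)" by (intro mult_left_mono) auto
        also have "\<dots> \<le> e/2" using ab v1 by (simp add: pos_less_divide_eq field_simps)
        finally show "cmod (c - crat a b) * hnorm H v \<le> e/2" .
        have "cmod (crat a b) * hnorm H (hdiff H v ?q) \<le> (cmod (crat a b) + 1) * hnorm H (hdiff H v ?q)"
          using vC q by (intro mult_right_mono) auto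
        also have "\<dots> < e/2" using ps c1 by (simp add: pos_less_divide_eq field_simps)
        finally show "cmod (crat a b) * hnorm H (hdiff H v ?q) < e/2" .
      qed
      finally show ?thesis using hcomb_scale[of y a b ps, OF y] by auto
    qed
    then show "hscale H c v \<in> D" using vC by (simp add: D_def)
  qed (auto simp: D_def)
  have "range y \<subseteq> ?R"
  proof
    fix z assume "z \<in> range y"
    then obtain n where n: "z = y n" by blast
    have "crat 1 0 = 1" by (simp add: crat_def complex_eq_iff)
    then have "hcomb H y [(1, 0, n)] = y n" using y add_zero scale_one by simp
    then show "z \<in> ?R" using n by (metis rangeI)
  qed
  then have "range y \<subseteq> D" using RD by blast
  then have hull: "hsubspace H hull range y \<subseteq> D" using sub by (rule hull_minimal)
  show ?thesis unfolding hdense_def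
  proof (intro ballI allI impI)
    fix v and e :: real assume v: "v \<in> C" and e: "e > 0"
    obtain k where k: "k \<in> hsubspace H hull range y" "hnorm H (hdiff H v k) < e/2"
      using d v half_gt_zero[OF e] unfolding hdense_def by blast
    then have kR: "k \<in> D" using hull by blast
    then have kC: "k \<in> C" by (simp add: D_def)
    obtain ps where ps: "hnorm H (hdiff H k (hcomb H y ps)) < e/2" using approx[OF kR half_gt_zero[OF e]] by blast
    have "hnorm H (hdiff H v (hcomb H y ps)) < e"
      using hnorm_triangle_diff[of v k "hcomb H y ps"] v kC y k ps by simp
    then show "\<exists>q\<in>?R. hnorm H (hdiff H v q) < e" by blast
  qed
qed

lemma op_norm_le: assumes T: "T \<in> bounded_ops H" and K: "op_norm H T \<le> K"
  shows "0 \<le> K" "x \<in> C \<Longrightarrow> hnorm H (ap T x) \<le> K * hnorm H x"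
proof -
  note t = bounded_opsD[OF T]
  obtain k where k: "k \<ge> 0" "\<forall>x\<in>C. hnorm H (ap T x) \<le> k * hnorm H x" using t(9) by blast
  have bdd: "bdd_above ((\<lambda>x. hnorm H (ap T x)) ` {x \<in> C. hnorm H x \<le> 1})"
  proof (rule bdd_aboveI2)
    fix x assume "x \<in> {x \<in> C. hnorm H x \<le> 1}"
    then show "hnorm H (ap T x) \<le> k" using k by (auto intro: order_trans[OF _ mult_left_le[of "hnorm H x" k]])
  qed
  have le: "hnorm H (ap T x) \<le> K" if "x \<in> C" "hnorm H x \<le> 1" for x
    using cSUP_upper[OF _ bdd, of x] that K by (auto simp: op_norm_def)
  show "0 \<le> K" using le[of "hzero H"] t(8) by simp
  assume x: "x \<in> C"
  show "hnorm H (ap T x) \<le> K * hnorm H x"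
  proof (cases "hnorm H x = 0")
    case True
    then have "x = hzero H" using hnorm_eq_0 x by blast
    then show ?thesis using t(8) by simp
  next
    case False
    then have p: "hnorm H x > 0" using hnorm_ge[OF x] by simp
    have "hnorm H (ap T (hscale H (complex_of_real (1 / hnorm H x)) x)) \<le> K"
      by (rule le) (use x p in \<open>auto simp: norm_divide\<close>)
    then show ?thesis using x p by (simp add: t(4,6) norm_divide field_simps)
  qed
qed

lemma op_norm_leI: assumes K: "0 \<le> K" and b: "\<And>x. x \<in> C \<Longrightarrow> hnorm H (ap T x) \<le> K * hnorm H x"
  shows "op_norm H T \<le> K"
  unfolding op_norm_def
proof (rule cSUP_least)
  show "{x \<in> C. hnorm H x \<le> 1} \<noteq> {}" using zero_closed by (intro ex_in_conv[THEN iffD1] exI[of _ "hzero H"]) simp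
  fix x assume "x \<in> {x \<in> C. hnorm H x \<le> 1}"
  then have x: "x \<in> C" "hnorm H x \<le> 1" by auto
  have "hnorm H (ap T x) \<le> K * hnorm H x" by (rule b[OF x(1)])
  also have "\<dots> \<le> K" using x K by (simp add: mult_left_le)
  finally show "hnorm H (ap T x) \<le> K" .
qed

lemma bounded_eq_on_dense:
  assumes A: "A \<in> bounded_ops H" and B: "B \<in> bounded_ops H" and D: "hdense H D" "D \<subseteq> C" and eq: "\<And>x. x \<in> D \<Longrightarrow> ap A x = ap B x"
  shows "A = B"
proof (rule op_eqI[OF A B])
  fix x assume x: "x \<in> C"
  obtain X where X: "\<And>n. X n \<in> D" "hlim H X x" using hdense_obtain_seq[OF D x] by metis
  have XC: "X n \<in> C" for n using X D by blast
  have "hlim H (\<lambda>n. ap A (X n)) (ap A x)" "hlim H (\<lambda>n. ap B (X n)) (ap B x)"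
    by (rule hlim_ap[OF A X(2) XC x], rule hlim_ap[OF B X(2) XC x])
  then show "ap A x = ap B x" using eq[OF X(1)] hlim_unique[of "\<lambda>n. ap A (X n)"] XC x bounded_opsD(4)[OF A] bounded_opsD(4)[OF B] by simp
qed

end

context hilbert_field
begin

sublocale DI: hilbert_space DI by (rule hilbert_space_DI)

text \<open>
  The given fields become square integrable after multiplication with positive functions,
  made from an integrable positive function, which exists because \<open>\<omega>\<close> is \<open>\<sigma>\<close>-finite.
  Rational combinations then turn a total sequence into a dense one.
\<close>

lemma exists_dense_sequence:
  "\<exists>d :: nat \<Rightarrow> 'z \<Rightarrow> 'v. (\<forall>n. d n \<in> L2) \<and> (\<forall>t. hdense (H t) (range (\<lambda>n. d n t)))"
proof -
  obtain h :: "'z \<Rightarrow> real" where h: "h \<in> borel_measurable \<omega>" "\<And>x. h x > 0" "\<And>x. h x \<le> 1" "integrable \<omega> h"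
    by (rule obtain_positive_integrable_function, rule that)
  obtain X :: "nat \<Rightarrow> 'z \<Rightarrow> 'v" where X: "\<And>n. X n \<in> S" "\<And>t. hdense (H t) (hsubspace (H t) hull range (\<lambda>n. X n t))"
    using fundamental by blast
  define c where "c n t = sqrt (h t) / (1 + hnorm (H t) (X n t))" for n and t :: 'z
  have n1: "1 + hnorm (H t) (X n t) > 0" for n t using fib.hnorm_ge[of "X n t" t] X(1) by (simp add: add_pos_nonneg)
  have c0: "c n t > 0" for n t using h(2)[of t] n1 by (simp add: c_def)
  define Y where "Y n t = hscale (H t) (complex_of_real (c n t)) (X n t)" for n and t :: 'z
  have YS: "Y n \<in> S" for n unfolding Y_def[abs_def]
  proof (rule S_scale[OF X(1)])
    have [measurable]: "(\<lambda>t. hnorm (H t) (X n t)) \<in> borel_measurable \<omega>" by (rule S_norm[OF X(1)])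
    have [measurable]: "h \<in> borel_measurable \<omega>" by (rule h)
    show "(\<lambda>t. complex_of_real (c n t)) \<in> borel_measurable \<omega>" unfolding c_def by measurable
  qed
  have YL: "Y n \<in> L2" for n
  proof -
    have "integrable \<omega> (\<lambda>t. (hnorm (H t) (Y n t))\<^sup>2)"
    proof (rule Bochner_Integration.integrable_bound[OF h(4)])
      show "AE t in \<omega>. norm ((hnorm (H t) (Y n t))\<^sup>2) \<le> norm (h t)"
      proof (rule AE_I2)
        fix t
        have "hnorm (H t) (Y n t) = c n t * hnorm (H t) (X n t)" using X(1) c0[of n t] by (simp add: Y_def)
        also have "\<dots> \<le> c n t * (1 + hnorm (H t) (X n t))" using c0[of n t] by (intro mult_left_mono) auto
        also have "\<dots> = sqrt (h t)" using n1[of t n] by (simp add: c_def)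
        finally have "(hnorm (H t) (Y n t))\<^sup>2 \<le> (sqrt (h t))\<^sup>2" using YS by (intro power_mono) auto
        then show "norm ((hnorm (H t) (Y n t))\<^sup>2) \<le> norm (h t)" using h(2)[of t] by simp
      qed
    qed (rule S_norm_sq[OF YS])
    then show ?thesis using YS L2_iff by blast
  qed
  have dY: "hdense (H t) (hsubspace (H t) hull range (\<lambda>n. Y n t))" for t
  proof -
    have "range (\<lambda>n. X n t) \<subseteq> K" if K: "hsubspace (H t) K" "range (\<lambda>n. Y n t) \<subseteq> K" for K
    proof
      fix v assume "v \<in> range (\<lambda>n. X n t)"
      then obtain n where n: "v = X n t" by blast
      have "v = hscale (H t) (complex_of_real (1 / c n t)) (Y n t)"
        using X(1) c0[of n t] by (simp add: n Y_def fib.scale_scale fib.scale_one flip: of_real_mult)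
      moreover have "Y n t \<in> K" using K(2) by blast
      ultimately show "v \<in> K" using K(1) by (simp add: hsubspace_def)
    qed
    then have "hsubspace (H t) hull range (\<lambda>n. X n t) \<subseteq> hsubspace (H t) hull range (\<lambda>n. Y n t)"
      unfolding hull_def by blast
    then show ?thesis using X(2)[of t] unfolding hdense_def by blast
  qed
  define d where "d n t = hcomb (H t) (\<lambda>n. Y n t) (from_nat n)" for n t
  have dL: "(\<lambda>t. hcomb (H t) (\<lambda>n. Y n t) ps) \<in> L2" for ps
    by (induction ps) (auto simp: YL)
  have "range (\<lambda>n. d n t) = range (hcomb (H t) (\<lambda>n. Y n t))" for t
    unfolding d_def by (metis (no_types) surj_from_nat image_comp o_def image_cong)
  then have "hdense (H t) (range (\<lambda>n. d n t))" for t
    using fib.hcomb_dense[OF _ dY[of t]] YS by simp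
  moreover have "d n \<in> L2" for n unfolding d_def[abs_def] by (rule dL)
  ultimately show ?thesis by blast
qed

definition dseq :: "nat \<Rightarrow> 'z \<Rightarrow> 'v" where
  "dseq = (SOME d. (\<forall>n. d n \<in> L2) \<and> (\<forall>t. hdense (H t) (range (\<lambda>n. d n t))))"

lemma dseq_L2 [simp]: "dseq n \<in> L2" and dseq_dense: "hdense (H t) (range (\<lambda>n. dseq n t))"
  using someI_ex[OF exists_dense_sequence] unfolding dseq_def[symmetric] by blast+

lemma dseq_C: "range (\<lambda>n. dseq n t) \<subseteq> fib.C t" by auto

text \<open>
  Every measurable field is a pointwise limit of fields that are piecewise members of the
  dense sequence: at each point the first member within distance \<open>2\<^sup>-\<^sup>j\<close> is taken.
\<close>

lemma dseq_index:
  assumes x: "x \<in> S"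
  obtains k :: "nat \<Rightarrow> 'z \<Rightarrow> nat" where "\<And>j. k j \<in> \<omega> \<rightarrow>\<^sub>M count_space UNIV"
    "\<And>j t. hnorm (H t) (hdiff (H t) (x t) (dseq (k j t) t)) < (1/2)^j"
    "\<And>t. hlim (H t) (\<lambda>j. dseq (k j t) t) (x t)"
proof -
  define k where "k j t = (LEAST n. hnorm (H t) (hdiff (H t) (x t) (dseq n t)) < (1/2)^j)" for j t
  have m: "k j \<in> \<omega> \<rightarrow>\<^sub>M count_space UNIV" for j
    unfolding k_def[abs_def]
  proof (rule measurable_Least)
    fix n
    have [measurable]: "(\<lambda>t. hnorm (H t) (hdiff (H t) (x t) (dseq n t))) \<in> borel_measurable \<omega>"
      by (rule S_norm) (use x in simp)
    show "Measurable.pred \<omega> (\<lambda>t. hnorm (H t) (hdiff (H t) (x t) (dseq n t)) < (1/2)^j)" by measurable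
  qed
  have lt: "hnorm (H t) (hdiff (H t) (x t) (dseq (k j t) t)) < (1/2)^j" for j t
  proof -
    have "(1/2::real)^j > 0" by simp
    then have "\<exists>y\<in>range (\<lambda>n. dseq n t). hnorm (H t) (hdiff (H t) (x t) y) < (1/2)^j"
      using dseq_dense[of t] S_C[OF x] unfolding hdense_def by simp
    then obtain n where "hnorm (H t) (hdiff (H t) (x t) (dseq n t)) < (1/2)^j" by auto
    then show ?thesis unfolding k_def by (rule LeastI)
  qed
  have "hlim (H t) (\<lambda>j. dseq (k j t) t) (x t)" for t unfolding hlim_def
  proof (rule tendsto_0_le)
    show "(\<lambda>j. (1/2::real)^j) \<longlonglongrightarrow> 0" by (simp add: LIMSEQ_realpow_zero)
    show "norm (hnorm (H t) (hdiff (H t) (dseq (k j t) t) (x t))) \<le> (1/2)^j" for j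
      using lt[of t j] fib.hnorm_diff_commute[of "x t" t "dseq (k j t) t"] x by simp
  qed
  then show thesis using that m lt by blast
qed

section \<open>Essentially bounded fields\<close>

abbreviation "ebf \<equiv> ess_bounded_field \<omega> H S"
abbreviation "dop \<equiv> dint_op \<omega> H S"

lemma ebf_bo: "ebf B \<Longrightarrow> B t \<in> bounded_ops (H t)"
  by (simp add: ess_bounded_field_def measurable_bounded_field_def)

lemma ebf_C [simp]: "ebf B \<Longrightarrow> x \<in> fib.C t \<Longrightarrow> ap (B t) x \<in> fib.C t"
  using fib.bounded_opsD(4)[OF ebf_bo] .

lemma ebf_S [simp]: "ebf B \<Longrightarrow> x \<in> S \<Longrightarrow> (\<lambda>t. ap (B t) (x t)) \<in> S"
  by (simp add: ess_bounded_field_def measurable_bounded_field_def)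

abbreviation "ae_bounded K B \<equiv> AE t in \<omega>. \<forall>x\<in>fib.C t. hnorm (H t) (ap (B t) x) \<le> K * hnorm (H t) x"

lemma ebf_bound:
  assumes "ebf B"
  obtains K where "0 \<le> K" "ae_bounded K B"
proof -
  obtain K where K: "AE t in \<omega>. op_norm (H t) (B t) \<le> K" using assms by (auto simp: ess_bounded_field_def)
  have "ae_bounded \<bar>K\<bar> B"
    using K
  proof eventually_elim
    case (elim t)
    then have "op_norm (H t) (B t) \<le> \<bar>K\<bar>" by simp
    then show ?case using fib.op_norm_le(2)[OF ebf_bo[OF assms]] by blast
  qed
  then show thesis using that[of "\<bar>K\<bar>"] by simp
qed

lemma ebf_I:
  assumes "\<And>t. B t \<in> bounded_ops (H t)" "\<And>x. x \<in> S \<Longrightarrow> (\<lambda>t. ap (B t) (x t)) \<in> S" "0 \<le> K"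
    "ae_bounded K B"
  shows "ebf B"
proof -
  have "AE t in \<omega>. op_norm (H t) (B t) \<le> K"
    using assms(4) by eventually_elim (rule fib.op_norm_leI[OF assms(3)], blast)
  then show ?thesis using assms(1,2) by (auto simp: ess_bounded_field_def measurable_bounded_field_def)
qed

lemma ebf_L2 [simp]: "ebf B \<Longrightarrow> x \<in> L2 \<Longrightarrow> (\<lambda>t. ap (B t) (x t)) \<in> L2"
proof -
  assume B: "ebf B" and x: "x \<in> L2"
  obtain K where K: "0 \<le> K" "ae_bounded K B"
    using ebf_bound[OF B] by blast
  show ?thesis
  proof (rule L2_bound[OF _ x, of _ K])
    show "AE t in \<omega>. hnorm (H t) (ap (B t) (x t)) \<le> K * hnorm (H t) (x t)"
      using K(2) by eventually_elim (use x in simp)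
  qed (use B x in simp)
qed

lemma dop_witness:
  assumes w: "dint_witness \<omega> H S T X x"
  shows "dop T X = Some (cls (\<lambda>t. ap (T t) (x t)))"
proof -
  let ?y = "SOME x. dint_witness \<omega> H S T X x"
  have y: "dint_witness \<omega> H S T X ?y" using someI[of "dint_witness \<omega> H S T X", OF w] .
  obtain u where u: "u \<in> L2" "X = cls u" using w DI_E by (auto simp: dint_witness_def)
  have "AE t in \<omega>. ?y t = u t" "AE t in \<omega>. x t = u t" using y w u cls_iff by (auto simp: dint_witness_def)
  then have "AE t in \<omega>. ap (T t) (?y t) = ap (T t) (x t)" by eventually_elim simp
  then have "cls (\<lambda>t. ap (T t) (?y t)) = cls (\<lambda>t. ap (T t) (x t))" by (rule cls_cong)
  then show ?thesis using w unfolding dint_op_def by auto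
qed

lemma dop_iff:
  assumes x: "x \<in> L2" and y: "y \<in> L2"
  shows "dop T (cls x) = Some (cls y) \<longleftrightarrow>
     (\<exists>u\<in>L2. (AE t in \<omega>. u t = x t) \<and> (\<forall>t. u t \<in> dom (T t)) \<and> (\<lambda>t. ap (T t) (u t)) \<in> L2
        \<and> (AE t in \<omega>. ap (T t) (u t) = y t))"
proof -
  have w: "dint_witness \<omega> H S T (cls x) u \<longleftrightarrow> u \<in> L2 \<and> (AE t in \<omega>. u t = x t) \<and> (\<forall>t. u t \<in> dom (T t)) \<and> (\<lambda>t. ap (T t) (u t)) \<in> L2" for u
    using x by (auto simp: dint_witness_def cls_iff)
  show ?thesis
  proof
    assume d: "dop T (cls x) = Some (cls y)"
    then obtain u where u: "dint_witness \<omega> H S T (cls x) u" by (auto simp: dint_op_def split: if_splits)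
    then have "cls (\<lambda>t. ap (T t) (u t)) = cls y" using dop_witness d by simp
    then show "\<exists>u\<in>L2. (AE t in \<omega>. u t = x t) \<and> (\<forall>t. u t \<in> dom (T t)) \<and> (\<lambda>t. ap (T t) (u t)) \<in> L2
        \<and> (AE t in \<omega>. ap (T t) (u t) = y t)" using u w cls_eqD by blast
  next
    assume "\<exists>u\<in>L2. (AE t in \<omega>. u t = x t) \<and> (\<forall>t. u t \<in> dom (T t)) \<and> (\<lambda>t. ap (T t) (u t)) \<in> L2
        \<and> (AE t in \<omega>. ap (T t) (u t) = y t)"
    then obtain u where u: "dint_witness \<omega> H S T (cls x) u" "AE t in \<omega>. ap (T t) (u t) = y t" using w by blast
    then show "dop T (cls x) = Some (cls y)" using dop_witness cls_cong by metis
  qed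
qed

lemma dop_SomeE:
  assumes "dop T X = Some Y"
  obtains u where "u \<in> L2" "X = cls u" "\<And>t. u t \<in> dom (T t)" "(\<lambda>t. ap (T t) (u t)) \<in> L2" "Y = cls (\<lambda>t. ap (T t) (u t))"
proof -
  obtain u where u: "dint_witness \<omega> H S T X u" using assms by (auto simp: dint_op_def split: if_splits)
  obtain x where x: "x \<in> L2" "X = cls x" using u DI_E by (auto simp: dint_witness_def)
  have "u \<in> L2" "X = cls u" using u x cls_iff cls_cong by (auto simp: dint_witness_def)
  then show thesis using that[of u] u dop_witness[OF u] assms by (auto simp: dint_witness_def)
qed

lemma dop_ebf: assumes B: "ebf B" and x: "x \<in> L2" shows "dop B (cls x) = Some (cls (\<lambda>t. ap (B t) (x t)))"
proof (rule dop_witness)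
  have "x t \<in> dom (B t)" for t using fib.bounded_opsD(2)[OF ebf_bo[OF B]] x by simp
  then show "dint_witness \<omega> H S B (cls x) x" using x B by (simp add: dint_witness_def cls_self)
qed

lemma dop_ap [simp]: "ebf B \<Longrightarrow> x \<in> L2 \<Longrightarrow> ap (dop B) (cls x) = cls (\<lambda>t. ap (B t) (x t))"
  by (simp add: dop_ebf)

lemma dop_bounded: assumes B: "ebf B" shows "dop B \<in> bounded_ops DI"
proof -
  obtain K where K: "0 \<le> K" "ae_bounded K B"
    using ebf_bound[OF B] by blast
  have "mk_op DI (ap (dop B)) \<in> bounded_ops DI"
  proof (rule DI.mk_op_bounded[where k = K])
    fix X assume "X \<in> DI.C"
    then obtain x where x: "x \<in> L2" "X = cls x" by (rule DI_E)
    show "ap (dop B) X \<in> DI.C" using x B by simp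
    show "ap (dop B) (hscale DI a X) = hscale DI a (ap (dop B) X)" for a
      using x B fib.bounded_opsD(6)[OF ebf_bo[OF B]] by (simp add: DI_scale)
    show "ap (dop B) (hadd DI X Y) = hadd DI (ap (dop B) X) (ap (dop B) Y)" if Y: "Y \<in> DI.C" for Y
    proof -
      obtain y where y: "y \<in> L2" "Y = cls y" using Y by (rule DI_E)
      show ?thesis using x y B fib.bounded_opsD(5)[OF ebf_bo[OF B]] by (simp add: DI_add)
    qed
    have "(LINT t|\<omega>. (hnorm (H t) (ap (B t) (x t)))\<^sup>2) \<le> (LINT t|\<omega>. K\<^sup>2 * (hnorm (H t) (x t))\<^sup>2)"
    proof (rule integral_mono_AE)
      show "AE t in \<omega>. (hnorm (H t) (ap (B t) (x t)))\<^sup>2 \<le> K\<^sup>2 * (hnorm (H t) (x t))\<^sup>2"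
        using K(2)
      proof eventually_elim
        case (elim t)
        then have "(hnorm (H t) (ap (B t) (x t)))\<^sup>2 \<le> (K * hnorm (H t) (x t))\<^sup>2" using x B by (intro power_mono) auto
        then show ?case by (simp add: power_mult_distrib)
      qed
    qed (use L2_integrable[OF ebf_L2[OF B x(1)]] L2_integrable[OF x(1)] in auto)
    then have "(hnorm DI (ap (dop B) X))\<^sup>2 \<le> (K * hnorm DI X)\<^sup>2"
      using x B by (simp add: DI_norm_sq power_mult_distrib)
    then show "hnorm DI (ap (dop B) X) \<le> K * hnorm DI X"
      using x K(1) DI_norm_ge[OF x(1)] by (meson mult_nonneg_nonneg power2_le_imp_le DI.hnorm_ge DI_mem)
  qed
  moreover have "mk_op DI (ap (dop B)) = dop B"
  proof
    fix X
    show "mk_op DI (ap (dop B)) X = dop B X"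
    proof (cases "X \<in> DI.C")
      case True
      then obtain x where "x \<in> L2" "X = cls x" by (rule DI_E)
      then show ?thesis using dop_ebf[OF B] by (simp add: mk_op_def)
    next
      case False
      then show ?thesis by (auto simp: mk_op_def dint_op_def dint_witness_def)
    qed
  qed
  ultimately show ?thesis by simp
qed

lemma dop_eqI:
  assumes A: "A \<in> bounded_ops DI" and B: "ebf B" and eq: "\<And>x. x \<in> L2 \<Longrightarrow> ap A (cls x) = cls (\<lambda>t. ap (B t) (x t))"
  shows "A = dop B"
proof (rule DI.op_eqI[OF A dop_bounded[OF B]])
  fix X assume "X \<in> DI.C"
  then obtain x where "x \<in> L2" "X = cls x" by (rule DI_E)
  then show "ap A X = ap (dop B) X" using eq B by simp
qed

lemma dop_AE_eqI: assumes A: "ebf A" and B: "ebf B" and eq: "AE t in \<omega>. A t = B t" shows "dop A = dop B"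
proof (rule dop_eqI[OF dop_bounded[OF A] B])
  fix x assume "x \<in> L2"
  moreover have "AE t in \<omega>. ap (A t) (x t) = ap (B t) (x t)" using eq by eventually_elim simp
  ultimately show "ap (dop A) (cls x) = cls (\<lambda>t. ap (B t) (x t))" using A cls_cong by simp
qed

lemma dop_AE_eqD: assumes A: "ebf A" and B: "ebf B" and eq: "dop A = dop B" shows "AE t in \<omega>. A t = B t"
proof -
  have "AE t in \<omega>. ap (A t) (dseq n t) = ap (B t) (dseq n t)" for n
    by (rule cls_eqD) (use A B dop_ap[OF A, of "dseq n"] dop_ap[OF B, of "dseq n"] eq in auto)
  then have "AE t in \<omega>. \<forall>n. ap (A t) (dseq n t) = ap (B t) (dseq n t)" by (simp add: AE_all_countable)
  then show ?thesis
    by eventually_elim (rule fib.bounded_eq_on_dense[OF ebf_bo[OF A] ebf_bo[OF B] dseq_dense dseq_C], auto)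
qed

lemma ebf_comp: assumes A: "ebf A" and B: "ebf B"
  shows "ebf (\<lambda>t. A t \<circ>\<^sub>m B t)" "dop (\<lambda>t. A t \<circ>\<^sub>m B t) = dop A \<circ>\<^sub>m dop B"
proof -
  have e: "ap (A t \<circ>\<^sub>m B t) x = ap (A t) (ap (B t) x)" if "x \<in> fib.C t" for t x
    using fib.ap_comp[OF ebf_bo[OF B] that] .
  obtain K where K: "0 \<le> K" "ae_bounded K A"
    using ebf_bound[OF A] by blast
  obtain L where L: "0 \<le> L" "ae_bounded L B"
    using ebf_bound[OF B] by blast
  show AB: "ebf (\<lambda>t. A t \<circ>\<^sub>m B t)"
  proof (rule ebf_I[of _ "K * L"])
    show "A t \<circ>\<^sub>m B t \<in> bounded_ops (H t)" for t by (rule fib.comp_bounded[OF ebf_bo[OF A] ebf_bo[OF B]])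
    show "(\<lambda>t. ap (A t \<circ>\<^sub>m B t) (x t)) \<in> S" if x: "x \<in> S" for x
      using ebf_S[OF A ebf_S[OF B x]] e x by simp
    show "ae_bounded (K * L) (\<lambda>t. A t \<circ>\<^sub>m B t)"
      using K(2) L(2)
    proof eventually_elim
      case (elim t)
      show ?case
      proof
        fix x assume x: "x \<in> fib.C t"
        have "hnorm (H t) (ap (A t) (ap (B t) x)) \<le> K * hnorm (H t) (ap (B t) x)" using elim x B by simp
        also have "\<dots> \<le> K * (L * hnorm (H t) x)" using elim x K(1) by (intro mult_left_mono) auto
        finally show "hnorm (H t) (ap (A t \<circ>\<^sub>m B t) x) \<le> K * L * hnorm (H t) x" using e[OF x] by (simp add: mult.assoc)
      qed
    qed
  qed (use K L in auto)
  show "dop (\<lambda>t. A t \<circ>\<^sub>m B t) = dop A \<circ>\<^sub>m dop B"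
    by (rule dop_eqI[symmetric, OF DI.comp_bounded[OF dop_bounded[OF A] dop_bounded[OF B]] AB])
       (use A B e in \<open>simp add: DI.ap_comp[OF dop_bounded[OF B]]\<close>)
qed

lemma ebf_adjoint: assumes A: "ebf A"
  shows "ebf (\<lambda>t. op_adjoint (H t) (A t))" "dop (\<lambda>t. op_adjoint (H t) (A t)) = op_adjoint DI (dop A)"
proof -
  obtain K where K: "0 \<le> K" "ae_bounded K A"
    using ebf_bound[OF A] by blast
  note ad = fib.adjoint_bounded[OF ebf_bo[OF A]]
  have adC: "ap (op_adjoint (H t) (A t)) x \<in> fib.C t" if "x \<in> fib.C t" for t x
    using fib.bounded_opsD(4)[OF ad(1) that] .
  show B: "ebf (\<lambda>t. op_adjoint (H t) (A t))"
  proof (rule ebf_I[OF ad(1) _ K(1)])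
    fix x assume x: "x \<in> S"
    show "(\<lambda>t. ap (op_adjoint (H t) (A t)) (x t)) \<in> S"
    proof (rule S_I)
      fix y assume y: "y \<in> S"
      have "(\<lambda>t. hinner (H t) (ap (A t) (y t)) (x t)) \<in> borel_measurable \<omega>"
        by (rule inner_measurable) (use A x y in auto)
      then show "(\<lambda>t. hinner (H t) (y t) (ap (op_adjoint (H t) (A t)) (x t))) \<in> borel_measurable \<omega>"
        using ad(2) x y by simp
    qed (use adC x in simp)
  next
    show "AE t in \<omega>. \<forall>x\<in>fib.C t. hnorm (H t) (ap (op_adjoint (H t) (A t)) x) \<le> K * hnorm (H t) x"
      using K(2)
    proof eventually_elim
      case (elim t)
      show ?case
      proof
        fix x assume x: "x \<in> fib.C t"
        let ?y = "ap (op_adjoint (H t) (A t)) x"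
        have y: "?y \<in> fib.C t" using adC x .
        have "(hnorm (H t) ?y)\<^sup>2 = Re (hinner (H t) (ap (A t) ?y) x)" using ad(2)[OF y x] fib.hnorm_sq[OF y] by simp
        also have "\<dots> \<le> hnorm (H t) (ap (A t) ?y) * hnorm (H t) x"
          by (rule order_trans[OF complex_Re_le_cmod fib.Cauchy_Schwarz]) (use A x y in auto)
        also have "\<dots> \<le> K * hnorm (H t) ?y * hnorm (H t) x" using elim x y by (intro mult_right_mono) auto
        finally have "hnorm (H t) ?y * hnorm (H t) ?y \<le> (K * hnorm (H t) x) * hnorm (H t) ?y" by (simp add: power2_eq_square mult_ac)
        then show "hnorm (H t) ?y \<le> K * hnorm (H t) x" by (rule le_of_mult_le) (use K(1) x in simp)
      qed
    qed
  qed
  show "dop (\<lambda>t. op_adjoint (H t) (A t)) = op_adjoint DI (dop A)"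
  proof (rule DI.adjoint_eqI[symmetric, OF dop_bounded[OF A] dop_bounded[OF B]])
    fix X Y assume "X \<in> DI.C" "Y \<in> DI.C"
    then obtain x y where xy: "x \<in> L2" "X = cls x" "y \<in> L2" "Y = cls y" by (metis DI_E)
    show "hinner DI (ap (dop A) X) Y = hinner DI X (ap (dop (\<lambda>t. op_adjoint (H t) (A t))) Y)"
      using xy A B ad(2) DI_inner[OF ebf_L2[OF A xy(1)] xy(3)] DI_inner[OF xy(1) ebf_L2[OF B xy(3)]] by simp
  qed
qed

lemma ebf_lin:
  fixes c d :: complex
  assumes A: "ebf A" and B: "ebf B"
  shows "ebf (\<lambda>t. op_lin (H t) c (A t) d (B t))"
    "dop (\<lambda>t. op_lin (H t) c (A t) d (B t)) = op_lin DI c (dop A) d (dop B)"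
proof -
  obtain K where K: "0 \<le> K" "ae_bounded K A"
    using ebf_bound[OF A] by blast
  obtain L where L: "0 \<le> L" "ae_bounded L B"
    using ebf_bound[OF B] by blast
  show F: "ebf (\<lambda>t. op_lin (H t) c (A t) d (B t))"
  proof (rule ebf_I[of _ "cmod c * K + cmod d * L"])
    show "op_lin (H t) c (A t) d (B t) \<in> bounded_ops (H t)" for t
      by (rule fib.op_lin_bounded[OF ebf_bo[OF A] ebf_bo[OF B]])
    show "(\<lambda>t. ap (op_lin (H t) c (A t) d (B t)) (x t)) \<in> S" if "x \<in> S" for x using that A B by simp
    show "AE t in \<omega>. \<forall>x\<in>fib.C t. hnorm (H t) (ap (op_lin (H t) c (A t) d (B t)) x) \<le> (cmod c * K + cmod d * L) * hnorm (H t) x"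
      using K(2) L(2) by eventually_elim (use fib.op_lin_bound ebf_C[OF A] ebf_C[OF B] in blast)
  qed (use K L in auto)
  show "dop (\<lambda>t. op_lin (H t) c (A t) d (B t)) = op_lin DI c (dop A) d (dop B)"
    by (rule dop_eqI[symmetric, OF DI.op_lin_bounded[OF dop_bounded[OF A] dop_bounded[OF B]] F])
       (use A B in \<open>simp add: DI_add DI_scale\<close>)
qed

lemma ebf_scalar:
  assumes f: "f \<in> borel_measurable \<omega>" and K: "\<And>t. cmod (f t) \<le> K"
  shows "ebf (\<lambda>t. scalar_op (H t) (f t))"
proof (rule ebf_I[of _ K])
  show "0 \<le> K" using K norm_ge_zero order_trans by blast
  show "AE t in \<omega>. \<forall>x\<in>fib.C t. hnorm (H t) (ap (scalar_op (H t) (f t)) x) \<le> K * hnorm (H t) x"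
    using K by (intro AE_I2) (auto intro: mult_right_mono)
qed (use S_scale[OF _ f] in auto)

end

context hilbert_space
begin

section \<open>Operators that commute with the diagonal operators\<close>

text \<open>
  The assumption consists of countably many inequalities, so for fields it holds in almost
  every fibre as soon as each of them does.
\<close>

lemma extend_from_dense:
  fixes d y :: "nat \<Rightarrow> 'v"
  assumes d: "\<And>k. d k \<in> C" and y: "\<And>k. y k \<in> C" and dense: "hdense H (range d)" and K: "0 \<le> K"
    and le: "\<And>a b a' b' k l m. hnorm H (hdiff H (hadd H (hscale H (crat a b) (y k)) (hscale H (crat a' b') (y l))) (y m))
        \<le> K * hnorm H (hdiff H (hadd H (hscale H (crat a b) (d k)) (hscale H (crat a' b') (d l))) (d m))"
  obtains B where "B \<in> bounded_ops H" "\<And>k. ap B (d k) = y k" "\<And>x. x \<in> C \<Longrightarrow> hnorm H (ap B x) \<le> K * hnorm H x"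
proof -
  have cq10: "crat 1 0 = 1" and cq00: "crat 0 0 = 0" by (simp_all add: crat_def complex_eq_iff)
  have le1: "hnorm H (hdiff H (y k) (y m)) \<le> K * hnorm H (hdiff H (d k) (d m))" for k m
    using le[of 1 0 k 0 0 k m] d y by (simp add: cq10 cq00 scale_one add_zero)
  have ex: "\<exists>\<kappa> z. z \<in> C \<and> hlim H (\<lambda>j. d (\<kappa> j)) v \<and> hlim H (\<lambda>j. y (\<kappa> j)) z" if v: "v \<in> C" for v
  proof -
    obtain X where X: "\<And>n. X n \<in> range d" "hlim H X v" using hdense_obtain_seq[OF dense _ v] d by (metis image_subsetI)
    then have "\<forall>n. \<exists>k. X n = d k" by blast
    then obtain \<kappa> where k: "\<And>n. X n = d (\<kappa> n)" by metis
    have lv: "hlim H (\<lambda>j. d (\<kappa> j)) v" using X(2) unfolding k .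
    show ?thesis using dominated_converges[of "\<lambda>j. d (\<kappa> j)" v "\<lambda>j. y (\<kappa> j)" K] lv d v y le1 by blast
  qed
  then have "\<forall>v\<in>C. \<exists>z \<kappa>. z \<in> C \<and> hlim H (\<lambda>j. d (\<kappa> j)) v \<and> hlim H (\<lambda>j. y (\<kappa> j)) z" by blast
  then obtain f where f0: "\<forall>v\<in>C. \<exists>\<kappa>. f v \<in> C \<and> hlim H (\<lambda>j. d (\<kappa> j)) v \<and> hlim H (\<lambda>j. y (\<kappa> j)) (f v)" by metis
  then obtain \<kappa> where f: "\<And>v. v \<in> C \<Longrightarrow> f v \<in> C" "\<And>v. v \<in> C \<Longrightarrow> hlim H (\<lambda>j. d (\<kappa> v j)) v"
    "\<And>v. v \<in> C \<Longrightarrow> hlim H (\<lambda>j. y (\<kappa> v j)) (f v)" by metis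
  have ineq: "hnorm H (hdiff H (hadd H (hscale H (crat a b) (f v)) (hscale H (crat a' b') (f w))) (f u))
      \<le> K * hnorm H (hdiff H (hadd H (hscale H (crat a b) v) (hscale H (crat a' b') w)) u)"
    if c: "v \<in> C" "w \<in> C" "u \<in> C" for a b a' b' v w u
  proof (rule LIMSEQ_le)
    show "(\<lambda>j. hnorm H (hdiff H (hadd H (hscale H (crat a b) (y (\<kappa> v j))) (hscale H (crat a' b') (y (\<kappa> w j)))) (y (\<kappa> u j))))
       \<longlonglongrightarrow> hnorm H (hdiff H (hadd H (hscale H (crat a b) (f v)) (hscale H (crat a' b') (f w))) (f u))"
      by (intro hlim_norm hlim_diff hlim_add hlim_scale f) (use c y f(1) in auto)
    show "(\<lambda>j. K * hnorm H (hdiff H (hadd H (hscale H (crat a b) (d (\<kappa> v j))) (hscale H (crat a' b') (d (\<kappa> w j)))) (d (\<kappa> u j))))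
       \<longlonglongrightarrow> K * hnorm H (hdiff H (hadd H (hscale H (crat a b) v) (hscale H (crat a' b') w)) u)"
      by (intro tendsto_mult_left hlim_norm hlim_diff hlim_add hlim_scale f(2)) (use c d in auto)
    show "\<exists>N. \<forall>n\<ge>N. hnorm H (hdiff H (hadd H (hscale H (crat a b) (y (\<kappa> v n))) (hscale H (crat a' b') (y (\<kappa> w n)))) (y (\<kappa> u n)))
       \<le> K * hnorm H (hdiff H (hadd H (hscale H (crat a b) (d (\<kappa> v n))) (hscale H (crat a' b') (d (\<kappa> w n)))) (d (\<kappa> u n)))"
      using le by blast
  qed
  have fadd: "f (hadd H v w) = hadd H (f v) (f w)" if c: "v \<in> C" "w \<in> C" for v w
  proof -
    have "hnorm H (hdiff H (hadd H (f v) (f w)) (f (hadd H v w))) \<le> 0"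
      using ineq[OF c add_closed[OF c], of 1 0 1 0] c f(1) by (simp add: cq10 scale_one diff_self)
    then have "hnorm H (hdiff H (hadd H (f v) (f w)) (f (hadd H v w))) = 0" using c f(1) by (intro antisym) auto
    then show ?thesis using c f(1) hnorm_eq_0 hdiff_eq_0 by simp
  qed
  have fscale: "f (hscale H c v) = hscale H c (f v)" if v: "v \<in> C" for c v
  proof -
    let ?u = "hscale H c v"
    have "hnorm H (hdiff H (hscale H c (f v)) (f ?u)) \<le> e" if e: "e > 0" for e
    proof -
      define M where "M = hnorm H (f v) + K * hnorm H v + 1"
      have "0 \<le> K * hnorm H v" using K v by simp
      then have M: "M > 0" "hnorm H (f v) + K * hnorm H v \<le> M" using hnorm_ge[OF f(1)[OF v]] by (simp_all add: M_def)
      have "e / M > 0" using e M by simp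
      then obtain a b where ab: "cmod (c - crat a b) < e / M" by (rule crat_dense)
      have 1: "hnorm H (hdiff H (hscale H (crat a b) (f v)) (f ?u)) \<le> K * hnorm H (hdiff H (hscale H (crat a b) v) ?u)"
        using ineq[of v v ?u a b 0 0] v f(1) by (simp add: cq00 add_zero)
      have "hdiff H (hscale H (crat a b) v) ?u = hscale H (crat a b - c) v"
        by (rule inner_ext) (use v in \<open>simp_all add: algebra_simps\<close>)
      then have 2: "hnorm H (hdiff H (hscale H (crat a b) v) ?u) = cmod (c - crat a b) * hnorm H v"
        using v by (simp add: norm_minus_commute)
      have "hdiff H (hscale H c (f v)) (hscale H (crat a b) (f v)) = hscale H (c - crat a b) (f v)"
        by (rule inner_ext) (use v f(1) in \<open>simp_all add: algebra_simps\<close>)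
      then have 3: "hnorm H (hdiff H (hscale H c (f v)) (hscale H (crat a b) (f v))) = cmod (c - crat a b) * hnorm H (f v)"
        using v f(1) by simp
      have "hnorm H (hdiff H (hscale H c (f v)) (f ?u)) \<le> cmod (c - crat a b) * hnorm H (f v) + K * (cmod (c - crat a b) * hnorm H v)"
        using hnorm_triangle_diff[of "hscale H c (f v)" "hscale H (crat a b) (f v)" "f ?u"] v f(1) 1 2 3 by simp
      also have "\<dots> = cmod (c - crat a b) * (hnorm H (f v) + K * hnorm H v)" by (simp add: algebra_simps)
      also have "\<dots> \<le> cmod (c - crat a b) * M" using M(2) by (intro mult_left_mono) auto
      also have "\<dots> \<le> e" using ab M(1) by (simp add: pos_less_divide_eq)
      finally show ?thesis .
    qed
    then have "hnorm H (hdiff H (hscale H c (f v)) (f ?u)) \<le> 0" by (meson dense_ge)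
    then have "hnorm H (hdiff H (hscale H c (f v)) (f ?u)) = 0" using v f(1) by (intro antisym) auto
    then show ?thesis using v f(1) hnorm_eq_0 hdiff_eq_0 by simp
  qed
  have fd: "f (d k) = y k" for k
  proof -
    have "hlim H (\<lambda>j. y (\<kappa> (d k) j)) (y k)" unfolding hlim_def
    proof (rule tendsto_0_le)
      show "(\<lambda>j. K * hnorm H (hdiff H (d (\<kappa> (d k) j)) (d k))) \<longlonglongrightarrow> 0"
        using f(2)[OF d] unfolding hlim_def by (rule tendsto_mult_right_zero)
      show "norm (hnorm H (hdiff H (y (\<kappa> (d k) j)) (y k))) \<le> K * hnorm H (hdiff H (d (\<kappa> (d k) j)) (d k))" for j
        using le1 y by simp
    qed
    then show ?thesis using hlim_unique[OF f(3)[OF d]] y f(1) d by blast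
  qed
  have fb: "hnorm H (f v) \<le> K * hnorm H v" if v: "v \<in> C" for v
  proof -
    have "f (hzero H) = hzero H" using fscale[of "hzero H" 0] f(1) by simp
    then show ?thesis using ineq[OF v v zero_closed, of 1 0 0 0] v f(1) by (simp add: cq10 cq00 scale_one add_zero)
  qed
  have "mk_op H f \<in> bounded_ops H" by (rule mk_op_bounded[OF f(1) fadd fscale fb])
  then show thesis using that[of "mk_op H f"] fd fb d by simp
qed

end

context hilbert_field
begin

definition cut :: "'z set \<Rightarrow> ('z \<Rightarrow> 'v operator)" where
  "cut A = (\<lambda>t. scalar_op (H t) (indicator A t))"

lemma ebf_cut: "A \<in> sets \<omega> \<Longrightarrow> ebf (cut A)"
  unfolding cut_def by (rule ebf_scalar[of _ 1]) (auto simp: indicator_def)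

text \<open>
  Cutting \<open>u\<close> down to the set of points where the inequality fails would contradict the
  bound for \<open>B\<close>.
\<close>

lemma local_bound:
  assumes B: "B \<in> bounded_ops DI" and K: "0 \<le> K" "\<And>X. X \<in> DI.C \<Longrightarrow> hnorm DI (ap B X) \<le> K * hnorm DI X"
    and comm: "\<And>A X. A \<in> sets \<omega> \<Longrightarrow> X \<in> DI.C \<Longrightarrow> ap B (ap (dop (cut A)) X) = ap (dop (cut A)) (ap B X)"
    and u: "u \<in> L2" and v: "v \<in> L2" and uv: "ap B (cls u) = cls v"
  shows "AE t in \<omega>. hnorm (H t) (v t) \<le> K * hnorm (H t) (u t)"
proof -
  have [measurable]: "(\<lambda>t. hnorm (H t) (u t)) \<in> borel_measurable \<omega>" "(\<lambda>t. hnorm (H t) (v t)) \<in> borel_measurable \<omega>"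
    using u v S_norm by auto
  define A where "A = {t \<in> space \<omega>. K * hnorm (H t) (u t) < hnorm (H t) (v t)}"
  have A: "A \<in> sets \<omega>" unfolding A_def by measurable
  have cut: "ap (dop (cut A)) (cls x) = cls (\<lambda>t. hscale (H t) (indicator A t) (x t))" if "x \<in> L2" for x
    using dop_ap[OF ebf_cut[OF A] that] that by (simp add: cut_def)
  have L: "(\<lambda>t. hscale (H t) (indicator A t) (x t)) \<in> L2" if "x \<in> L2" for x
    by (rule L2_scale_bounded[OF that, of _ 1]) (use A in \<open>auto simp: indicator_def\<close>)
  have "ap B (cls (\<lambda>t. hscale (H t) (indicator A t) (u t))) = cls (\<lambda>t. hscale (H t) (indicator A t) (v t))"
    using comm[OF A DI_mem[OF u]] cut[OF u] cut[OF v] uv by simp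
  then have "hnorm DI (cls (\<lambda>t. hscale (H t) (indicator A t) (v t))) \<le> K * hnorm DI (cls (\<lambda>t. hscale (H t) (indicator A t) (u t)))"
    using K(2)[OF DI_mem[OF L[OF u]]] by simp
  then have "(hnorm DI (cls (\<lambda>t. hscale (H t) (indicator A t) (v t))))\<^sup>2 \<le> (K * hnorm DI (cls (\<lambda>t. hscale (H t) (indicator A t) (u t))))\<^sup>2"
    using DI_norm_ge[OF L[OF v]] by (intro power_mono)
  then have le: "(LINT t|\<omega>. (hnorm (H t) (hscale (H t) (indicator A t) (v t)))\<^sup>2)
      \<le> K\<^sup>2 * (LINT t|\<omega>. (hnorm (H t) (hscale (H t) (indicator A t) (u t)))\<^sup>2)"
    unfolding power_mult_distrib DI_norm_sq[OF L[OF u]] DI_norm_sq[OF L[OF v]] .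
  define g where "g t = (hnorm (H t) (hscale (H t) (indicator A t) (v t)))\<^sup>2 - K\<^sup>2 * (hnorm (H t) (hscale (H t) (indicator A t) (u t)))\<^sup>2" for t
  have gi: "integrable \<omega> g" unfolding g_def using L2_integrable[OF L[OF u]] L2_integrable[OF L[OF v]] by simp
  have ge: "g t = indicator A t * ((hnorm (H t) (v t))\<^sup>2 - (K * hnorm (H t) (u t))\<^sup>2)" for t
    using u v by (simp add: g_def indicator_def power_mult_distrib)
  have pos: "0 < (hnorm (H t) (v t))\<^sup>2 - (K * hnorm (H t) (u t))\<^sup>2" if "t \<in> A" for t
  proof -
    have "(K * hnorm (H t) (u t))\<^sup>2 < (hnorm (H t) (v t))\<^sup>2"
      using that K(1) u by (intro power_strict_mono) (auto simp: A_def)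
    then show ?thesis by simp
  qed
  have g0: "0 \<le> g t" for t unfolding ge using pos[of t] by (cases "t \<in> A") auto
  have "(LINT t|\<omega>. g t) \<le> 0" unfolding g_def using le L2_integrable[OF L[OF u]] L2_integrable[OF L[OF v]] by simp
  then have "(LINT t|\<omega>. g t) = 0" using g0 by (intro antisym Bochner_Integration.integral_nonneg) auto
  then have "AE t in \<omega>. g t = 0" using integral_nonneg_eq_0_iff_AE[OF gi] g0 by simp
  then show ?thesis
  proof eventually_elim
    case (elim t)
    then have "t \<notin> A" using pos[of t] by (auto simp: ge)
    then show ?case using space_UNIV by (auto simp: A_def)
  qed
qed

text \<open>
  The values of \<open>B\<close> on the dense sequence satisfy, in almost every fibre, the inequalities
  that a bounded linear map satisfies, and so extend to operators on the fibres.
\<close>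

theorem commutant_diagonal_decomposable:
  assumes B: "B \<in> bounded_ops DI"
    and comm: "\<And>A X. A \<in> sets \<omega> \<Longrightarrow> X \<in> DI.C \<Longrightarrow> ap B (ap (dop (cut A)) X) = ap (dop (cut A)) (ap B X)"
  obtains Bf where "ebf Bf" "B = dop Bf"
proof -
  note b = DI.bounded_opsD[OF B]
  obtain K where K: "0 \<le> K" "\<And>X. X \<in> DI.C \<Longrightarrow> hnorm DI (ap B X) \<le> K * hnorm DI X" using b(9) by blast
  have "\<forall>x\<in>L2. \<exists>y\<in>L2. ap B (cls x) = cls y" using b(4) DI_E DI_mem by metis
  then obtain F where F: "\<And>x. x \<in> L2 \<Longrightarrow> F x \<in> L2" "\<And>x. x \<in> L2 \<Longrightarrow> ap B (cls x) = cls (F x)" by metis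
  define y where "y n = F (dseq n)" for n
  have y: "y n \<in> L2" "ap B (cls (dseq n)) = cls (y n)" for n using F by (simp_all add: y_def)
  have yC: "y n t \<in> fib.C t" for n t using y by simp
  have ineq: "AE t in \<omega>. hnorm (H t) (hdiff (H t) (hadd (H t) (hscale (H t) c (y k t)) (hscale (H t) c' (y l t))) (y m t))
      \<le> K * hnorm (H t) (hdiff (H t) (hadd (H t) (hscale (H t) c (dseq k t)) (hscale (H t) c' (dseq l t))) (dseq m t))" for c c' k l m
  proof (rule local_bound[OF B K comm])
    have "ap B (hdiff DI (hadd DI (hscale DI c (cls (dseq k))) (hscale DI c' (cls (dseq l)))) (cls (dseq m)))
      = hdiff DI (hadd DI (hscale DI c (cls (y k))) (hscale DI c' (cls (y l)))) (cls (y m))"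
      using b(5-7) y by simp
    then show "ap B (cls (\<lambda>t. hdiff (H t) (hadd (H t) (hscale (H t) c (dseq k t)) (hscale (H t) c' (dseq l t))) (dseq m t)))
      = cls (\<lambda>t. hdiff (H t) (hadd (H t) (hscale (H t) c (y k t)) (hscale (H t) c' (y l t))) (y m t))"
      using y(1) by (simp add: DI_add DI_scale DI_diff)
  qed (use y(1) in auto)
  define P where "P t \<longleftrightarrow> (\<forall>a b a' b' k l m. hnorm (H t) (hdiff (H t) (hadd (H t) (hscale (H t) (crat a b) (y k t)) (hscale (H t) (crat a' b') (y l t))) (y m t))
      \<le> K * hnorm (H t) (hdiff (H t) (hadd (H t) (hscale (H t) (crat a b) (dseq k t)) (hscale (H t) (crat a' b') (dseq l t))) (dseq m t)))" for t
  have "AE t in \<omega>. P t" unfolding P_def using ineq by (simp add: AE_all_countable)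
  then obtain N where N0: "\<And>t. t \<in> space \<omega> - N \<Longrightarrow> P t" and Nn: "N \<in> null_sets \<omega>"
    by (elim AE_E3) (rule that)
  have N: "P t" if "t \<notin> N" for t using N0[of t] that space_UNIV by simp
  have NM: "N \<in> sets \<omega>" using Nn by auto
  have "\<exists>T. T \<in> bounded_ops (H t) \<and> (\<forall>k. ap T (dseq k t) = y k t) \<and> (\<forall>x\<in>fib.C t. hnorm (H t) (ap T x) \<le> K * hnorm (H t) x)"
    if z: "t \<notin> N" for t
  proof -
    obtain T where "T \<in> bounded_ops (H t)" "\<And>k. ap T (dseq k t) = y k t" "\<And>x. x \<in> fib.C t \<Longrightarrow> hnorm (H t) (ap T x) \<le> K * hnorm (H t) x"
      by (rule fib.extend_from_dense[of "\<lambda>k. dseq k t" t "\<lambda>k. y k t" K]) (use N[OF z] yC dseq_dense K(1) in \<open>auto simp: P_def\<close>)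
    then show ?thesis by blast
  qed
  then obtain T where T: "\<And>t. t \<notin> N \<Longrightarrow> T t \<in> bounded_ops (H t)" "\<And>t k. t \<notin> N \<Longrightarrow> ap (T t) (dseq k t) = y k t"
    "\<And>t x. t \<notin> N \<Longrightarrow> x \<in> fib.C t \<Longrightarrow> hnorm (H t) (ap (T t) x) \<le> K * hnorm (H t) x"
    by metis
  \<comment> \<open>a field must consist of operators at every point, also on the exceptional null set\<close>
  define Bf where "Bf t = (if t \<in> N then scalar_op (H t) 0 else T t)" for t
  have Bfb: "Bf t \<in> bounded_ops (H t)" for t using T(1) by (simp add: Bf_def)
  have BfS: "(\<lambda>t. ap (Bf t) (x t)) \<in> S" if x: "x \<in> S" for x
  proof -
    obtain k where k: "\<And>j. k j \<in> \<omega> \<rightarrow>\<^sub>M count_space UNIV" "\<And>t. hlim (H t) (\<lambda>j. dseq (k j t) t) (x t)"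
      using dseq_index[OF x] by metis
    show ?thesis
    proof (rule S_lim[of "\<lambda>j t. if t \<in> N then hzero (H t) else y (k j t) t"])
      show "(\<lambda>t. if t \<in> N then hzero (H t) else y (k j t) t) \<in> S" for j
        by (rule S_if[OF S_zero S_choice NM]) (use y(1) k in auto)
      show "ap (Bf t) (x t) \<in> fib.C t" for t by (rule fib.bounded_opsD(4)[OF Bfb]) (use x in simp)
      show "hlim (H t) (\<lambda>j. if t \<in> N then hzero (H t) else y (k j t) t) (ap (Bf t) (x t))" for t
      proof (cases "t \<in> N")
        case True then show ?thesis using x by (simp add: Bf_def)
      next
        case False
        have "hlim (H t) (\<lambda>j. ap (T t) (dseq (k j t) t)) (ap (T t) (x t))"
          by (rule fib.hlim_ap[OF T(1)[OF False] k(2)]) (use x in auto)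
        then show ?thesis using False T(2)[OF False] by (simp add: Bf_def)
      qed
    qed
  qed
  have nN: "AE t in \<omega>. t \<notin> N" using Nn by (rule AE_not_in)
  have ebf: "ebf Bf"
  proof (rule ebf_I[OF Bfb BfS K(1)])
    show "ae_bounded K Bf"
      using nN by eventually_elim (use T(3) in \<open>simp add: Bf_def\<close>)
  qed
  have "B = dop Bf"
  proof (rule dop_eqI[OF B ebf])
    fix x assume x: "x \<in> L2"
    obtain k where k: "\<And>j. k j \<in> \<omega> \<rightarrow>\<^sub>M count_space UNIV" "\<And>t. hlim (H t) (\<lambda>j. dseq (k j t) t) (x t)"
      using dseq_index[OF L2_S[OF x]] by metis
    have "AE t in \<omega>. hnorm (H t) (hdiff (H t) (y n t) (F x t)) \<le> K * hnorm (H t) (hdiff (H t) (dseq n t) (x t))" for n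
    proof (rule local_bound[OF B K comm])
      show "ap B (cls (\<lambda>t. hdiff (H t) (dseq n t) (x t))) = cls (\<lambda>t. hdiff (H t) (y n t) (F x t))"
        using b(7)[of "cls (dseq n)" "cls x"] x y F by (simp add: DI_diff)
    qed (use x y F in auto)
    then have "AE t in \<omega>. \<forall>n. hnorm (H t) (hdiff (H t) (y n t) (F x t)) \<le> K * hnorm (H t) (hdiff (H t) (dseq n t) (x t))"
      by (simp add: AE_all_countable)
    then have "AE t in \<omega>. F x t = ap (Bf t) (x t)"
      using nN
    proof eventually_elim
      case (elim t)
      have xC: "x t \<in> fib.C t" and FC: "F x t \<in> fib.C t" using x F by auto
      have "hlim (H t) (\<lambda>j. y (k j t) t) (F x t)" unfolding hlim_def
      proof (rule tendsto_0_le)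
        show "(\<lambda>j. K * hnorm (H t) (hdiff (H t) (dseq (k j t) t) (x t))) \<longlonglongrightarrow> 0"
          using k(2)[of t] unfolding hlim_def by (rule tendsto_mult_right_zero)
        show "norm (hnorm (H t) (hdiff (H t) (y (k j t) t) (F x t))) \<le> K * hnorm (H t) (hdiff (H t) (dseq (k j t) t) (x t))" for j
          using elim(1) yC FC by simp
      qed
      moreover have "hlim (H t) (\<lambda>j. ap (T t) (dseq (k j t) t)) (ap (T t) (x t))"
        by (rule fib.hlim_ap[OF T(1)[OF elim(2)] k(2)]) (use xC in auto)
      ultimately have "F x t = ap (T t) (x t)"
        using fib.hlim_unique[of t "\<lambda>j. y (k j t) t"] T(2)[OF elim(2)] yC FC fib.bounded_opsD(4)[OF T(1)[OF elim(2)] xC] by simp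
      then show ?case using elim(2) by (simp add: Bf_def)
    qed
    then show "ap B (cls x) = cls (\<lambda>t. ap (Bf t) (x t))" using F(2)[OF x] cls_cong by simp
  qed
  then show thesis using that ebf by blast
qed

section \<open>Decomposable von Neumann algebras\<close>

text \<open>
  Summability in the mean of the squared distances makes them summable in almost every
  fibre.
\<close>

lemma fast_convergence_AE:
  assumes x: "\<And>n. x n \<in> L2" and v: "v \<in> L2" and le: "\<And>n. n \<ge> N \<Longrightarrow> hnorm DI (hdiff DI (cls v) (cls (x n))) \<le> (1/2)^n"
  shows "AE t in \<omega>. hlim (H t) (\<lambda>n. x n t) (v t)"
proof -
  define f where "f n t = (hnorm (H t) (hdiff (H t) (v t) (x (n + N) t)))\<^sup>2" for n t
  have "AE t in \<omega>. summable (\<lambda>n. f n t)"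
  proof (rule AE_summable_of_integrals)
    show "integrable \<omega> (f n)" for n unfolding f_def using L2_integrable[OF L2_diff[OF v x]] .
    show "(LINT t|\<omega>. f n t) \<le> (1/4)^n" for n
    proof -
      have "(LINT t|\<omega>. f n t) = (hnorm DI (hdiff DI (cls v) (cls (x (n + N)))))\<^sup>2"
        unfolding f_def DI_diff[OF v x] by (rule DI_norm_sq[symmetric]) (use v x in simp)
      also have "\<dots> \<le> ((1/2)^(n + N))\<^sup>2" using le[of "n + N"] v x by (intro power_mono DI.hnorm_ge) auto
      also have "\<dots> \<le> ((1/2)^n)\<^sup>2" by (intro power_mono power_decreasing) auto
      finally show ?thesis unfolding half_power_sq .
    qed
    show "summable (\<lambda>n. (1/4::real)^n)" by (rule summable_geometric) simp
  qed (simp add: f_def)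
  then show ?thesis
  proof eventually_elim
    case (elim t)
    have "(\<lambda>n. f n t) \<longlonglongrightarrow> 0" using elim by (rule summable_LIMSEQ_zero)
    then have "(\<lambda>n. sqrt (f n t)) \<longlonglongrightarrow> sqrt 0" by (rule tendsto_real_sqrt)
    then have "(\<lambda>n. hnorm (H t) (hdiff (H t) (x (n + N) t) (v t))) \<longlonglongrightarrow> 0"
      using v x fib.hnorm_diff_commute[of "v t" t] by (simp add: f_def)
    then show ?case unfolding hlim_def by (rule LIMSEQ_offset)
  qed
qed

text \<open>
  Both \<open>M\<close> and its commutant commute with the diagonal operators and therefore consist of
  decomposable operators. A field with values in the \<open>Mf t\<close> commutes in almost every fibre
  with every element of the commutant, because such an element commutes there with the
  countably many generators. Conversely, the fields with values in the \<open>Mf t\<close> form a star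
  algebra whose bicommutant contains \<open>M\<close>. An element \<open>A\<close> of \<open>M\<close> and its adjoint are
  approximated by this algebra on the dense sequence, at a geometric rate, so that the
  approximations converge in almost every fibre.
\<close>

lemma decomposable_vna_iff:
  assumes dv: "decomposable_vna \<omega> H S M Mf"
  shows "AE t in \<omega>. von_neumann_algebra (H t) (Mf t)"
    "A \<in> M \<Longrightarrow> \<exists>Af. ebf Af \<and> A = dop Af \<and> (AE t in \<omega>. Af t \<in> Mf t)"
    "ebf Af \<Longrightarrow> AE t in \<omega>. Af t \<in> Mf t \<Longrightarrow> dop Af \<in> M"
proof -
  obtain G where G: "countable G" "\<And>T. T \<in> G \<Longrightarrow> ebf T"
    "M = generated_vna DI (diagonal_ops \<omega> H S \<union> dop ` G)"
    "AE t in \<omega>. Mf t = generated_vna (H t) ((\<lambda>T. T t) ` G)"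
    using dv unfolding decomposable_vna_def by blast
  let ?D = "diagonal_ops \<omega> H S"
  have Dm: "\<exists>T. ebf T \<and> a = dop T \<and> (\<forall>t. \<exists>c. T t = scalar_op (H t) c)" if "a \<in> ?D" for a
    using that by (auto simp: diagonal_ops_def)
  have Db: "?D \<subseteq> bounded_ops DI" using Dm dop_bounded by blast
  have Gb: "dop ` G \<subseteq> bounded_ops DI" using G(2) dop_bounded by blast
  have Gfb: "(\<lambda>T. T t) ` G \<subseteq> bounded_ops (H t)" for t using G(2) ebf_bo by blast
  let ?X = "?D \<union> dop ` G"
  have Xb: "?X \<subseteq> bounded_ops DI" using Db Gb by blast
  let ?Y = "?X \<union> op_adjoint DI ` ?X"
  have Yb: "?Y \<subseteq> bounded_ops DI" using Xb DI.adjoint_bounded(1) by blast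
  have M_eq: "M = commutant DI (commutant DI ?Y)" unfolding G(3) by (rule DI.generated_vna_eq(1)[OF Xb])
  have vna: "von_neumann_algebra (H t) (generated_vna (H t) ((\<lambda>T. T t) ` G))" for t
    by (rule fib.generated_vna_eq(2)[OF Gfb])
  show vf: "AE t in \<omega>. von_neumann_algebra (H t) (Mf t)"
    using G(4) by eventually_elim (use vna in simp)
  define \<A> where "\<A> = {dop Af |Af. ebf Af \<and> (AE t in \<omega>. Af t \<in> Mf t)}"
  have \<A>I: "dop Af \<in> \<A>" if "ebf Af" "AE t in \<omega>. Af t \<in> Mf t" for Af
    using that by (auto simp: \<A>_def)
  have scalar_mem: "scalar_op (H t) c \<in> N" if N: "von_neumann_algebra (H t) N" for t c N
  proof (rule fib.vna_memI[OF N fib.scalar_bounded])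
    fix U x assume U: "U \<in> commutant (H t) N" and x: "x \<in> fib.C t"
    note u = fib.bounded_opsD[OF fib.vnaD(5)[OF N U]]
    show "ap U (ap (scalar_op (H t) c) x) = ap (scalar_op (H t) c) (ap U x)" using x u(4,6) by simp
  qed
  have comp_mem: "a \<circ>\<^sub>m b \<in> N" if N: "von_neumann_algebra (H t) N" and ab: "a \<in> N" "b \<in> N" for t a b N
  proof (rule fib.vna_memI[OF N fib.comp_bounded[OF fib.vnaD(1)[OF N ab(1)] fib.vnaD(1)[OF N ab(2)]]])
    fix U x assume U: "U \<in> commutant (H t) N" and x: "x \<in> fib.C t"
    note u = fib.bounded_opsD(4)[OF fib.vnaD(5)[OF N U]] and bdd = fib.bounded_opsD(4)[OF fib.vnaD(1)[OF N ab(2)]]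
    show "ap U (ap (a \<circ>\<^sub>m b) x) = ap (a \<circ>\<^sub>m b) (ap U x)"
      using fib.vnaD(3)[OF N ab(1) U] fib.vnaD(3)[OF N ab(2) U] x u bdd fib.ap_comp[OF fib.vnaD(1)[OF N ab(2)]] by simp
  qed
  have lin_mem: "op_lin (H t) c a d b \<in> N" if N: "von_neumann_algebra (H t) N" and ab: "a \<in> N" "b \<in> N" for t a b N c d
    using fib.commutant_op_lin[OF fib.commutant_bounded, of a t N b c d] N ab by (simp add: von_neumann_algebra_def)
  have \<A>: "DI.star_algebra \<A>"
    unfolding DI.star_algebra_def
  proof (intro conjI ballI allI)
    show "\<A> \<subseteq> bounded_ops DI" using dop_bounded by (auto simp: \<A>_def)
    have one: "ebf (\<lambda>t. scalar_op (H t) 1)" by (rule ebf_scalar[of _ 1]) auto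
    have "dop (\<lambda>t. scalar_op (H t) 1) = scalar_op DI 1"
    proof (rule dop_eqI[symmetric, OF DI.scalar_bounded one])
      fix x assume "x \<in> L2"
      then show "ap (scalar_op DI 1) (cls x) = cls (\<lambda>t. ap (scalar_op (H t) 1) (x t))" by (simp add: DI_scale)
    qed
    moreover have "AE t in \<omega>. scalar_op (H t) 1 \<in> Mf t" using vf by eventually_elim (rule scalar_mem)
    ultimately show "scalar_op DI 1 \<in> \<A>" using \<A>I[OF one] by simp
    fix a assume "a \<in> \<A>"
    then obtain af where a: "ebf af" "a = dop af" "AE t in \<omega>. af t \<in> Mf t" by (auto simp: \<A>_def)
    have "AE t in \<omega>. op_adjoint (H t) (af t) \<in> Mf t" using a(3) vf by eventually_elim (rule fib.vnaD(2))
    then show "op_adjoint DI a \<in> \<A>" using \<A>I[OF ebf_adjoint(1)[OF a(1)]] ebf_adjoint(2)[OF a(1)] a(2) by simp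
    fix b assume "b \<in> \<A>"
    then obtain bf where b: "ebf bf" "b = dop bf" "AE t in \<omega>. bf t \<in> Mf t" by (auto simp: \<A>_def)
    have "AE t in \<omega>. af t \<circ>\<^sub>m bf t \<in> Mf t" using a(3) b(3) vf by eventually_elim (rule comp_mem)
    then show "a \<circ>\<^sub>m b \<in> \<A>" using \<A>I[OF ebf_comp(1)[OF a(1) b(1)]] ebf_comp(2)[OF a(1) b(1)] a(2) b(2) by simp
    fix c d
    note F = ebf_lin[OF a(1) b(1), of c d]
    have "AE t in \<omega>. op_lin (H t) c (af t) d (bf t) \<in> Mf t"
      using a(3) b(3) vf by eventually_elim (rule lin_mem)
    then show "op_lin DI c a d b \<in> \<A>" using \<A>I[OF F(1)] F(2) a(2) b(2) by simp
  qed
  have DA: "?D \<subseteq> \<A>"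
  proof
    fix a assume "a \<in> ?D"
    then obtain T where T: "ebf T" "a = dop T" "\<And>t. \<exists>c. T t = scalar_op (H t) c" using Dm by metis
    have "AE t in \<omega>. T t \<in> Mf t" using vf by eventually_elim (use T(3) scalar_mem in metis)
    then show "a \<in> \<A>" using T by (auto simp: \<A>_def)
  qed
  have GA: "dop ` G \<subseteq> \<A>"
  proof
    fix a assume "a \<in> dop ` G"
    then obtain T where T: "T \<in> G" "a = dop T" by blast
    have "AE t in \<omega>. T t \<in> Mf t" using G(4)
    proof eventually_elim
      case (elim t)
      show ?case unfolding elim generated_vna_def by (rule hull_inc) (use T in blast)
    qed
    then show "a \<in> \<A>" using T G(2) by (auto simp: \<A>_def)
  qed
  have YA: "?Y \<subseteq> \<A>"
  proof -
    have "op_adjoint DI a \<in> \<A>" if "a \<in> \<A>" for a using \<A> that by (simp add: DI.star_algebra_def)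
    then show ?thesis using DA GA by blast
  qed
  have cut_D: "dop (cut A) \<in> ?D" if "A \<in> sets \<omega>" for A
    using ebf_cut[OF that] by (auto simp: diagonal_ops_def cut_def)
  have D_comm: "ap a (ap b X) = ap b (ap a X)" if a: "a \<in> ?D" and b: "b \<in> \<A>" and X: "X \<in> DI.C" for a b X
  proof -
    obtain T where T: "ebf T" "a = dop T" "\<And>t. \<exists>c. T t = scalar_op (H t) c" using Dm[OF a] by metis
    obtain bf where bf: "ebf bf" "b = dop bf" using b by (auto simp: \<A>_def)
    obtain x where x: "x \<in> L2" "X = cls x" using X by (rule DI_E)
    have "ap (T t) (ap (bf t) (x t)) = ap (bf t) (ap (T t) (x t))" for t
    proof -
      obtain c where c: "T t = scalar_op (H t) c" using T(3) by blast
      then show ?thesis using x bf(1) fib.bounded_opsD(6)[OF ebf_bo[OF bf(1)]] by simp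
    qed
    then show ?thesis using T bf x by simp
  qed
  have DY': "?D \<subseteq> commutant DI ?Y"
    unfolding subset_iff DI.commutant_iff[OF Yb] using Db D_comm YA by (meson subsetD)
  have decomp: "\<exists>Bf. ebf Bf \<and> B = dop Bf" if B: "B \<in> commutant DI Z" and Z: "?D \<subseteq> Z" "Z \<subseteq> bounded_ops DI" for B Z
  proof -
    have "ap B (ap (dop (cut A)) X) = ap (dop (cut A)) (ap B X)" if "A \<in> sets \<omega>" "X \<in> DI.C" for A X
      using B cut_D[OF that(1)] Z that(2) DI.commutant_iff[OF Z(2)] by blast
    then show ?thesis using commutant_diagonal_decomposable[of B] B DI.commutant_bounded by (metis subsetD)
  qed
  show "dop Af \<in> M" if Af: "ebf Af" "AE t in \<omega>. Af t \<in> Mf t" for Af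
    unfolding M_eq DI.commutant_iff[OF DI.commutant_bounded]
  proof (intro conjI ballI dop_bounded Af(1))
    fix B X assume B: "B \<in> commutant DI ?Y" and X: "X \<in> DI.C"
    obtain Bf where Bf: "ebf Bf" "B = dop Bf" using decomp[OF B _ Yb] by blast
    obtain x where x: "x \<in> L2" "X = cls x" using X by (rule DI_E)
    have cm: "AE t in \<omega>. Bf t \<circ>\<^sub>m T t = T t \<circ>\<^sub>m Bf t" if T: "ebf T" "dop T \<in> ?Y" for T
    proof (rule dop_AE_eqD[OF ebf_comp(1)[OF Bf(1) T(1)] ebf_comp(1)[OF T(1) Bf(1)]])
      have "B \<circ>\<^sub>m dop T = dop T \<circ>\<^sub>m B" using B T(2) by (auto simp: commutant_def)
      then show "dop (\<lambda>t. Bf t \<circ>\<^sub>m T t) = dop (\<lambda>t. T t \<circ>\<^sub>m Bf t)"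
        using ebf_comp(2)[OF Bf(1) T(1)] ebf_comp(2)[OF T(1) Bf(1)] Bf(2) by simp
    qed
    have "AE t in \<omega>. Bf t \<circ>\<^sub>m T t = T t \<circ>\<^sub>m Bf t \<and> Bf t \<circ>\<^sub>m op_adjoint (H t) (T t) = op_adjoint (H t) (T t) \<circ>\<^sub>m Bf t"
      if T: "T \<in> G" for T
      using cm[OF G(2)[OF T]] cm[OF ebf_adjoint(1)[OF G(2)[OF T]]] T ebf_adjoint(2)[OF G(2)[OF T]] by simp
    then have "AE t in \<omega>. \<forall>T\<in>G. Bf t \<circ>\<^sub>m T t = T t \<circ>\<^sub>m Bf t \<and> Bf t \<circ>\<^sub>m op_adjoint (H t) (T t) = op_adjoint (H t) (T t) \<circ>\<^sub>m Bf t"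
      unfolding AE_ball_countable[OF G(1)] by blast
    then have "AE t in \<omega>. ap (Af t) (ap (Bf t) (x t)) = ap (Bf t) (ap (Af t) (x t))"
      using Af(2) G(4)
    proof eventually_elim
      case (elim t)
      let ?Yf = "(\<lambda>T. T t) ` G \<union> op_adjoint (H t) ` (\<lambda>T. T t) ` G"
      have "Bf t \<in> commutant (H t) ?Yf" using elim(1) ebf_bo[OF Bf(1)] by (auto simp: commutant_def)
      moreover have "Af t \<in> commutant (H t) (commutant (H t) ?Yf)"
        using elim(2) unfolding elim(3) fib.generated_vna_eq(1)[OF Gfb] .
      ultimately show ?case using fib.commutant_iff[OF fib.commutant_bounded] x by (metis L2_S S_C)
    qed
    then show "ap (dop Af) (ap B X) = ap B (ap (dop Af) X)" using Bf x Af(1) cls_cong by simp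
  qed
  assume A: "A \<in> M"
  have A2: "A \<in> commutant DI (commutant DI \<A>)"
    using A DI.commutant_antimono[OF DI.commutant_antimono[OF YA]] unfolding M_eq by blast
  obtain Af where Af: "ebf Af" "A = dop Af"
    using decomp[OF A[unfolded M_eq] DY' DI.commutant_bounded] by blast
  let ?ad = "\<lambda>T t. op_adjoint (H t) (T t)"
  define Q where "Q n a \<longleftrightarrow> ebf a \<and> (AE t in \<omega>. a t \<in> Mf t) \<and> (\<forall>i<n. hnorm DI (hdiff DI (ap A (cls (dseq i))) (ap (dop a) (cls (dseq i)))) < (1/2)^n
     \<and> hnorm DI (hdiff DI (ap (op_adjoint DI A) (cls (dseq i))) (ap (op_adjoint DI (dop a)) (cls (dseq i)))) < (1/2)^n)" for n :: nat and a
  have "\<exists>a. Q n a" for n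
  proof -
    obtain a where a: "a \<in> \<A>" "\<And>i. i < n \<Longrightarrow> hnorm DI (hdiff DI (ap A (cls (dseq i))) (ap a (cls (dseq i)))) < (1/2)^n"
      "\<And>i. i < n \<Longrightarrow> hnorm DI (hdiff DI (ap (op_adjoint DI A) (cls (dseq i))) (ap (op_adjoint DI a) (cls (dseq i)))) < (1/2)^n"
      using DI.strong_star_approximation[OF \<A> A2, of n "\<lambda>i. cls (dseq i)" "(1/2)^n"] by auto
    obtain af where "ebf af" "AE t in \<omega>. af t \<in> Mf t" "a = dop af" using a(1) by (auto simp: \<A>_def)
    then have "Q n af" using a(2,3) by (simp add: Q_def)
    then show ?thesis by blast
  qed
  then have "\<forall>n. \<exists>a. Q n a" by blast
  then obtain a where Q: "\<forall>n. Q n (a n)" by (rule choice[THEN exE])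
  have a: "ebf (a n)" "AE t in \<omega>. a n t \<in> Mf t"
    "i < n \<Longrightarrow> hnorm DI (hdiff DI (ap A (cls (dseq i))) (ap (dop (a n)) (cls (dseq i)))) < (1/2)^n"
    "i < n \<Longrightarrow> hnorm DI (hdiff DI (ap (op_adjoint DI A) (cls (dseq i))) (ap (op_adjoint DI (dop (a n))) (cls (dseq i)))) < (1/2)^n" for n i
    using Q[rule_format, of n] unfolding Q_def by blast+
  have l1: "AE t in \<omega>. hlim (H t) (\<lambda>n. ap (a n t) (dseq i t)) (ap (Af t) (dseq i t))" for i
  proof (rule fast_convergence_AE[where N = "Suc i"])
    fix n assume "Suc i \<le> n"
    then show "hnorm DI (hdiff DI (cls (\<lambda>t. ap (Af t) (dseq i t))) (cls (\<lambda>t. ap (a n t) (dseq i t)))) \<le> (1/2)^n"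
      using a(3)[of i n] a(1)[of n] Af by simp
  qed (use a(1) Af in auto)
  have l2: "AE t in \<omega>. hlim (H t) (\<lambda>n. ap (?ad (a n) t) (dseq i t)) (ap (?ad Af t) (dseq i t))" for i
  proof (rule fast_convergence_AE[where N = "Suc i"])
    fix n assume "Suc i \<le> n"
    then show "hnorm DI (hdiff DI (cls (\<lambda>t. ap (?ad Af t) (dseq i t))) (cls (\<lambda>t. ap (?ad (a n) t) (dseq i t)))) \<le> (1/2)^n"
      using a(4)[of i n] ebf_adjoint[OF a(1)[of n]] ebf_adjoint[OF Af(1)] Af(2)
        dop_ap[OF ebf_adjoint(1)[OF a(1)[of n]], of "dseq i"] dop_ap[OF ebf_adjoint(1)[OF Af(1)], of "dseq i"] by simp
  qed (use ebf_adjoint(1)[OF a(1)] ebf_adjoint(1)[OF Af(1)] ebf_L2[of "?ad Af"] ebf_L2[of "?ad (a _)"] in auto)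
  have "AE t in \<omega>. \<forall>i. hlim (H t) (\<lambda>n. ap (a n t) (dseq i t)) (ap (Af t) (dseq i t))" using l1 by (simp add: AE_all_countable)
  moreover have "AE t in \<omega>. \<forall>i. hlim (H t) (\<lambda>n. ap (?ad (a n) t) (dseq i t)) (ap (?ad Af t) (dseq i t))" using l2 by (simp add: AE_all_countable)
  moreover have "AE t in \<omega>. \<forall>n. a n t \<in> Mf t" using a(2) by (simp add: AE_all_countable)
  ultimately have "AE t in \<omega>. Af t \<in> Mf t" using vf
  proof eventually_elim
    case (elim t)
    note N = elim(4)
    note Ab = ebf_bo[OF Af(1), of t]
    note ad = fib.adjoint_bounded[OF Ab]
    note AC = fib.bounded_opsD(4)[OF Ab] and A'C = fib.bounded_opsD(4)[OF ad(1)]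
    show ?case
    proof (rule fib.vna_memI[OF N Ab])
      fix U x assume U: "U \<in> commutant (H t) (Mf t)" and x: "x \<in> fib.C t"
      note Ub = fib.vnaD(5)[OF N U]
      note UC = fib.bounded_opsD(4)[OF Ub]
      have "U \<circ>\<^sub>m Af t = Af t \<circ>\<^sub>m U"
      proof (rule fib.bounded_eq_on_dense[OF fib.comp_bounded[OF Ub Ab] fib.comp_bounded[OF Ab Ub] dseq_dense dseq_C])
        fix u assume "u \<in> range (\<lambda>n. dseq n t)"
        then obtain i where i: "u = dseq i t" by blast
        have uC: "u \<in> fib.C t" using i by simp
        \<comment> \<open>the operators \<open>a n t\<close> may be unbounded in \<open>n\<close>: convergence of the adjoints makes up for it\<close>
        have "ap U (ap (Af t) u) = ap (Af t) (ap U u)"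
        proof (rule fib.hdense_ext[OF dseq_dense dseq_C])
          fix k assume "k \<in> range (\<lambda>n. dseq n t)"
          then obtain j where j: "k = dseq j t" by blast
          have kC: "k \<in> fib.C t" using j by simp
          note anb = fib.vnaD(1)[OF N elim(3)[rule_format]]
          have "(\<lambda>n. hinner (H t) (ap U (ap (a n t) u)) k) \<longlonglongrightarrow> hinner (H t) (ap U (ap (Af t) u)) k"
            by (rule fib.hlim_inner_left[OF fib.hlim_ap[OF Ub]])
               (use elim(1) i AC UC uC kC fib.bounded_opsD(4)[OF anb] in auto)
          moreover have "hinner (H t) (ap U (ap (a n t) u)) k = hinner (H t) (ap U u) (ap (?ad (a n) t) k)" for n
            using fib.vnaD(3)[OF N elim(3)[rule_format] U uC, of n] fib.adjoint_bounded(2)[OF anb UC[OF uC] kC] by simp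
          moreover have "(\<lambda>n. hinner (H t) (ap U u) (ap (?ad (a n) t) k)) \<longlonglongrightarrow> hinner (H t) (ap U u) (ap (?ad Af t) k)"
            by (rule fib.hlim_inner[OF fib.hlim_const])
               (use elim(2) j A'C UC uC kC fib.bounded_opsD(4)[OF fib.adjoint_bounded(1)[OF anb]] in auto)
          ultimately have "hinner (H t) (ap U (ap (Af t) u)) k = hinner (H t) (ap U u) (ap (?ad Af t) k)"
            using LIMSEQ_unique by simp
          then show "hinner (H t) (ap U (ap (Af t) u)) k = hinner (H t) (ap (Af t) (ap U u)) k"
            using ad(2)[OF UC[OF uC] kC] by simp
        qed (use uC UC AC in auto)
        then show "ap (U \<circ>\<^sub>m Af t) u = ap (Af t \<circ>\<^sub>m U) u" using fib.ap_comp[OF Ab uC] fib.ap_comp[OF Ub uC] by simp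
      qed
      then show "ap U (ap (Af t) x) = ap (Af t) (ap U x)" using fib.ap_comp[OF Ab x] fib.ap_comp[OF Ub x] by metis
    qed
  qed
  then show "\<exists>Af. ebf Af \<and> A = dop Af \<and> (AE t in \<omega>. Af t \<in> Mf t)" using Af by blast
qed

end

context hilbert_space
begin

section \<open>Matrices of graph projections\<close>

text \<open>
  The block matrix with rows \<open>(a, b)\<close> and \<open>(c, d)\<close> is a selfadjoint idempotent, and its
  range contains no vector \<open>(0, y)\<close> except zero; for if \<open>d y = y\<close> then also \<open>b y = 0\<close>.
\<close>

definition graph_matrix :: "'v operator \<Rightarrow> 'v operator \<Rightarrow> 'v operator \<Rightarrow> 'v operator \<Rightarrow> bool" where
  "graph_matrix a b c d \<longleftrightarrow>
     (\<forall>x\<in>C. \<forall>y\<in>C. hinner H (ap a x) y = hinner H x (ap a y) \<and> hinner H (ap b x) y = hinner H x (ap c y)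
        \<and> hinner H (ap d x) y = hinner H x (ap d y))
     \<and> (\<forall>x\<in>C. hadd H (ap a (ap a x)) (ap b (ap c x)) = ap a x \<and> hadd H (ap c (ap a x)) (ap d (ap c x)) = ap c x
        \<and> hadd H (ap a (ap b x)) (ap b (ap d x)) = ap b x \<and> hadd H (ap c (ap b x)) (ap d (ap d x)) = ap d x)
     \<and> (\<forall>x\<in>C. ap d x = x \<longrightarrow> x = hzero H)"

lemma graph_fixed:
  assumes T: "closed_op H T"
  shows "T x = Some y \<longleftrightarrow> x \<in> C \<and> y \<in> C \<and> hadd H (ap (p11 T) x) (ap (p12 T) y) = x \<and> hadd H (ap (p21 T) x) (ap (p22 T) y) = y"
    (is "_ \<longleftrightarrow> ?R")
proof
  note l = linear_opD[OF closed_opD[OF T]]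
  have img: "T (hadd H (ap (p11 T) x) (ap (p12 T) y)) = Some (hadd H (ap (p21 T) x) (ap (p22 T) y))" if "x \<in> C" "y \<in> C"
    by (rule l(4)[OF graph_proj_col1(1)[OF T that(1)] graph_proj_col2(1)[OF T that(2)]])
  show "T x = Some y" if ?R using img that by simp
  assume xy: "T x = Some y"
  have c: "x \<in> C" "y \<in> C" using xy l by blast+
  let ?u = "hadd H (ap (p11 T) x) (ap (p12 T) y)" and ?v = "hadd H (ap (p21 T) x) (ap (p22 T) y)"
  note e = entries_closed[OF T c(1)] entries_closed[OF T c(2)]
  have d: "T (hdiff H x ?u) = Some (hdiff H y ?v)" by (rule l(6)[OF xy img[OF c]])
  have "hinner H (hdiff H x ?u) a + hinner H (hdiff H y ?v) b = 0" if ab: "T a = Some b" for a b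
  proof -
    have "a \<in> C" "b \<in> C" using ab l by blast+
    then show ?thesis using graph_proj_col1(2)[OF T c(1) ab] graph_proj_col2(2)[OF T c(2) ab] c e by simp
  qed
  then have "hinner H (hdiff H x ?u) (hdiff H x ?u) + hinner H (hdiff H y ?v) (hdiff H y ?v) = 0" using d by blast
  moreover have C: "hdiff H x ?u \<in> C" "hdiff H y ?v \<in> C" using c e by simp_all
  ultimately have "(hnorm H (hdiff H x ?u))\<^sup>2 + (hnorm H (hdiff H y ?v))\<^sup>2 = 0"
    unfolding inner_self[OF C(1)] inner_self[OF C(2)] of_real_add[symmetric] by (simp only: of_real_eq_0_iff)
  then have "hnorm H (hdiff H x ?u) = 0" "hnorm H (hdiff H y ?v) = 0" by (simp_all add: sum_power2_eq_zero_iff)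
  then have "x = ?u" "y = ?v" using hnorm_eq_0 C hdiff_eq_0 c e by simp_all
  then show ?R using c by simp
qed

lemma graph_matrix_entries:
  assumes T: "closed_op H T" shows "graph_matrix (p11 T) (p12 T) (p21 T) (p22 T)"
proof -
  note l = linear_opD[OF closed_opD[OF T]]
  note g1 = graph_proj_col1[OF T] and g2 = graph_proj_col2[OF T]
  note e = entries_closed[OF T]
  have sym: "hinner H (ap (p11 T) x) y = hinner H x (ap (p11 T) y)" "hinner H (ap (p12 T) x) y = hinner H x (ap (p21 T) y)"
    "hinner H (ap (p22 T) x) y = hinner H x (ap (p22 T) y)" if x: "x \<in> C" and y: "y \<in> C" for x y
  proof -
    have cnj: "hinner H y z = hinner H w z + hinner H w' z' \<Longrightarrow> hinner H z y = hinner H z w + hinner H z' w'"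
      if "z \<in> C" "w \<in> C" "z' \<in> C" "w' \<in> C" for z w z' w'
      using inner_cnj[of z y] inner_cnj[of z w] inner_cnj[of z' w'] that y by (metis complex_cnj_add complex_cnj_cnj inner_cnj)
    have cnj': "hinner H y z' = hinner H w z + hinner H w' z' \<Longrightarrow> hinner H z' y = hinner H z w + hinner H z' w'"
      if "z \<in> C" "w \<in> C" "z' \<in> C" "w' \<in> C" for z w z' w'
      using that y by (metis complex_cnj_add inner_cnj)
    show "hinner H (ap (p11 T) x) y = hinner H x (ap (p11 T) y)"
      using g1(2)[OF x g1(1)[OF y]] cnj[OF _ _ _ _ g1(2)[OF y g1(1)[OF x]]] e x y by simp
    show "hinner H (ap (p12 T) x) y = hinner H x (ap (p21 T) y)"
      using g2(2)[OF x g1(1)[OF y]] cnj[OF _ _ _ _ g1(2)[OF y g2(1)[OF x]]] e x y by simp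
    show "hinner H (ap (p22 T) x) y = hinner H x (ap (p22 T) y)"
      using g2(2)[OF x g2(1)[OF y]] cnj'[OF _ _ _ _ g2(2)[OF y g2(1)[OF x]]] e x y by simp
  qed
  have ker: "x = hzero H" if x: "x \<in> C" and d: "ap (p22 T) x = x" for x
  proof -
    have "hinner H x x = hinner H (ap (p12 T) x) (ap (p12 T) x) + hinner H x x"
      using g2(2)[OF x g2(1)[OF x]] d by simp
    then have "ap (p12 T) x = hzero H" using inner_self_zero e(3)[OF x] by simp
    then show ?thesis using g2(1)[OF x] d l(3) by simp
  qed
  show ?thesis unfolding graph_matrix_def
    using sym ker graph_fixed[OF T] g1(1) g2(1) by simp
qed

text \<open>The graph of \<open>T\<close> consists of the pairs that the matrix fixes.\<close>

lemma operator_of_graph_matrix: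
  assumes bd: "a \<in> bounded_ops H" "b \<in> bounded_ops H" "c \<in> bounded_ops H" "d \<in> bounded_ops H"
    and g: "graph_matrix a b c d"
  obtains T where "closed_op H T" "p11 T = a" "p12 T = b" "p21 T = c" "p22 T = d"
proof -
  note A = bounded_opsD[OF bd(1)] and B = bounded_opsD[OF bd(2)] and C' = bounded_opsD[OF bd(3)] and D = bounded_opsD[OF bd(4)]
  note m = A(4) B(4) C'(4) D(4)
  have sym: "hinner H (ap a x) y = hinner H x (ap a y)" "hinner H (ap b x) y = hinner H x (ap c y)"
    "hinner H (ap d x) y = hinner H x (ap d y)" if "x \<in> C" "y \<in> C" for x y
    using g that unfolding graph_matrix_def by blast+
  have idem: "hadd H (ap a (ap a x)) (ap b (ap c x)) = ap a x" "hadd H (ap c (ap a x)) (ap d (ap c x)) = ap c x"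
    "hadd H (ap a (ap b x)) (ap b (ap d x)) = ap b x" "hadd H (ap c (ap b x)) (ap d (ap d x)) = ap d x" if "x \<in> C" for x
    using g that unfolding graph_matrix_def by blast+
  have ker: "x = hzero H" if "x \<in> C" "ap d x = x" for x using g that unfolding graph_matrix_def by blast
  have sym': "hinner H (ap c x) y = hinner H x (ap b y)" if "x \<in> C" "y \<in> C" for x y
    using sym(2)[OF that(2,1)] that m by (metis inner_cnj)
  define G where "G x y \<longleftrightarrow> x \<in> C \<and> y \<in> C \<and> hadd H (ap a x) (ap b y) = x \<and> hadd H (ap c x) (ap d y) = y" for x y
  have Gadd: "G (hadd H x x') (hadd H y y')" if "G x y" "G x' y'" for x y x' y'
  proof -
    have c: "x \<in> C" "y \<in> C" "x' \<in> C" "y' \<in> C" using that by (simp_all add: G_def)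
    have 1: "hadd H (ap a (hadd H x x')) (ap b (hadd H y y')) = hadd H (hadd H (ap a x) (ap b y)) (hadd H (ap a x') (ap b y'))"
      by (rule inner_ext) (use c m A(5) B(5) in simp_all)
    have 2: "hadd H (ap c (hadd H x x')) (ap d (hadd H y y')) = hadd H (hadd H (ap c x) (ap d y)) (hadd H (ap c x') (ap d y'))"
      by (rule inner_ext) (use c m C'(5) D(5) in simp_all)
    show ?thesis using that c unfolding G_def 1 2 by simp
  qed
  have Gscale: "G (hscale H r x) (hscale H r y)" if "G x y" for r x y
  proof -
    have c: "x \<in> C" "y \<in> C" using that by (simp_all add: G_def)
    have 1: "hadd H (ap a (hscale H r x)) (ap b (hscale H r y)) = hscale H r (hadd H (ap a x) (ap b y))"
      using c m A(6) B(6) scale_add_right by simp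
    have 2: "hadd H (ap c (hscale H r x)) (ap d (hscale H r y)) = hscale H r (hadd H (ap c x) (ap d y))"
      using c m C'(6) D(6) scale_add_right by simp
    show ?thesis using that c unfolding G_def 1 2 by simp
  qed
  have G0: "G (hzero H) (hzero H)" using A(8) B(8) C'(8) D(8) by (simp add: G_def add_zero)
  have Guniq: "y = y'" if "G x y" "G x y'" for x y y'
  proof -
    have "G (hdiff H x x) (hdiff H y y')" unfolding hdiff_def by (rule Gadd[OF that(1) Gscale[OF that(2)]])
    moreover have c: "x \<in> C" "y \<in> C" "y' \<in> C" using that by (simp_all add: G_def)
    ultimately have "hadd H (hzero H) (ap d (hdiff H y y')) = hdiff H y y'" using C'(8) diff_self by (simp add: G_def)
    then have "ap d (hdiff H y y') = hdiff H y y'" using m c zero_add by simp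
    then show ?thesis using ker[of "hdiff H y y'"] hdiff_eq_0 c by simp
  qed
  define T where "T x = (if \<exists>y. G x y then Some (SOME y. G x y) else None)" for x
  have T: "T x = Some y \<longleftrightarrow> G x y" for x y
    using someI[of "G x"] Guniq by (auto simp: T_def)
  have lin: "linear_op H T" unfolding linear_op_iff T using G0 Gadd Gscale by (auto simp: G_def)
  have closed: "closed_op H T" unfolding closed_op_def
  proof (intro conjI lin)
    show "hclosed (hsum H H) (Map.graph T)" unfolding hclosed_def
    proof (intro allI ballI impI)
      fix X p assume p: "p \<in> hcarrier (hsum H H)" and X: "(\<forall>n. X n \<in> Map.graph T) \<and> hlim (hsum H H) X p"
      obtain x y where xy: "p = (x, y)" "x \<in> C" "y \<in> C" using p by auto
      have G: "G (fst (X n)) (snd (X n))" for n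
        using X T by (auto simp: Map.graph_def split_beta)
      then have XC: "fst (X n) \<in> C" "snd (X n) \<in> C" for n by (simp_all add: G_def)
      have l: "hlim H (\<lambda>n. fst (X n)) x" "hlim H (\<lambda>n. snd (X n)) y"
        using X hsum_hlim_iff[OF hilbert_space_axioms hilbert_space_axioms, of X p] XC xy by (auto simp: mem_Times_iff)
      have "hlim H (\<lambda>n. hadd H (ap a (fst (X n))) (ap b (snd (X n)))) (hadd H (ap a x) (ap b y))"
        by (intro hlim_add hlim_ap[OF bd(1)] hlim_ap[OF bd(2)] l) (use XC xy m in auto)
      moreover have "hadd H (ap a (fst (X n))) (ap b (snd (X n))) = fst (X n)" for n using G[of n] by (simp add: G_def)
      ultimately have 1: "hlim H (\<lambda>n. fst (X n)) (hadd H (ap a x) (ap b y))" by simp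
      have "hlim H (\<lambda>n. hadd H (ap c (fst (X n))) (ap d (snd (X n)))) (hadd H (ap c x) (ap d y))"
        by (intro hlim_add hlim_ap[OF bd(3)] hlim_ap[OF bd(4)] l) (use XC xy m in auto)
      moreover have "hadd H (ap c (fst (X n))) (ap d (snd (X n))) = snd (X n)" for n using G[of n] by (simp add: G_def)
      ultimately have 2: "hlim H (\<lambda>n. snd (X n)) (hadd H (ap c x) (ap d y))" by simp
      have "hadd H (ap a x) (ap b y) = x" by (rule hlim_unique[OF 1 l(1)]) (use XC xy m in auto)
      moreover have "hadd H (ap c x) (ap d y) = y" by (rule hlim_unique[OF 2 l(2)]) (use XC xy m in auto)
      ultimately have "G x y" using xy by (simp add: G_def)
      then show "p \<in> Map.graph T" using xy T by (simp add: Map.graph_def)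
    qed
  qed
  have col: "T (ap a x) = Some (ap c x)" "T (ap b x) = Some (ap d x)" if "x \<in> C" for x
    using idem[OF that] m that unfolding T G_def by simp_all
  have c1: "ap (p11 T) x = ap a x" "ap (p21 T) x = ap c x" if x: "x \<in> C" for x
  proof -
    have "hinner H x r = hinner H (ap a x) r + hinner H (ap c x) s" if "T r = Some s" for r s
    proof -
      have G: "G r s" using that T by simp
      then have rs: "r \<in> C" "s \<in> C" "r = hadd H (ap a r) (ap b s)" by (simp_all add: G_def)
      have "hinner H x (hadd H (ap a r) (ap b s)) = hinner H (ap a x) r + hinner H (ap c x) s"
        using sym(1)[OF x rs(1)] sym'[OF x rs(2)] rs(1,2) x m by simp
      then show ?thesis using rs(3) by simp
    qed
    then show "ap (p11 T) x = ap a x" "ap (p21 T) x = ap c x" using col1_unique[OF closed x col(1)[OF x]] by blast+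
  qed
  have c2: "ap (p12 T) x = ap b x" "ap (p22 T) x = ap d x" if x: "x \<in> C" for x
  proof -
    have "hinner H x s = hinner H (ap b x) r + hinner H (ap d x) s" if "T r = Some s" for r s
    proof -
      have G: "G r s" using that T by simp
      then have rs: "r \<in> C" "s \<in> C" "s = hadd H (ap c r) (ap d s)" by (simp_all add: G_def)
      have "hinner H x (hadd H (ap c r) (ap d s)) = hinner H (ap b x) r + hinner H (ap d x) s"
        using sym(2)[OF x rs(1)] sym(3)[OF x rs(2)] rs(1,2) x m by simp
      then show ?thesis using rs(3) by simp
    qed
    then show "ap (p12 T) x = ap b x" "ap (p22 T) x = ap d x" using col2_unique[OF closed x col(2)[OF x]] by blast+
  qed
  note eb = entries_bounded[OF closed]
  show thesis
    by (rule that[OF closed op_eqI[OF eb(1) bd(1)] op_eqI[OF eb(3) bd(2)] op_eqI[OF eb(2) bd(3)] op_eqI[OF eb(4) bd(4)]])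
       (simp_all add: c1 c2)
qed

end

context hilbert_field
begin

section \<open>Decomposition of closed operators\<close>

abbreviation "e11 Tf \<equiv> \<lambda>t. entry11 (H t) (graph_proj (H t) (Tf t))"
abbreviation "e12 Tf \<equiv> \<lambda>t. entry12 (H t) (graph_proj (H t) (Tf t))"
abbreviation "e21 Tf \<equiv> \<lambda>t. entry21 (H t) (graph_proj (H t) (Tf t))"
abbreviation "e22 Tf \<equiv> \<lambda>t. entry22 (H t) (graph_proj (H t) (Tf t))"

lemma entries_ebf:
  assumes "measurable_closed_field H S Tf"
  shows "ebf (e11 Tf)" "ebf (e12 Tf)" "ebf (e21 Tf)" "ebf (e22 Tf)"
proof -
  have T: "closed_op (H t) (Tf t)" for t using assms by (simp add: measurable_closed_field_def)
  note b = fib.entries_bounded[OF T] and k = fib.entries_bound[OF T]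
  have m: "measurable_bounded_field H S (e11 Tf)" "measurable_bounded_field H S (e12 Tf)"
    "measurable_bounded_field H S (e21 Tf)" "measurable_bounded_field H S (e22 Tf)"
    using assms by (simp_all add: measurable_closed_field_def)
  have *: "ebf B" if "measurable_bounded_field H S B" "\<And>t x. x \<in> fib.C t \<Longrightarrow> hnorm (H t) (ap (B t) x) \<le> 1 * hnorm (H t) x" for B
    by (rule ebf_I[of _ 1]) (use that in \<open>auto simp: measurable_bounded_field_def\<close>)
  show "ebf (e11 Tf)" "ebf (e12 Tf)" "ebf (e21 Tf)" "ebf (e22 Tf)"
    by (rule *[OF m(1) k(1)] *[OF m(2) k(3)] *[OF m(3) k(2)] *[OF m(4) k(4)], assumption)+
qed

text \<open>
  The columns of the fibrewise projections satisfy the equations that characterize the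
  columns of the graph projection of the direct integral.
\<close>

lemma entries_dop:
  assumes m: "measurable_closed_field H S Tf" and c: "closed_op DI (dop Tf)"
  shows "DI.p11 (dop Tf) = dop (e11 Tf)" "DI.p12 (dop Tf) = dop (e12 Tf)"
    "DI.p21 (dop Tf) = dop (e21 Tf)" "DI.p22 (dop Tf) = dop (e22 Tf)"
proof -
  have T: "closed_op (H t) (Tf t)" for t using m by (simp add: measurable_closed_field_def)
  note g1 = fib.graph_proj_col1[OF T] and g2 = fib.graph_proj_col2[OF T]
  note e = entries_ebf[OF m]
  have some: "dop Tf (cls u) = Some (cls v)" if "u \<in> L2" "v \<in> L2" "\<And>t. Tf t (u t) = Some (v t)" for u v
    unfolding dop_iff[OF that(1,2)] using that by (intro bexI[of _ u]) auto
  have intg: "hinner DI (cls x) (cls p) = hinner DI (cls u) (cls a) + hinner DI (cls v) (cls b)"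
    if "x \<in> L2" "p \<in> L2" "u \<in> L2" "v \<in> L2" "a \<in> L2" "b \<in> L2"
      "\<And>t. hinner (H t) (x t) (p t) = hinner (H t) (u t) (a t) + hinner (H t) (v t) (b t)" for x p u v a b
    using that by (simp add: DI_inner Bochner_Integration.integral_add L2_inner_integrable)
  have 1: "ap (DI.p11 (dop Tf)) (cls x) = cls (\<lambda>t. ap (e11 Tf t) (x t))" "ap (DI.p21 (dop Tf)) (cls x) = cls (\<lambda>t. ap (e21 Tf t) (x t))"
    if x: "x \<in> L2" for x
  proof -
    have u: "(\<lambda>t. ap (e11 Tf t) (x t)) \<in> L2" and v: "(\<lambda>t. ap (e21 Tf t) (x t)) \<in> L2" using ebf_L2 e x by blast+
    have uv: "dop Tf (cls (\<lambda>t. ap (e11 Tf t) (x t))) = Some (cls (\<lambda>t. ap (e21 Tf t) (x t)))"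
      by (rule some[OF u v]) (use g1(1) x in simp)
    have o: "hinner DI (cls x) A = hinner DI (cls (\<lambda>t. ap (e11 Tf t) (x t))) A + hinner DI (cls (\<lambda>t. ap (e21 Tf t) (x t))) B"
      if AB: "dop Tf A = Some B" for A B
    proof -
      obtain a where a: "a \<in> L2" "A = cls a" "\<And>t. a t \<in> dom (Tf t)" "(\<lambda>t. ap (Tf t) (a t)) \<in> L2" "B = cls (\<lambda>t. ap (Tf t) (a t))"
        by (rule dop_SomeE[OF AB]) (rule that)
      have "Tf t (a t) = Some (ap (Tf t) (a t))" for t using a(3)[of t] by auto
      then show ?thesis unfolding a(2,5) using g1(2) x by (intro intg x u v a) auto
    qed
    show "ap (DI.p11 (dop Tf)) (cls x) = cls (\<lambda>t. ap (e11 Tf t) (x t))" "ap (DI.p21 (dop Tf)) (cls x) = cls (\<lambda>t. ap (e21 Tf t) (x t))"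
      using DI.col1_unique[OF c DI_mem[OF x] uv o] by blast+
  qed
  have 2: "ap (DI.p12 (dop Tf)) (cls x) = cls (\<lambda>t. ap (e12 Tf t) (x t))" "ap (DI.p22 (dop Tf)) (cls x) = cls (\<lambda>t. ap (e22 Tf t) (x t))"
    if x: "x \<in> L2" for x
  proof -
    have u: "(\<lambda>t. ap (e12 Tf t) (x t)) \<in> L2" and v: "(\<lambda>t. ap (e22 Tf t) (x t)) \<in> L2" using ebf_L2 e x by blast+
    have uv: "dop Tf (cls (\<lambda>t. ap (e12 Tf t) (x t))) = Some (cls (\<lambda>t. ap (e22 Tf t) (x t)))"
      by (rule some[OF u v]) (use g2(1) x in simp)
    have o: "hinner DI (cls x) B = hinner DI (cls (\<lambda>t. ap (e12 Tf t) (x t))) A + hinner DI (cls (\<lambda>t. ap (e22 Tf t) (x t))) B"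
      if AB: "dop Tf A = Some B" for A B
    proof -
      obtain a where a: "a \<in> L2" "A = cls a" "\<And>t. a t \<in> dom (Tf t)" "(\<lambda>t. ap (Tf t) (a t)) \<in> L2" "B = cls (\<lambda>t. ap (Tf t) (a t))"
        by (rule dop_SomeE[OF AB]) (rule that)
      have "Tf t (a t) = Some (ap (Tf t) (a t))" for t using a(3)[of t] by auto
      then show ?thesis unfolding a(2,5) using g2(2) x by (intro intg x u v a) auto
    qed
    show "ap (DI.p12 (dop Tf)) (cls x) = cls (\<lambda>t. ap (e12 Tf t) (x t))" "ap (DI.p22 (dop Tf)) (cls x) = cls (\<lambda>t. ap (e22 Tf t) (x t))"
      using DI.col2_unique[OF c DI_mem[OF x] uv o] by blast+
  qed
  note eb = DI.entries_bounded[OF c]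
  show "DI.p11 (dop Tf) = dop (e11 Tf)" by (rule dop_eqI[OF eb(1) e(1) 1(1)])
  show "DI.p12 (dop Tf) = dop (e12 Tf)" by (rule dop_eqI[OF eb(3) e(2) 2(1)])
  show "DI.p21 (dop Tf) = dop (e21 Tf)" by (rule dop_eqI[OF eb(2) e(3) 1(2)])
  show "DI.p22 (dop Tf) = dop (e22 Tf)" by (rule dop_eqI[OF eb(4) e(4) 2(2)])
qed

text \<open>
  A selfadjoint injective operator has dense range. Approximating the dense sequence by
  the range, at a geometric rate, shows that almost all fibre operators have dense range,
  and these are selfadjoint too.
\<close>

lemma injective_fibres:
  assumes c: "ebf cf" and sym: "AE t in \<omega>. \<forall>x\<in>fib.C t. \<forall>y\<in>fib.C t. hinner (H t) (ap (cf t) x) y = hinner (H t) x (ap (cf t) y)"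
    and inj: "\<And>X. X \<in> DI.C \<Longrightarrow> ap (dop cf) X = hzero DI \<Longrightarrow> X = hzero DI"
  shows "AE t in \<omega>. \<forall>x\<in>fib.C t. ap (cf t) x = hzero (H t) \<longrightarrow> x = hzero (H t)"
proof -
  note b = DI.bounded_opsD[OF dop_bounded[OF c]]
  let ?R = "ap (dop cf) ` DI.C"
  have DIsym: "hinner DI (ap (dop cf) X) Y = hinner DI X (ap (dop cf) Y)" if XY: "X \<in> DI.C" "Y \<in> DI.C" for X Y
  proof -
    obtain x where x: "x \<in> L2" "X = cls x" using XY(1) by (rule DI_E)
    obtain y where y: "y \<in> L2" "Y = cls y" using XY(2) by (rule DI_E)
    have "(LINT t|\<omega>. hinner (H t) (ap (cf t) (x t)) (y t)) = (LINT t|\<omega>. hinner (H t) (x t) (ap (cf t) (y t)))"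
    proof (rule integral_cong_AE)
      show "(\<lambda>t. hinner (H t) (ap (cf t) (x t)) (y t)) \<in> borel_measurable \<omega>"
        by (rule inner_measurable) (use c x y in auto)
      show "(\<lambda>t. hinner (H t) (x t) (ap (cf t) (y t))) \<in> borel_measurable \<omega>"
        by (rule inner_measurable) (use c x y in auto)
      show "AE t in \<omega>. hinner (H t) (ap (cf t) (x t)) (y t) = hinner (H t) (x t) (ap (cf t) (y t))"
        using sym by eventually_elim (use x y in simp)
    qed
    then show ?thesis using x y c DI_inner[OF ebf_L2[OF c x(1)] y(1)] DI_inner[OF x(1) ebf_L2[OF c y(1)]] by simp
  qed
  have sub: "hsubspace DI ?R" unfolding hsubspace_def
  proof (intro conjI ballI allI)
    show "?R \<subseteq> DI.C" using b(4) by blast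
    show "hzero DI \<in> ?R" using b(8) DI.zero_closed by (metis imageI)
    show "hadd DI P Q \<in> ?R" if PQ: "P \<in> ?R" "Q \<in> ?R" for P Q
    proof -
      obtain X Y where "X \<in> DI.C" "Y \<in> DI.C" "P = ap (dop cf) X" "Q = ap (dop cf) Y" using PQ by blast
      then show ?thesis using b(5)[of X Y] DI.add_closed[of X Y] by (intro image_eqI[of _ _ "hadd DI X Y"]) auto
    qed
    show "hscale DI r P \<in> ?R" if P: "P \<in> ?R" for r P
    proof -
      obtain X where "X \<in> DI.C" "P = ap (dop cf) X" using P by blast
      then show ?thesis using b(6)[of X r] by (intro image_eqI[of _ _ "hscale DI r X"]) auto
    qed
  qed
  have dense: "hdense DI ?R"
  proof (rule DI.hdense_subspaceI[OF sub])
    fix V assume V: "V \<in> DI.C" and o: "\<And>k. k \<in> ?R \<Longrightarrow> hinner DI V k = 0"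
    have "hinner DI (ap (dop cf) V) (ap (dop cf) V) = 0"
      using DIsym[OF V b(4)[OF V]] o[OF imageI[OF b(4)[OF V]]] by simp
    then have "ap (dop cf) V = hzero DI" by (rule DI.inner_self_zero[OF b(4)[OF V]])
    then show "V = hzero DI" by (rule inj[OF V])
  qed
  have "\<exists>y\<in>L2. hnorm DI (hdiff DI (cls (dseq k)) (cls (\<lambda>t. ap (cf t) (y t)))) < (1/2)^n" for k n
  proof -
    have "(1/2::real)^n > 0" by simp
    then obtain P where P: "P \<in> ?R" "hnorm DI (hdiff DI (cls (dseq k)) P) < (1/2)^n"
      using dense DI_mem[OF dseq_L2] unfolding hdense_def by blast
    obtain Y where Y: "Y \<in> DI.C" "P = ap (dop cf) Y" using P(1) by blast
    obtain y where y: "y \<in> L2" "Y = cls y" using Y(1) by (rule DI_E)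
    show ?thesis using P(2) Y(2) y c by auto
  qed
  then have "\<forall>k n. \<exists>y. y \<in> L2 \<and> hnorm DI (hdiff DI (cls (dseq k)) (cls (\<lambda>t. ap (cf t) (y t)))) < (1/2)^n" by blast
  then obtain y where y: "\<And>k n. y k n \<in> L2"
    "\<And>k n. hnorm DI (hdiff DI (cls (dseq k)) (cls (\<lambda>t. ap (cf t) (y k n t)))) < (1/2)^n" by metis
  have "AE t in \<omega>. hlim (H t) (\<lambda>n. ap (cf t) (y k n t)) (dseq k t)" for k
    by (rule fast_convergence_AE[where N = 0]) (use y c less_imp_le[OF y(2)] in auto)
  then have "AE t in \<omega>. \<forall>k. hlim (H t) (\<lambda>n. ap (cf t) (y k n t)) (dseq k t)" by (simp add: AE_all_countable)
  then show ?thesis using sym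
  proof eventually_elim
    case (elim t)
    show ?case
    proof (intro ballI impI)
      fix x assume x: "x \<in> fib.C t" and z: "ap (cf t) x = hzero (H t)"
      show "x = hzero (H t)"
      proof (rule fib.hdense_orth_zero[OF dseq_dense dseq_C x])
        fix v assume "v \<in> range (\<lambda>n. dseq n t)"
        then obtain k where k: "v = dseq k t" by blast
        have yC: "y k n t \<in> fib.C t" for n using y by simp
        have "(\<lambda>n. hinner (H t) (ap (cf t) (y k n t)) x) \<longlonglongrightarrow> hinner (H t) (dseq k t) x"
          by (rule fib.hlim_inner_left) (use elim(1) c yC x in auto)
        moreover have "hinner (H t) (ap (cf t) (y k n t)) x = 0" for n
          using elim(2) yC x z by simp
        ultimately show "hinner (H t) v x = 0" using k LIMSEQ_unique[OF _ tendsto_const] by simp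
      qed
    qed
  qed
qed

lemma densely_defined_fibres_iff:
  assumes m: "measurable_closed_field H S Tf" and c: "closed_op DI (dop Tf)"
  shows "densely_defined DI (dop Tf) \<longleftrightarrow> (AE t in \<omega>. densely_defined (H t) (Tf t))"
proof -
  have T: "closed_op (H t) (Tf t)" for t using m by (simp add: measurable_closed_field_def)
  note e = entries_ebf(1)[OF m]
  show ?thesis unfolding DI.densely_defined_iff_p11[OF c] fib.densely_defined_iff_p11[OF T] entries_dop(1)[OF m c]
  proof
    assume inj: "\<forall>X\<in>DI.C. ap (dop (e11 Tf)) X = hzero DI \<longrightarrow> X = hzero DI"
    show "AE t in \<omega>. \<forall>x\<in>fib.C t. ap (e11 Tf t) x = hzero (H t) \<longrightarrow> x = hzero (H t)"
    proof (rule injective_fibres[OF e])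
      show "AE t in \<omega>. \<forall>x\<in>fib.C t. \<forall>y\<in>fib.C t. hinner (H t) (ap (e11 Tf t) x) y = hinner (H t) x (ap (e11 Tf t) y)"
        using fib.graph_matrix_entries[OF T] unfolding fib.graph_matrix_def by (intro AE_I2) blast
    qed (use inj in blast)
  next
    assume inj: "AE t in \<omega>. \<forall>x\<in>fib.C t. ap (e11 Tf t) x = hzero (H t) \<longrightarrow> x = hzero (H t)"
    show "\<forall>X\<in>DI.C. ap (dop (e11 Tf)) X = hzero DI \<longrightarrow> X = hzero DI"
    proof (intro ballI impI)
      fix X assume X: "X \<in> DI.C" and z: "ap (dop (e11 Tf)) X = hzero DI"
      obtain x where x: "x \<in> L2" "X = cls x" using X by (rule DI_E)
      have "cls (\<lambda>t. ap (e11 Tf t) (x t)) = cls (\<lambda>t. hzero (H t))" using z dop_ap[OF e x(1)] x by (simp add: DI_zero)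
      then have "AE t in \<omega>. ap (e11 Tf t) (x t) = hzero (H t)" by (rule cls_eqD[OF ebf_L2[OF e x(1)]])
      then have "AE t in \<omega>. x t = hzero (H t)" using inj by eventually_elim (use x in simp)
      then show "X = hzero DI" unfolding x DI_zero by (rule cls_cong)
    qed
  qed
qed

lemma AE_sum_comp:
  assumes e: "ebf a" "ebf b" "ebf c" "ebf d" "ebf f"
    and eq: "\<And>X. X \<in> DI.C \<Longrightarrow> hadd DI (ap (dop a) (ap (dop b) X)) (ap (dop c) (ap (dop d) X)) = ap (dop f) X"
  shows "AE t in \<omega>. \<forall>x\<in>fib.C t. hadd (H t) (ap (a t) (ap (b t) x)) (ap (c t) (ap (d t) x)) = ap (f t) x"
proof -
  note ab = ebf_comp(1)[OF e(1,2)] and cd = ebf_comp(1)[OF e(3,4)]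
  let ?F = "\<lambda>t. op_lin (H t) 1 (a t \<circ>\<^sub>m b t) 1 (c t \<circ>\<^sub>m d t)"
  note F = ebf_lin(1)[OF ab cd, of 1 1]
  have Fx: "ap (?F t) x = hadd (H t) (ap (a t) (ap (b t) x)) (ap (c t) (ap (d t) x))" if "x \<in> fib.C t" for t x
    using that e fib.ap_comp[OF ebf_bo[OF e(2)] that] fib.ap_comp[OF ebf_bo[OF e(4)] that] by (simp add: fib.scale_one)
  have "dop ?F = dop f"
  proof (rule dop_eqI[OF dop_bounded[OF F] e(5)])
    fix x assume x: "x \<in> L2"
    have "ap (dop ?F) (cls x) = cls (\<lambda>t. hadd (H t) (ap (a t) (ap (b t) (x t))) (ap (c t) (ap (d t) (x t))))"
      unfolding dop_ap[OF F x] using Fx x by simp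
    also have "\<dots> = hadd DI (ap (dop a) (ap (dop b) (cls x))) (ap (dop c) (ap (dop d) (cls x)))"
      using e x DI_add[OF ebf_L2[OF e(1) ebf_L2[OF e(2) x]] ebf_L2[OF e(3) ebf_L2[OF e(4) x]]] by simp
    also have "\<dots> = cls (\<lambda>t. ap (f t) (x t))" using eq[OF DI_mem[OF x]] dop_ap[OF e(5) x] by simp
    finally show "ap (dop ?F) (cls x) = cls (\<lambda>t. ap (f t) (x t))" .
  qed
  then have "AE t in \<omega>. ?F t = f t" by (rule dop_AE_eqD[OF F e(5)])
  then show ?thesis
  proof eventually_elim
    case (elim t)
    show ?case
    proof
      fix x assume x: "x \<in> fib.C t"
      show "hadd (H t) (ap (a t) (ap (b t) x)) (ap (c t) (ap (d t) x)) = ap (f t) x"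
        using Fx[OF x] unfolding elim by (rule sym)
    qed
  qed
qed

lemma AE_adjoint:
  assumes a: "ebf a" and b: "ebf b"
    and eq: "\<And>X Y. X \<in> DI.C \<Longrightarrow> Y \<in> DI.C \<Longrightarrow> hinner DI (ap (dop a) X) Y = hinner DI X (ap (dop b) Y)"
  shows "AE t in \<omega>. \<forall>x\<in>fib.C t. \<forall>y\<in>fib.C t. hinner (H t) (ap (a t) x) y = hinner (H t) x (ap (b t) y)"
proof -
  have "dop (\<lambda>t. op_adjoint (H t) (a t)) = dop b"
    unfolding ebf_adjoint(2)[OF a] by (rule DI.adjoint_eqI[OF dop_bounded[OF a] dop_bounded[OF b] eq])
  then have "AE t in \<omega>. op_adjoint (H t) (a t) = b t" by (rule dop_AE_eqD[OF ebf_adjoint(1)[OF a] b])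
  then show ?thesis by eventually_elim (use fib.adjoint_bounded(2)[OF ebf_bo[OF a]] in auto)
qed

lemma graph_matrix_fibres:
  assumes e: "ebf a" "ebf b" "ebf c" "ebf d" and g: "DI.graph_matrix (dop a) (dop b) (dop c) (dop d)"
  shows "AE t in \<omega>. fib.graph_matrix t (a t) (b t) (c t) (d t)"
proof -
  note g' = g[unfolded DI.graph_matrix_def]
  have s: "AE t in \<omega>. \<forall>x\<in>fib.C t. \<forall>y\<in>fib.C t. hinner (H t) (ap (a t) x) y = hinner (H t) x (ap (a t) y)"
      "AE t in \<omega>. \<forall>x\<in>fib.C t. \<forall>y\<in>fib.C t. hinner (H t) (ap (b t) x) y = hinner (H t) x (ap (c t) y)"
      "AE t in \<omega>. \<forall>x\<in>fib.C t. \<forall>y\<in>fib.C t. hinner (H t) (ap (d t) x) y = hinner (H t) x (ap (d t) y)"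
    by (rule AE_adjoint[OF e(1,1)] AE_adjoint[OF e(2,3)] AE_adjoint[OF e(4,4)], use g' in blast)+
  have i1: "AE t in \<omega>. \<forall>x\<in>fib.C t. hadd (H t) (ap (a t) (ap (a t) x)) (ap (b t) (ap (c t) x)) = ap (a t) x"
    by (rule AE_sum_comp[OF e(1,1,2,3,1)]) (use g' in blast)
  have i2: "AE t in \<omega>. \<forall>x\<in>fib.C t. hadd (H t) (ap (c t) (ap (a t) x)) (ap (d t) (ap (c t) x)) = ap (c t) x"
    by (rule AE_sum_comp[OF e(3,1,4,3,3)]) (use g' in blast)
  have i3: "AE t in \<omega>. \<forall>x\<in>fib.C t. hadd (H t) (ap (a t) (ap (b t) x)) (ap (b t) (ap (d t) x)) = ap (b t) x"
    by (rule AE_sum_comp[OF e(1,2,2,4,2)]) (use g' in blast)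
  have i4: "AE t in \<omega>. \<forall>x\<in>fib.C t. hadd (H t) (ap (c t) (ap (b t) x)) (ap (d t) (ap (d t) x)) = ap (d t) x"
    by (rule AE_sum_comp[OF e(3,2,4,4,4)]) (use g' in blast)
  have one: "ebf (\<lambda>t. scalar_op (H t) 1)" by (rule ebf_scalar[of _ 1]) auto
  let ?F = "\<lambda>t. op_lin (H t) 1 (scalar_op (H t) 1) (-1) (d t)"
  note F = ebf_lin(1)[OF one e(4), of 1 "-1"]
  have Fx: "ap (?F t) x = hdiff (H t) x (ap (d t) x)" if "x \<in> fib.C t" for t x
    using that e by (simp add: fib.scale_one hdiff_def)
  have "AE t in \<omega>. \<forall>x\<in>fib.C t. ap (?F t) x = hzero (H t) \<longrightarrow> x = hzero (H t)"
  proof (rule injective_fibres[OF F])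
    show "AE t in \<omega>. \<forall>x\<in>fib.C t. \<forall>y\<in>fib.C t. hinner (H t) (ap (?F t) x) y = hinner (H t) x (ap (?F t) y)"
      using s(3)
    proof eventually_elim
      case (elim t)
      show ?case
      proof (intro ballI)
        fix x y assume xy: "x \<in> fib.C t" "y \<in> fib.C t"
        show "hinner (H t) (ap (?F t) x) y = hinner (H t) x (ap (?F t) y)"
          unfolding Fx[OF xy(1)] Fx[OF xy(2)] using elim xy e by simp
      qed
    qed
    fix X assume X: "X \<in> DI.C" and z: "ap (dop ?F) X = hzero DI"
    obtain x where x: "x \<in> L2" "X = cls x" using X by (rule DI_E)
    have "ap (dop ?F) X = hdiff DI X (ap (dop d) X)"
      unfolding x(2) dop_ap[OF F x(1)] dop_ap[OF e(4) x(1)] DI_diff[OF x(1) ebf_L2[OF e(4) x(1)]] using Fx x by simp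
    then have "ap (dop d) X = X"
      using z DI.hdiff_eq_0[OF X DI.bounded_opsD(4)[OF dop_bounded[OF e(4)] X]] by simp
    then show "X = hzero DI" using g' X by blast
  qed
  then show ?thesis using s i1 i2 i3 i4
  proof eventually_elim
    case (elim t)
    have "x = hzero (H t)" if x: "x \<in> fib.C t" "ap (d t) x = x" for x
      using elim(1) Fx[OF x(1)] x fib.diff_self by metis
    then show ?case using elim(2-) unfolding fib.graph_matrix_def by blast
  qed
qed

text \<open>
  Being the matrix of a graph projection consists of identities and of the injectivity of
  \<open>1 - d\<close>, and both pass to almost every fibre.
\<close>

theorem decomposable_of_entries:
  assumes T: "closed_op DI T" and e: "ebf a" "ebf b" "ebf c" "ebf d"
    and eq: "DI.p11 T = dop a" "DI.p12 T = dop b" "DI.p21 T = dop c" "DI.p22 T = dop d"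
  shows "decomposable_op \<omega> H S T"
proof -
  have "AE t in \<omega>. fib.graph_matrix t (a t) (b t) (c t) (d t)"
    by (rule graph_matrix_fibres[OF e]) (use DI.graph_matrix_entries[OF T] eq in simp)
  then obtain N where N0: "\<And>t. t \<in> space \<omega> - N \<Longrightarrow> fib.graph_matrix t (a t) (b t) (c t) (d t)" and Nn: "N \<in> null_sets \<omega>"
    by (elim AE_E3) (rule that)
  have N: "fib.graph_matrix t (a t) (b t) (c t) (d t)" if "t \<notin> N" for t using N0[of t] that space_UNIV by simp
  have nN: "AE t in \<omega>. t \<notin> N" using Nn by (rule AE_not_in)
  \<comment> \<open>on the null set the entries are replaced by those of the zero operator, whose graph projection is \<open>1, 0, 0, 0\<close>\<close>
  define patch where "patch r B t = (if t \<in> N then scalar_op (H t) r else B t)" for r :: complex and B :: "'z \<Rightarrow> 'v operator" and t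
  have patch: "ebf (patch r B)" "dop (patch r B) = dop B" if B: "ebf B" for r B
  proof -
    obtain K where K: "0 \<le> K" "ae_bounded K B"
      using ebf_bound[OF B] by blast
    show m: "ebf (patch r B)"
    proof (rule ebf_I[OF _ _ K(1)])
      show "patch r B t \<in> bounded_ops (H t)" for t using ebf_bo[OF B] by (simp add: patch_def)
      fix x assume x: "x \<in> S"
      have "(\<lambda>t. if t \<in> N then hscale (H t) r (x t) else ap (B t) (x t)) \<in> S"
        by (rule S_if) (use x B Nn in auto)
      also have "(\<lambda>t. if t \<in> N then hscale (H t) r (x t) else ap (B t) (x t)) = (\<lambda>t. ap (patch r B t) (x t))"
        using x by (auto simp: patch_def)
      finally show "(\<lambda>t. ap (patch r B t) (x t)) \<in> S" .
    next
      show "ae_bounded K (patch r B)"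
        using K(2) nN by eventually_elim (simp add: patch_def)
    qed
    show "dop (patch r B) = dop B"
      by (rule dop_AE_eqI[OF m B]) (use nN in eventually_elim, simp add: patch_def)
  qed
  define a' b' c' d' where "a' = patch 1 a" and "b' = patch 0 b" and "c' = patch 0 c" and "d' = patch 0 d"
  have e': "ebf a'" "ebf b'" "ebf c'" "ebf d'" and
    eq': "DI.p11 T = dop a'" "DI.p12 T = dop b'" "DI.p21 T = dop c'" "DI.p22 T = dop d'"
    using patch e eq by (simp_all add: a'_def b'_def c'_def d'_def)
  have g: "fib.graph_matrix t (a' t) (b' t) (c' t) (d' t)" for t
  proof (cases "t \<in> N")
    case True
    then show ?thesis
      by (auto simp: fib.graph_matrix_def a'_def b'_def c'_def d'_def patch_def fib.scale_one fib.add_zero)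
  next
    case False
    then show ?thesis using N by (simp add: a'_def b'_def c'_def d'_def patch_def)
  qed
  have "\<exists>Tz. closed_op (H t) Tz \<and> fib.p11 t Tz = a' t \<and> fib.p12 t Tz = b' t \<and> fib.p21 t Tz = c' t \<and> fib.p22 t Tz = d' t" for t
    using fib.operator_of_graph_matrix[OF ebf_bo[OF e'(1)] ebf_bo[OF e'(2)] ebf_bo[OF e'(3)] ebf_bo[OF e'(4)] g] by metis
  then have "\<exists>Tf. \<forall>t. closed_op (H t) (Tf t) \<and> fib.p11 t (Tf t) = a' t \<and> fib.p12 t (Tf t) = b' t \<and> fib.p21 t (Tf t) = c' t \<and> fib.p22 t (Tf t) = d' t"
    by (intro choice) blast
  then obtain Tf where Tf: "\<And>t. closed_op (H t) (Tf t)" and en: "\<And>t. fib.p11 t (Tf t) = a' t" "\<And>t. fib.p12 t (Tf t) = b' t"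
    "\<And>t. fib.p21 t (Tf t) = c' t" "\<And>t. fib.p22 t (Tf t) = d' t" by blast
  have m: "measurable_closed_field H S Tf"
    unfolding measurable_closed_field_def en using Tf e' by (auto simp: ess_bounded_field_def)
  note gf = fib.graph_fixed[OF Tf, unfolded en] and GF = DI.graph_fixed[OF T, unfolded eq']
  have cols: "hadd DI (ap (dop a') (cls x)) (ap (dop b') (cls y)) = cls (\<lambda>t. hadd (H t) (ap (a' t) (x t)) (ap (b' t) (y t)))"
    "hadd DI (ap (dop c') (cls x)) (ap (dop d') (cls y)) = cls (\<lambda>t. hadd (H t) (ap (c' t) (x t)) (ap (d' t) (y t)))"
    if "x \<in> L2" "y \<in> L2" for x y
    using that e' by (simp_all add: DI_add)
  have graph_eq: "T X = Some Y \<longleftrightarrow> dop Tf X = Some Y" for X Y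
  proof
    assume "T X = Some Y"
    then have XY: "X \<in> DI.C" "Y \<in> DI.C" "hadd DI (ap (dop a') X) (ap (dop b') Y) = X"
      "hadd DI (ap (dop c') X) (ap (dop d') Y) = Y" unfolding GF by blast+
    obtain x where x: "x \<in> L2" "X = cls x" using XY(1) by (rule DI_E)
    obtain y where y: "y \<in> L2" "Y = cls y" using XY(2) by (rule DI_E)
    let ?u = "\<lambda>t. hadd (H t) (ap (a' t) (x t)) (ap (b' t) (y t))" and ?v = "\<lambda>t. hadd (H t) (ap (c' t) (x t)) (ap (d' t) (y t))"
    have uL: "?u \<in> L2" and vL: "?v \<in> L2" using x y e' by simp_all
    have u: "AE t in \<omega>. ?u t = x t" by (rule cls_eqD[OF uL]) (use XY(3) cols(1)[OF x(1) y(1)] x y in simp)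
    have v: "AE t in \<omega>. ?v t = y t" by (rule cls_eqD[OF vL]) (use XY(4) cols(2)[OF x(1) y(1)] x y in simp)
    have Tuv: "Tf t (?u t) = Some (?v t)" for t
    proof -
      have xy: "x t \<in> fib.C t" "y t \<in> fib.C t" using x y by simp_all
      show ?thesis
        using fib.linear_opD(4)[OF fib.closed_opD[OF Tf] fib.graph_proj_col1(1)[OF Tf xy(1)] fib.graph_proj_col2(1)[OF Tf xy(2)]]
        by (simp add: en)
    qed
    then have "(\<lambda>t. ap (Tf t) (?u t)) = ?v" by (simp only: option.sel)
    then show "dop Tf X = Some Y" unfolding x(2) y(2) dop_iff[OF x(1) y(1)]
      using u v uL vL Tuv by (intro bexI[of _ ?u]) (auto simp only: domIff option.sel)
  next
    assume "dop Tf X = Some Y"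
    then obtain u where u: "u \<in> L2" "X = cls u" "\<And>t. u t \<in> dom (Tf t)" "(\<lambda>t. ap (Tf t) (u t)) \<in> L2" "Y = cls (\<lambda>t. ap (Tf t) (u t))"
      by (elim dop_SomeE) (rule that)
    have "Tf t (u t) = Some (ap (Tf t) (u t))" for t using u(3)[of t] by auto
    then show "T X = Some Y" unfolding GF u(2,5) cols[OF u(1,4)] using gf u(1,4) by simp
  qed
  have "T X = dop Tf X" for X using graph_eq[of X "the (T X)"] graph_eq[of X "the (dop Tf X)"] by (cases "T X"; cases "dop Tf X") auto
  then have "T = dop Tf" by (rule ext)
  then show ?thesis using m unfolding decomposable_op_def decomposition_of_def by blast
qed

section \<open>Affiliation and decomposition\<close>

theorem affiliated_iff_decomposable:
  assumes dv: "decomposable_vna \<omega> H S M Mf" and T: "closed_op DI T"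
  shows "affiliated DI M T \<longleftrightarrow> decomposable_op \<omega> H S T
    \<and> (\<forall>Tf. decomposition_of \<omega> H S T Tf \<longrightarrow> (AE t in \<omega>. affiliated (H t) (Mf t) (Tf t)))"
proof (intro iffI conjI allI impI)
  note mem = decomposable_vna_iff[OF dv]
  have M: "von_neumann_algebra DI M" using dv by (simp add: decomposable_vna_def)
  { assume aff: "affiliated DI M T"
    note P = DI.affiliated_imp_entries[OF M aff]
    obtain a where a: "ebf a" "DI.p11 T = dop a" "AE t in \<omega>. a t \<in> Mf t" using mem(2)[OF P(1)] by blast
    obtain b where b: "ebf b" "DI.p12 T = dop b" using mem(2)[OF P(2)] by blast
    obtain c where c: "ebf c" "DI.p21 T = dop c" "AE t in \<omega>. c t \<in> Mf t" using mem(2)[OF P(3)] by blast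
    obtain d where d: "ebf d" "DI.p22 T = dop d" using mem(2)[OF P(4)] by blast
    show "decomposable_op \<omega> H S T"
      by (rule decomposable_of_entries[OF T a(1) b(1) c(1) d(1) a(2) b(2) c(2) d(2)])
    fix Tf assume Tf: "decomposition_of \<omega> H S T Tf"
    then have m: "measurable_closed_field H S Tf" and TT: "T = dop Tf" by (simp_all add: decomposition_of_def)
    have cl: "closed_op (H t) (Tf t)" for t using m by (simp add: measurable_closed_field_def)
    note e = entries_ebf[OF m] and E = entries_dop[OF m T[unfolded TT]]
    have "AE t in \<omega>. e11 Tf t = a t" by (rule dop_AE_eqD[OF e(1) a(1)]) (use E(1) a(2) TT in simp)
    moreover have "AE t in \<omega>. e21 Tf t = c t" by (rule dop_AE_eqD[OF e(3) c(1)]) (use E(3) c(2) TT in simp)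
    moreover have "AE t in \<omega>. densely_defined (H t) (Tf t)"
      using densely_defined_fibres_iff[OF m T[unfolded TT]] aff TT by (simp add: affiliated_def)
    ultimately show "AE t in \<omega>. affiliated (H t) (Mf t) (Tf t)" using a(3) c(3) mem(1)
    proof eventually_elim
      case (elim t)
      interpret cdd: closed_densely_defined "H t" "Tf t" by unfold_locales (use cl elim in auto)
      show ?case by (rule cdd.entries_imp_affiliated) (use elim in auto)
    qed }
  assume dec: "decomposable_op \<omega> H S T \<and> (\<forall>Tf. decomposition_of \<omega> H S T Tf \<longrightarrow> (AE t in \<omega>. affiliated (H t) (Mf t) (Tf t)))"
  then obtain Tf where Tf: "decomposition_of \<omega> H S T Tf" by (auto simp: decomposable_op_def)
  then have aff: "AE t in \<omega>. affiliated (H t) (Mf t) (Tf t)" using dec by blast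
  from Tf have m: "measurable_closed_field H S Tf" and TT: "T = dop Tf" by (simp_all add: decomposition_of_def)
  note e = entries_ebf[OF m] and E = entries_dop[OF m T[unfolded TT]]
  have "AE t in \<omega>. densely_defined (H t) (Tf t)" using aff by eventually_elim (simp add: affiliated_def)
  then have dd: "densely_defined DI T" using densely_defined_fibres_iff[OF m T[unfolded TT]] TT by simp
  have en: "AE t in \<omega>. e11 Tf t \<in> Mf t \<and> e21 Tf t \<in> Mf t"
    using aff mem(1) by eventually_elim (use fib.affiliated_imp_entries in blast)
  have p11: "DI.p11 T \<in> M" unfolding TT E(1) by (rule mem(3)[OF e(1)]) (use en in auto)
  have p21: "DI.p21 T \<in> M" unfolding TT E(3) by (rule mem(3)[OF e(3)]) (use en in auto)
  interpret cdd: closed_densely_defined DI T by unfold_locales (use T dd in auto)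
  show "affiliated DI M T" by (rule cdd.entries_imp_affiliated[OF M p11 p21])
qed

end

theorem proposition4p4:
  fixes \<omega> :: "'z::polish_space measure"
    and H :: "'z \<Rightarrow> 'v hilbert_struct"
    and S :: "('z \<Rightarrow> 'v) set"
    and M :: "('z \<Rightarrow> 'v) set operator set"
    and Mf :: "'z \<Rightarrow> 'v operator set"
    and T :: "('z \<Rightarrow> 'v) set operator"
  assumes "sets \<omega> = sets borel"
    and "sigma_finite_measure \<omega>"
    and "measurable_hilbert_field \<omega> H S"
    and "decomposable_vna \<omega> H S M Mf"
    and "closed_op (direct_integral \<omega> H S) T"
  shows "affiliated (direct_integral \<omega> H S) M T \<longleftrightarrow>
    decomposable_op \<omega> H S T
    \<and> (\<forall>Tf. decomposition_of \<omega> H S T Tf \<longrightarrow> (AE \<zeta> in \<omega>. affiliated (H \<zeta>) (Mf \<zeta>) (Tf \<zeta>)))"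
proof -
  have sp: "space \<omega> = UNIV" using sets_eq_imp_space_eq[OF assms(1)] by simp
  have "hilbert_field \<omega> H S" unfolding hilbert_field_def hilbert_field_axioms_def using assms(2,3) sp by blast
  then show ?thesis by (rule hilbert_field.affiliated_iff_decomposable[OF _ assms(4,5)])
qed

end
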